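(* Let $X$ be a topological space. Then the natural map $|\mathrm{Sing}\, X| \to |\mathrm{Sing}_{RV} X|$ is a homotopy equivalence. In particular, $|\mathrm{Sing}_{RV} X|$ and $X$ have the same weak homotopy type.
   Context: $(\Omega,\lambda)$ is a fixed atomless complete probability space. $[n]=\{0,\dots,n\}$; $\mathbf{\Delta}$ is the category of the $[n]$, $n\ge0$, with weakly increasing maps. $|\cdot|$ is the usual geometric realization of simplicial sets. $\Delta_n = \{(x_0,\dots,x_n)\in[0,1]^{n+1} : \sum x_i=1\}$ with, for $\sigma:[n]\to[m]$, $\Delta(\sigma)(x_0,\dots,x_n)=(\sum_{j\in\sigma^{-1}(i)}x_j)_{i=0,\dots,m}$. $\nabla_n=L^1(\Omega,[n])$ is the set of measurable maps $f:\Omega\to[n]$ modulo almost everywhere equality, with metric $d(f,g)=\lambda(\{t:f(t)\ne g(t)\})$, and $\nabla(\sigma):\nabla_n\to\nabla_m$, $f\mapsto\sigma\circ f$. The probability-law map is $p_n:\nabla_n\to\Delta_n$, $f\mapsto(\lambda(f^{-1}(i)))_{i=0,\dots,n}$. $\mathrm{Sing}\,X$ is the usual singular simplicial set: $(\mathrm{Sing}\,X)_n$ is the set of continuous maps $\Delta_n\to X$, with $f\cdot\sigma=f\circ\Delta(\sigma)$. $\mathrm{Sing}_{RV}X$ is the simplicial set with $(\mathrm{Sing}_{RV}X)_n$ the set of continuous maps $\nabla_n\to X$, with $f\cdot\sigma=f\circ\nabla(\sigma)$. The natural map is the realization of the morphism of simplicial sets $\mathrm{Sing}\,X\to\mathrm{Sing}_{RV}X$,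 $f\mapsto f\circ p_n$ for $f \in (\mathrm{Sing}\,X)_n$. *)

theory Defs
  imports "HOL-Probability.Probability" "HOL-Homology.Homology"
begin

section \<open>Simplicial sets and geometric realization\<close>

text \<open>The object \<open>[n] = {0,\<dots>,n}\<close> of the simplex category is the set \<open>{..n}\<close>; morphisms are
  extensional functions, so that equal morphisms are equal as HOL functions.\<close>

definition order_maps :: "nat \<Rightarrow> nat \<Rightarrow> (nat \<Rightarrow> nat) set" where
  "order_maps n m = {\<sigma> \<in> {..n} \<rightarrow>\<^sub>E {..m}. mono_on {..n} \<sigma>}"

text \<open>For \<open>\<sigma> : [n] \<rightarrow> [m]\<close> and an \<open>m\<close>-simplex \<open>x\<close>, \<open>act K n m \<sigma> x\<close> is the \<open>n\<close>-simplex \<open>x \<cdot> \<sigma>\<close>.\<close>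

record 's sset =
  simplices :: "nat \<Rightarrow> 's set"
  act :: "nat \<Rightarrow> nat \<Rightarrow> (nat \<Rightarrow> nat) \<Rightarrow> 's \<Rightarrow> 's"

definition simplicial_set :: "'s sset \<Rightarrow> bool" where
  "simplicial_set K \<longleftrightarrow>
     (\<forall>n m. \<forall>\<sigma> \<in> order_maps n m. \<forall>x \<in> simplices K m. act K n m \<sigma> x \<in> simplices K n) \<and>
     (\<forall>n. \<forall>x \<in> simplices K n. act K n n (restrict id {..n}) x = x) \<and>
     (\<forall>n m k. \<forall>\<sigma> \<in> order_maps n m. \<forall>\<tau> \<in> order_maps m k. \<forall>x \<in> simplices K k.
        act K n m \<sigma> (act K m k \<tau> x) = act K n k (compose {..n} \<tau> \<sigma>) x)"

definition simplicial_map :: "'s sset \<Rightarrow> 't sset \<Rightarrow> (nat \<Rightarrow> 's \<Rightarrow> 't) \<Rightarrow> bool" where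
  "simplicial_map K L \<phi> \<longleftrightarrow>
     (\<forall>n. \<phi> n \<in> simplices K n \<rightarrow> simplices L n) \<and>
     (\<forall>n m. \<forall>\<sigma> \<in> order_maps n m. \<forall>x \<in> simplices K m.
        \<phi> n (act K n m \<sigma> x) = act L n m \<sigma> (\<phi> m x))"

text \<open>Points of the standard simplex are sequences vanishing beyond position \<open>n\<close>.\<close>

definition simplex_space :: "nat \<Rightarrow> (nat \<Rightarrow> real) topology" where
  "simplex_space n = subtopology (powertop_real UNIV) (standard_simplex n)"

definition delta_map :: "nat \<Rightarrow> nat \<Rightarrow> (nat \<Rightarrow> nat) \<Rightarrow> (nat \<Rightarrow> real) \<Rightarrow> nat \<Rightarrow> real" where
  "delta_map n m \<sigma> x = (\<lambda>i. if i \<le> m then \<Sum>j | j \<le> n \<and> \<sigma> j = i. x j else 0)"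

definition quotient_topology :: "'a topology \<Rightarrow> ('a \<Rightarrow> 'b) \<Rightarrow> 'b topology" where
  "quotient_topology X q =
     topology (\<lambda>U. U \<subseteq> q ` topspace X \<and> openin X {x \<in> topspace X. q x \<in> U})"

type_synonym 's prepoint = "(nat \<times> 's) \<times> (nat \<Rightarrow> real)"

definition prerealization :: "'s sset \<Rightarrow> 's prepoint topology" where
  "prerealization K = sum_topology (\<lambda>(n, s). simplex_space n) (SIGMA n:UNIV. simplices K n)"

definition glue :: "'s sset \<Rightarrow> 's prepoint \<Rightarrow> 's prepoint \<Rightarrow> bool" where
  "glue K a b \<longleftrightarrow>
     (\<exists>n m. \<exists>\<sigma> \<in> order_maps n m. \<exists>x \<in> simplices K m. \<exists>t \<in> standard_simplex n.
        a = ((n, act K n m \<sigma> x), t) \<and> b = ((m, x), delta_map n m \<sigma> t))"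

definition realization_class :: "'s sset \<Rightarrow> 's prepoint \<Rightarrow> 's prepoint set" where
  "realization_class K a = {b. equivclp (glue K) a b}"

definition realization :: "'s sset \<Rightarrow> 's prepoint set topology" where
  "realization K = quotient_topology (prerealization K) (realization_class K)"

text \<open>For a simplicial map all classes in the following union coincide.\<close>

definition realization_map ::
    "'t sset \<Rightarrow> (nat \<Rightarrow> 's \<Rightarrow> 't) \<Rightarrow> 's prepoint set \<Rightarrow> 't prepoint set" where
  "realization_map L \<phi> C = (\<Union>((n, s), t) \<in> C. realization_class L ((n, \<phi> n s), t))"

section \<open>The spaces of random variables\<close>

definition atomless :: "'a measure \<Rightarrow> bool" where
  "atomless M \<longleftrightarrow>
     (\<forall>A \<in> sets M. 0 < emeasure M A \<longrightarrow>
        (\<exists>B \<in> sets M. B \<subseteq> A \<and> 0 < emeasure M B \<and> emeasure M B < emeasure M A))"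

definition ae_rel :: "'a measure \<Rightarrow> nat \<Rightarrow> (('a \<Rightarrow> nat) \<times> ('a \<Rightarrow> nat)) set" where
  "ae_rel M n = {(f, g). f \<in> measurable M (count_space {..n}) \<and>
     g \<in> measurable M (count_space {..n}) \<and> (AE t in M. f t = g t)}"

definition nabla :: "'a measure \<Rightarrow> nat \<Rightarrow> ('a \<Rightarrow> nat) set set" where
  "nabla M n = measurable M (count_space {..n}) // ae_rel M n"

text \<open>An arbitrary representative of a class; the definitions below do not depend on the choice.\<close>

definition rep :: "('a \<Rightarrow> nat) set \<Rightarrow> 'a \<Rightarrow> nat" where
  "rep F = (SOME f. f \<in> F)"

definition nabla_dist :: "'a measure \<Rightarrow> ('a \<Rightarrow> nat) set \<Rightarrow> ('a \<Rightarrow> nat) set \<Rightarrow> real" where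
  "nabla_dist M F G = measure M {t \<in> space M. rep F t \<noteq> rep G t}"

definition nabla_space :: "'a measure \<Rightarrow> nat \<Rightarrow> ('a \<Rightarrow> nat) set topology" where
  "nabla_space M n = Metric_space.mtopology (nabla M n) (nabla_dist M)"

definition nabla_map :: "'a measure \<Rightarrow> nat \<Rightarrow> (nat \<Rightarrow> nat) \<Rightarrow> ('a \<Rightarrow> nat) set \<Rightarrow> ('a \<Rightarrow> nat) set" where
  "nabla_map M m \<sigma> F = ae_rel M m `` {\<sigma> \<circ> rep F}"

definition law :: "'a measure \<Rightarrow> ('a \<Rightarrow> nat) set \<Rightarrow> nat \<Rightarrow> real" where
  "law M F = (\<lambda>i. measure M {t \<in> space M. rep F t = i})"

section \<open>The singular simplicial sets\<close>

text \<open>Simplices are extensional functions, so that equal maps are equal as HOL functions.\<close>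

definition Sing :: "'x topology \<Rightarrow> ((nat \<Rightarrow> real) \<Rightarrow> 'x) sset" where
  "Sing X = \<lparr>simplices = (\<lambda>n. {f. singular_simplex n X f}),
     act = (\<lambda>n m \<sigma> f. restrict (f \<circ> delta_map n m \<sigma>) (standard_simplex n))\<rparr>"

definition Sing_RV :: "'a measure \<Rightarrow> 'x topology \<Rightarrow> (('a \<Rightarrow> nat) set \<Rightarrow> 'x) sset" where
  "Sing_RV M X = \<lparr>simplices = (\<lambda>n. {f. continuous_map (nabla_space M n) X f \<and> f \<in> extensional (nabla M n)}),
     act = (\<lambda>n m \<sigma> f. restrict (f \<circ> nabla_map M m \<sigma>) (nabla M n))\<rparr>"

definition law_pullback ::
    "'a measure \<Rightarrow> nat \<Rightarrow> ((nat \<Rightarrow> real) \<Rightarrow> 'x) \<Rightarrow> ('a \<Rightarrow> nat) set \<Rightarrow> 'x" where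
  "law_pullback M n f = restrict (f \<circ> law M) (nabla M n)"

definition natural_map ::
    "'a measure \<Rightarrow> 'x topology \<Rightarrow> ((nat \<Rightarrow> real) \<Rightarrow> 'x) prepoint set \<Rightarrow>
       (('a \<Rightarrow> nat) set \<Rightarrow> 'x) prepoint set" where
  "natural_map M X = realization_map (Sing_RV M X) (law_pullback M)"

section \<open>Homotopy equivalences and weak homotopy type\<close>

definition homotopy_equivalence :: "'a topology \<Rightarrow> 'b topology \<Rightarrow> ('a \<Rightarrow> 'b) \<Rightarrow> bool" where
  "homotopy_equivalence X Y f \<longleftrightarrow> continuous_map X Y f \<and>
     (\<exists>g. continuous_map Y X g \<and>
        homotopic_with (\<lambda>_. True) X X (g \<circ> f) id \<and>
        homotopic_with (\<lambda>_. True) Y Y (f \<circ> g) id)"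

definition cube :: "nat \<Rightarrow> (nat \<Rightarrow> real) topology" where
  "cube n = product_topology (\<lambda>_. top_of_set {0..1}) {..<n}"

definition cube_boundary :: "nat \<Rightarrow> (nat \<Rightarrow> real) set" where
  "cube_boundary n = {s \<in> topspace (cube n). \<exists>i<n. s i = 0 \<or> s i = 1}"

definition based_maps :: "nat \<Rightarrow> 'a topology \<Rightarrow> 'a \<Rightarrow> ((nat \<Rightarrow> real) \<Rightarrow> 'a) set" where
  "based_maps n X x = {f. continuous_map (cube n) X f \<and> (\<forall>s \<in> cube_boundary n. f s = x)}"

definition based_class ::
    "nat \<Rightarrow> 'a topology \<Rightarrow> 'a \<Rightarrow> ((nat \<Rightarrow> real) \<Rightarrow> 'a) \<Rightarrow> ((nat \<Rightarrow> real) \<Rightarrow> 'a) set" where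
  "based_class n X x f =
     {g. homotopic_with (\<lambda>h. \<forall>s \<in> cube_boundary n. h s = x) (cube n) X f g}"

definition cube_concat ::
    "((nat \<Rightarrow> real) \<Rightarrow> 'a) \<Rightarrow> ((nat \<Rightarrow> real) \<Rightarrow> 'a) \<Rightarrow> (nat \<Rightarrow> real) \<Rightarrow> 'a" where
  "cube_concat f g s =
     (if s 0 \<le> 1/2 then f (s(0 := 2 * s 0)) else g (s(0 := 2 * s 0 - 1)))"

text \<open>Only used for \<open>n \<ge> 1\<close>. The union in the multiplication is over equal classes.\<close>

definition homotopy_group :: "nat \<Rightarrow> 'a topology \<Rightarrow> 'a \<Rightarrow> ((nat \<Rightarrow> real) \<Rightarrow> 'a) set monoid" where
  "homotopy_group n X x =
     \<lparr>carrier = based_class n X x ` based_maps n X x,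
      mult = (\<lambda>A B. \<Union>f \<in> A. \<Union>g \<in> B. based_class n X x (cube_concat f g)),
      one = based_class n X x (\<lambda>_. x)\<rparr>"

definition homotopy_group_map ::
    "nat \<Rightarrow> 'b topology \<Rightarrow> ('a \<Rightarrow> 'b) \<Rightarrow> 'a \<Rightarrow>
       ((nat \<Rightarrow> real) \<Rightarrow> 'a) set \<Rightarrow> ((nat \<Rightarrow> real) \<Rightarrow> 'b) set" where
  "homotopy_group_map n Y \<phi> x A = (\<Union>f \<in> A. based_class n Y (\<phi> x) (\<phi> \<circ> f))"

definition weak_homotopy_equivalence :: "'a topology \<Rightarrow> 'b topology \<Rightarrow> ('a \<Rightarrow> 'b) \<Rightarrow> bool" where
  "weak_homotopy_equivalence X Y \<phi> \<longleftrightarrow> continuous_map X Y \<phi> \<and>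
     bij_betw (\<lambda>C. \<Union>x \<in> C. path_component_of_set Y (\<phi> x))
       (path_components_of X) (path_components_of Y) \<and>
     (\<forall>n\<ge>1. \<forall>x \<in> topspace X.
        homotopy_group_map n Y \<phi> x \<in> iso (homotopy_group n X x) (homotopy_group n Y (\<phi> x)))"

definition weakly_linked :: "'a topology \<Rightarrow> 'b topology \<Rightarrow> bool" where
  "weakly_linked X Y \<longleftrightarrow>
     (\<exists>f. weak_homotopy_equivalence X Y f) \<or> (\<exists>g. weak_homotopy_equivalence Y X g)"

text \<open>A finite zigzag of weak homotopy equivalences joins \<open>X\<close> and \<open>Y\<close>. HOL does not quantify over
  types inside a formula, so the type \<open>'c\<close> of the points of the intermediate spaces is a parameter;
  for every choice of \<open>'c\<close> this implies that \<open>X\<close> and \<open>Y\<close> have the same weak homotopy type.\<close>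

definition same_weak_homotopy_type :: "'c itself \<Rightarrow> 'a topology \<Rightarrow> 'b topology \<Rightarrow> bool" where
  "same_weak_homotopy_type (_ :: 'c itself) X Y \<longleftrightarrow>
     (\<exists>U V :: 'c topology. weakly_linked X U \<and> weakly_linked\<^sup>*\<^sup>* U V \<and> weakly_linked V Y)"

section \<open>Well-definedness\<close>

text \<open>Main facts: \<open>openin_quotient_topology\<close>, \<open>Metric_space_nabla\<close>, \<open>simplicial_set_Sing\<close>,
  \<open>simplicial_set_Sing_RV\<close>, \<open>simplicial_map_law_pullback\<close> and \<open>realization_map_class\<close>.\<close>

lemma openin_quotient_topology:
  "openin (quotient_topology X q) U \<longleftrightarrow>
     U \<subseteq> q ` topspace X \<and> openin X {x \<in> topspace X. q x \<in> U}"
proof -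
  have 1: "{x \<in> topspace X. q x \<in> S \<inter> T} = {x \<in> topspace X. q x \<in> S} \<inter> {x \<in> topspace X. q x \<in> T}" for S T
    by auto
  have 2: "{x \<in> topspace X. q x \<in> \<Union> \<K>} = (\<Union>K\<in>\<K>. {x \<in> topspace X. q x \<in> K})" for \<K>
    by auto
  have "istopology (\<lambda>U. U \<subseteq> q ` topspace X \<and> openin X {x \<in> topspace X. q x \<in> U})"
    unfolding istopology_def 1 2 by (auto simp: openin_Int intro!: openin_Union)
  then show ?thesis
    by (simp add: quotient_topology_def)
qed

lemma equiv_ae_rel: "equiv (measurable M (count_space {..n})) (ae_rel M n)"
  unfolding equiv_def refl_on_def sym_def trans_def ae_rel_def
  by (auto elim: eventually_elim2 eventually_mono)

lemma rep_in:
  assumes "F \<in> nabla M n"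
  shows "rep F \<in> F" "rep F \<in> measurable M (count_space {..n})" "F = ae_rel M n `` {rep F}"
proof -
  obtain f where f: "F = ae_rel M n `` {f}" "f \<in> measurable M (count_space {..n})"
    using assms unfolding nabla_def by (rule quotientE)
  have "(f, f) \<in> ae_rel M n" using f(2) by (simp add: ae_rel_def)
  then have "f \<in> F" using f(1) by simp
  then show 1: "rep F \<in> F"
    unfolding rep_def by (rule someI[of "\<lambda>f. f \<in> F"])
  then have r: "(f, rep F) \<in> ae_rel M n" using f(1) by simp
  then show "rep F \<in> measurable M (count_space {..n})"
    by (simp add: ae_rel_def)
  show "F = ae_rel M n `` {rep F}"
    using equiv_class_eq[OF equiv_ae_rel r] f(1) by simp
qed

lemma class_in: "f \<in> measurable M (count_space {..n}) \<Longrightarrow> ae_rel M n `` {f} \<in> nabla M n"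
  unfolding nabla_def by (rule quotientI)

lemma rep_class:
  assumes "f \<in> measurable M (count_space {..n})"
  shows "AE t in M. rep (ae_rel M n `` {f}) t = f t"
proof -
  have "(f, rep (ae_rel M n `` {f})) \<in> ae_rel M n"
    using rep_in(1)[OF class_in[OF assms]] by auto
  then show ?thesis by (auto simp: ae_rel_def elim: eventually_mono)
qed

lemma class_eq:
  assumes "f \<in> measurable M (count_space {..n})" "g \<in> measurable M (count_space {..n})"
    "AE t in M. f t = g t"
  shows "ae_rel M n `` {f} = ae_rel M n `` {g}"
  using assms by (intro equiv_class_eq[OF equiv_ae_rel]) (auto simp: ae_rel_def)

lemma nabla_eqI:
  assumes "F \<in> nabla M n" "G \<in> nabla M n" "AE t in M. rep F t = rep G t"
  shows "F = G"
  using class_eq[OF rep_in(2)[OF assms(1)] rep_in(2)[OF assms(2)] assms(3)]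
    rep_in(3)[OF assms(1)] rep_in(3)[OF assms(2)] by simp

lemma sets_neq:
  assumes "f \<in> measurable M (count_space {..n})" "g \<in> measurable M (count_space {..m})"
  shows "{t \<in> space M. f t \<noteq> (g t :: nat)} \<in> sets M"
proof -
  have [measurable]: "f \<in> measurable M (count_space UNIV)"
    by (rule measurable_compose[OF assms(1)]) (simp add: measurable_count_space_eq1)
  have [measurable]: "g \<in> measurable M (count_space UNIV)"
    by (rule measurable_compose[OF assms(2)]) (simp add: measurable_count_space_eq1)
  have "{t \<in> space M. f t \<noteq> g t} = space M - (\<Union>i. (f -` {i} \<inter> space M) \<inter> (g -` {i} \<inter> space M))"
    by auto
  moreover have "f -` {i} \<inter> space M \<in> sets M" "g -` {i} \<inter> space M \<in> sets M" for i
    by (auto intro!: measurable_sets[where A="count_space UNIV"])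
  ultimately show ?thesis by auto
qed

lemma Metric_space_nabla:
  assumes "prob_space M"
  shows "Metric_space (nabla M n) (nabla_dist M)"
proof
  interpret prob_space M by fact
  show "0 \<le> nabla_dist M x y" for x y by (simp add: nabla_dist_def)
  show "nabla_dist M x y = nabla_dist M y x" for x y
    unfolding nabla_dist_def by (metis (no_types, lifting))
  fix x y z assume x: "x \<in> nabla M n" and y: "y \<in> nabla M n"
  note [measurable] = rep_in(2)[OF x] rep_in(2)[OF y]
  have "(nabla_dist M x y = 0) = (AE t in M. rep x t = rep y t)"
    unfolding nabla_dist_def
    by (subst AE_iff_measurable[OF sets_neq[OF rep_in(2)[OF x] rep_in(2)[OF y]] refl]) (auto simp: emeasure_eq_measure)
  then show "(nabla_dist M x y = 0) = (x = y)"
    using nabla_eqI[OF x y] by auto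
  assume z: "z \<in> nabla M n"
  note [measurable] = rep_in(2)[OF z]
  have "nabla_dist M x z \<le> measure M ({t \<in> space M. rep x t \<noteq> rep y t} \<union> {t \<in> space M. rep y t \<noteq> rep z t})"
    unfolding nabla_dist_def by (rule finite_measure_mono) (auto intro!: sets_neq rep_in x y z)
  also have "\<dots> \<le> nabla_dist M x y + nabla_dist M y z"
    unfolding nabla_dist_def by (rule measure_Un_le) (auto intro!: sets_neq rep_in x y z)
  finally show "nabla_dist M x z \<le> nabla_dist M x y + nabla_dist M y z" .
qed

lemma order_mapsD:
  assumes "\<sigma> \<in> order_maps n m"
  shows "\<And>i. i \<le> n \<Longrightarrow> \<sigma> i \<le> m" "mono_on {..n} \<sigma>" "\<sigma> \<in> {..n} \<rightarrow> {..m}"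
  using assms by (auto simp: order_maps_def)

lemma delta_map_in:
  assumes "\<sigma> \<in> order_maps n m" "x \<in> standard_simplex n"
  shows "delta_map n m \<sigma> x \<in> standard_simplex m"
proof -
  have x: "0 \<le> x i" "sum x {..n} = 1" for i using assms by (auto simp: standard_simplex_def)
  have "(\<Sum>j | j \<le> n \<and> \<sigma> j = i. x j) \<le> sum x {..n}" for i
    by (rule sum_mono2) (auto simp: x)
  moreover have "(\<Sum>i\<le>m. \<Sum>j | j \<le> n \<and> \<sigma> j = i. x j) = sum x {..n}"
    using sum.group[of "{..n}" "{..m}" \<sigma> x] order_mapsD[OF assms(1)] by (auto simp: Collect_conj_eq)
  ultimately show ?thesis
    unfolding standard_simplex_def delta_map_def by (auto simp: x sum_nonneg)
qed

lemma continuous_delta_map: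
  assumes "\<sigma> \<in> order_maps n m"
  shows "continuous_map (simplex_space n) (simplex_space m) (delta_map n m \<sigma>)"
  unfolding simplex_space_def
proof (rule continuous_map_into_subtopology)
  have "continuous_map (subtopology (powertop_real UNIV) (standard_simplex n)) euclideanreal
      (\<lambda>x. delta_map n m \<sigma> x i)" for i
    unfolding delta_map_def
    by (cases "i \<le> m")
      (auto intro!: continuous_map_sum continuous_map_from_subtopology continuous_map_product_projection)
  then show "continuous_map (subtopology (powertop_real UNIV) (standard_simplex n)) (powertop_real UNIV) (delta_map n m \<sigma>)"
    by (auto simp: continuous_map_componentwise_UNIV)
qed (use delta_map_in[OF assms] in auto)

lemma delta_map_id:
  assumes "x \<in> standard_simplex n"
  shows "delta_map n n (restrict id {..n}) x = x"
proof
  fix i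
  have "{j. j \<le> n \<and> restrict id {..n} j = i} = (if i \<le> n then {i} else {})" by auto
  then show "delta_map n n (restrict id {..n}) x i = x i"
    using assms by (auto simp: delta_map_def standard_simplex_def)
qed

lemma delta_map_comp:
  assumes s: "\<sigma> \<in> order_maps n m"
  shows "delta_map m k \<tau> (delta_map n m \<sigma> x) = delta_map n k (compose {..n} \<tau> \<sigma>) x"
proof
  fix i
  have "(\<Sum>j | j \<le> m \<and> \<tau> j = i. \<Sum>l | l \<le> n \<and> \<sigma> l = j. x l) = (\<Sum>l | l \<le> n \<and> \<tau> (\<sigma> l) = i. x l)"
  proof -
    have "(\<Sum>j | j \<le> m \<and> \<tau> j = i. \<Sum>l | l \<le> n \<and> \<sigma> l = j. x l)
        = (\<Sum>j \<in> {j. j \<le> m \<and> \<tau> j = i}. \<Sum>l | l \<in> {l. l \<le> n \<and> \<tau> (\<sigma> l) = i} \<and> \<sigma> l = j. x l)"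
      by (intro sum.cong) auto
    also have "\<dots> = (\<Sum>l | l \<le> n \<and> \<tau> (\<sigma> l) = i. x l)"
      by (rule sum.group) (use order_mapsD[OF s] in auto)
    finally show ?thesis .
  qed
  moreover have "(\<Sum>l | l \<le> n \<and> compose {..n} \<tau> \<sigma> l = i. x l) = (\<Sum>l | l \<le> n \<and> \<tau> (\<sigma> l) = i. x l)"
    by (intro sum.cong) (auto simp: compose_def)
  moreover have "(\<Sum>j | j \<le> m \<and> \<tau> j = i. delta_map n m \<sigma> x j) = (\<Sum>j | j \<le> m \<and> \<tau> j = i. \<Sum>l | l \<le> n \<and> \<sigma> l = j. x l)"
    by (intro sum.cong) (auto simp: delta_map_def)
  ultimately show "delta_map m k \<tau> (delta_map n m \<sigma> x) i = delta_map n k (compose {..n} \<tau> \<sigma>) x i"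
    unfolding delta_map_def[of m k] delta_map_def[of n k] by simp
qed

lemma restrict_id_order: "restrict id {..n} \<in> order_maps n n"
  by (auto simp: order_maps_def mono_on_def)

lemma simplicial_set_Sing: "simplicial_set (Sing X)"
  unfolding simplicial_set_def
proof (intro conjI allI ballI)
  fix n m \<sigma> x assume s: "\<sigma> \<in> order_maps n m" and x: "x \<in> simplices (Sing X) m"
  have "continuous_map (simplex_space n) X (x \<circ> delta_map n m \<sigma>)"
    using x continuous_map_compose[OF continuous_delta_map[OF s]]
    by (auto simp: Sing_def singular_simplex_def simplex_space_def)
  then show "act (Sing X) n m \<sigma> x \<in> simplices (Sing X) n"
    by (auto simp: Sing_def singular_simplex_def simplex_space_def intro: continuous_map_eq)
next
  fix n x assume "x \<in> simplices (Sing X) n"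
  then show "act (Sing X) n n (restrict id {..n}) x = x"
    by (auto simp: Sing_def singular_simplex_def delta_map_id extensional_def fun_eq_iff)
next
  fix n m k \<sigma> \<tau> x assume "\<sigma> \<in> order_maps n m" "\<tau> \<in> order_maps m k" "x \<in> simplices (Sing X) k"
  then show "act (Sing X) n m \<sigma> (act (Sing X) m k \<tau> x) = act (Sing X) n k (compose {..n} \<tau> \<sigma>) x"
    by (auto simp: Sing_def delta_map_comp delta_map_in fun_eq_iff)
qed

lemma meas_comp:
  assumes "\<sigma> \<in> order_maps n m" "f \<in> measurable M (count_space {..n})"
  shows "\<sigma> \<circ> f \<in> measurable M (count_space {..m})"
  by (rule measurable_comp[OF assms(2)]) (use order_mapsD[OF assms(1)] in auto)

lemma nabla_map_in:
  assumes "\<sigma> \<in> order_maps n m" "F \<in> nabla M n"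
  shows "nabla_map M m \<sigma> F \<in> nabla M m" "AE t in M. rep (nabla_map M m \<sigma> F) t = \<sigma> (rep F t)"
  using class_in[OF meas_comp[OF assms(1)]] rep_class[OF meas_comp[OF assms(1)]] rep_in(2)[OF assms(2)]
  by (auto simp: nabla_map_def)

lemma nabla_map_id:
  assumes "F \<in> nabla M n" shows "nabla_map M n (restrict id {..n}) F = F"
proof (rule nabla_eqI)
  have "rep F t \<le> n" if "t \<in> space M" for t
    using measurable_space[OF rep_in(2)[OF assms] that] by simp
  then show "AE t in M. rep (nabla_map M n (restrict id {..n}) F) t = rep F t"
    using nabla_map_in(2)[OF restrict_id_order assms] by (auto elim!: AE_mp intro!: AE_I2)
qed (use assms nabla_map_in[OF restrict_id_order] in auto)

lemma compose_order:
  assumes "\<sigma> \<in> order_maps n m" "\<tau> \<in> order_maps m k"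
  shows "compose {..n} \<tau> \<sigma> \<in> order_maps n k"
  using assms by (fastforce simp: order_maps_def compose_def mono_on_def PiE_iff)

lemma nabla_map_comp:
  assumes s: "\<sigma> \<in> order_maps n m" and t: "\<tau> \<in> order_maps m k" and F: "F \<in> nabla M n"
  shows "nabla_map M k \<tau> (nabla_map M m \<sigma> F) = nabla_map M k (compose {..n} \<tau> \<sigma>) F"
proof (rule nabla_eqI)
  note G = nabla_map_in[OF s F]
  show "nabla_map M k \<tau> (nabla_map M m \<sigma> F) \<in> nabla M k" "nabla_map M k (compose {..n} \<tau> \<sigma>) F \<in> nabla M k"
    using nabla_map_in(1) compose_order assms G by blast+
  have le: "rep F t \<le> n" if "t \<in> space M" for t
    using measurable_space[OF rep_in(2)[OF F] that] by simp
  show "AE t in M. rep (nabla_map M k \<tau> (nabla_map M m \<sigma> F)) t = rep (nabla_map M k (compose {..n} \<tau> \<sigma>) F) t"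
    using G(2) nabla_map_in(2)[OF t G(1)] nabla_map_in(2)[OF compose_order[OF s t] F] AE_space[of M]
    by eventually_elim (use le in \<open>auto simp: compose_def\<close>)
qed

lemma nabla_map_dist:
  assumes "prob_space M" and s: "\<sigma> \<in> order_maps n m" and F: "F \<in> nabla M n" and G: "G \<in> nabla M n"
  shows "nabla_dist M (nabla_map M m \<sigma> F) (nabla_map M m \<sigma> G) \<le> nabla_dist M F G"
proof -
  interpret prob_space M by fact
  show ?thesis unfolding nabla_dist_def
  proof (rule finite_measure_mono_AE)
    show "AE t in M. t \<in> {t \<in> space M. rep (nabla_map M m \<sigma> F) t \<noteq> rep (nabla_map M m \<sigma> G) t} \<longrightarrow>
        t \<in> {t \<in> space M. rep F t \<noteq> rep G t}"
      using nabla_map_in(2)[OF s F] nabla_map_in(2)[OF s G] by eventually_elim auto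
  qed (rule sets_neq[OF rep_in(2)[OF F] rep_in(2)[OF G]])
qed

lemma continuous_nabla_map:
  assumes M: "prob_space M" and s: "\<sigma> \<in> order_maps n m"
  shows "continuous_map (nabla_space M n) (nabla_space M m) (nabla_map M m \<sigma>)"
  unfolding nabla_space_def Metric_space.continuous_map_to_metric[OF Metric_space_nabla[OF M]]
proof (intro ballI allI impI, goal_cases)
  case (1 F e)
  interpret A: Metric_space "nabla M n" "nabla_dist M" by (rule Metric_space_nabla[OF M])
  interpret B: Metric_space "nabla M m" "nabla_dist M" by (rule Metric_space_nabla[OF M])
  have F: "F \<in> nabla M n" using 1 by (simp add: A.topspace_mtopology)
  have "nabla_map M m \<sigma> G \<in> B.mball (nabla_map M m \<sigma> F) e" if "G \<in> A.mball F e" for G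
    using that nabla_map_in(1)[OF s, of _ M] nabla_map_dist[OF M s F, of G] by auto
  then show ?case
    using 1 F by (intro exI[of _ "A.mball F e"]) auto
qed

lemma simplicial_set_Sing_RV:
  assumes "prob_space M"
  shows "simplicial_set (Sing_RV M X)"
  unfolding simplicial_set_def
proof (intro conjI allI ballI)
  interpret A: Metric_space "nabla M n" "nabla_dist M" for n by (rule Metric_space_nabla[OF assms])
  have [simp]: "topspace (nabla_space M n) = nabla M n" for n
    by (simp add: nabla_space_def)
  fix n m \<sigma> x assume s: "\<sigma> \<in> order_maps n m" and x: "x \<in> simplices (Sing_RV M X) m"
  have "continuous_map (nabla_space M n) X (x \<circ> nabla_map M m \<sigma>)"
    using x continuous_map_compose[OF continuous_nabla_map[OF assms s]]
    by (auto simp: Sing_RV_def)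
  then show "act (Sing_RV M X) n m \<sigma> x \<in> simplices (Sing_RV M X) n"
    by (auto simp: Sing_RV_def intro: continuous_map_eq)
next
  fix n x assume "x \<in> simplices (Sing_RV M X) n"
  then show "act (Sing_RV M X) n n (restrict id {..n}) x = x"
    by (auto simp: Sing_RV_def nabla_map_id extensional_def fun_eq_iff)
next
  fix n m k \<sigma> \<tau> x assume "\<sigma> \<in> order_maps n m" "\<tau> \<in> order_maps m k" "x \<in> simplices (Sing_RV M X) k"
  then show "act (Sing_RV M X) n m \<sigma> (act (Sing_RV M X) m k \<tau> x) = act (Sing_RV M X) n k (compose {..n} \<tau> \<sigma>) x"
    by (auto simp: Sing_RV_def nabla_map_comp nabla_map_in fun_eq_iff)
qed

lemma sets_rep: 
  assumes "F \<in> nabla M n" shows "{t \<in> space M. rep F t = i} \<in> sets M"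
proof -
  have "rep F -` ({i} \<inter> {..n}) \<inter> space M \<in> sets M"
    by (rule measurable_sets[OF rep_in(2)[OF assms]]) auto
  moreover have "rep F -` ({i} \<inter> {..n}) \<inter> space M = {t \<in> space M. rep F t = i}"
    using measurable_space[OF rep_in(2)[OF assms]] by auto
  ultimately show ?thesis by simp
qed

lemma law_in:
  assumes M: "prob_space M" and F: "F \<in> nabla M n"
  shows "law M F \<in> standard_simplex n"
proof -
  interpret prob_space M by fact
  have le: "rep F t \<le> n" if "t \<in> space M" for t
    using measurable_space[OF rep_in(2)[OF F] that] by simp
  have "(\<Sum>i\<le>n. law M F i) = measure M (\<Union>i\<le>n. {t \<in> space M. rep F t = i})"
    unfolding law_def
    by (rule finite_measure_finite_Union[symmetric]) (auto simp: sets_rep[OF F] disjoint_family_on_def)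
  also have "(\<Union>i\<le>n. {t \<in> space M. rep F t = i}) = space M" using le by auto
  finally have "(\<Sum>i\<le>n. law M F i) = 1" by (simp add: prob_space)
  moreover have "law M F i = 0" if "i > n" for i
  proof -
    have "{t \<in> space M. rep F t = i} = {}" using le that by fastforce
    then show ?thesis unfolding law_def by (metis measure_empty)
  qed
  ultimately show ?thesis by (auto simp: standard_simplex_def law_def)
qed

lemma law_nabla_map:
  assumes M: "prob_space M" and s: "\<sigma> \<in> order_maps n m" and F: "F \<in> nabla M n"
  shows "law M (nabla_map M m \<sigma> F) = delta_map n m \<sigma> (law M F)"
proof
  fix i
  interpret prob_space M by fact
  have le: "rep F t \<le> n" if "t \<in> space M" for t
    using measurable_space[OF rep_in(2)[OF F] that] by simp
  note G = nabla_map_in[OF s F]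
  let ?J = "{j. j \<le> n \<and> \<sigma> j = i}"
  have "law M (nabla_map M m \<sigma> F) i = measure M (\<Union>j\<in>?J. {t \<in> space M. rep F t = j})"
    unfolding law_def
  proof (rule finite_measure_eq_AE)
    show "AE t in M. (t \<in> {t \<in> space M. rep (nabla_map M m \<sigma> F) t = i}) = (t \<in> (\<Union>j\<in>?J. {t \<in> space M. rep F t = j}))"
      using G(2) by eventually_elim (use le in auto)
  qed (auto intro!: sets.finite_UN sets_rep F G)
  also have "\<dots> = (\<Sum>j\<in>?J. law M F j)"
    unfolding law_def
    by (rule finite_measure_finite_Union) (auto simp: sets_rep[OF F] disjoint_family_on_def)
  also have "\<dots> = delta_map n m \<sigma> (law M F) i"
  proof (cases "i \<le> m")
    case False
    then have e: "?J = {}" using order_mapsD(1)[OF s] by auto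
    show ?thesis using False unfolding delta_map_def e by simp
  qed (simp add: delta_map_def)
  finally show "law M (nabla_map M m \<sigma> F) i = delta_map n m \<sigma> (law M F) i" .
qed

lemma law_dist:
  assumes M: "prob_space M" and F: "F \<in> nabla M n" and G: "G \<in> nabla M n"
  shows "law M F i \<le> law M G i + nabla_dist M F G"
proof -
  interpret prob_space M by fact
  have "law M F i \<le> measure M ({t \<in> space M. rep G t = i} \<union> {t \<in> space M. rep F t \<noteq> rep G t})"
    unfolding law_def by (rule finite_measure_mono) (auto intro!: sets_rep sets_neq rep_in(2) F G)
  also have "\<dots> \<le> law M G i + nabla_dist M F G"
    unfolding law_def nabla_dist_def
    by (rule measure_Un_le) (auto intro!: sets_rep sets_neq rep_in(2) F G)
  finally show ?thesis .
qed

lemma continuous_law: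
  assumes M: "prob_space M"
  shows "continuous_map (nabla_space M n) (simplex_space n) (law M)"
  unfolding simplex_space_def
proof (rule continuous_map_into_subtopology)
  interpret A: Metric_space "nabla M n" "nabla_dist M" by (rule Metric_space_nabla[OF M])
  show "law M \<in> topspace (nabla_space M n) \<rightarrow> standard_simplex n"
    using law_in[OF M] by (auto simp: nabla_space_def)
  have "continuous_map A.mtopology euclideanreal (\<lambda>F. law M F i)" for i
    unfolding mtopology_is_euclidean[symmetric] Met_TC.continuous_map_to_metric
  proof (intro ballI allI impI, goal_cases)
    case (1 F e)
    have "dist (law M F i) (law M G i) < e" if "G \<in> A.mball F e" for G
      using that law_dist[OF M, of F n G i] law_dist[OF M, of G n F i] A.commute[of F G]
      by (auto simp: dist_real_def)
    then show ?case
      using 1 by (intro exI[of _ "A.mball F e"]) auto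
  qed
  then show "continuous_map (nabla_space M n) (powertop_real UNIV) (law M)"
    by (simp add: continuous_map_componentwise_UNIV nabla_space_def)
qed

lemma simplicial_map_law_pullback:
  assumes M: "prob_space M"
  shows "simplicial_map (Sing X) (Sing_RV M X) (law_pullback M)"
  unfolding simplicial_map_def
proof (intro conjI allI ballI funcsetI)
  interpret A: Metric_space "nabla M n" "nabla_dist M" for n by (rule Metric_space_nabla[OF M])
  have [simp]: "topspace (nabla_space M n) = nabla M n" for n
    by (simp add: nabla_space_def)
  fix n x assume x: "x \<in> simplices (Sing X) n"
  have "continuous_map (nabla_space M n) X (x \<circ> law M)"
    using x continuous_map_compose[OF continuous_law[OF M]]
    by (auto simp: Sing_def singular_simplex_def simplex_space_def)
  then show "law_pullback M n x \<in> simplices (Sing_RV M X) n"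
    by (auto simp: Sing_RV_def law_pullback_def intro: continuous_map_eq)
next
  fix n m \<sigma> x assume s: "\<sigma> \<in> order_maps n m" and x: "x \<in> simplices (Sing X) m"
  show "law_pullback M n (act (Sing X) n m \<sigma> x) = act (Sing_RV M X) n m \<sigma> (law_pullback M m x)"
    by (auto simp: Sing_RV_def Sing_def law_pullback_def fun_eq_iff law_in[OF M] law_nabla_map[OF M s] nabla_map_in(1)[OF s])
qed

lemma realization_map_class:
  assumes "simplicial_map K L \<phi>" "s \<in> simplices K n" "t \<in> standard_simplex n"
  shows "realization_map L \<phi> (realization_class K ((n, s), t)) = realization_class L ((n, \<phi> n s), t)"
proof -
  define h where "h = (\<lambda>((n, s), t :: nat \<Rightarrow> real). ((n :: nat, \<phi> n s), t))"
  have glue: "glue L (h a) (h b)" if "glue K a b" for a b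
    using that assms(1) unfolding glue_def simplicial_map_def h_def by fastforce
  have *: "equivclp (glue L) (h a) (h b)" if "equivclp (glue K) a b" for a b
    using that
  proof (induction rule: equivclp_induct)
    case (step y z)
    then have "equivclp (glue L) (h y) (h z)" using glue by blast
    with step(3) show ?case by (rule equivclp_trans)
  qed simp
  have "realization_class L (h b) = realization_class L (h a)" if "b \<in> realization_class K a" for a b
  proof -
    have ab: "equivclp (glue L) (h a) (h b)" using * that by (simp add: realization_class_def)
    have "equivclp (glue L) (h b) c \<longleftrightarrow> equivclp (glue L) (h a) c" for c
      using equivclp_trans[OF ab] equivclp_trans[OF equivclp_sym[OF ab]] by blast
    then show ?thesis unfolding realization_class_def by (rule Collect_cong)
  qed
  moreover have "a \<in> realization_class K a" for a by (simp add: realization_class_def)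
  moreover have "realization_map L \<phi> C = (\<Union>b \<in> C. realization_class L (h b))" for C
    by (simp add: realization_map_def h_def case_prod_beta)
  ultimately have "realization_map L \<phi> (realization_class K a) = realization_class L (h a)" for a
    by blast
  from this[of "((n, s), t)"] show ?thesis by (simp add: h_def)
qed

end

theory Submission imports Defs begin

text \<open>An atomless space carries a uniform variable \<open>U\<close>. Rearranging a random variable in increasing order of
  \<open>U\<close> on the event \<open>U < t\<close>, for \<open>t\<close> running from \<open>0\<close> to \<open>1\<close>, deforms the space \<open>\<nabla>\<^sub>n\<close>, naturally in \<open>n\<close>, onto
  a copy of \<open>\<Delta>\<^sub>n\<close> on which the law is the identity. Applied to the doubled vertex set \<open>[2n+1]\<close> this gives a
  simplicial form of the homotopy, so the natural map has a strict left inverse and is a homotopy equivalence.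

  That \<open>|Sing X| \<rightarrow> X\<close> is a weak equivalence is shown without subdivision or simplicial approximation. A map
  \<open>\<phi>\<close> from the cube to \<open>X\<close> is compared with the map into \<open>|Sing X|\<close> that sends \<open>s\<close> to the point with barycentric
  coordinates \<open>\<rho>(s)\<close> of the singular simplex obtained by composing \<open>\<phi>\<close> with an affine simplex on the points
  of a fine net, where \<open>\<rho>\<close> is a partition of unity. A map \<open>\<psi>\<close> into \<open>|Sing X|\<close> is first lifted to the fat
  realization, in which only zero weights are dropped; there the vertices carrying a positive weight can be
  selected locally constantly, and this links \<open>\<psi>\<close> with the map just described for \<open>\<phi> = ev \<circ> \<psi>\<close>.\<close>

section \<open>Realizations\<close>

text \<open>In the realization a point does not remember its vertices: neighbouring entries of a
  list merge as soon as the simplex degenerates there. Vertices of positive weight cannot be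
  followed along a path, hence the detour through the fat realization. The lift is built by
  recursion over the dimension of the nondegenerate simplex carrying a point. Dimension m moves
  while time runs from 2^-(m+1) to 2^-m, so faces are still at rest while a larger simplex moves,
  and a deformation that arrives on a face is continued by the one of that face. Even in the fat
  realization the index of a vertex jumps when an entry of weight zero is dropped. Vertices are
  therefore addressed by marks in the unit interval, which the weights subdivide: an entry of weight
  zero has an interval of length zero and shifts nothing. Both homotopies on realizations are
  stationary at vertices. Base points are moved to vertices along a path, once and for all.\<close>

lemma topspace_quotient_topology [simp]: "topspace (quotient_topology X q) = q ` topspace X"
proof
  show "topspace (quotient_topology X q) \<subseteq> q ` topspace X"
    using openin_topspace[of "quotient_topology X q"] unfolding openin_quotient_topology by (rule conjunct1)
  have "{x \<in> topspace X. q x \<in> q ` topspace X} = topspace X" by auto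
  then have "openin (quotient_topology X q) (q ` topspace X)"
    by (simp add: openin_quotient_topology)
  then show "q ` topspace X \<subseteq> topspace (quotient_topology X q)"
    by (rule openin_subset)
qed

lemma quotient_map_quotient_topology: "quotient_map X (quotient_topology X q) q"
  by (auto simp: quotient_map_def openin_quotient_topology)

lemma continuous_map_from_quotient:
  "continuous_map (quotient_topology X q) Y f \<longleftrightarrow> continuous_map X Y (f \<circ> q)"
  using continuous_compose_quotient_map_eq[OF quotient_map_quotient_topology] by blast

text \<open>An open set of a summand is open in the sum, so continuity can be tested on the product
  of \<open>T\<close> with each summand, for arbitrary \<open>T\<close>.\<close>

lemma continuous_map_prod_sum_topology:
  assumes "\<And>i. i \<in> I \<Longrightarrow> continuous_map (prod_topology T (X i)) Y (\<lambda>(\<tau>, x). f \<tau> (i, x))"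
  shows "continuous_map (prod_topology T (sum_topology X I)) Y (\<lambda>(\<tau>, p). f \<tau> p)"
  unfolding continuous_map_def
proof (intro conjI allI impI)
  show "(\<lambda>(\<tau>, p). f \<tau> p) \<in> topspace (prod_topology T (sum_topology X I)) \<rightarrow> topspace Y"
    using assms by (fastforce simp: continuous_map_def Pi_iff)
  fix U assume U: "openin Y U"
  show "openin (prod_topology T (sum_topology X I))
      {p \<in> topspace (prod_topology T (sum_topology X I)). (case p of (\<tau>, p) \<Rightarrow> f \<tau> p) \<in> U}"
    unfolding openin_prod_topology_alt
  proof (intro allI impI, goal_cases)
    case (1 \<tau> p)
    obtain i x where p: "p = (i, x)" "i \<in> I" "x \<in> topspace (X i)" "\<tau> \<in> topspace T" "f \<tau> (i, x) \<in> U"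
      using 1 by (cases p) auto
    define S where "S = {p \<in> topspace (prod_topology T (X i)). (case p of (\<tau>, x) \<Rightarrow> f \<tau> (i, x)) \<in> U}"
    have "openin (prod_topology T (X i)) S"
      unfolding S_def by (rule openin_continuous_map_preimage[OF assms[OF p(2)] U])
    moreover have "(\<tau>, x) \<in> S"
      using p by (simp add: S_def)
    ultimately obtain V W where VW: "openin T V" "openin (X i) W" "\<tau> \<in> V" "x \<in> W" "V \<times> W \<subseteq> S"
      unfolding openin_prod_topology_alt by meson
    have "openin (sum_topology X I) (Pair i ` W)"
      using open_map_component_injection[OF p(2), of X] VW(2) by (auto simp: open_map_def)
    moreover have "V \<times> (Pair i ` W) \<subseteq> {p \<in> topspace (prod_topology T (sum_topology X I)). (case p of (\<tau>, p) \<Rightarrow> f \<tau> p) \<in> U}"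
      using VW(5) p(2) by (auto simp: S_def)
    ultimately show ?case
      using VW(1,3,4) p(1) by (intro exI[of _ V] exI[of _ "Pair i ` W"]) auto
  qed
qed

text \<open>Products with a locally compact Hausdorff space preserve quotient maps. Hence homotopies
  and parametrized maps can be given simplex by simplex when the parameter space is of this kind:
  the unit interval or a compact box.\<close>

lemma continuous_map_prod_quotient:
  assumes "locally_compact_space T" "Hausdorff_space T"
    and "continuous_map (prod_topology T X) Y (\<lambda>(\<tau>, x). f \<tau> (q x))"
  shows "continuous_map (prod_topology T (quotient_topology X q)) Y (\<lambda>(\<tau>, x). f \<tau> x)"
proof -
  have "quotient_map (prod_topology T X) (prod_topology T (quotient_topology X q)) (\<lambda>(x, y). (x, q y))"
    by (rule quotient_map_prod_right) (use assms quotient_map_quotient_topology in auto)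
  then show ?thesis
    by (rule continuous_compose_quotient_map_eq[THEN iffD1]) (use assms(3) in \<open>simp add: o_def case_prod_beta'\<close>)
qed

lemma topspace_simplex_space [simp]: "topspace (simplex_space n) = standard_simplex n"
  by (simp add: simplex_space_def)

lemma topspace_prerealization:
  "topspace (prerealization K) = {((n, s), t). s \<in> simplices K n \<and> t \<in> standard_simplex n}"
  by (auto simp: prerealization_def)

text \<open>The map \<open>q\<close> is left open because the same criterion serves the realization
  and the fat realization.\<close>

lemma continuous_map_prod_prerealization_quotient:
  assumes "locally_compact_space T" "Hausdorff_space T"
    and "\<And>n s. s \<in> simplices K n \<Longrightarrow>
      continuous_map (prod_topology T (simplex_space n)) Y (\<lambda>(\<tau>, t). f \<tau> (q ((n, s), t)))"
  shows "continuous_map (prod_topology T (quotient_topology (prerealization K) q)) Y (\<lambda>(\<tau>, x). f \<tau> x)"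
  by (rule continuous_map_prod_quotient[OF assms(1,2)], unfold prerealization_def,
      rule continuous_map_prod_sum_topology[of _ _ _ _ "\<lambda>\<tau> x. f \<tau> (q x)"]) (use assms(3) in auto)

lemma continuous_map_prerealization_quotient:
  assumes "\<And>n s. s \<in> simplices K n \<Longrightarrow> continuous_map (simplex_space n) Y (\<lambda>t. f (q ((n, s), t)))"
  shows "continuous_map (quotient_topology (prerealization K) q) Y f"
  unfolding continuous_map_from_quotient
proof -
  have *: "continuous_map (simplex_space n) Y (\<lambda>t. f (q ((n, s), t)))" if "s \<in> simplices K n" for n s
    using assms that by simp
  show "continuous_map (prerealization K) Y (f \<circ> q)"
    unfolding continuous_map_def
  proof (intro conjI allI impI)
    show "f \<circ> q \<in> topspace (prerealization K) \<rightarrow> topspace Y"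
      using * by (fastforce simp: topspace_prerealization continuous_map_def)
    fix U assume U: "openin Y U"
    have "openin (simplex_space n) {t \<in> standard_simplex n. f (q ((n, s), t)) \<in> U}" if "s \<in> simplices K n" for n s
      using *[OF that] U by (simp add: continuous_map_def)
    then show "openin (prerealization K) {x \<in> topspace (prerealization K). (f \<circ> q) x \<in> U}"
      unfolding prerealization_def openin_sum_topology by (auto simp: conj_commute)
  qed
qed

lemma continuous_map_quotient_simplex:
  assumes "s \<in> simplices K n"
  shows "continuous_map (simplex_space n) (quotient_topology (prerealization K) q) (\<lambda>t. q ((n, s), t))"
proof -
  have "continuous_map (simplex_space n) (prerealization K) (\<lambda>t. ((n, s), t))"
    unfolding prerealization_def
    using continuous_map_component_injection[of "(n, s)" "SIGMA n:UNIV. simplices K n" "\<lambda>(n, s). simplex_space n"] assms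
    by simp
  then show ?thesis
    using continuous_map_compose[OF _ quotient_imp_continuous_map[OF quotient_map_quotient_topology]]
    by (simp add: o_def)
qed

lemmas continuous_realization_class = continuous_map_quotient_simplex[where q = "realization_class K" and K = K for K,
    folded realization_def]

lemma topspace_realization: "topspace (realization K) = realization_class K ` topspace (prerealization K)"
  by (simp add: realization_def)

lemma realization_class_in:
  "s \<in> simplices K n \<Longrightarrow> t \<in> standard_simplex n \<Longrightarrow> realization_class K ((n, s), t) \<in> topspace (realization K)"
  by (auto simp: topspace_realization topspace_prerealization)

lemma realization_cases:
  assumes "p \<in> topspace (realization K)"
  obtains n s t where "p = realization_class K ((n, s), t)" "s \<in> simplices K n" "t \<in> standard_simplex n"
  using assms by (auto simp: topspace_realization topspace_prerealization)

lemma realization_class_eq_iff: "realization_class K a = realization_class K b \<longleftrightarrow> equivclp (glue K) a b"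
proof
  assume "realization_class K a = realization_class K b"
  then have "b \<in> realization_class K a" by (simp add: realization_class_def)
  then show "equivclp (glue K) a b" by (simp add: realization_class_def)
next
  assume ab: "equivclp (glue K) a b"
  have "equivclp (glue K) a c \<longleftrightarrow> equivclp (glue K) b c" for c
    using equivclp_trans[OF ab] equivclp_trans[OF equivclp_sym[OF ab]] by blast
  then show "realization_class K a = realization_class K b" by (simp add: realization_class_def)
qed

lemma realization_class_act:
  assumes "\<sigma> \<in> order_maps n m" "x \<in> simplices K m" "t \<in> standard_simplex n"
  shows "realization_class K ((n, act K n m \<sigma> x), t) = realization_class K ((m, x), delta_map n m \<sigma> t)"
proof -
  have "glue K ((n, act K n m \<sigma> x), t) ((m, x), delta_map n m \<sigma> t)"
    unfolding glue_def using assms by blast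
  then show ?thesis unfolding realization_class_eq_iff by blast
qed

section \<open>Maps out of a realization\<close>

text \<open>The value at an arbitrary representative; it is meaningful for functions that are
  constant along \<open>glue\<close>.\<close>

definition lift_class :: "('s prepoint \<Rightarrow> 'b) \<Rightarrow> 's prepoint set \<Rightarrow> 'b" where
  "lift_class f C = f (SOME a. a \<in> C)"

lemma equivclp_invariant:
  assumes "equivclp R a b" "\<And>a b. R a b \<Longrightarrow> f a = f b"
  shows "f a = f b"
  using assms(1) by (induction rule: equivclp_induct) (use assms(2) in auto)

lemma lift_class:
  assumes "\<And>n m \<sigma> x t. \<sigma> \<in> order_maps n m \<Longrightarrow> x \<in> simplices K m \<Longrightarrow> t \<in> standard_simplex n \<Longrightarrow>
    f ((n, act K n m \<sigma> x), t) = f ((m, x), delta_map n m \<sigma> t)"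
  shows "lift_class f (realization_class K a) = f a"
proof -
  have "a \<in> realization_class K a" by (simp add: realization_class_def)
  then have "(SOME b. b \<in> realization_class K a) \<in> realization_class K a" by (rule someI)
  then have "equivclp (glue K) a (SOME b. b \<in> realization_class K a)"
    by (simp add: realization_class_def)
  then have "f a = f (SOME b. b \<in> realization_class K a)"
    by (rule equivclp_invariant) (use assms in \<open>auto simp: glue_def\<close>)
  then show ?thesis by (simp add: lift_class_def)
qed

lemma continuous_realization_map:
  assumes "simplicial_map K L \<phi>"
  shows "continuous_map (realization K) (realization L) (realization_map L \<phi>)"
  unfolding realization_def
proof (rule continuous_map_prerealization_quotient)
  fix n s assume s: "s \<in> simplices K n"
  have "\<phi> n s \<in> simplices L n" using assms s by (auto simp: simplicial_map_def)
  then have "continuous_map (simplex_space n) (realization L) (\<lambda>t. realization_class L ((n, \<phi> n s), t))"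
    by (rule continuous_realization_class)
  then show "continuous_map (simplex_space n) (quotient_topology (prerealization L) (realization_class L))
      (\<lambda>t. realization_map L \<phi> (realization_class K ((n, s), t)))"
    unfolding realization_def
    by (rule continuous_map_eq) (simp add: realization_map_class[OF assms s])
qed

abbreviation unit_interval :: "real topology" where
  "unit_interval \<equiv> top_of_set {0..1}"

lemma locally_compact_unit_interval: "locally_compact_space unit_interval" "Hausdorff_space unit_interval"
  by (auto simp: Hausdorff_space_subtopology
      intro!: compact_imp_locally_compact_space compact_space_subtopology)

section \<open>The doubled vertex set and join homotopies\<close>

text \<open>The join of \<open>\<sigma>\<close> with itself: positions up to n form the first copy
  of [n], and position n + 1 + i is vertex i of the second copy.\<close>

definition dbl_map :: "nat \<Rightarrow> nat \<Rightarrow> (nat \<Rightarrow> nat) \<Rightarrow> nat \<Rightarrow> nat" where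
  "dbl_map n m \<sigma> = (\<lambda>j\<in>{..2*n+1}. if j \<le> n then \<sigma> j else m + 1 + \<sigma> (j - n - 1))"

text \<open>The join of two copies of a simplex contains the segment between the two copies of
  \<open>t\<close>; this is its point at parameter \<open>\<tau>\<close>.\<close>

definition dbl_point :: "nat \<Rightarrow> real \<Rightarrow> (nat \<Rightarrow> real) \<Rightarrow> nat \<Rightarrow> real" where
  "dbl_point n \<tau> t = (\<lambda>j. if j \<le> n then (1 - \<tau>) * t j else if j \<le> 2*n+1 then \<tau> * t (j - n - 1) else 0)"

definition dbl_face :: "nat \<Rightarrow> bool \<Rightarrow> nat \<Rightarrow> nat" where
  "dbl_face n b = (\<lambda>j\<in>{..n}. if b then j + n + 1 else j)"

lemma dbl_map_order: "\<sigma> \<in> order_maps n m \<Longrightarrow> dbl_map n m \<sigma> \<in> order_maps (2*n+1) (2*m+1)"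
proof -
  assume s: "\<sigma> \<in> order_maps n m"
  note D = order_mapsD[OF s]
  have "mono_on {..2*n+1} (dbl_map n m \<sigma>)"
  proof (rule mono_onI)
    fix r u assume ru: "r \<in> {..2*n+1}" "u \<in> {..2*n+1}" "r \<le> u"
    have "\<sigma> r \<le> \<sigma> u" if "u \<le> n" using D(2) that ru by (auto simp: mono_on_def)
    moreover have "\<sigma> (r-n-1) \<le> \<sigma> (u-n-1)" by (rule mono_onD[OF D(2)]) (use ru in auto)
    moreover have "\<sigma> r \<le> m" if "r \<le> n" using D(1) that by auto
    ultimately show "dbl_map n m \<sigma> r \<le> dbl_map n m \<sigma> u"
      using ru by (auto simp: dbl_map_def)
  qed
  moreover have "dbl_map n m \<sigma> j \<le> 2*m+1" if "j \<le> 2*n+1" for j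
    using D(1)[of j] D(1)[of "j-n-1"] that by (auto simp: dbl_map_def)
  ultimately show ?thesis
    by (auto simp: order_maps_def dbl_map_def)
qed

lemma dbl_face_order: "dbl_face n b \<in> order_maps n (2*n+1)"
  by (auto simp: order_maps_def dbl_face_def mono_on_def)

lemma sum_upto_double:
  "(\<Sum>j\<le>2*n+1. f j) = (\<Sum>j\<le>n. f j) + (\<Sum>j\<le>n. f (j+n+1) :: real)" for n :: nat
proof -
  have "{..2*n+1} = {..n} \<union> {n+1..2*n+1}" by auto
  then have "(\<Sum>j\<le>2*n+1. f j) = (\<Sum>j\<le>n. f j) + (\<Sum>j=n+1..2*n+1. f j)"
    by (simp add: sum.union_disjoint)
  also have "(\<Sum>j=n+1..2*n+1. f j) = (\<Sum>j\<le>n. f (j+n+1))"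
    by (rule sum.reindex_bij_witness[of _ "\<lambda>j. j+n+1" "\<lambda>j. j-n-1"]) auto
  finally show ?thesis .
qed

lemma dbl_point_in:
  assumes "t \<in> standard_simplex n" "0 \<le> \<tau>" "\<tau> \<le> 1"
  shows "dbl_point n \<tau> t \<in> standard_simplex (2*n+1)"
proof -
  have t: "0 \<le> t i" "t i \<le> 1" "sum t {..n} = 1" for i using assms by (auto simp: standard_simplex_def)
  have "(\<Sum>j\<le>2*n+1. dbl_point n \<tau> t j) = (\<Sum>j\<le>n. (1-\<tau>) * t j) + (\<Sum>j\<le>n. \<tau> * t j)"
    unfolding sum_upto_double by (intro arg_cong2[of _ _ _ _ "(+)"] sum.cong) (auto simp: dbl_point_def)
  also have "\<dots> = 1" by (simp add: sum_distrib_left[symmetric] t)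
  finally have "(\<Sum>j\<le>2*n+1. dbl_point n \<tau> t j) = 1" .
  moreover have "0 \<le> dbl_point n \<tau> t j" "dbl_point n \<tau> t j \<le> 1" for j
    using assms(2,3) t mult_le_one by (auto simp: dbl_point_def)
  ultimately show ?thesis
    by (auto simp: standard_simplex_def dbl_point_def)
qed

lemma dbl_point_delta:
  assumes s: "\<sigma> \<in> order_maps n m"
  shows "delta_map (2*n+1) (2*m+1) (dbl_map n m \<sigma>) (dbl_point n \<tau> t) = dbl_point m \<tau> (delta_map n m \<sigma> t)"
proof
  fix i
  note D = order_mapsD[OF s]
  have eq: "(\<Sum>j | j \<le> 2*n+1 \<and> dbl_map n m \<sigma> j = i. dbl_point n \<tau> t j)
     = (\<Sum>j | j \<le> n \<and> \<sigma> j = i. (1-\<tau>) * t j) + (\<Sum>j | j \<le> n \<and> m + 1 + \<sigma> j = i. \<tau> * t j)"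
  proof -
    have "(\<Sum>j | j \<le> 2*n+1 \<and> dbl_map n m \<sigma> j = i. dbl_point n \<tau> t j) = (\<Sum>j\<le>2*n+1. if dbl_map n m \<sigma> j = i then dbl_point n \<tau> t j else 0)"
      by (subst sum.inter_filter[symmetric]) (auto intro!: sum.cong)
    also have "\<dots> = (\<Sum>j\<le>n. if \<sigma> j = i then (1-\<tau>) * t j else 0) + (\<Sum>j\<le>n. if m + 1 + \<sigma> j = i then \<tau> * t j else 0)"
      unfolding sum_upto_double
      by (intro arg_cong2[of _ _ _ _ "(+)"] sum.cong) (auto simp: dbl_point_def dbl_map_def)
    also have "\<dots> = (\<Sum>j | j \<in> {..n} \<and> \<sigma> j = i. (1-\<tau>) * t j) + (\<Sum>j | j \<in> {..n} \<and> m + 1 + \<sigma> j = i. \<tau> * t j)"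
      by (simp only: sum.inter_filter[OF finite_atMost])
    finally show ?thesis by simp
  qed
  have z1: "{j. j \<le> n \<and> \<sigma> j = i} = {}" if "i > m" using D(1) that by fastforce
  have z2: "{j. j \<le> n \<and> m + 1 + \<sigma> j = i} = {}" if "i \<le> m \<or> i > 2*m+1" using D(1) that by fastforce
  have z3: "{j. j \<le> n \<and> Suc (m + \<sigma> j) = i} = {j. j \<le> n \<and> \<sigma> j = i - Suc m}" if "i > m" using that by auto
  consider "i \<le> m" | "i > m" "i \<le> 2*m+1" | "i > 2*m+1" by linarith
  then show "delta_map (2*n+1) (2*m+1) (dbl_map n m \<sigma>) (dbl_point n \<tau> t) i = dbl_point m \<tau> (delta_map n m \<sigma> t) i"
  proof cases
    case 1
    then show ?thesis using eq z2 by (simp add: delta_map_def dbl_point_def sum_distrib_left)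
  next
    case 2
    then show ?thesis using eq z1 z3 by (simp add: delta_map_def dbl_point_def sum_distrib_left)
  next
    case 3
    then show ?thesis by (simp add: delta_map_def dbl_point_def)
  qed
qed

lemma dbl_point_face:
  assumes "t \<in> standard_simplex n"
  shows "dbl_point n (if b then 1 else 0) t = delta_map n (2*n+1) (dbl_face n b) t"
proof
  fix i
  have t: "t i = 0" if "i > n" using assms that by (auto simp: standard_simplex_def)
  have "{j. j \<le> n \<and> dbl_face n b j = i} =
     (if b then if n < i \<and> i \<le> 2*n+1 then {i - n - 1} else {} else if i \<le> n then {i} else {})"
    by (auto simp: dbl_face_def)
  then show "dbl_point n (if b then 1 else 0) t i = delta_map n (2*n+1) (dbl_face n b) t i"
    using t by (auto simp: dbl_point_def delta_map_def)
qed

lemma continuous_map_simplexI: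
  assumes "\<And>i. i \<le> n \<Longrightarrow> continuous_map T euclideanreal (\<lambda>x. f x i)"
    and "\<And>x. x \<in> topspace T \<Longrightarrow> f x \<in> standard_simplex n"
  shows "continuous_map T (simplex_space n) f"
  unfolding simplex_space_def continuous_map_in_subtopology continuous_map_componentwise_UNIV
proof (intro conjI allI)
  fix i
  show "continuous_map T euclideanreal (\<lambda>x. f x i)"
  proof (cases "i \<le> n")
    case False
    then have "\<And>x. x \<in> topspace T \<Longrightarrow> f x i = 0" using assms(2) by (auto simp: standard_simplex_def)
    then show ?thesis using continuous_map_eq[of T euclideanreal "\<lambda>_. 0" "\<lambda>x. f x i"] by simp
  qed (rule assms)
qed (use assms in auto)

lemma continuous_simplex_coord [continuous_intros]:
  "continuous_map T (simplex_space n) f \<Longrightarrow> continuous_map T euclideanreal (\<lambda>x. f x i)"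
  unfolding simplex_space_def continuous_map_in_subtopology continuous_map_componentwise_UNIV by simp

lemma continuous_dbl_point:
  "continuous_map (prod_topology unit_interval (simplex_space n)) (simplex_space (2*n+1)) (\<lambda>(\<tau>, t). dbl_point n \<tau> t)"
proof (rule continuous_map_simplexI)
  let ?T = "prod_topology unit_interval (simplex_space n)"
  have 1: "continuous_map ?T euclideanreal fst"
    using continuous_map_fst[of unit_interval] continuous_map_in_subtopology by blast
  have 2: "continuous_map ?T euclideanreal (\<lambda>x. snd x i)" for i
    by (rule continuous_simplex_coord[OF continuous_map_snd])
  fix i
  show "continuous_map ?T euclideanreal (\<lambda>x. (case x of (\<tau>, t) \<Rightarrow> dbl_point n \<tau> t) i)"
    unfolding dbl_point_def case_prod_beta
    by (cases "i \<le> n"; cases "i \<le> 2*n+1") (auto intro!: continuous_map_real_mult continuous_map_diff 1 2)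
qed (auto intro!: dbl_point_in[simplified])

text \<open>A simplex over the doubled vertex set gives a straight-line homotopy between its two halves;
  no subdivision of prisms is needed.\<close>

lemma join_homotopy:
  assumes K: "\<And>n x. x \<in> simplices K n \<Longrightarrow> E n x \<in> simplices L (2*n+1)"
    and nat: "\<And>n m \<sigma> x. \<sigma> \<in> order_maps n m \<Longrightarrow> x \<in> simplices K m \<Longrightarrow>
      E n (act K n m \<sigma> x) = act L (2*n+1) (2*m+1) (dbl_map n m \<sigma>) (E m x)"
  obtains h where "continuous_map (prod_topology unit_interval (realization K)) (realization L) h"
    and "\<And>n x t \<tau>. x \<in> simplices K n \<Longrightarrow> t \<in> standard_simplex n \<Longrightarrow> \<tau> \<in> {0..1} \<Longrightarrow>
      h (\<tau>, realization_class K ((n, x), t)) = realization_class L ((2*n+1, E n x), dbl_point n \<tau> t)"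
    and "\<And>n x t b. x \<in> simplices K n \<Longrightarrow> t \<in> standard_simplex n \<Longrightarrow>
      h (if b then 1 else 0, realization_class K ((n, x), t)) = realization_class L ((n, act L n (2*n+1) (dbl_face n b) (E n x)), t)"
proof -
  define F where "F \<tau> a = (case a of ((n, x), t) \<Rightarrow> realization_class L ((2*n+1, E n x), dbl_point n \<tau> t))"
    for \<tau> :: real and a :: "'a prepoint"
  define h where "h = (\<lambda>(\<tau>, C). lift_class (F (min 1 (max 0 \<tau>))) C)"
  have h: "h (\<tau>, realization_class K a) = F \<tau> a" if "\<tau> \<in> {0..1}" for \<tau> a
  proof -
    have "min 1 (max 0 \<tau>) = \<tau>" using that by auto
    moreover have "lift_class (F \<tau>) (realization_class K a) = F \<tau> a"
    proof (rule lift_class)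
      fix n m \<sigma> x t assume a: "\<sigma> \<in> order_maps n m" "x \<in> simplices K m" "t \<in> standard_simplex n"
      show "F \<tau> ((n, act K n m \<sigma> x), t) = F \<tau> ((m, x), delta_map n m \<sigma> t)"
        unfolding F_def split nat[OF a(1,2)] dbl_point_delta[OF a(1), symmetric]
        by (rule realization_class_act) (use a that K dbl_map_order dbl_point_in in auto)
    qed
    ultimately show ?thesis by (simp add: h_def)
  qed
  have 1: "continuous_map (prod_topology unit_interval (realization K)) (realization L) (\<lambda>(\<tau>, x). h (\<tau>, x))"
    unfolding realization_def[of K]
  proof (rule continuous_map_prod_prerealization_quotient[OF locally_compact_unit_interval])
    fix n s assume "s \<in> simplices K n"
    then have "continuous_map (simplex_space (2*n+1)) (realization L) (\<lambda>t. realization_class L ((2*n+1, E n s), t))"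
      by (intro continuous_realization_class K)
    from continuous_map_compose[OF continuous_dbl_point this]
    show "continuous_map (prod_topology unit_interval (simplex_space n)) (realization L) (\<lambda>(\<tau>, t). h (\<tau>, realization_class K ((n, s), t)))"
      by (rule continuous_map_eq) (auto simp: h F_def)
  qed
  have 3: "h (if b then 1 else 0, realization_class K ((n, x), t)) = realization_class L ((n, act L n (2*n+1) (dbl_face n b) (E n x)), t)"
    if "x \<in> simplices K n" "t \<in> standard_simplex n" for n x t b
  proof -
    have "h (if b then 1 else 0, realization_class K ((n, x), t)) = F (if b then 1 else 0) ((n, x), t)"
      by (rule h) auto
    also have "\<dots> = realization_class L ((2*n+1, E n x), delta_map n (2*n+1) (dbl_face n b) t)"
      unfolding F_def split dbl_point_face[OF that(2)] ..
    finally show ?thesis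
      using realization_class_act[OF dbl_face_order[of n b] K[OF that(1)] that(2)] by simp
  qed
  show thesis
    by (rule that[of h]) (use 1 3 in \<open>auto simp: h F_def\<close>)
qed

text \<open>Points are sequences padded with zeros, so (1, 0, 0, ...) is at once the first vertex of
  every standard simplex and the only point of the 0-simplex.\<close>

lemma realization_path_to_vertex:
  assumes K: "simplicial_set K" and p: "p \<in> topspace (realization K)"
  obtains x where "x \<in> simplices K 0" "path_component_of (realization K) p (realization_class K ((0, x), \<lambda>j. if j = 0 then 1 else 0))"
proof -
  obtain n s t where p: "p = realization_class K ((n, s), t)" and s: "s \<in> simplices K n" and t: "t \<in> standard_simplex n"
    using realization_cases[OF p] .
  let ?e = "\<lambda>j::nat. if j = 0 then 1 else 0 :: real"
  define \<sigma> :: "nat \<Rightarrow> nat" where "\<sigma> = (\<lambda>j\<in>{..0}. 0)"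
  have \<sigma>: "\<sigma> \<in> order_maps 0 n" by (auto simp: order_maps_def \<sigma>_def mono_on_def)
  have e0: "?e \<in> standard_simplex 0" by simp
  have en: "?e \<in> standard_simplex n" by simp
  have "delta_map 0 n \<sigma> ?e i = ?e i" for i
  proof -
    have *: "{j. j \<le> 0 \<and> \<sigma> j = i} = (if i = 0 then {0} else {})" by (auto simp: \<sigma>_def)
    show ?thesis unfolding delta_map_def * by simp
  qed
  then have d: "delta_map 0 n \<sigma> ?e = ?e" by blast
  have x: "act K 0 n \<sigma> s \<in> simplices K 0" using K \<sigma> s by (auto simp: simplicial_set_def)
  have eq: "realization_class K ((n, s), ?e) = realization_class K ((0, act K 0 n \<sigma> s), ?e)"
    using realization_class_act[OF \<sigma> s e0] d by simp
  have "path_connected_space (simplex_space n)"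
    using path_connectedin_standard_simplex[of n] unfolding simplex_space_def path_connectedin_def by simp
  then have "path_component_of (simplex_space n) t ?e"
    using t en unfolding path_connected_space_iff_path_component by simp
  then obtain g where g: "pathin (simplex_space n) g" "g 0 = t" "g 1 = ?e" unfolding path_component_of_def by auto
  have "pathin (realization K) ((\<lambda>t. realization_class K ((n, s), t)) \<circ> g)"
    by (rule pathin_compose[OF g(1) continuous_realization_class[OF s]])
  then have "path_component_of (realization K) p (realization_class K ((n, s), ?e))"
    unfolding path_component_of_def p using g by (intro exI[of _ "(\<lambda>t. realization_class K ((n, s), t)) \<circ> g"]) auto
  then show thesis using that[OF x] eq by simp
qed

lemma Sing_simplices: "f \<in> simplices (Sing X) k \<longleftrightarrow> continuous_map (simplex_space k) X f \<and> f \<in> extensional (standard_simplex k)"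
  by (auto simp: Sing_def singular_simplex_def simplex_space_def)

section \<open>Uniform variables on atomless spaces\<close>

context prob_space begin

text \<open>Of a proper part of \<open>A\<close> and its complement in \<open>A\<close>, both of
  positive measure, one has at most half the measure. Iterating this gives arbitrarily small
  sets.\<close>

lemma atomless_small:
  assumes "atomless M" "A \<in> events" "0 < prob A" "0 < \<epsilon>"
  obtains B where "B \<in> events" "B \<subseteq> A" "0 < prob B" "prob B < \<epsilon>"
proof -
  have half: "\<exists>B\<in>events. B \<subseteq> A \<and> 0 < prob B \<and> prob B \<le> prob A / 2" if A: "A \<in> events" "0 < prob A" for A
  proof -
    have "0 < emeasure M A" using A(2) by (simp add: emeasure_eq_measure)
    then obtain B where B: "B \<in> events" "B \<subseteq> A" "0 < emeasure M B" "emeasure M B < emeasure M A"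
      using assms(1) A(1) unfolding atomless_def by blast
    then have b: "0 < prob B" "prob B < prob A" by (simp_all add: emeasure_eq_measure ennreal_less_iff)
    have d: "prob (A - B) = prob A - prob B" by (rule finite_measure_Diff[OF A(1) B(1,2)])
    show ?thesis
    proof (cases "prob B \<le> prob A / 2")
      case True then show ?thesis using B(1,2) b(1) by blast
    next
      case False
      then show ?thesis using A(1) B(1) b d by (intro bexI[of _ "A - B"]) auto
    qed
  qed
  have "\<exists>B\<in>events. B \<subseteq> A \<and> 0 < prob B \<and> prob B \<le> (1/2) ^ k" for k
  proof (induction k)
    case (Suc k)
    then obtain B where B: "B \<in> events" "B \<subseteq> A" "0 < prob B" "prob B \<le> (1/2) ^ k" by blast
    obtain C where "C \<in> events" "C \<subseteq> B" "0 < prob C" "prob C \<le> prob B / 2" using half[OF B(1,3)] by blast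
    then show ?case using B by (intro bexI[of _ C]) auto
  qed (use assms in auto)
  moreover obtain k where "(1/2) ^ k < \<epsilon>" using real_arch_pow_inv[OF assms(4), of "1/2"] by auto
  ultimately obtain B where "B \<in> events" "B \<subseteq> A" "0 < prob B" "prob B \<le> (1/2) ^ k" by blast
  then show thesis using that[of B] \<open>(1/2) ^ k < \<epsilon>\<close> by auto
qed

text \<open>Sierpinski's theorem. Each step of the exhaustion gains at least half of what is still possible.\<close>

lemma atomless_intermediate:
  assumes at: "atomless M" and A: "A \<in> events" and c: "0 \<le> c" "c \<le> prob A"
  obtains B where "B \<in> events" "B \<subseteq> A" "prob B = c"
proof -
  let ?S = "\<lambda>B. {D. D \<in> events \<and> D \<subseteq> A \<and> B \<subseteq> D \<and> prob D \<le> c}"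
  have step: "\<exists>C. C \<in> ?S B \<and> (\<forall>D\<in>?S B. prob D - prob C \<le> prob C - prob B)" if B: "B \<in> ?S {}" for B
  proof -
    define s where "s = (SUP D\<in>?S B. prob D)"
    have BS: "B \<in> ?S B" using B by simp
    then have ne: "?S B \<noteq> {}" by blast
    have bdd: "bdd_above (prob ` ?S B)" by (rule bdd_aboveI[of _ 1]) (elim imageE, simp)
    have up: "prob D \<le> s" if "D \<in> ?S B" for D unfolding s_def by (rule cSUP_upper[OF that bdd])
    \<comment> \<open>\<open>C\<close> lies at least half-way from \<open>prob B\<close> to the
      supremum, so what any admissible \<open>D\<close> still gains over \<open>C\<close> is at most
      what \<open>C\<close> gained over \<open>B\<close>.\<close>
    obtain C where C: "C \<in> ?S B" "(s + prob B) / 2 \<le> prob C"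
    proof (cases "s = prob B")
      case True then show thesis using BS by (intro that[of B]) simp_all
    next
      case False
      then have "(s + prob B) / 2 < s" using up[OF BS] by simp
      then show thesis unfolding s_def less_cSUP_iff[OF ne bdd] by (elim bexE) (rule that, assumption, simp add: s_def)
    qed
    have "prob D - prob C \<le> prob C - prob B" if "D \<in> ?S B" for D using up[OF that] C(2) by (simp add: field_simps)
    then show ?thesis using C(1) by (intro exI[of _ C]) simp
  qed
  obtain f where f: "\<And>n. f n \<in> ?S {}" "\<And>n. f (Suc n) \<in> ?S (f n) \<and> (\<forall>D\<in>?S (f n). prob D - prob (f (Suc n)) \<le> prob (f (Suc n)) - prob (f n))"
  proof -
    have "\<exists>f. \<forall>n. f n \<in> ?S {} \<and> (f (Suc n) \<in> ?S (f n) \<and> (\<forall>D\<in>?S (f n). prob D - prob (f (Suc n)) \<le> prob (f (Suc n)) - prob (f n)))"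
    proof (rule dependent_nat_choice)
      show "\<exists>x. x \<in> ?S {}" using c by (intro exI[of _ "{}"]) auto
      fix B and n :: nat assume B: "B \<in> ?S {}"
      obtain C where C: "C \<in> ?S B" "\<forall>D\<in>?S B. prob D - prob C \<le> prob C - prob B" using step[OF B] by blast
      have "C \<in> ?S {}" using C(1) by simp
      then show "\<exists>C. C \<in> ?S {} \<and> (C \<in> ?S B \<and> (\<forall>D\<in>?S B. prob D - prob C \<le> prob C - prob B))" using C by blast
    qed
    then show thesis using that by blast
  qed
  have inc: "incseq f" by (rule incseq_SucI) (use f(2) in blast)
  define L where "L = (\<Union>n. f n)"
  have Lev: "L \<in> events" "L \<subseteq> A" unfolding L_def using f(1) by blast+
  have lim: "(\<lambda>n. prob (f n)) \<longlonglongrightarrow> prob L" unfolding L_def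
    by (rule finite_Lim_measure_incseq[OF _ inc]) (use f(1) in blast)
  have "prob L \<le> c" by (rule LIMSEQ_le_const2[OF lim]) (use f(1) in blast)
  moreover have "\<not> prob L < c"
  proof
    assume l: "prob L < c"
    have "prob (A - L) = prob A - prob L" by (rule finite_measure_Diff[OF A Lev])
    then have "0 < prob (A - L)" using l c by simp
    then obtain D where D: "D \<in> events" "D \<subseteq> A - L" "0 < prob D" "prob D < c - prob L"
      using l by (elim atomless_small[OF at, of "A - L" "c - prob L", rotated 1]) (use A Lev in auto)
    have LD: "prob (L \<union> D) = prob L + prob D" by (rule finite_measure_Union) (use D Lev in auto)
    \<comment> \<open>The enlarged set competes at every stage, so its gain over
      \<open>f (Suc n)\<close> is bounded by increments that tend to zero.\<close>
    have "L \<union> D \<in> ?S (f n)" for n using LD D Lev unfolding L_def by auto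
    then have "prob (L \<union> D) - prob (f (Suc n)) \<le> prob (f (Suc n)) - prob (f n)" for n using f(2) by blast
    moreover have "(\<lambda>n. prob (L \<union> D) - prob (f (Suc n))) \<longlonglongrightarrow> prob (L \<union> D) - prob L"
      by (intro tendsto_diff tendsto_const LIMSEQ_Suc lim)
    moreover have "(\<lambda>n. prob (f (Suc n)) - prob (f n)) \<longlonglongrightarrow> prob L - prob L"
      by (intro tendsto_diff LIMSEQ_Suc lim)
    ultimately have "prob (L \<union> D) - prob L \<le> prob L - prob L" by (intro LIMSEQ_le) auto
    then show False using LD D(3) by simp
  qed
  ultimately show thesis using that[OF Lev] by linarith
qed

lemma atomless_between:
  assumes at: "atomless M" and A: "A \<in> events" and B: "B \<in> events" "A \<subseteq> B" and c: "prob A \<le> c" "c \<le> prob B"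
  shows "\<exists>C. C \<in> events \<and> A \<subseteq> C \<and> C \<subseteq> B \<and> prob C = c"
proof -
  have "prob (B - A) = prob B - prob A" by (rule finite_measure_Diff[OF B(1) A B(2)])
  then obtain D where D: "D \<in> events" "D \<subseteq> B - A" "prob D = c - prob A"
    by (elim atomless_intermediate[OF at, of "B - A" "c - prob A", rotated 3]) (use A B c in auto)
  have "prob (A \<union> D) = prob A + prob D" by (rule finite_measure_Union) (use A D in auto)
  then show ?thesis using A B D by (intro exI[of _ "A \<union> D"]) auto
qed

text \<open>Sets of intermediate measure are inserted between neighbours of the chain. A refinement
  keeps the old sets at even indices, so sets of levels n and m are compared at the common level n +
  m.\<close>

lemma atomless_dyadic:
  assumes at: "atomless M"
  obtains D :: "nat \<Rightarrow> nat \<Rightarrow> 'a set" where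
    "\<And>n k. k \<le> 2 ^ n \<Longrightarrow> D n k \<in> events \<and> prob (D n k) = real k / 2 ^ n"
    "\<And>n k m j. k \<le> 2 ^ n \<Longrightarrow> j \<le> 2 ^ m \<Longrightarrow> real k / 2 ^ n \<le> real j / 2 ^ m \<Longrightarrow> D n k \<subseteq> D m j"
proof -
  let ?P = "\<lambda>n f. (\<forall>k\<le>2 ^ n. f k \<in> events \<and> prob (f k) = real k / 2 ^ n) \<and> (\<forall>k<2 ^ n. f k \<subseteq> f (Suc k))"
  have "\<exists>D. \<forall>n. ?P n (D n) \<and> (\<forall>k\<le>2 ^ n. D (Suc n) (2 * k) = D n k)"
  proof (rule dependent_nat_choice)
    show "\<exists>f. ?P 0 f"
      by (rule exI[of _ "\<lambda>k. if k = 0 then {} else space M"]) (auto simp: prob_space le_Suc_eq)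
    fix f and n :: nat assume f: "?P n f"
    have "\<exists>C. C \<in> events \<and> f k \<subseteq> C \<and> C \<subseteq> f (Suc k) \<and> prob C = real (2 * k + 1) / 2 ^ Suc n" if k: "k < 2 ^ n" for k
    proof (rule atomless_between[OF at])
      have k': "Suc k \<le> 2 ^ n" using k by simp
      have "prob (f k) = real k / 2 ^ n" "prob (f (Suc k)) = real (Suc k) / 2 ^ n" using f k k' by auto
      then show "prob (f k) \<le> real (2 * k + 1) / 2 ^ Suc n" "real (2 * k + 1) / 2 ^ Suc n \<le> prob (f (Suc k))"
        by (simp_all add: field_simps)
      show "f k \<in> events" "f (Suc k) \<in> events" "f k \<subseteq> f (Suc k)" using f k k' by auto
    qed
    then obtain h where h: "\<And>k. k < 2 ^ n \<Longrightarrow> h k \<in> events \<and> f k \<subseteq> h k \<and> h k \<subseteq> f (Suc k) \<and> prob (h k) = real (2 * k + 1) / 2 ^ Suc n"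
      by metis
    let ?g = "\<lambda>j. if even j then f (j div 2) else h (j div 2)"
    have "?g j \<in> events \<and> prob (?g j) = real j / 2 ^ Suc n" if j: "j \<le> 2 ^ Suc n" for j
    proof (cases "even j")
      case True
      then obtain k where k: "j = 2 * k" by blast
      then have "f k \<in> events" "prob (f k) = real k / 2 ^ n" using f j by auto
      then show ?thesis using k by simp
    next
      case False
      then obtain k where k: "j = 2 * k + 1" by (rule oddE)
      then have "k < 2 ^ n" using j by simp
      then show ?thesis using h[of k] k by simp
    qed
    moreover have "?g j \<subseteq> ?g (Suc j)" if j: "j < 2 ^ Suc n" for j
    proof (cases "even j")
      case True
      then obtain k where k: "j = 2 * k" by blast
      then have "k < 2 ^ n" using j by simp
      then show ?thesis using h[of k] k by simp
    next
      case False
      then obtain k where k: "j = 2 * k + 1" by (rule oddE)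
      then have "k < 2 ^ n" using j by simp
      then show ?thesis using h[of k] k by simp
    qed
    ultimately show "\<exists>g. ?P (Suc n) g \<and> (\<forall>k\<le>2 ^ n. g (2 * k) = f k)" by (intro exI[of _ ?g]) simp
  qed
  then obtain D where D: "\<And>n. ?P n (D n)" "\<And>n k. k \<le> 2 ^ n \<Longrightarrow> D (Suc n) (2 * k) = D n k" by blast
  have ref: "D (n + d) (k * 2 ^ d) = D n k" if "k \<le> 2 ^ n" for n k d
  proof (induction d)
    case (Suc d)
    have "k * 2 ^ d \<le> 2 ^ (n + d)" using that by (simp add: power_add)
    from D(2)[OF this] Suc show ?case by (simp add: mult.left_commute)
  qed simp
  have mono: "D n k \<subseteq> D n k'" if "k \<le> k'" "k' \<le> 2 ^ n" for n k k'
    using that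
  proof (induction k' rule: dec_induct)
    case (step m) then show ?case using D(1)[of n] by (meson Suc_leD Suc_le_eq order_trans)
  qed simp
  have "D n k \<subseteq> D m j" if "k \<le> 2 ^ n" "j \<le> 2 ^ m" "real k / 2 ^ n \<le> real j / 2 ^ m" for n k m j
  proof -
    have "real k * 2 ^ m \<le> real j * 2 ^ n" using that(3) by (simp add: field_simps)
    then have "real (k * 2 ^ m) \<le> real (j * 2 ^ n)" by simp
    then have "k * 2 ^ m \<le> j * 2 ^ n" unfolding of_nat_le_iff .
    moreover have "j * 2 ^ n \<le> 2 ^ (n + m)" using that(2) by (simp add: power_add)
    ultimately have "D (n + m) (k * 2 ^ m) \<subseteq> D (n + m) (j * 2 ^ n)" by (rule mono)
    then show ?thesis using ref[OF that(1), of m] ref[OF that(2), of n] by (simp add: add.commute)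
  qed
  moreover have "D n k \<in> events \<and> prob (D n k) = real k / 2 ^ n" if "k \<le> 2 ^ n" for n k using D(1) that by blast
  ultimately show thesis by (intro that)
qed

text \<open>\<open>U \<omega>\<close> is the infimum of the dyadic numbers whose set in the chain
  contains \<open>\<omega>\<close>. The event \<open>U < t\<close> is then the union of the sets
  with index below t, squeezed between sets of known measure.\<close>

lemma atomless_uniform:
  assumes at: "atomless M"
  obtains U where "U \<in> borel_measurable M" "\<And>\<omega>. 0 \<le> U \<omega>" "\<And>t. 0 \<le> t \<Longrightarrow> t \<le> 1 \<Longrightarrow> prob {\<omega> \<in> space M. U \<omega> < t} = t"
proof -
  obtain D where D: "\<And>n k. k \<le> 2 ^ n \<Longrightarrow> D n k \<in> events \<and> prob (D n k) = real k / 2 ^ n"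
    and ch: "\<And>n k m j. k \<le> 2 ^ n \<Longrightarrow> j \<le> 2 ^ m \<Longrightarrow> real k / 2 ^ n \<le> real j / 2 ^ m \<Longrightarrow> D n k \<subseteq> D m j"
    by (rule atomless_dyadic[OF at]) blast
  \<comment> \<open>The element 1 keeps the infimum defined where no set of the chain contains
    \<open>\<omega>\<close>, in particular outside the space.\<close>
  define Z where "Z \<omega> = insert 1 {real k / 2 ^ n | n k. k \<le> 2 ^ n \<and> \<omega> \<in> D n k}" for \<omega>
  define U where "U \<omega> = Inf (Z \<omega>)" for \<omega>
  have Z0: "0 \<le> z" if "z \<in> Z \<omega>" for z \<omega> using that by (auto simp: Z_def)
  have bdd: "bdd_below (Z \<omega>)" for \<omega> by (rule bdd_belowI[of _ 0]) (rule Z0)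
  have ne: "Z \<omega> \<noteq> {}" for \<omega> by (simp add: Z_def)
  define I where "I t = {(n, k). k \<le> 2 ^ n \<and> real k / 2 ^ n < t}" for t :: real
  define W where "W t = (\<Union>(n, k)\<in>I t. D n k)" for t
  have WI: "W t \<in> events" for t
    unfolding W_def by (rule sets.countable_UN'') (use D in \<open>auto simp: I_def\<close>)
  have less: "{\<omega> \<in> space M. U \<omega> < t} = W t" if "t \<le> 1" for t
  proof -
    have "U \<omega> < t \<longleftrightarrow> (\<exists>z\<in>Z \<omega>. z < t)" for \<omega> unfolding U_def by (rule cInf_less_iff[OF ne bdd])
    moreover have "(\<exists>z\<in>Z \<omega>. z < t) \<longleftrightarrow> \<omega> \<in> W t" for \<omega>
      using that unfolding Z_def W_def I_def by auto
    moreover have "W t \<subseteq> space M" by (rule sets.sets_into_space[OF WI])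
    ultimately show ?thesis by auto
  qed
  \<comment> \<open>\<open>x\<close> is rounded up to a multiple of 2^-n, with n so large that 2^-n
    is below y - x.\<close>
  have near: "\<exists>n k. k \<le> 2 ^ n \<and> x \<le> real k / 2 ^ n \<and> real k / 2 ^ n < y" if x: "0 \<le> x" "x < y" "x \<le> 1" for x y :: real
  proof -
    obtain n where n: "(1/2) ^ n < y - x" using real_arch_pow_inv[of "y - x" "1/2"] x by auto
    define k where "k = nat \<lceil>x * 2 ^ n\<rceil>"
    have k0: "0 \<le> \<lceil>x * 2 ^ n\<rceil>" using x(1) by (simp add: order.strict_trans2[of "-1" 0])
    have rk: "real k = of_int \<lceil>x * 2 ^ n\<rceil>" unfolding k_def using k0 by simp
    have 1: "x * 2 ^ n \<le> real k" "real k < x * 2 ^ n + 1" unfolding rk by linarith+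
    have "x * 2 ^ n \<le> 2 ^ n" using x(3) by simp
    then have "\<lceil>x * 2 ^ n\<rceil> \<le> 2 ^ n" by (simp add: ceiling_le_iff)
    then have "k \<le> 2 ^ n" unfolding k_def by (simp add: nat_le_iff)
    moreover have "x \<le> real k / 2 ^ n" using 1(1) by (simp add: pos_le_divide_eq)
    moreover have "real k / 2 ^ n < y"
    proof -
      have "real k / 2 ^ n < (x * 2 ^ n + 1) / 2 ^ n" using 1(2) by (rule divide_strict_right_mono) simp
      also have "\<dots> = x + (1/2) ^ n" by (simp add: add_divide_distrib power_one_over)
      finally show ?thesis using n by simp
    qed
    ultimately show ?thesis by blast
  qed
  have PW: "prob (W t) = t" if t: "0 \<le> t" "t \<le> 1" for t
  proof (rule antisym)
    show "prob (W t) \<le> t"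
    proof (rule dense_ge)
      fix z assume z: "t < z"
      obtain m j where j: "j \<le> 2 ^ m" "t \<le> real j / 2 ^ m" "real j / 2 ^ m < z" using near[OF t(1) z t(2)] by blast
      have "W t \<subseteq> D m j" unfolding W_def I_def using ch[OF _ j(1)] j(2) by fastforce
      then have "prob (W t) \<le> prob (D m j)" using D[OF j(1)] by (intro finite_measure_mono) auto
      then show "prob (W t) \<le> z" using D[OF j(1)] j(3) by linarith
    qed
    show "t \<le> prob (W t)"
    proof (rule dense_le)
      fix y assume y: "y < t"
      show "y \<le> prob (W t)"
      proof (cases "0 \<le> y")
        case True
        obtain n k where k: "k \<le> 2 ^ n" "y \<le> real k / 2 ^ n" "real k / 2 ^ n < t" using near[OF True y] t(2) y by auto
        have "D n k \<subseteq> W t" unfolding W_def I_def using k by blast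
        then have "prob (D n k) \<le> prob (W t)" by (rule finite_measure_mono[OF _ WI])
        then show ?thesis using D[OF k(1)] k(2) by linarith
      qed (use measure_nonneg[of M "W t"] in linarith)
    qed
  qed
  have U1: "U \<omega> \<le> 1" for \<omega> unfolding U_def by (rule cInf_lower[OF _ bdd]) (simp add: Z_def)
  show thesis
  proof (rule that[of U])
    show "U \<in> borel_measurable M" unfolding borel_measurable_iff_less
    proof
      fix a show "{w \<in> space M. U w < a} \<in> events"
      proof (cases "a \<le> 1")
        case False
        then have "{w \<in> space M. U w < a} = space M" using U1 by (force intro: le_less_trans)
        then show ?thesis by simp
      qed (simp add: less WI)
    qed
    show "0 \<le> U \<omega>" for \<omega> unfolding U_def by (rule cInf_greatest[OF ne Z0])
    show "prob {\<omega> \<in> space M. U \<omega> < t} = t" if "0 \<le> t" "t \<le> 1" for t using that by (simp add: less PW)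
  qed
qed

end

section \<open>Quantiles and monotone rearrangement\<close>

lemma Least_eq_below:
  fixes P Q :: "nat \<Rightarrow> bool"
  assumes "P n" "Q n" "\<And>i. i \<le> n \<Longrightarrow> P i = Q i"
  shows "(LEAST i. P i) = (LEAST i. Q i)"
proof (rule Least_equality[symmetric])
  have "(LEAST i. P i) \<le> n" by (rule Least_le[of P n]) (rule assms(1))
  moreover have "P (LEAST i. P i)" by (rule LeastI[of P n]) (rule assms(1))
  ultimately show "Q (LEAST i. P i)" using assms(3) by blast
  fix y assume "Q y"
  show "(LEAST i. P i) \<le> y"
  proof (cases "y \<le> n")
    case True then show ?thesis using \<open>Q y\<close> assms(3) by (intro Least_le) blast
  qed (use \<open>(LEAST i. P i) \<le> n\<close> in linarith)
qed

lemma Lipschitz_continuous: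
  assumes A: "Metric_space A d" and B: "Metric_space B e" and f: "\<And>x. x \<in> A \<Longrightarrow> f x \<in> B"
    and L: "\<And>x y. x \<in> A \<Longrightarrow> y \<in> A \<Longrightarrow> e (f x) (f y) \<le> C * d x y" and C: "0 < C"
  shows "continuous_map (Metric_space.mtopology A d) (Metric_space.mtopology B e) f"
  unfolding Metric_space.continuous_map_to_metric[OF B]
proof (intro ballI allI impI)
  interpret A: Metric_space A d by (rule A)
  interpret B: Metric_space B e by (rule B)
  fix x \<epsilon> assume x: "x \<in> topspace A.mtopology" and \<epsilon>: "0 < (\<epsilon>::real)"
  have xA: "x \<in> A" using x by simp
  have "f y \<in> B.mball (f x) \<epsilon>" if y: "y \<in> A.mball x (\<epsilon> / C)" for y
  proof -
    have yA: "y \<in> A" "d x y < \<epsilon> / C" using y by auto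
    have "C * d x y < \<epsilon>" using yA(2) C by (simp add: pos_less_divide_eq mult.commute)
    then have "e (f x) (f y) < \<epsilon>" using L[OF xA yA(1)] by linarith
    then show ?thesis using f xA yA(1) by simp
  qed
  then show "\<exists>U. openin A.mtopology U \<and> x \<in> U \<and> (\<forall>y\<in>U. f y \<in> B.mball (f x) \<epsilon>)"
    using xA \<epsilon> C by (intro exI[of _ "A.mball x (\<epsilon> / C)"]) auto
qed

text \<open>The codiagonal of the two copies of [n]. For n > 0 it is not increasing, hence no
  morphism of the simplex category; it is applied to the random variables themselves, where it
  commutes with doubled maps.\<close>

definition fold2 :: "nat \<Rightarrow> nat \<Rightarrow> nat" where
  "fold2 n j = (if j \<le> n then j else j - n - 1)"

locale uniform_prob = prob_space M for M :: "'a measure" +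
  fixes U :: "'a \<Rightarrow> real"
  assumes U_meas [measurable]: "U \<in> borel_measurable M" and U_nonneg: "\<And>\<omega>. 0 \<le> U \<omega>"
    and U_dist: "\<And>t. 0 \<le> t \<Longrightarrow> t \<le> 1 \<Longrightarrow> prob {\<omega> \<in> space M. U \<omega> < t} = t"
begin

text \<open>For a distribution function \<open>a\<close> this is the quantile function evaluated at
  \<open>U\<close>, used only on \<open>U < t\<close>. The alternative \<open>i = n\<close> bounds
  the value by n whatever \<open>a\<close> is.\<close>

definition hop :: "nat \<Rightarrow> (nat \<Rightarrow> real) \<Rightarrow> real \<Rightarrow> ('a \<Rightarrow> nat) \<Rightarrow> 'a \<Rightarrow> nat" where
  "hop n a t v \<omega> = (if U \<omega> < t then LEAST i. U \<omega> < a i \<or> i = n else v \<omega>)"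

text \<open>The distribution function of \<open>v\<close> on the event \<open>U < t\<close>. For
  \<open>v\<close> with values in [n] and t in the unit interval, its value at n is t.\<close>

definition cum :: "('a \<Rightarrow> nat) \<Rightarrow> real \<Rightarrow> nat \<Rightarrow> real" where
  "cum v t i = prob {\<omega> \<in> space M. v \<omega> \<le> i \<and> U \<omega> < t}"

text \<open>On \<open>U < t\<close> the values of \<open>v\<close> are rearranged in increasing order of \<open>U\<close>, without changing the law.\<close>

definition sorted_below :: "nat \<Rightarrow> real \<Rightarrow> ('a \<Rightarrow> nat) \<Rightarrow> 'a \<Rightarrow> nat" where
  "sorted_below n t v = hop n (cum v t) t v"

lemma meas_nat [measurable_dest]: "v \<in> measurable M (count_space {..n}) \<Longrightarrow> v \<in> measurable M (count_space (UNIV :: nat set))"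
  by (rule measurable_compose[of v M "count_space {..n}" "\<lambda>x. x"]) (simp_all add: measurable_count_space_eq1)

lemma meas_natI:
  assumes "v \<in> measurable M (count_space (UNIV :: nat set))" "\<And>\<omega>. \<omega> \<in> space M \<Longrightarrow> v \<omega> \<le> n"
  shows "v \<in> measurable M (count_space {..n})"
  by (rule measurableI) (use assms measurable_sets[OF assms(1)] in auto)

lemma meas_le: "v \<in> measurable M (count_space {..n}) \<Longrightarrow> \<omega> \<in> space M \<Longrightarrow> v \<omega> \<le> (n::nat)"
  using measurable_space[of v M "count_space {..n}" \<omega>] by simp

lemma hop_meas:
  assumes v: "v \<in> measurable M (count_space {..n})"
  shows "hop n a t v \<in> measurable M (count_space {..n})"
proof (rule meas_natI)
  note [measurable] = meas_nat[OF v]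
  show "hop n a t v \<in> measurable M (count_space UNIV)" unfolding hop_def[abs_def] by measurable
  show "hop n a t v \<omega> \<le> n" if "\<omega> \<in> space M" for \<omega>
    using meas_le[OF v that] Least_le[of "\<lambda>i. U \<omega> < a i \<or> i = n" n] by (simp add: hop_def)
qed

definition band :: "real \<Rightarrow> real \<Rightarrow> 'a set" where
  "band x y = {\<omega> \<in> space M. min x y \<le> U \<omega> \<and> U \<omega> < max x y}"

lemma band: "band x y \<in> events" "0 \<le> x \<Longrightarrow> x \<le> 1 \<Longrightarrow> 0 \<le> y \<Longrightarrow> y \<le> 1 \<Longrightarrow> prob (band x y) = \<bar>x - y\<bar>"
proof -
  show "band x y \<in> events" unfolding band_def by measurable
  assume "0 \<le> x" "x \<le> 1" "0 \<le> y" "y \<le> 1"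
  then have m: "0 \<le> min x y" "min x y \<le> 1" "0 \<le> max x y" "max x y \<le> 1" by auto
  have e: "{\<omega> \<in> space M. U \<omega> < z} \<in> events" for z by measurable
  have b: "band x y = {\<omega> \<in> space M. U \<omega> < max x y} - {\<omega> \<in> space M. U \<omega> < min x y}" by (auto simp: band_def)
  have "prob (band x y) = prob {\<omega> \<in> space M. U \<omega> < max x y} - prob {\<omega> \<in> space M. U \<omega> < min x y}"
    unfolding b by (rule finite_measure_Diff[OF e e]) (auto simp: max_def min_def)
  then show "prob (band x y) = \<bar>x - y\<bar>" using m by (simp add: U_dist max_def min_def)
qed

text \<open>The two variables can differ only where \<open>v\<close> and \<open>w\<close> do, or
  where \<open>U\<close> separates \<open>t\<close> from \<open>u\<close> or some \<open>a i\<close>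
  from \<open>b i\<close>; the latter events have the distance of the two thresholds as
  probability.\<close>

lemma hop_dist:
  assumes v: "v \<in> measurable M (count_space {..n})" and w: "w \<in> measurable M (count_space {..n})"
    and a: "\<And>i. 0 \<le> a i \<and> a i \<le> 1" and b: "\<And>i. 0 \<le> b i \<and> b i \<le> 1" and t: "0 \<le> t" "t \<le> 1" "0 \<le> u" "u \<le> 1"
  shows "prob {\<omega> \<in> space M. hop n a t v \<omega> \<noteq> hop n b u w \<omega>} \<le> \<bar>t - u\<bar> + prob {\<omega> \<in> space M. v \<omega> \<noteq> w \<omega>} + (\<Sum>i\<le>n. \<bar>a i - b i\<bar>)"
proof -
  let ?N = "{\<omega> \<in> space M. v \<omega> \<noteq> w \<omega>}"
  have N: "?N \<in> events" by (rule sets_neq[OF v w])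
  have UB: "(\<Union>i\<le>n. band (a i) (b i)) \<in> events" using band(1) by blast
  have "{\<omega> \<in> space M. hop n a t v \<omega> \<noteq> hop n b u w \<omega>} \<subseteq> (band t u \<union> ?N) \<union> (\<Union>i\<le>n. band (a i) (b i))"
  proof (rule subsetI, rule ccontr)
    fix \<omega> assume h: "\<omega> \<in> {\<omega> \<in> space M. hop n a t v \<omega> \<noteq> hop n b u w \<omega>}" and no: "\<omega> \<notin> (band t u \<union> ?N) \<union> (\<Union>i\<le>n. band (a i) (b i))"
    have sp: "\<omega> \<in> space M" using h by simp
    have tu: "(U \<omega> < t) = (U \<omega> < u)" and vw: "v \<omega> = w \<omega>" using no sp by (auto simp: band_def)
    have ab: "(U \<omega> < a i) = (U \<omega> < b i)" if "i \<le> n" for i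
    proof -
      have "\<omega> \<notin> band (a i) (b i)" using no that by blast
      then show ?thesis using sp by (auto simp: band_def)
    qed
    have "(LEAST i. U \<omega> < a i \<or> i = n) = (LEAST i. U \<omega> < b i \<or> i = n)"
      by (rule Least_eq_below[of _ n]) (use ab in auto)
    then show False using h tu vw by (simp add: hop_def cong: if_cong)
  qed
  then have "prob {\<omega> \<in> space M. hop n a t v \<omega> \<noteq> hop n b u w \<omega>} \<le> prob ((band t u \<union> ?N) \<union> (\<Union>i\<le>n. band (a i) (b i)))"
    by (rule finite_measure_mono) (use band(1) N UB in auto)
  also have "\<dots> \<le> prob (band t u \<union> ?N) + prob (\<Union>i\<le>n. band (a i) (b i))" by (rule measure_Un_le) (use band(1) N UB in auto)
  also have "\<dots> \<le> (prob (band t u) + prob ?N) + (\<Sum>i\<le>n. prob (band (a i) (b i)))"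
    by (intro add_mono measure_Un_le measure_UNION_le) (use band(1) N in auto)
  also have "\<dots> = \<bar>t - u\<bar> + prob ?N + (\<Sum>i\<le>n. \<bar>a i - b i\<bar>)" using band(2) a b t by simp
  finally show ?thesis .
qed

lemma cum_bounds: "0 \<le> cum v t i \<and> cum v t i \<le> 1"
  by (simp add: cum_def)

lemma cum_event:
  fixes v :: "'a \<Rightarrow> nat"
  shows "v \<in> measurable M (count_space {..n}) \<Longrightarrow> {\<omega> \<in> space M. v \<omega> \<le> i \<and> U \<omega> < t} \<in> events"
proof -
  assume "v \<in> measurable M (count_space {..n})"
  note [measurable] = meas_nat[OF this]
  show ?thesis by measurable
qed

lemma cum_dist:
  assumes v: "v \<in> measurable M (count_space {..n})" and w: "w \<in> measurable M (count_space {..n})"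
    and t: "0 \<le> t" "t \<le> 1" "0 \<le> u" "u \<le> 1"
  shows "\<bar>cum v t i - cum w u i\<bar> \<le> \<bar>t - u\<bar> + prob {\<omega> \<in> space M. v \<omega> \<noteq> w \<omega>}"
proof -
  have le: "cum v t i \<le> cum w u i + (\<bar>t - u\<bar> + prob {\<omega> \<in> space M. v \<omega> \<noteq> w \<omega>})"
    if v: "v \<in> measurable M (count_space {..n})" and w: "w \<in> measurable M (count_space {..n})"
      and t: "0 \<le> t" "t \<le> 1" "0 \<le> u" "u \<le> 1" for v w t u
  proof -
    let ?N = "{\<omega> \<in> space M. v \<omega> \<noteq> w \<omega>}" and ?C = "{\<omega> \<in> space M. w \<omega> \<le> i \<and> U \<omega> < u}"
    have N: "?N \<in> events" by (rule sets_neq[OF v w])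
    have "cum v t i \<le> prob (?C \<union> (band t u \<union> ?N))" unfolding cum_def
      by (rule finite_measure_mono) (use cum_event[OF w] band(1) N in \<open>auto simp: band_def\<close>)
    also have "\<dots> \<le> prob ?C + (prob (band t u) + prob ?N)"
      by (rule order_trans[OF measure_Un_le add_left_mono[OF measure_Un_le]]) (use cum_event[OF w] band(1) N in auto)
    finally show ?thesis using band(2)[OF t] by (simp add: cum_def)
  qed
  have "{\<omega> \<in> space M. v \<omega> \<noteq> w \<omega>} = {\<omega> \<in> space M. w \<omega> \<noteq> v \<omega>}" by auto
  then show ?thesis using le[OF v w t] le[OF w v t(3,4,1,2)] by (simp add: abs_le_iff abs_minus_commute)
qed

lemma sorted_below_meas: "v \<in> measurable M (count_space {..n}) \<Longrightarrow> sorted_below n t v \<in> measurable M (count_space {..n})"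
  unfolding sorted_below_def by (rule hop_meas)

text \<open>The constant n + 2 counts the change of \<open>t\<close> and \<open>v\<close> once
  directly and once for each of the n + 1 thresholds.\<close>

lemma sorted_below_dist:
  assumes v: "v \<in> measurable M (count_space {..n})" and w: "w \<in> measurable M (count_space {..n})"
    and t: "0 \<le> t" "t \<le> 1" "0 \<le> u" "u \<le> 1"
  shows "prob {\<omega> \<in> space M. sorted_below n t v \<omega> \<noteq> sorted_below n u w \<omega>} \<le> real (n + 2) * (\<bar>t - u\<bar> + prob {\<omega> \<in> space M. v \<omega> \<noteq> w \<omega>})"
proof -
  let ?d = "\<bar>t - u\<bar> + prob {\<omega> \<in> space M. v \<omega> \<noteq> w \<omega>}"
  have "(\<Sum>i\<le>n. \<bar>cum v t i - cum w u i\<bar>) \<le> (\<Sum>i\<le>n. ?d)" by (rule sum_mono) (rule cum_dist[OF v w t])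
  also have "\<dots> = real (n + 1) * ?d" by simp
  finally have "(\<Sum>i\<le>n. \<bar>cum v t i - cum w u i\<bar>) \<le> real (n + 1) * ?d" .
  moreover have "prob {\<omega> \<in> space M. sorted_below n t v \<omega> \<noteq> sorted_below n u w \<omega>} \<le> ?d + (\<Sum>i\<le>n. \<bar>cum v t i - cum w u i\<bar>)"
    unfolding sorted_below_def by (rule hop_dist[OF v w _ _ t]) (rule cum_bounds)+
  moreover have "real (n + 2) * ?d = ?d + real (n + 1) * ?d" by (simp add: algebra_simps)
  ultimately show ?thesis by linarith
qed

lemma sorted_below_AE:
  assumes v: "v \<in> measurable M (count_space {..n})" and w: "w \<in> measurable M (count_space {..n})"
    and e: "AE \<omega> in M. v \<omega> = w \<omega>"
  shows "AE \<omega> in M. sorted_below n t v \<omega> = sorted_below n t w \<omega>"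
proof -
  have "cum v t = cum w t"
  proof
    fix i show "cum v t i = cum w t i" unfolding cum_def
      by (rule finite_measure_eq_AE) (use e cum_event[OF v] cum_event[OF w] in auto)
  qed
  then show ?thesis using e unfolding sorted_below_def hop_def by auto
qed

text \<open>Let k be the first index whose threshold exceeds \<open>U\<close>. For increasing
  \<open>\<sigma>\<close> the event \<open>v \<le> k\<close> lies in
  \<open>\<sigma> \<circ> v \<le> \<sigma> k\<close>, while
  \<open>\<sigma> \<circ> v \<le> i\<close> with i below \<open>\<sigma> k\<close> forces
  \<open>v < k\<close>. So \<open>\<sigma> k\<close> is the corresponding index for
  \<open>\<sigma> \<circ> v\<close>. This is the source of all naturality in the
  deformation.\<close>

lemma sorted_below_natural:
  assumes s: "\<sigma> \<in> order_maps n m" and v: "v \<in> measurable M (count_space {..n})" and t: "0 \<le> t" "t \<le> 1" and w: "\<omega> \<in> space M"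
  shows "sorted_below m t (\<sigma> \<circ> v) \<omega> = \<sigma> (sorted_below n t v \<omega>)"
proof (cases "U \<omega> < t")
  case True
  let ?P = "\<lambda>i. U \<omega> < cum v t i \<or> i = n" and ?Q = "\<lambda>i. U \<omega> < cum (\<sigma> \<circ> v) t i \<or> i = m"
  define k where "k = (LEAST i. ?P i)"
  have \<sigma>v: "\<sigma> \<circ> v \<in> measurable M (count_space {..m})" by (rule meas_comp[OF s v])
  have le: "v x \<le> n" if "x \<in> space M" for x by (rule meas_le[OF v that])
  have kn: "k \<le> n" unfolding k_def by (rule Least_le) simp
  have "cum v t n = prob {x \<in> space M. U x < t}" unfolding cum_def by (rule arg_cong[where f = prob]) (use le in auto)
  then have "cum v t n = t" using U_dist[OF t] by simp
  moreover have "?P k" unfolding k_def by (rule LeastI[of ?P n]) simp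
  \<comment> \<open>Also for k = n: the last threshold is \<open>t\<close>, which exceeds
    \<open>U\<close>.\<close>
  ultimately have Uk: "U \<omega> < cum v t k" using True by auto
  have "(LEAST i. ?Q i) = \<sigma> k"
  proof (rule Least_equality)
    have "cum v t k \<le> cum (\<sigma> \<circ> v) t (\<sigma> k)" unfolding cum_def
      by (rule finite_measure_mono[OF _ cum_event[OF \<sigma>v]]) (use order_mapsD(2)[OF s] kn le in \<open>auto simp: mono_on_def\<close>)
    then show "?Q (\<sigma> k)" using Uk by linarith
    fix i assume i: "?Q i"
    show "\<sigma> k \<le> i"
    proof (rule ccontr)
      assume n: "\<not> \<sigma> k \<le> i"
      have "\<sigma> k \<le> m" by (rule order_mapsD(1)[OF s kn])
      then have Ui: "U \<omega> < cum (\<sigma> \<circ> v) t i" using i n by auto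
      have lt: "v x < k" if "x \<in> space M" "\<sigma> (v x) \<le> i" for x
      proof (rule ccontr)
        assume "\<not> v x < k"
        then have "\<sigma> k \<le> \<sigma> (v x)" using order_mapsD(2)[OF s] le[OF that(1)] kn by (auto simp: mono_on_def)
        then show False using that(2) n by simp
      qed
      show False
      proof (cases k)
        case 0
        have "{x \<in> space M. (\<sigma> \<circ> v) x \<le> i \<and> U x < t} = {}" using lt 0 by auto
        then have "cum (\<sigma> \<circ> v) t i = 0" unfolding cum_def by (metis measure_empty)
        then show False using Ui U_nonneg[of \<omega>] by simp
      next
        case (Suc j)
        have "cum (\<sigma> \<circ> v) t i \<le> cum v t j" unfolding cum_def
          by (rule finite_measure_mono[OF _ cum_event[OF v]]) (use lt Suc in \<open>auto simp: less_Suc_eq_le\<close>)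
        then have "?P j" using Ui by linarith
        then have "k \<le> j" unfolding k_def by (rule Least_le)
        then show False using Suc by simp
      qed
    qed
  qed
  then show ?thesis using True by (simp add: sorted_below_def hop_def k_def)
qed (simp add: sorted_below_def hop_def)

text \<open>The increasing rearrangement of a variable with law \<open>x\<close>: its quantile
  function evaluated at \<open>U\<close>. The constant 0 enters only on the null event
  \<open>U \<ge> 1\<close>.\<close>

definition sec :: "nat \<Rightarrow> (nat \<Rightarrow> real) \<Rightarrow> ('a \<Rightarrow> nat) set" where
  "sec n x = ae_rel M n `` {hop n (\<lambda>i. \<Sum>j\<le>i. x j) 1 (\<lambda>_. 0)}"

text \<open>The mass on the second copy of [n]. It serves as the time of the deformation, so the
  homotopy parameter is carried by the random variable itself.\<close>

definition tail :: "nat \<Rightarrow> ('a \<Rightarrow> nat) set \<Rightarrow> real" where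
  "tail n F = prob {\<omega> \<in> space M. n < rep F \<omega>}"

text \<open>The copies are folded together and the result is sorted where \<open>U\<close> is below
  the mass of the second copy. A variable on the first copy is left alone, one on the second is
  sorted completely.\<close>

definition slide :: "nat \<Rightarrow> ('a \<Rightarrow> nat) set \<Rightarrow> ('a \<Rightarrow> nat) set" where
  "slide n F = ae_rel M n `` {sorted_below n (tail n F) (fold2 n \<circ> rep F)}"

lemma M: "prob_space M" by (rule prob_space_axioms)

lemma partial_sum_bounds:
  assumes "x \<in> standard_simplex n" shows "0 \<le> (\<Sum>j\<le>i. x j) \<and> (\<Sum>j\<le>i. x j) \<le> 1"
proof -
  have x: "0 \<le> x j" "n < j \<Longrightarrow> x j = 0" "(\<Sum>j\<le>n. x j) = 1" for j using assms by (auto simp: standard_simplex_def)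
  have "(\<Sum>j\<le>i. x j) \<le> (\<Sum>j\<le>max i n. x j)" by (rule sum_mono2) (use x in auto)
  also have "\<dots> = (\<Sum>j\<le>n. x j)" by (rule sum.mono_neutral_right) (use x in auto)
  finally show ?thesis using x by (simp add: sum_nonneg)
qed

lemma zero_meas: "(\<lambda>_. 0) \<in> measurable M (count_space {..n::nat})"
  by simp

lemma sec_in: "sec n x \<in> nabla M n"
  unfolding sec_def by (rule class_in[OF hop_meas[OF zero_meas]])

lemma nabla_dist_class:
  assumes "v \<in> measurable M (count_space {..n})" "w \<in> measurable M (count_space {..n})"
  shows "nabla_dist M (ae_rel M n `` {v}) (ae_rel M n `` {w}) = prob {\<omega> \<in> space M. v \<omega> \<noteq> w \<omega>}"
  unfolding nabla_dist_def
proof (rule finite_measure_eq_AE)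
  show "AE x in M. (x \<in> {t \<in> space M. rep (ae_rel M n `` {v}) t \<noteq> rep (ae_rel M n `` {w}) t}) = (x \<in> {\<omega> \<in> space M. v \<omega> \<noteq> w \<omega>})"
    using rep_class[OF assms(1)] rep_class[OF assms(2)] by eventually_elim auto
qed (intro sets_neq[of _ M n _ n] rep_in class_in assms)+

lemma continuous_sec: "continuous_map (simplex_space n) (nabla_space M n) (sec n)"
  unfolding nabla_space_def Metric_space.continuous_map_to_metric[OF Metric_space_nabla[OF M]]
proof (intro ballI allI impI)
  interpret B: Metric_space "nabla M n" "nabla_dist M" by (rule Metric_space_nabla[OF M])
  fix x \<epsilon> assume x: "x \<in> topspace (simplex_space n)" and \<epsilon>: "0 < (\<epsilon>::real)"
  have xs: "x \<in> standard_simplex n" using x by (simp add: simplex_space_def)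
  define g where "g y = (\<Sum>i\<le>n. \<bar>(\<Sum>j\<le>i. x j) - (\<Sum>j\<le>i. y j)\<bar>)" for y :: "nat \<Rightarrow> real"
  have pj: "continuous_map (simplex_space n) euclideanreal (\<lambda>y. y j)" for j
    unfolding simplex_space_def by (intro continuous_map_from_subtopology continuous_map_product_projection) simp
  have g: "continuous_map (simplex_space n) euclideanreal g" unfolding g_def
    by (intro continuous_map_sum continuous_map_real_abs continuous_map_diff pj) simp_all
  have d: "nabla_dist M (sec n x) (sec n y) \<le> g y" if y: "y \<in> standard_simplex n" for y
  proof -
    have "nabla_dist M (sec n x) (sec n y) = prob {\<omega> \<in> space M. hop n (\<lambda>i. \<Sum>j\<le>i. x j) 1 (\<lambda>_. 0) \<omega> \<noteq> hop n (\<lambda>i. \<Sum>j\<le>i. y j) 1 (\<lambda>_. 0) \<omega>}"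
      unfolding sec_def by (rule nabla_dist_class[OF hop_meas[OF zero_meas] hop_meas[OF zero_meas]])
    also have "\<dots> \<le> \<bar>1 - 1\<bar> + prob {\<omega> \<in> space M. (0::nat) \<noteq> 0} + g y" unfolding g_def
      by (rule hop_dist[OF zero_meas zero_meas partial_sum_bounds[OF xs] partial_sum_bounds[OF y]]) simp_all
    finally show ?thesis by simp
  qed
  have "openin (simplex_space n) {y \<in> topspace (simplex_space n). g y \<in> {..<\<epsilon>}}"
    by (rule openin_continuous_map_preimage[OF g]) simp
  moreover have "sec n y \<in> B.mball (sec n x) \<epsilon>" if "y \<in> {y \<in> topspace (simplex_space n). g y \<in> {..<\<epsilon>}}" for y
    using that d[of y] sec_in by (auto simp: simplex_space_def)
  moreover have "g x = 0" by (simp add: g_def)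
  ultimately show "\<exists>U. openin (simplex_space n) U \<and> x \<in> U \<and> (\<forall>y\<in>U. sec n y \<in> B.mball (sec n x) \<epsilon>)"
    using x \<epsilon> by (intro exI[of _ "{y \<in> topspace (simplex_space n). g y \<in> {..<\<epsilon>}}"]) simp
qed

lemma AE_U_less: "AE \<omega> in M. U \<omega> < 1"
proof -
  have "AE \<omega> in M. \<omega> \<in> {\<omega> \<in> space M. U \<omega> < 1}" by (rule AE_prob_1) (simp add: U_dist)
  then show ?thesis by eventually_elim simp
qed

text \<open>Where \<open>U < 1\<close> the quantile has value i exactly when \<open>U\<close> lies
  between the two consecutive partial sums, an interval of length \<open>x i\<close>.\<close>

lemma law_sec:
  assumes x: "x \<in> standard_simplex n" shows "law M (sec n x) = x"
proof
  fix i
  let ?S = "\<lambda>i. \<Sum>j\<le>i. x j"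
  have xj: "0 \<le> x j" "n < j \<Longrightarrow> x j = 0" "?S n = 1" for j using x by (auto simp: standard_simplex_def)
  have mono: "?S a \<le> ?S b" if "a \<le> b" for a b by (rule sum_mono2) (use that xj in auto)
  let ?h = "hop n ?S 1 (\<lambda>_. 0)"
  show "law M (sec n x) i = x i"
  proof (cases "i \<le> n")
    case True
    define lo where "lo = (if i = 0 then 0 else ?S (i - 1))"
    have lo: "0 \<le> lo" "lo \<le> ?S i" "lo \<le> 1" "?S i - lo = x i"
      using xj(1) mono[of "i - 1" i] partial_sum_bounds[OF x] by (cases i; simp add: lo_def)+
    have hi: "0 \<le> ?S i" "?S i \<le> 1" using partial_sum_bounds[OF x] by auto
    have key: "?h \<omega> = i \<longleftrightarrow> \<omega> \<in> band lo (?S i)" if u: "U \<omega> < 1" and sp: "\<omega> \<in> space M" for \<omega>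
    proof -
      let ?P = "\<lambda>i. U \<omega> < ?S i \<or> i = n"
      have Pn: "?P n" by simp
      have h: "?h \<omega> = (LEAST i. ?P i)" using u by (simp add: hop_def)
      have PS: "?P j \<Longrightarrow> U \<omega> < ?S j" for j using u xj(3) by auto
      show ?thesis
      proof
        assume hi: "?h \<omega> = i"
        have "U \<omega> < ?S i" using PS[OF LeastI[of ?P n]] Pn h hi by simp
        moreover have "lo \<le> U \<omega>"
        proof (cases i)
          case (Suc k)
          have "\<not> ?P k" using not_less_Least[of k ?P] h hi Suc by simp
          then show ?thesis using Suc by (simp add: lo_def)
        qed (simp add: lo_def U_nonneg)
        ultimately show "\<omega> \<in> band lo (?S i)" using sp lo(2) by (simp add: band_def)
      next
        assume "\<omega> \<in> band lo (?S i)"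
        then have b: "lo \<le> U \<omega>" "U \<omega> < ?S i" using lo(2) by (auto simp: band_def)
        have "(LEAST i. ?P i) = i"
        proof (rule Least_equality)
          show "?P i" using b(2) by simp
          fix y assume "?P y"
          then have y: "U \<omega> < ?S y" by (rule PS)
          show "i \<le> y"
          proof (rule ccontr)
            assume "\<not> i \<le> y"
            then have "?S y \<le> lo" using mono[of y "i - 1"] by (auto simp: lo_def)
            then show False using y b(1) by linarith
          qed
        qed
        then show "?h \<omega> = i" using h by simp
      qed
    qed
    have "law M (sec n x) i = prob (band lo (?S i))" unfolding law_def
    proof (rule finite_measure_eq_AE)
      show "AE \<omega> in M. (\<omega> \<in> {t \<in> space M. rep (sec n x) t = i}) = (\<omega> \<in> band lo (?S i))"
        using rep_class[OF hop_meas[OF zero_meas], of n ?S 1, folded sec_def] AE_U_less AE_space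
        by eventually_elim (use key in auto)
    qed (intro sets_rep[OF sec_in] band(1))+
    also have "\<dots> = x i" using band(2)[OF lo(1,3) hi] lo(2,4) by (simp add: abs_minus_commute)
    finally show ?thesis .
  next
    case False
    then show ?thesis using law_in[OF M sec_in, of n x] xj(2)[of i] by (simp add: standard_simplex_def)
  qed
qed

lemma fold_meas:
  assumes "F \<in> nabla M (2*n+1)" shows "fold2 n \<circ> rep F \<in> measurable M (count_space {..n})"
proof (rule meas_natI)
  have "rep F \<in> measurable M (count_space UNIV)" by (rule meas_nat[OF rep_in(2)[OF assms]])
  then show "fold2 n \<circ> rep F \<in> measurable M (count_space UNIV)" by (rule measurable_comp) simp
  show "(fold2 n \<circ> rep F) \<omega> \<le> n" if "\<omega> \<in> space M" for \<omega>
    using meas_le[OF rep_in(2)[OF assms] that] by (auto simp: fold2_def)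
qed

lemma tail_bounds: "0 \<le> tail n F" "tail n F \<le> 1"
  by (simp_all add: tail_def)

lemma tail_event: "F \<in> nabla M k \<Longrightarrow> {\<omega> \<in> space M. n < rep F \<omega>} \<in> events"
proof -
  assume "F \<in> nabla M k"
  note [measurable] = meas_nat[OF rep_in(2)[OF this]]
  show ?thesis by measurable
qed

lemma slide_in: "F \<in> nabla M (2*n+1) \<Longrightarrow> slide n F \<in> nabla M n"
  unfolding slide_def by (rule class_in[OF sorted_below_meas[OF fold_meas]])

text \<open>Lipschitz: a change of \<open>F\<close> on a set of measure d changes the time by at
  most d and the folded variable on a set of measure at most d.\<close>

lemma continuous_slide: "continuous_map (nabla_space M (2*n+1)) (nabla_space M n) (slide n)"
  unfolding nabla_space_def
proof (rule Lipschitz_continuous[OF Metric_space_nabla[OF M] Metric_space_nabla[OF M] slide_in])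
  fix F G assume F: "F \<in> nabla M (2*n+1)" and G: "G \<in> nabla M (2*n+1)"
  let ?d = "nabla_dist M F G"
  have N: "{\<omega> \<in> space M. rep F \<omega> \<noteq> rep G \<omega>} \<in> events" by (rule sets_neq[OF rep_in(2)[OF F] rep_in(2)[OF G]])
  have 1: "prob {\<omega> \<in> space M. (fold2 n \<circ> rep F) \<omega> \<noteq> (fold2 n \<circ> rep G) \<omega>} \<le> ?d"
    unfolding nabla_dist_def by (rule finite_measure_mono[OF _ N]) auto
  have t: "tail n F \<le> tail n G + ?d" if F: "F \<in> nabla M (2*n+1)" and G: "G \<in> nabla M (2*n+1)" and d: "nabla_dist M F G = ?d" for F G
  proof -
    have N: "{\<omega> \<in> space M. rep F \<omega> \<noteq> rep G \<omega>} \<in> events" by (rule sets_neq[OF rep_in(2)[OF F] rep_in(2)[OF G]])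
    have "tail n F \<le> prob ({\<omega> \<in> space M. n < rep G \<omega>} \<union> {\<omega> \<in> space M. rep F \<omega> \<noteq> rep G \<omega>})"
      unfolding tail_def by (rule finite_measure_mono) (use tail_event[OF G] N in auto)
    also have "\<dots> \<le> tail n G + nabla_dist M F G" unfolding tail_def nabla_dist_def
      by (rule measure_Un_le[OF tail_event[OF G] N])
    finally show ?thesis using d by simp
  qed
  have sym: "nabla_dist M G F = ?d" by (rule Metric_space.commute[OF Metric_space_nabla[OF M]])
  have 2: "\<bar>tail n F - tail n G\<bar> \<le> ?d" using t[OF F G refl] t[OF G F sym] by linarith
  have "nabla_dist M (slide n F) (slide n G) \<le> real (n + 2) * (\<bar>tail n F - tail n G\<bar> + prob {\<omega> \<in> space M. (fold2 n \<circ> rep F) \<omega> \<noteq> (fold2 n \<circ> rep G) \<omega>})"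
    unfolding slide_def nabla_dist_class[OF sorted_below_meas[OF fold_meas[OF F]] sorted_below_meas[OF fold_meas[OF G]]]
    by (rule sorted_below_dist[OF fold_meas[OF F] fold_meas[OF G] tail_bounds tail_bounds])
  also have "\<dots> \<le> real (n + 2) * (?d + ?d)" using 1 2 by (intro mult_left_mono add_mono) auto
  finally show "nabla_dist M (slide n F) (slide n G) \<le> (2 * real (n + 2)) * ?d" by (simp add: algebra_simps)
qed (assumption, rule mult_pos_pos, simp, rule of_nat_0_less_iff[THEN iffD2], simp)

lemma rep_slide: "F \<in> nabla M (2*n+1) \<Longrightarrow> AE \<omega> in M. rep (slide n F) \<omega> = sorted_below n (tail n F) (fold2 n \<circ> rep F) \<omega>"
  unfolding slide_def by (rule rep_class[OF sorted_below_meas[OF fold_meas]])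

end

section \<open>Naturality of the deformation and the inverse of the natural map\<close>

context uniform_prob begin

text \<open>Doubled maps preserve the two copies and commute with folding. The times therefore
  agree, and sorting is natural.\<close>

lemma slide_natural:
  assumes s: "\<sigma> \<in> order_maps n m" and F: "F \<in> nabla M (2*n+1)"
  shows "slide m (nabla_map M (2*m+1) (dbl_map n m \<sigma>) F) = nabla_map M m \<sigma> (slide n F)"
proof (rule nabla_eqI)
  let ?G = "nabla_map M (2*m+1) (dbl_map n m \<sigma>) F"
  note G = nabla_map_in[OF dbl_map_order[OF s] F]
  show "slide m ?G \<in> nabla M m" by (rule slide_in[OF G(1)])
  show "nabla_map M m \<sigma> (slide n F) \<in> nabla M m" by (rule nabla_map_in(1)[OF s slide_in[OF F]])
  have le: "rep F \<omega> \<le> 2 * n + 1" if "\<omega> \<in> space M" for \<omega> by (rule meas_le[OF rep_in(2)[OF F] that])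
  have gt: "m < dbl_map n m \<sigma> j \<longleftrightarrow> n < j" if "j \<le> 2 * n + 1" for j
    using that order_mapsD(1)[OF s, of j] by (auto simp: dbl_map_def)
  have fo: "fold2 m (dbl_map n m \<sigma> j) = \<sigma> (fold2 n j)" if "j \<le> 2 * n + 1" for j
    using that order_mapsD(1)[OF s, of j] by (auto simp: dbl_map_def fold2_def)
  have tl: "tail m ?G = tail n F" unfolding tail_def
  proof (rule finite_measure_eq_AE)
    show "AE \<omega> in M. (\<omega> \<in> {\<omega> \<in> space M. m < rep ?G \<omega>}) = (\<omega> \<in> {\<omega> \<in> space M. n < rep F \<omega>})"
      using G(2) AE_space by eventually_elim (use gt le in auto)
  qed (rule tail_event[OF G(1)] tail_event[OF F])+
  have "AE \<omega> in M. (fold2 m \<circ> rep ?G) \<omega> = (\<sigma> \<circ> (fold2 n \<circ> rep F)) \<omega>"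
    using G(2) AE_space by eventually_elim (use fo le in simp)
  then have "AE \<omega> in M. sorted_below m (tail n F) (fold2 m \<circ> rep ?G) \<omega> = sorted_below m (tail n F) (\<sigma> \<circ> (fold2 n \<circ> rep F)) \<omega>"
    by (rule sorted_below_AE[OF fold_meas[OF G(1)] meas_comp[OF s fold_meas[OF F]]])
  then show "AE \<omega> in M. rep (slide m ?G) \<omega> = rep (nabla_map M m \<sigma> (slide n F)) \<omega>"
    using rep_slide[OF G(1), unfolded tl] rep_slide[OF F] nabla_map_in(2)[OF s slide_in[OF F]] AE_space
    by eventually_elim (simp add: sorted_below_natural[OF s fold_meas[OF F] tail_bounds])
qed

text \<open>On the first copy the time is 0 and nothing moves. On the second it is 1, and the
  thresholds become the partial sums of the law.\<close>

lemma slide_face: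
  assumes F: "F \<in> nabla M n"
  shows "slide n (nabla_map M (2*n+1) (dbl_face n False) F) = F"
    and "slide n (nabla_map M (2*n+1) (dbl_face n True) F) = sec n (law M F)"
proof -
  have le: "rep F \<omega> \<le> n" if "\<omega> \<in> space M" for \<omega> by (rule meas_le[OF rep_in(2)[OF F] that])
  have fo: "fold2 n (dbl_face n b j) = j" if "j \<le> n" for b j using that by (auto simp: dbl_face_def fold2_def)
  have *: "AE \<omega> in M. rep (slide n (nabla_map M (2*n+1) (dbl_face n b) F)) \<omega> = sorted_below n (if b then 1 else 0) (rep F) \<omega>"
    and in': "slide n (nabla_map M (2*n+1) (dbl_face n b) F) \<in> nabla M n" for b
  proof -
    let ?G = "nabla_map M (2*n+1) (dbl_face n b) F"
    note G = nabla_map_in[OF dbl_face_order F, of b]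
    show "slide n ?G \<in> nabla M n" by (rule slide_in[OF G(1)])
    have gt: "n < dbl_face n b j \<longleftrightarrow> b" if "j \<le> n" for j using that by (auto simp: dbl_face_def)
    have "tail n ?G = prob (if b then space M else {})" unfolding tail_def
    proof (rule finite_measure_eq_AE)
      show "AE \<omega> in M. (\<omega> \<in> {\<omega> \<in> space M. n < rep ?G \<omega>}) = (\<omega> \<in> (if b then space M else {}))"
        using G(2) AE_space by eventually_elim (use gt le in auto)
    qed (use tail_event[OF G(1)] in auto)
    then have tl: "tail n ?G = (if b then 1 else 0)" by (simp add: prob_space)
    have "AE \<omega> in M. (fold2 n \<circ> rep ?G) \<omega> = rep F \<omega>"
      using G(2) AE_space by eventually_elim (use fo le in simp)
    then have "AE \<omega> in M. sorted_below n (tail n ?G) (fold2 n \<circ> rep ?G) \<omega> = sorted_below n (tail n ?G) (rep F) \<omega>"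
      by (rule sorted_below_AE[OF fold_meas[OF G(1)] rep_in(2)[OF F]])
    with rep_slide[OF G(1)] show "AE \<omega> in M. rep (slide n ?G) \<omega> = sorted_below n (if b then 1 else 0) (rep F) \<omega>"
      by eventually_elim (simp only: tl)
  qed
  show "slide n (nabla_map M (2*n+1) (dbl_face n False) F) = F"
  proof (rule nabla_eqI[OF in' F])
    show "AE \<omega> in M. rep (slide n (nabla_map M (2*n+1) (dbl_face n False) F)) \<omega> = rep F \<omega>"
      using *[of False] by eventually_elim (simp add: sorted_below_def hop_def leD[OF U_nonneg])
  qed
  have cum: "cum (rep F) 1 i = (\<Sum>j\<le>i. law M F j)" for i
  proof -
    have "cum (rep F) 1 i = prob (\<Union>j\<le>i. {\<omega> \<in> space M. rep F \<omega> = j})" unfolding cum_def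
    proof (rule finite_measure_eq_AE)
      show "AE \<omega> in M. (\<omega> \<in> {\<omega> \<in> space M. rep F \<omega> \<le> i \<and> U \<omega> < 1}) = (\<omega> \<in> (\<Union>j\<le>i. {\<omega> \<in> space M. rep F \<omega> = j}))"
        using AE_U_less by eventually_elim auto
      show "{\<omega> \<in> space M. rep F \<omega> \<le> i \<and> U \<omega> < 1} \<in> events" by (rule cum_event[OF rep_in(2)[OF F]])
      show "(\<Union>j\<le>i. {\<omega> \<in> space M. rep F \<omega> = j}) \<in> events" using sets_rep[OF F] by blast
    qed
    also have "\<dots> = (\<Sum>j\<le>i. law M F j)" unfolding law_def
      by (rule finite_measure_finite_Union) (auto simp: sets_rep[OF F] disjoint_family_on_def)
    finally show ?thesis .
  qed
  show "slide n (nabla_map M (2*n+1) (dbl_face n True) F) = sec n (law M F)"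
  proof (rule nabla_eqI[OF in' sec_in])
    have c: "cum (rep F) 1 = (\<lambda>i. \<Sum>j\<le>i. law M F j)" by (rule ext) (rule cum)
    have r: "AE \<omega> in M. rep (sec n (law M F)) \<omega> = hop n (\<lambda>i. \<Sum>j\<le>i. law M F j) 1 (\<lambda>_. 0) \<omega>"
      unfolding sec_def by (rule rep_class[OF hop_meas[OF zero_meas]])
    show "AE \<omega> in M. rep (slide n (nabla_map M (2*n+1) (dbl_face n True) F)) \<omega> = rep (sec n (law M F)) \<omega>"
      using *[of True] r AE_U_less by eventually_elim (simp add: sorted_below_def c hop_def)
  qed
qed

lemma dbl_face_natural:
  assumes s: "\<sigma> \<in> order_maps n m" shows "compose {..n} (dbl_face m b) \<sigma> = compose {..n} (dbl_map n m \<sigma>) (dbl_face n b)"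
  using order_mapsD(1)[OF s] by (auto simp: compose_def dbl_face_def dbl_map_def fun_eq_iff)

text \<open>\<open>sec\<close> after \<open>law\<close> is the restriction of \<open>slide\<close>
  to the second copy, so naturality passes from \<open>slide\<close> to \<open>sec\<close>; by
  \<open>law_sec\<close>, the variable \<open>sec n x\<close> has the law \<open>x\<close>.\<close>

lemma sec_natural:
  assumes s: "\<sigma> \<in> order_maps n m" and x: "x \<in> standard_simplex n"
  shows "sec m (delta_map n m \<sigma> x) = nabla_map M m \<sigma> (sec n x)"
proof -
  let ?F = "sec n x"
  have "sec m (delta_map n m \<sigma> x) = sec m (law M (nabla_map M m \<sigma> ?F))"
    by (simp add: law_nabla_map[OF M s sec_in] law_sec[OF x])
  also have "\<dots> = slide m (nabla_map M (2*m+1) (dbl_face m True) (nabla_map M m \<sigma> ?F))"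
    by (rule slide_face(2)[OF nabla_map_in(1)[OF s sec_in], symmetric])
  also have "nabla_map M (2*m+1) (dbl_face m True) (nabla_map M m \<sigma> ?F) = nabla_map M (2*m+1) (dbl_map n m \<sigma>) (nabla_map M (2*n+1) (dbl_face n True) ?F)"
    unfolding nabla_map_comp[OF s dbl_face_order sec_in] nabla_map_comp[OF dbl_face_order dbl_map_order[OF s] sec_in] dbl_face_natural[OF s] ..
  also have "slide m \<dots> = nabla_map M m \<sigma> (slide n (nabla_map M (2*n+1) (dbl_face n True) ?F))"
    by (rule slide_natural[OF s nabla_map_in(1)[OF dbl_face_order sec_in]])
  also have "\<dots> = nabla_map M m \<sigma> ?F" by (simp only: slide_face(2)[OF sec_in] law_sec[OF x])
  finally show ?thesis .
qed

lemma topspace_nabla: "topspace (nabla_space M n) = nabla M n"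
proof -
  interpret Metric_space "nabla M n" "nabla_dist M" by (rule Metric_space_nabla[OF M])
  show ?thesis by (simp add: nabla_space_def)
qed

lemma Sing_RV_simplices: "f \<in> simplices (Sing_RV M X) k \<longleftrightarrow> continuous_map (nabla_space M k) X f \<and> f \<in> extensional (nabla M k)"
  by (simp add: Sing_RV_def)

definition sec_pullback :: "nat \<Rightarrow> (('a \<Rightarrow> nat) set \<Rightarrow> 'x) \<Rightarrow> (nat \<Rightarrow> real) \<Rightarrow> 'x" where
  "sec_pullback n f = restrict (f \<circ> sec n) (standard_simplex n)"

text \<open>Turns an n-simplex into a (2n+1)-simplex, the form of input that
  \<open>join_homotopy\<close> takes.\<close>

definition slide_pullback :: "nat \<Rightarrow> (('a \<Rightarrow> nat) set \<Rightarrow> 'x) \<Rightarrow> ('a \<Rightarrow> nat) set \<Rightarrow> 'x" where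
  "slide_pullback n f = restrict (f \<circ> slide n) (nabla M (2*n+1))"

lemma simplicial_map_sec_pullback: "simplicial_map (Sing_RV M X) (Sing X) sec_pullback"
  unfolding simplicial_map_def
proof (intro conjI allI ballI funcsetI)
  fix n f assume "f \<in> simplices (Sing_RV M X) n"
  then have "continuous_map (simplex_space n) X (f \<circ> sec n)"
    by (intro continuous_map_compose[OF continuous_sec]) (simp add: Sing_RV_simplices)
  then have "continuous_map (simplex_space n) X (sec_pullback n f)"
    by (rule continuous_map_eq) (simp add: sec_pullback_def)
  then show "sec_pullback n f \<in> simplices (Sing X) n" by (simp add: Sing_simplices sec_pullback_def)
next
  fix n m \<sigma> f assume s: "\<sigma> \<in> order_maps n m"
  show "sec_pullback n (act (Sing_RV M X) n m \<sigma> f) = act (Sing X) n m \<sigma> (sec_pullback m f)"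
    by (auto simp: sec_pullback_def Sing_def Sing_RV_def fun_eq_iff sec_in sec_natural[OF s] delta_map_in[OF s])
qed

lemma sec_law_pullback:
  assumes "f \<in> simplices (Sing X) n" shows "sec_pullback n (law_pullback M n f) = f"
proof
  fix x show "sec_pullback n (law_pullback M n f) x = f x"
  proof (cases "x \<in> standard_simplex n")
    case True then show ?thesis by (simp add: sec_pullback_def law_pullback_def sec_in law_sec)
  next
    case False then show ?thesis using assms by (auto simp: sec_pullback_def Sing_simplices extensional_def)
  qed
qed

text \<open>The doubled simplex of \<open>f\<close> restricts to \<open>f\<close> on the first copy
  and to \<open>f \<circ> sec n \<circ> law M\<close> on the second. The last clause keeps the
  homotopy based at vertices.\<close>

lemma natural_map_homotopy:
  obtains K where "continuous_map (prod_topology unit_interval (realization (Sing_RV M X))) (realization (Sing_RV M X)) K"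
    "\<And>b. b \<in> topspace (realization (Sing_RV M X)) \<Longrightarrow> K (0, b) = b"
    "\<And>b. b \<in> topspace (realization (Sing_RV M X)) \<Longrightarrow> K (1, b) = natural_map M X (realization_map (Sing X) sec_pullback b)"
    "\<And>f \<tau> e. f \<in> simplices (Sing_RV M X) 0 \<Longrightarrow> e \<in> standard_simplex 0 \<Longrightarrow> \<tau> \<in> {0..1} \<Longrightarrow>
      K (\<tau>, realization_class (Sing_RV M X) ((0, f), e)) = realization_class (Sing_RV M X) ((0, f), e)"
proof -
  let ?L = "Sing_RV M X"
  have K: "slide_pullback n f \<in> simplices ?L (2*n+1)" if "f \<in> simplices ?L n" for n f
  proof -
    have "continuous_map (nabla_space M (2*n+1)) X (f \<circ> slide n)"
      by (rule continuous_map_compose[OF continuous_slide]) (use that in \<open>simp add: Sing_RV_simplices\<close>)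
    then have "continuous_map (nabla_space M (2*n+1)) X (slide_pullback n f)"
      by (rule continuous_map_eq) (simp add: slide_pullback_def topspace_nabla)
    then show ?thesis unfolding Sing_RV_simplices by (simp add: slide_pullback_def)
  qed
  have nat: "slide_pullback n (act ?L n m \<sigma> f) = act ?L (2*n+1) (2*m+1) (dbl_map n m \<sigma>) (slide_pullback m f)"
    if s: "\<sigma> \<in> order_maps n m" for n m \<sigma> and f :: "('a \<Rightarrow> nat) set \<Rightarrow> 'b"
  proof
    fix F
    show "slide_pullback n (act ?L n m \<sigma> f) F = act ?L (2*n+1) (2*m+1) (dbl_map n m \<sigma>) (slide_pullback m f) F"
    proof (cases "F \<in> nabla M (2*n+1)")
      case True
      have "slide m (nabla_map M (2*m+1) (dbl_map n m \<sigma>) F) = nabla_map M m \<sigma> (slide n F)" by (rule slide_natural[OF s True])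
      then show ?thesis using slide_in[OF True] nabla_map_in(1)[OF dbl_map_order[OF s] True] True
        by (simp add: slide_pullback_def Sing_RV_def)
    qed (simp add: slide_pullback_def Sing_RV_def)
  qed
  obtain h where h: "continuous_map (prod_topology unit_interval (realization ?L)) (realization ?L) h"
    and h1: "\<And>n x t \<tau>. x \<in> simplices ?L n \<Longrightarrow> t \<in> standard_simplex n \<Longrightarrow> \<tau> \<in> {0..1} \<Longrightarrow>
      h (\<tau>, realization_class ?L ((n, x), t)) = realization_class ?L ((2*n+1, slide_pullback n x), dbl_point n \<tau> t)"
    and h2: "\<And>n x t b. x \<in> simplices ?L n \<Longrightarrow> t \<in> standard_simplex n \<Longrightarrow>
      h (if b then 1 else 0, realization_class ?L ((n, x), t)) = realization_class ?L ((n, act ?L n (2*n+1) (dbl_face n b) (slide_pullback n x)), t)"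
    by (rule join_homotopy[of ?L slide_pullback ?L, OF K nat]) (assumption+, rule that, assumption+)
  have face: "act ?L n (2*n+1) (dbl_face n b) (slide_pullback n f) = (if b then law_pullback M n (sec_pullback n f) else f)"
    if f: "f \<in> simplices ?L n" for n f b
  proof
    fix F show "act ?L n (2*n+1) (dbl_face n b) (slide_pullback n f) F = (if b then law_pullback M n (sec_pullback n f) else f) F"
    proof (cases "F \<in> nabla M n")
      case True
      have "act ?L n (2*n+1) (dbl_face n b) (slide_pullback n f) F = f (slide n (nabla_map M (2*n+1) (dbl_face n b) F))"
        using True nabla_map_in(1)[OF dbl_face_order True] by (simp add: slide_pullback_def Sing_RV_def)
      also have "\<dots> = (if b then law_pullback M n (sec_pullback n f) else f) F"
        using slide_face[OF True] True law_in[OF M True] by (cases b) (simp_all add: law_pullback_def sec_pullback_def)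
      finally show ?thesis .
    next
      case False
      then show ?thesis using f unfolding Sing_RV_simplices by (simp add: Sing_RV_def law_pullback_def extensional_def)
    qed
  qed
  show thesis
  proof (rule that[OF h])
    fix b assume "b \<in> topspace (realization ?L)"
    then obtain n f t where b: "b = realization_class ?L ((n, f), t)" and f: "f \<in> simplices ?L n" and t: "t \<in> standard_simplex n"
      by (rule realization_cases)
    show "h (0, b) = b" using h2[OF f t, of False] face[OF f, of False] by (simp add: b)
    have "realization_map (Sing X) sec_pullback b = realization_class (Sing X) ((n, sec_pullback n f), t)"
      unfolding b by (rule realization_map_class[OF simplicial_map_sec_pullback f t])
    moreover have "sec_pullback n f \<in> simplices (Sing X) n"
      using simplicial_map_sec_pullback f unfolding simplicial_map_def by blast
    ultimately have "natural_map M X (realization_map (Sing X) sec_pullback b) = realization_class ?L ((n, law_pullback M n (sec_pullback n f)), t)"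
      unfolding natural_map_def using realization_map_class[OF simplicial_map_law_pullback[OF M] _ t] by simp
    then show "h (1, b) = natural_map M X (realization_map (Sing X) sec_pullback b)"
      using h2[OF f t, of True] face[OF f, of True] by (simp add: b)
  next
    fix f \<tau> and e :: "nat \<Rightarrow> real" assume f: "f \<in> simplices ?L 0" and e: "e \<in> standard_simplex 0" and t: "(\<tau>::real) \<in> {0..1}"
    let ?\<kappa> = "restrict (\<lambda>_. 0) {..1} :: nat \<Rightarrow> nat"
    have \<kappa>: "?\<kappa> \<in> order_maps 1 0" by (auto simp: order_maps_def mono_on_def)
    \<comment> \<open>Since \<open>nabla M 0\<close> is a single point, the doubled simplex of a
      vertex is degenerate and the segment in it collapses.\<close>
    have one: "F = G" if F: "F \<in> nabla M 0" and G: "G \<in> nabla M 0" for F G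
    proof (rule nabla_eqI[OF F G])
      show "AE t in M. rep F t = rep G t"
        using AE_space by eventually_elim (use meas_le[OF rep_in(2)[OF F]] meas_le[OF rep_in(2)[OF G]] in simp)
    qed
    have E: "slide_pullback 0 f = act ?L 1 0 ?\<kappa> f"
    proof
      fix F show "slide_pullback 0 f F = act ?L 1 0 ?\<kappa> f F"
      proof (cases "F \<in> nabla M 1")
        case True
        have "slide 0 F = nabla_map M 0 ?\<kappa> F"
          by (rule one[OF slide_in nabla_map_in(1)[OF \<kappa> True]]) (use True in simp)
        then show ?thesis using True by (simp add: slide_pullback_def Sing_RV_def)
      qed (simp add: slide_pullback_def Sing_RV_def)
    qed
    have dp: "dbl_point 0 \<tau> e \<in> standard_simplex 1" using dbl_point_in[OF e, of \<tau>] t by simp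
    have u: "c = d" if "c \<in> standard_simplex 0" "d \<in> standard_simplex 0" for c d :: "nat \<Rightarrow> real"
      using that by (auto simp: standard_simplex_def fun_eq_iff) (metis gr0I)
    have "h (\<tau>, realization_class ?L ((0, f), e)) = realization_class ?L ((1, act ?L 1 0 ?\<kappa> f), dbl_point 0 \<tau> e)"
      using h1[OF f e t] by (simp add: E)
    also have "\<dots> = realization_class ?L ((0, f), delta_map 1 0 ?\<kappa> (dbl_point 0 \<tau> e))"
      by (rule realization_class_act[OF \<kappa> f dp])
    also have "delta_map 1 0 ?\<kappa> (dbl_point 0 \<tau> e) = e" by (rule u[OF delta_map_in[OF \<kappa> dp] e])
    finally show "h (\<tau>, realization_class ?L ((0, f), e)) = realization_class ?L ((0, f), e)" .
  qed
qed

end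

section \<open>Simplices with repeated vertices\<close>

text \<open>The affine map of simplices that sends vertex j to \<open>is ! j\<close>, for labels in
  any order and with repetitions. For increasing lists it is \<open>delta_map\<close>.\<close>

definition push :: "'i list \<Rightarrow> (nat \<Rightarrow> real) \<Rightarrow> 'i \<Rightarrow> real" where
  "push is c a = (\<Sum>j | j < length is \<and> is ! j = a. c j)"

text \<open>The simplex that a map \<open>\<Psi>\<close> on weight functions induces on the vertices
  \<open>is\<close>. Faces, degeneracies and permutations of vertices all become operations on lists
  of labels.\<close>

definition lsimp :: "(('i \<Rightarrow> real) \<Rightarrow> 'x) \<Rightarrow> 'i list \<Rightarrow> (nat \<Rightarrow> real) \<Rightarrow> 'x" where
  "lsimp \<Psi> is = restrict (\<lambda>c. \<Psi> (push is c)) (standard_simplex (length is - 1))"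

definition wt :: "('i \<times> real) list \<Rightarrow> nat \<Rightarrow> real" where
  "wt L = (\<lambda>j. if j < length L then snd (L ! j) else 0)"

definition lpt :: "(('i \<Rightarrow> real) \<Rightarrow> 'x) \<Rightarrow> ('i \<times> real) list \<Rightarrow> ((nat \<Rightarrow> real) \<Rightarrow> 'x) prepoint" where
  "lpt \<Psi> L = ((length L - 1, lsimp \<Psi> (map fst L)), wt L)"

definition mass :: "('i \<times> real) list \<Rightarrow> 'i \<Rightarrow> real" where
  "mass L a = (\<Sum>p\<leftarrow>L. if fst p = a then snd p else 0)"

definition weighted :: "('i \<times> real) list \<Rightarrow> bool" where
  "weighted L \<longleftrightarrow> (\<forall>p\<in>set L. 0 \<le> snd p) \<and> sum_list (map snd L) = 1"

definition nz :: "('i \<times> real) list \<Rightarrow> ('i \<times> real) list" where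
  "nz L = filter (\<lambda>p. snd p \<noteq> 0) L"

definition coords :: "nat \<Rightarrow> (nat \<Rightarrow> real) \<Rightarrow> (nat \<times> real) list" where
  "coords k t = map (\<lambda>i. (i, t i)) [0..<Suc k]"

text \<open>Entries of weight zero are dropped, repeated vertices stay. The quotient along
  \<open>nf\<close> thus imposes the face relations and leaves out the degeneracy relations.\<close>

definition nf :: "((nat \<Rightarrow> real) \<Rightarrow> 'x) prepoint \<Rightarrow> ((nat \<Rightarrow> real) \<Rightarrow> 'x) prepoint" where
  "nf a = (case a of ((k, x), t) \<Rightarrow> lpt x (nz (coords k t)))"

definition fat :: "'x topology \<Rightarrow> ((nat \<Rightarrow> real) \<Rightarrow> 'x) prepoint topology" where
  "fat X = quotient_topology (prerealization (Sing X)) nf"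

abbreviation rc :: "'x topology \<Rightarrow> ((nat \<Rightarrow> real) \<Rightarrow> 'x) prepoint \<Rightarrow> ((nat \<Rightarrow> real) \<Rightarrow> 'x) prepoint set" where
  "rc X \<equiv> realization_class (Sing X)"

lemma weighted_nonempty: "weighted L \<Longrightarrow> L \<noteq> []"
  by (auto simp: weighted_def)

lemma weighted_nz [simp]: "weighted (nz L) = weighted L"
proof -
  have "sum_list (map snd (nz L)) = sum_list (map snd L)"
    by (induction L) (auto simp: nz_def)
  moreover have "0 \<le> snd p" if "\<forall>p\<in>set (nz L). 0 \<le> snd p" "p \<in> set L" for p
    using that by (cases p; cases "snd p = 0") (auto simp: nz_def)
  ultimately show ?thesis by (auto simp: weighted_def nz_def)
qed

lemma sum_wt: "(\<Sum>j<length L. wt L j) = sum_list (map snd L)"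
  by (simp add: sum_list_sum_nth wt_def atLeast0LessThan)

lemma wt_in:
  assumes "weighted L" shows "wt L \<in> standard_simplex (length L - 1)"
proof -
  have ne: "L \<noteq> []" by (rule weighted_nonempty[OF assms])
  have 0: "0 \<le> wt L j" for j using assms by (auto simp: wt_def weighted_def)
  have s: "(\<Sum>j<length L. wt L j) = 1" using assms sum_wt[of L] by (simp add: weighted_def)
  have "wt L j \<le> 1" for j
  proof (cases "j < length L")
    case True
    have "wt L j \<le> (\<Sum>j<length L. wt L j)"
      by (rule member_le_sum) (use True 0 in auto)
    then show ?thesis using s by simp
  qed (simp add: wt_def)
  moreover have "{..length L - 1} = {..<length L}" using ne by (cases L) auto
  ultimately show ?thesis using 0 s ne by (auto simp: standard_simplex_def wt_def)
qed

lemma coords_weighted: "t \<in> standard_simplex k \<Longrightarrow> weighted (coords k t)"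
  by (auto simp: coords_def weighted_def standard_simplex_def sum_list_distinct_conv_sum_set
      atLeast0LessThan lessThan_Suc_atMost interv_sum_list_conv_sum_set_nat o_def simp del: upt_Suc)

lemma wt_coords: "t \<in> standard_simplex k \<Longrightarrow> wt (coords k t) = t"
  by (auto simp: wt_def coords_def standard_simplex_def simp del: upt_Suc)

lemma coords_fst: "map fst (coords k t) = [0..<Suc k]" "length (coords k t) = Suc k"
  by (simp_all add: coords_def o_def del: upt_Suc)

lemma mass_push: "push (map fst L) (wt L) = mass L"
proof
  fix a
  have "push (map fst L) (wt L) a = (\<Sum>j | j \<in> {..<length L} \<and> fst (L ! j) = a. wt L j)"
    unfolding push_def by (intro sum.cong) auto
  also have "\<dots> = (\<Sum>j<length L. if fst (L ! j) = a then wt L j else 0)"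
    by (rule sum.inter_filter) simp
  also have "\<dots> = mass L a"
    unfolding mass_def by (simp add: sum_list_sum_nth atLeast0LessThan) (auto intro!: sum.cong simp: wt_def)
  finally show "push (map fst L) (wt L) a = mass L a" .
qed

lemma mass_append: "mass (L @ M) a = mass L a + mass M a"
  by (simp add: mass_def)

lemma mass_nz [simp]: "mass (nz L) = mass L"
proof
  fix a show "mass (nz L) a = mass L a"
    by (induction L) (auto simp: mass_def nz_def)
qed

lemma mass_coords: "t \<in> standard_simplex k \<Longrightarrow> mass (coords k t) = t"
proof
  fix a assume t: "t \<in> standard_simplex k"
  have "mass (coords k t) a = (\<Sum>i<Suc k. if i = a then t i else 0)"
    by (simp add: mass_def coords_def o_def interv_sum_list_conv_sum_set_nat atLeast0LessThan del: upt_Suc)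
  also have "\<dots> = t a" using t by (auto simp: standard_simplex_def)
  finally show "mass (coords k t) a = t a" .
qed

lemma push_push:
  assumes "set js \<subseteq> {..<length is}"
  shows "push is (push js c) = push (map ((!) is) js) c"
proof
  fix a
  have "push is (push js c) a = (\<Sum>i \<in> {i. i < length is \<and> is ! i = a}. \<Sum>l | l \<in> {l. l < length js \<and> is ! (js ! l) = a} \<and> js ! l = i. c l)"
    unfolding push_def by (intro sum.cong) auto
  also have "\<dots> = (\<Sum>l \<in> {l. l < length js \<and> is ! (js ! l) = a}. c l)"
    by (rule sum.group) (use assms in \<open>auto simp: subset_iff\<close>)
  also have "\<dots> = push (map ((!) is) js) c a"
    unfolding push_def by (intro sum.cong) auto
  finally show "push is (push js c) a = push (map ((!) is) js) c a" .
qed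

lemma push_in:
  assumes c: "c \<in> standard_simplex (length is - 1)" and "is \<noteq> []" "set is \<subseteq> {..m}"
  shows "push is c \<in> standard_simplex m"
proof -
  have l: "{..length is - 1} = {..<length is}" using assms(2) by (cases "is") auto
  have c: "0 \<le> c i" "(\<Sum>j<length is. c j) = 1" for i
    using c l by (auto simp: standard_simplex_def)
  have 0: "0 \<le> push is c i" for i unfolding push_def by (intro sum_nonneg) (auto simp: c)
  have "(\<Sum>i\<le>m. push is c i) = (\<Sum>i\<in>{..m}. \<Sum>j | j \<in> {..<length is} \<and> is ! j = i. c j)"
    unfolding push_def by (intro sum.cong) auto
  also have "\<dots> = (\<Sum>j<length is. c j)"
    by (rule sum.group) (use assms(3) nth_mem in \<open>auto simp: subset_iff\<close>)
  finally have s: "(\<Sum>i\<le>m. push is c i) = 1" using c by simp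
  have "push is c i \<le> 1" if "i \<le> m" for i
    using member_le_sum[of i "{..m}" "push is c"] 0 s that by auto
  moreover have "push is c i = 0" if "i > m" for i
  proof -
    have "{j. j < length is \<and> is ! j = i} = {}" using assms(3) that nth_mem by fastforce
    then show ?thesis by (metis push_def sum.empty)
  qed
  ultimately show ?thesis using 0 s by (auto simp: standard_simplex_def not_le) (metis not_le zero_le_one)
qed

lemma push_id: "c \<in> standard_simplex k \<Longrightarrow> push [0..<Suc k] c = c"
  using mass_push[of "coords k c"] by (simp add: coords_fst mass_coords wt_coords del: upt_Suc)

lemma lsimp_lsimp:
  assumes "js \<noteq> []" "set js \<subseteq> {..<length is}"
  shows "lsimp (lsimp \<Psi> is) js = lsimp \<Psi> (map ((!) is) js)"
proof -
  have "is \<noteq> []" using assms by (cases js) auto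
  then have "set js \<subseteq> {..length is - 1}" using assms(2) by (cases "is") auto
  then have "push js c \<in> standard_simplex (length is - 1)" if "c \<in> standard_simplex (length js - 1)" for c
    using push_in that assms(1) by blast
  then show ?thesis by (auto simp: lsimp_def fun_eq_iff push_push[OF assms(2)])
qed

lemma lpt_lsimp:
  assumes "L \<noteq> []" "fst ` set L \<subseteq> {..<length is}"
  shows "lpt (lsimp \<Psi> is) L = lpt \<Psi> (map (apfst ((!) is)) L)"
  using lsimp_lsimp[of "map fst L" "is" \<Psi>] assms
  by (auto simp: lpt_def o_def wt_def)

lemma nz_coords_wt: "map (apfst ((!) (map fst L))) (nz (coords (length L - 1) (wt L))) = nz L"
proof (cases "L = []")
  case False
  have "map (apfst ((!) (map fst L))) (nz (coords (length L - 1) (wt L)))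
    = nz (map (\<lambda>i. L ! i) [0..<length L])"
    using False unfolding nz_def coords_def filter_map map_map
    by (auto simp: wt_def o_def intro!: map_cong filter_cong simp del: upt_Suc)
  then show ?thesis by (simp add: map_nth)
qed (simp add: nz_def coords_def wt_def)

lemma nz_map_apfst: "nz (map (apfst g) L) = map (apfst g) (nz L)"
  by (auto simp: nz_def filter_map o_def)

lemma nf_lpt:
  assumes "weighted L"
  shows "nf (lpt \<Psi> L) = lpt \<Psi> (nz L)"
proof -
  have ne: "L \<noteq> []" by (rule weighted_nonempty[OF assms])
  have "weighted (nz (coords (length L - 1) (wt L)))"
    using coords_weighted[OF wt_in[OF assms]] by simp
  then have "nf (lpt \<Psi> L) = lpt \<Psi> (map (apfst ((!) (map fst L))) (nz (coords (length L - 1) (wt L))))"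
    unfolding nf_def lpt_def[of \<Psi> L] split
    by (intro lpt_lsimp weighted_nonempty) (use ne in \<open>auto simp: nz_def coords_def\<close>)
  then show ?thesis by (simp only: nz_coords_wt)
qed

lemma lsimp_id: "x \<in> simplices (Sing X) k \<Longrightarrow> lsimp x [0..<Suc k] = x"
  by (auto simp: lsimp_def Sing_def singular_simplex_def fun_eq_iff push_id extensional_def simp del: upt_Suc)

lemma continuous_push:
  assumes "is \<noteq> []" "set is \<subseteq> {..m}"
  shows "continuous_map (simplex_space (length is - 1)) (simplex_space m) (push is)"
  by (rule continuous_map_simplexI)
    (auto simp: push_def[abs_def] push_in[unfolded push_def] assms
      intro!: continuous_map_sum continuous_simplex_coord[OF continuous_map_id[unfolded id_def]]
        push_in[OF _ assms, unfolded push_def[abs_def]])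

lemma lsimp_Sing_general:
  assumes "continuous_map (simplex_space (length is - 1)) X (\<lambda>c. \<Psi> (push is c))"
  shows "lsimp \<Psi> is \<in> simplices (Sing X) (length is - 1)"
  unfolding Sing_simplices lsimp_def
  using continuous_map_eq[OF assms, of "restrict (\<lambda>c. \<Psi> (push is c)) (standard_simplex (length is - 1))"]
  by auto

lemma lsimp_Sing:
  assumes f: "f \<in> simplices (Sing X) m" and "is \<noteq> []" "set is \<subseteq> {..m}"
  shows "lsimp f is \<in> simplices (Sing X) (length is - 1)"
  by (rule lsimp_Sing_general)
    (use continuous_map_compose[OF continuous_push[OF assms(2,3)], of X f] f in \<open>auto simp: Sing_simplices o_def\<close>)

text \<open>Increasing lists correspond to the morphisms of the simplex category; this translates
  the operators of \<open>Sing X\<close> into operations on lists.\<close>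

lemma act_lsimp:
  assumes "is \<noteq> []" "set is \<subseteq> {..m}" "sorted is"
  shows "restrict ((!) is) {..length is - 1} \<in> order_maps (length is - 1) m"
    and "act (Sing X) (length is - 1) m (restrict ((!) is) {..length is - 1}) x = lsimp x is"
    and "delta_map (length is - 1) m (restrict ((!) is) {..length is - 1}) c = push is c"
proof -
  show "restrict ((!) is) {..length is - 1} \<in> order_maps (length is - 1) m"
  proof -
    have "is ! i \<le> m" if "i \<le> length is - 1" for i
      using assms(1,2) that nth_mem[of i "is"] by (cases "is") auto
    moreover have "mono_on {..length is - 1} ((!) is)"
      using assms(1) sorted_nth_mono[OF assms(3)] by (auto simp: mono_on_def neq_Nil_conv less_Suc_eq_le)
    ultimately show ?thesis by (auto simp: order_maps_def mono_on_def)
  qed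
  have e: "delta_map (length is - 1) m (restrict ((!) is) {..length is - 1}) c = push is c" for c
  proof
    fix i
    have "{j. j \<le> length is - 1 \<and> restrict ((!) is) {..length is - 1} j = i} = {j. j < length is \<and> is ! j = i}"
      using assms(1) by (cases "is") auto
    moreover have "{j. j < length is \<and> is ! j = i} = {}" if "\<not> i \<le> m"
      using assms(2) that nth_mem by fastforce
    ultimately show "delta_map (length is - 1) m (restrict ((!) is) {..length is - 1}) c i = push is c i"
      unfolding delta_map_def push_def by (metis sum.empty)
  qed
  then show "delta_map (length is - 1) m (restrict ((!) is) {..length is - 1}) c = push is c" .
  show "act (Sing X) (length is - 1) m (restrict ((!) is) {..length is - 1}) x = lsimp x is"
    by (simp add: Sing_def lsimp_def o_def e[simplified])
qed

lemma order_map_list: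
  assumes "\<sigma> \<in> order_maps n m"
  defines "is \<equiv> map \<sigma> [0..<Suc n]"
  shows "is \<noteq> []" "set is \<subseteq> {..m}" "sorted is" "length is - 1 = n" "restrict ((!) is) {..length is - 1} = \<sigma>"
proof -
  show "is \<noteq> []" "length is - 1 = n" by (auto simp: is_def)
  show "set is \<subseteq> {..m}" using order_mapsD(1)[OF assms(1)] by (auto simp: is_def)
  show "sorted is" using order_mapsD(2)[OF assms(1)]
    by (auto simp: is_def sorted_iff_nth_mono mono_on_def simp del: upt_Suc)
  show "restrict ((!) is) {..length is - 1} = \<sigma>"
    using assms(1) by (auto simp: is_def order_maps_def fun_eq_iff PiE_def extensional_def simp del: upt_Suc)
qed

text \<open>A sorted list is an increasing map of vertices applied to \<open>x\<close>, so one
  gluing replaces it by the total weight of each vertex of \<open>x\<close>.\<close>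

lemma rc_lpt_sorted:
  assumes x: "x \<in> simplices (Sing X) m" and L: "weighted L" "fst ` set L \<subseteq> {..m}" "sorted (map fst L)"
  shows "rc X (lpt x L) = rc X ((m, x), mass L)"
proof -
  have a: "map fst L \<noteq> []" "set (map fst L) \<subseteq> {..m}" using weighted_nonempty[OF L(1)] L(2) by auto
  show ?thesis
    using realization_class_act[OF act_lsimp(1)[OF a L(3)] x, of "wt L"] wt_in[OF L(1)]
    by (simp add: act_lsimp(2,3)[OF a L(3), simplified] lpt_def mass_push)
qed

lemma nz_coordsD: "p \<in> set (nz (coords k t)) \<Longrightarrow> fst p \<le> k"
  by (auto simp: nz_def coords_def simp del: upt_Suc)

lemma sorted_nz_coords: "sorted (map fst (nz (coords k t)))"
proof -
  have "map fst (nz (coords k t)) = filter (\<lambda>i. t i \<noteq> 0) [0..<Suc k]"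
    by (simp add: nz_def coords_def filter_map o_def del: upt_Suc)
  then show ?thesis by (metis sorted_upt sorted_filter[of "\<lambda>x. x", simplified])
qed

lemma rc_nf:
  assumes "x \<in> simplices (Sing X) k" "t \<in> standard_simplex k"
  shows "rc X (nf ((k, x), t)) = rc X ((k, x), t)"
proof -
  have "rc X (lpt x (nz (coords k t))) = rc X ((k, x), mass (nz (coords k t)))"
    by (rule rc_lpt_sorted[OF assms(1)])
      (use coords_weighted[OF assms(2)] sorted_nz_coords in \<open>auto dest!: nz_coordsD\<close>)
  then show ?thesis by (simp add: nf_def mass_coords[OF assms(2)])
qed

lemma rc_lpt_nz:
  assumes "weighted L" "lsimp \<Psi> (map fst L) \<in> simplices (Sing X) (length L - 1)"
  shows "rc X (lpt \<Psi> (nz L)) = rc X (lpt \<Psi> L)"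
  using rc_nf[OF assms(2) wt_in[OF assms(1)]] nf_lpt[OF assms(1), of \<Psi>] by (simp add: lpt_def)

lemma lsimp_sublist:
  assumes "lsimp \<Psi> (map fst L) \<in> simplices (Sing X) (length L - 1)" "L \<noteq> []" "filter P L \<noteq> []"
  shows "lsimp \<Psi> (map fst (filter P L)) \<in> simplices (Sing X) (length (filter P L) - 1)"
proof -
  let ?js = "filter (\<lambda>i. P (L ! i)) [0..<length L]"
  have e: "map ((!) L) ?js = filter P L"
    using filter_map[of P "(!) L" "[0..<length L]"] by (simp add: map_nth o_def)
  then have ne: "?js \<noteq> []" and l: "length ?js = length (filter P L)"
    using assms(3) by (auto simp flip: e simp del: filter_empty_conv)
  have "map fst (filter P L) = map ((!) (map fst L)) ?js"
    by (auto simp flip: e)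
  moreover have "lsimp (lsimp \<Psi> (map fst L)) ?js = lsimp \<Psi> (map ((!) (map fst L)) ?js)"
    by (rule lsimp_lsimp[OF ne]) auto
  moreover have "lsimp (lsimp \<Psi> (map fst L)) ?js \<in> simplices (Sing X) (length ?js - 1)"
    by (rule lsimp_Sing[OF assms(1) ne]) (use assms(2) in \<open>auto simp: le_diff_conv less_eq_Suc_le\<close>)
  ultimately show ?thesis using l by simp
qed

lemma topspace_fat: "topspace (fat X) = nf ` topspace (prerealization (Sing X))"
  by (simp add: fat_def)

text \<open>The form in which continuity is used for lists: with the labels held fixed, the weights
  move in a single standard simplex.\<close>

lemma continuous_lists:
  assumes "lsimp \<Psi> is \<in> simplices (Sing X) (length is - 1)"
    and "\<And>\<tau>. \<tau> \<in> topspace T \<Longrightarrow> map fst (L \<tau>) = is \<and> weighted (L \<tau>)"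
    and "\<And>j. j < length is \<Longrightarrow> continuous_map T euclideanreal (\<lambda>\<tau>. snd (L \<tau> ! j))"
  shows "continuous_map T (quotient_topology (prerealization (Sing X)) q) (\<lambda>\<tau>. q (lpt \<Psi> (L \<tau>)))"
proof -
  have l: "length (L \<tau>) = length is" if "\<tau> \<in> topspace T" for \<tau>
    using assms(2)[OF that] by (metis length_map)
  have "continuous_map T (simplex_space (length is - 1)) (\<lambda>\<tau>. wt (L \<tau>))"
  proof (rule continuous_map_simplexI)
    fix i assume i: "i \<le> length is - 1"
    show "continuous_map T euclideanreal (\<lambda>\<tau>. wt (L \<tau>) i)"
    proof (cases "topspace T = {}")
      case False
      then have "is \<noteq> []" using assms(2) weighted_nonempty by blast
      then have "i < length is" using i by (cases "is") auto
      then show ?thesis using continuous_map_eq[OF assms(3), of i] l by (auto simp: wt_def)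
    qed (simp add: continuous_map_on_empty2)
  qed (use wt_in assms(2) l in metis)
  from continuous_map_compose[OF this continuous_map_quotient_simplex[OF assms(1)]]
  show ?thesis
    by (rule continuous_map_eq) (use assms(2) l in \<open>auto simp: lpt_def\<close>)
qed

lemma nf_idem:
  assumes "a \<in> topspace (prerealization (Sing X))"
  shows "nf (nf a) = nf a"
proof -
  obtain k x t where a: "a = ((k, x), t)" "x \<in> simplices (Sing X) k" "t \<in> standard_simplex k"
    using assms by (auto simp: topspace_prerealization)
  have "weighted (nz (coords k t))" using coords_weighted[OF a(3)] by simp
  then show ?thesis
    using nf_lpt[of "nz (coords k t)" x] by (simp add: a(1) nf_def nz_def)
qed

text \<open>Points of \<open>fat X\<close> are themselves prepoints, namely normal forms, so they
  can be taken apart without choosing representatives.\<close>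

lemma fat_pre: "topspace (fat X) \<subseteq> topspace (prerealization (Sing X))"
proof
  fix z assume "z \<in> topspace (fat X)"
  then obtain k x t where z: "z = lpt x (nz (coords k t))" "x \<in> simplices (Sing X) k" "t \<in> standard_simplex k"
    by (auto simp: topspace_fat topspace_prerealization nf_def)
  have w: "weighted (nz (coords k t))" using coords_weighted[OF z(3)] by simp
  have "lsimp x (map fst (nz (coords k t))) \<in> simplices (Sing X) (length (nz (coords k t)) - 1)"
    using lsimp_Sing[OF z(2), of "map fst (nz (coords k t))"] weighted_nonempty[OF w]
    by (force simp: nz_def coords_def simp del: upt_Suc)
  then show "z \<in> topspace (prerealization (Sing X))"
    using wt_in[OF w] by (simp add: z(1) lpt_def topspace_prerealization)
qed

lemma nf_fat: "z \<in> topspace (fat X) \<Longrightarrow> nf z = z"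
  using nf_idem by (auto simp: topspace_fat)

lemma continuous_rc_fat: "continuous_map (fat X) (realization (Sing X)) (rc X)"
  unfolding fat_def
proof (rule continuous_map_prerealization_quotient)
  fix n s assume s: "s \<in> simplices (Sing X) n"
  show "continuous_map (simplex_space n) (realization (Sing X)) (\<lambda>t. rc X (nf ((n, s), t)))"
    by (rule continuous_map_eq[OF continuous_realization_class[OF s]]) (simp add: rc_nf[OF s])
qed

section \<open>Non-degenerate simplices\<close>

text \<open>Degeneracies are increasing lists of labels of a simplex of smaller dimension, onto or
  not; a list that is not onto factors through its support.\<close>

definition nondeg :: "'x topology \<Rightarrow> nat \<Rightarrow> ((nat \<Rightarrow> real) \<Rightarrow> 'x) \<Rightarrow> bool" where
  "nondeg X m f \<longleftrightarrow> f \<in> simplices (Sing X) m \<and>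
     (\<forall>r y is. r < m \<longrightarrow> y \<in> simplices (Sing X) r \<longrightarrow> length is = Suc m \<longrightarrow> set is \<subseteq> {..r} \<longrightarrow> sorted is \<longrightarrow> f \<noteq> lsimp y is)"

text \<open>The factorization of an increasing map into a surjection and an injection:
  \<open>js\<close> records the positions in the image, which is listed in increasing order.\<close>

lemma factor_through_support:
  assumes y: "y \<in> simplices (Sing X) r" and "is": "is \<noteq> []" "set is \<subseteq> {..r}" "sorted is"
  obtains y' js where "y' \<in> simplices (Sing X) (card (set is) - 1)" "length js = length is"
    "sorted js" "set js = {..card (set is) - 1}" "lsimp y is = lsimp y' js"
    "y' = lsimp y (sorted_list_of_set (set is))" "\<And>i. i < length is \<Longrightarrow> sorted_list_of_set (set is) ! (js ! i) = is ! i"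
proof -
  define \<kappa> where "\<kappa> = sorted_list_of_set (set is)"
  have \<kappa>: "set \<kappa> = set is" "sorted_wrt (<) \<kappa>" "length \<kappa> = card (set is)" "distinct \<kappa>" by (simp_all add: \<kappa>_def strict_sorted_iff)
  have \<kappa>ne: "\<kappa> \<noteq> []" using \<kappa>(1) "is"(1) by auto
  define pos where "pos a = (THE i. i < length \<kappa> \<and> \<kappa> ! i = a)" for a
  have pos1: "pos (\<kappa> ! i) = i" if "i < length \<kappa>" for i
    unfolding pos_def using \<kappa>(4) that nth_eq_iff_index_eq by (intro the_equality) auto
  have pos: "pos a < length \<kappa>" "\<kappa> ! pos a = a" if "a \<in> set is" for a
  proof -
    obtain i where "i < length \<kappa>" "\<kappa> ! i = a"
      using \<open>a \<in> set is\<close> unfolding \<kappa>(1)[symmetric] in_set_conv_nth by blast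
    then show "pos a < length \<kappa>" "\<kappa> ! pos a = a" using pos1[of i] by auto
  qed
  define js where "js = map pos is"
  have js: "set js = {..<length \<kappa>}"
  proof
    show "set js \<subseteq> {..<length \<kappa>}" using pos by (auto simp: js_def)
    show "{..<length \<kappa>} \<subseteq> set js"
    proof
      fix i assume "i \<in> {..<length \<kappa>}"
      then show "i \<in> set js" using pos1[of i] \<kappa>(1) nth_mem[of i \<kappa>] by (force simp: js_def)
    qed
  qed
  have "sorted js"
    unfolding sorted_iff_nth_mono
  proof (intro allI impI)
    fix i j assume ij: "i \<le> j" "j < length js"
    have a: "is ! i \<le> is ! j" using ij "is"(3) by (auto simp: js_def sorted_nth_mono)
    have "\<not> pos (is ! j) < pos (is ! i)"
    proof
      assume "pos (is ! j) < pos (is ! i)"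
      then have "\<kappa> ! pos (is ! j) < \<kappa> ! pos (is ! i)"
        using \<kappa>(2) pos(1)[of "is ! i"] ij by (auto simp: sorted_wrt_iff_nth_less js_def)
      then show False using a pos(2)[of "is ! i"] pos(2)[of "is ! j"] ij by (simp add: js_def)
    qed
    then show "js ! i \<le> js ! j" using ij by (simp add: js_def)
  qed
  moreover have "lsimp (lsimp y \<kappa>) js = lsimp y (map ((!) \<kappa>) js)"
    by (rule lsimp_lsimp) (use "is"(1) js in \<open>auto simp: js_def\<close>)
  moreover have "map ((!) \<kappa>) js = is" using pos by (auto simp: js_def intro: map_idI)
  moreover have "lsimp y \<kappa> \<in> simplices (Sing X) (length \<kappa> - 1)"
    by (rule lsimp_Sing[OF y \<kappa>ne]) (use \<kappa>(1) "is"(2) in auto)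
  moreover have "{..<length \<kappa>} = {..length \<kappa> - 1}" using \<kappa>ne by (cases \<kappa>) auto
  ultimately show thesis
    using that[of "lsimp y \<kappa>" js] js \<kappa>(3) pos unfolding \<kappa>_def by (simp add: js_def)
qed

text \<open>A repetition in \<open>is\<close> would leave fewer than m + 1 vertices in its support
  and exhibit \<open>f\<close> as degenerate.\<close>

lemma nondeg_sorted_list:
  assumes f: "nondeg X m f" "f = lsimp y is" and y: "y \<in> simplices (Sing X) r"
    and "is": "length is = Suc m" "set is \<subseteq> {..r}" "sorted is"
  shows "distinct is" "m \<le> r"
proof -
  have ne: "is \<noteq> []" using "is"(1) by auto
  obtain y' js where y': "y' \<in> simplices (Sing X) (card (set is) - 1)" "length js = length is"
    "sorted js" "set js = {..card (set is) - 1}" "lsimp y is = lsimp y' js"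
    using factor_through_support[OF y ne "is"(2,3)] by metis
  have "\<not> card (set is) - 1 < m"
    using f y' "is"(1) unfolding nondeg_def by (metis subset_refl)
  then have c: "card (set is) = length is" using card_length[of "is"] "is"(1) ne by (cases "card (set is)") auto
  then show "distinct is" by (rule card_distinct)
  show "m \<le> r" using card_mono[OF _ "is"(2)] c "is"(1) by simp
qed

lemma sorted_distinct_upt:
  assumes "sorted is" "distinct is" "length is = Suc m" "set is \<subseteq> {..m}"
  shows "is = [0..<Suc m]"
proof -
  have "set is = {..m}"
    by (rule card_subset_eq) (use assms(3,4) distinct_card[OF assms(2)] in auto)
  then have "is = sorted_list_of_set {..m}"
    using assms sorted_list_of_set_unique[of "{..m}" "is"] distinct_card[OF assms(2)]
    by (simp add: strict_sorted_iff)
  then show ?thesis using sorted_list_of_set_range[of 0 "Suc m"] by (simp add: atLeast0LessThan lessThan_Suc_atMost)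
qed

text \<open>A representation over a simplex of least dimension: a degeneracy of that simplex, or a
  list that is not onto, would lower the dimension further.\<close>

lemma eilenberg_zilber_exists:
  assumes x: "x \<in> simplices (Sing X) k"
  obtains m f "is" where "nondeg X m f" "length is = Suc k" "sorted is" "set is = {..m}" "x = lsimp f is"
proof -
  define P where "P m \<longleftrightarrow> (\<exists>f is. f \<in> simplices (Sing X) m \<and> length is = Suc k \<and> sorted is \<and> set is \<subseteq> {..m} \<and> x = lsimp f is)" for m
  have "x = lsimp x [0..<Suc k]" using lsimp_id[OF x] by simp
  then have "P k" unfolding P_def using x
    by (intro exI[of _ x] exI[of _ "[0..<Suc k]"]) (auto simp del: upt_Suc)
  define m where "m = (LEAST m. P m)"
  have Pm: "P m" unfolding m_def by (rule LeastI[of P, OF \<open>P k\<close>])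
  have least: "m \<le> r" if "P r" for r unfolding m_def by (rule Least_le[of P, OF that])
  obtain f "is" where f: "f \<in> simplices (Sing X) m" and l: "length is = Suc k" "sorted is" "set is \<subseteq> {..m}" "x = lsimp f is"
    using Pm unfolding P_def by blast
  have ne: "is \<noteq> []" using l by auto
  have "nondeg X m f"
    unfolding nondeg_def
  proof (intro conjI allI impI notI f)
    fix r y js assume a: "r < m" "y \<in> simplices (Sing X) r" "length js = Suc m" "set js \<subseteq> {..r}" "sorted js" "f = lsimp y js"
    have "x = lsimp y (map ((!) js) is)"
      unfolding l(4) a(6) by (rule lsimp_lsimp) (use a l ne in auto)
    moreover have "sorted (map ((!) js) is)"
      unfolding sorted_iff_nth_mono
    proof (intro allI impI)
      fix i j assume ij: "i \<le> j" "j < length (map ((!) js) is)"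
      have "is ! j \<le> m" using ij l(3) nth_mem[of j "is"] by force
      then show "map ((!) js) is ! i \<le> map ((!) js) is ! j"
        using ij sorted_nth_mono[OF l(2)] a(3) by (auto intro!: sorted_nth_mono[OF a(5)])
    qed
    moreover have "set (map ((!) js) is) \<subseteq> {..r}"
    proof
      fix b assume "b \<in> set (map ((!) js) is)"
      then obtain i where i: "i \<in> set is" "b = js ! i" by auto
      then have "i < length js" using l(3) a(3) by auto
      then show "b \<in> {..r}" using a(4) i(2) by (metis nth_mem subsetD)
    qed
    ultimately have "P r" unfolding P_def using a(2) l(1) by (intro exI[of _ y] exI[of _ "map ((!) js) is"]) auto
    then show False using least[of r] a(1) by simp
  qed
  moreover have "set is = {..m}"
  proof (rule ccontr)
    assume "set is \<noteq> {..m}"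
    then have c: "card (set is) < card {..m}" using l(3) by (intro psubset_card_mono) auto
    obtain y' js where y': "y' \<in> simplices (Sing X) (card (set is) - 1)" "length js = length is"
      "sorted js" "set js = {..card (set is) - 1}" "lsimp f is = lsimp y' js"
      using factor_through_support[OF f ne l(3,2)] by metis
    then have "P (card (set is) - 1)"
      unfolding P_def using l by (intro exI[of _ y'] exI[of _ js]) auto
    then have "m \<le> card (set is) - 1" by (rule least)
    moreover have "card (set is) \<noteq> 0" using ne by simp
    ultimately show False using c unfolding card_atMost by linarith
  qed
  ultimately show thesis using that l by blast
qed

text \<open>A section of the surjection \<open>is\<close> exhibits \<open>f\<close> as a reindexing
  of \<open>g\<close>. Nondegeneracy of \<open>f\<close> makes the reindexing injective, and
  exchanging the roles gives equality of dimensions.\<close>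

lemma eilenberg_zilber_unique:
  assumes f: "nondeg X m f" "length is = Suc k" "sorted is" "set is = {..m}"
    and g: "nondeg X r g" "length js = Suc k" "sorted js" "set js = {..r}"
    and eq: "lsimp f is = lsimp g js"
  shows "m = r" "f = g" "is = js"
proof -
  \<comment> \<open>The section may be made to pass through a prescribed position \<open>j\<close>,
    which lets the two lists be compared entry by entry.\<close>
  have sec: "\<exists>\<kappa>. \<forall>i\<le>m. \<kappa> i < Suc k \<and> is ! \<kappa> i = i \<and> (i = is ! j \<longrightarrow> \<kappa> i = j)"
    if "nondeg X m f" "length is = Suc k" "set is = {..m}" "j < Suc k" for m f "is" j
  proof -
    have "\<exists>l. l < Suc k \<and> is ! l = i \<and> (i = is ! j \<longrightarrow> l = j)" if "i \<le> m" for i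
    proof (cases "i = is ! j")
      case False
      have "i \<in> set is" using \<open>set is = {..m}\<close> that by simp
      then show ?thesis using False \<open>length is = Suc k\<close> by (auto simp: in_set_conv_nth)
    qed (use \<open>j < Suc k\<close> in auto)
    then show ?thesis by metis
  qed
  have main: "m \<le> r \<and> (m = r \<longrightarrow> f = g \<and> is = js)"
    if f: "nondeg X m f" "length is = Suc k" "sorted is" "set is = {..m}"
      and g: "nondeg X r g" "length js = Suc k" "sorted js" "set js = {..r}"
      and eq: "lsimp f is = lsimp g js" for m r f g "is" js
  proof -
    have key: "m \<le> r \<and> (m = r \<longrightarrow> f = g \<and> js ! j = is ! j)" if j: "j < Suc k" for j
    proof -
      obtain \<kappa> where \<kappa>: "\<And>i. i \<le> m \<Longrightarrow> \<kappa> i < Suc k" "\<And>i. i \<le> m \<Longrightarrow> is ! \<kappa> i = i" "is ! j \<le> m \<Longrightarrow> \<kappa> (is ! j) = j"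
        using sec[OF f(1,2,4) j] by blast
      define l where "l = map \<kappa> [0..<Suc m]"
      have lk: "l \<noteq> []" "set l \<subseteq> {..<Suc k}" using \<kappa>(1) by (auto simp: l_def simp del: upt_Suc)
      have fs: "f \<in> simplices (Sing X) m" and gs: "g \<in> simplices (Sing X) r" using f(1) g(1) by (auto simp: nondeg_def)
      have "lsimp (lsimp f is) l = lsimp f (map ((!) is) l)" by (rule lsimp_lsimp) (use lk f in auto)
      moreover have "map ((!) is) l = [0..<Suc m]" using \<kappa>(2) by (auto simp: l_def intro!: map_idI simp del: upt_Suc)
      ultimately have 1: "lsimp (lsimp f is) l = f" by (simp add: lsimp_id[OF fs] del: upt_Suc)
      have 2: "lsimp (lsimp g js) l = lsimp g (map ((!) js) l)" by (rule lsimp_lsimp) (use lk g in auto)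
      have eqf: "f = lsimp g (map ((!) js) l)" using 1 2 eq by simp
      have mono: "\<kappa> a \<le> \<kappa> b" if "a \<le> b" "b \<le> m" for a b
      proof (rule ccontr)
        assume "\<not> \<kappa> a \<le> \<kappa> b"
        then have "is ! \<kappa> b \<le> is ! \<kappa> a" using \<kappa>(1)[of a] that f(2) by (intro sorted_nth_mono[OF f(3)]) auto
        then have "a = b" using \<kappa>(2) that by simp
        then show False using \<open>\<not> \<kappa> a \<le> \<kappa> b\<close> by simp
      qed
      have srt: "sorted (map ((!) js) l)"
        unfolding sorted_iff_nth_mono l_def
        using mono \<kappa>(1) g(2) by (auto intro!: sorted_nth_mono[OF g(3)] simp: less_Suc_eq_le simp del: upt_Suc)
      have sub: "set (map ((!) js) l) \<subseteq> {..r}"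
        using lk(2) g(2,4) nth_mem[of _ js] by fastforce
      have len: "length (map ((!) js) l) = Suc m" by (simp add: l_def)
      note D = nondeg_sorted_list[OF f(1) eqf gs len sub srt]
      show ?thesis
      proof (intro conjI impI D(2))
        assume mr: "m = r"
        have e: "map ((!) js) l = [0..<Suc m]"
          by (rule sorted_distinct_upt[OF srt D(1) len]) (use sub mr in auto)
        show "f = g" using eqf e lsimp_id[OF gs] mr by simp
        have isj: "is ! j \<le> m" using f(2,4) j nth_mem[of j "is"] by auto
        have "map ((!) js) l ! (is ! j) = js ! \<kappa> (is ! j)" using isj by (simp add: l_def del: upt_Suc)
        then show "js ! j = is ! j" using \<kappa>(3)[OF isj] isj unfolding e by (simp del: upt_Suc)
      qed
    qed
    show ?thesis using key key[of 0] f(2) g(2) by (auto intro!: nth_equalityI)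
  qed
  have "m = r" using main[OF f g eq] main[OF g f eq[symmetric]] by simp
  then show "m = r" "f = g" "is = js" using main[OF f g eq] by auto
qed

section \<open>Sorted lists as blocks of equal labels, and canonical forms\<close>

definition blocks :: "nat \<Rightarrow> (nat \<Rightarrow> 'b list) \<Rightarrow> (nat \<times> 'b) list" where
  "blocks m B = concat (map (\<lambda>i. map (Pair i) (B i)) [0..<Suc m])"

lemma sum_list_concat: "sum_list (concat Ls) = sum_list (map sum_list Ls)" for Ls :: "real list list"
  by (induction Ls) auto

lemma blocks_Suc: "blocks (Suc m) B = blocks m B @ map (Pair (Suc m)) (B (Suc m))"
  by (simp add: blocks_def)

lemma blocks_0: "blocks 0 B = map (Pair 0) (B 0)"
  by (simp add: blocks_def)

lemma set_blocks: "set (blocks m B) = {(i, w). i \<le> m \<and> w \<in> set (B i)}"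
  by (auto simp: blocks_def less_Suc_eq_le simp del: upt_Suc)

lemma mass_blocks: "mass (blocks m B) = (\<lambda>i. if i \<le> m then sum_list (B i) else 0)"
proof (induction m)
  case 0
  have "mass (map (Pair 0) L) i = (if i = 0 then sum_list L else 0)" for L :: "real list" and i :: nat
    by (induction L) (auto simp: mass_def)
  then show ?case by (auto simp: blocks_0)
next
  case (Suc m)
  have "mass (map (Pair (Suc m)) L) i = (if i = Suc m then sum_list L else 0)" for L :: "real list" and i
    by (induction L) (auto simp: mass_def)
  then show ?case by (auto simp: blocks_Suc mass_append Suc fun_eq_iff)
qed

lemma sum_blocks: "sum_list (map snd (blocks m B)) = (\<Sum>i\<le>m. sum_list (B i))"
  by (induction m) (auto simp: blocks_0 blocks_Suc o_def)

lemma sorted_blocks: "sorted (map fst (blocks m B))"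
  by (induction m) (auto simp: blocks_0 blocks_Suc o_def sorted_append set_blocks sorted_replicate map_replicate_const)

lemma nz_blocks: "nz (blocks m B) = blocks m (\<lambda>i. filter (\<lambda>w. w \<noteq> 0) (B i))"
  by (induction m) (auto simp: blocks_0 blocks_Suc nz_def filter_map o_def)

lemma blocks_cong: "(\<And>i. i \<le> m \<Longrightarrow> B i = B' i) \<Longrightarrow> blocks m B = blocks m B'"
  unfolding blocks_def by (intro arg_cong[where f = concat] map_cong) auto

lemma filter_Pair: "filter (\<lambda>p. fst p = a) (map (Pair b) L) = (if a = b then map (Pair b) L else [])"
  by (induction L) auto

lemma blocks_inverse: "i \<le> m \<Longrightarrow> map snd (filter (\<lambda>p. fst p = i) (blocks m B)) = B i"
proof (induction m)
  case (Suc m)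
  have "filter (\<lambda>p. fst p = Suc m) (blocks m B) = []" by (auto simp: filter_empty_conv set_blocks)
  then show ?case using Suc by (auto simp: blocks_Suc filter_Pair o_def le_Suc_eq)
qed (auto simp: blocks_0 filter_Pair o_def)

lemma sorted_eq_blocks:
  fixes L :: "(nat \<times> real) list"
  assumes "sorted (map fst L)" "fst ` set L \<subseteq> {..m}"
  shows "L = blocks m (\<lambda>i. map snd (filter (\<lambda>p. fst p = i) L))"
  using assms
proof (induction m arbitrary: L)
  case 0
  then have "filter (\<lambda>p. fst p = 0) L = L" by (auto simp: filter_id_conv)
  moreover have "map (Pair 0) (map snd L) = L" using 0 by (auto intro!: map_idI prod_eqI)
  ultimately show ?case by (simp add: blocks_0)
next
  case (Suc m)
  let ?A = "filter (\<lambda>p. fst p \<le> m) L" and ?C = "filter (\<lambda>p. fst p = Suc m) L"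
  have split: "filter (\<lambda>p. fst p \<le> m) L @ filter (\<lambda>p. fst p = Suc m) L = L"
    if "sorted (map fst L)" "fst ` set L \<subseteq> {..Suc m}" for L :: "(nat \<times> real) list"
    using that
  proof (induction L)
    case (Cons p L)
    show ?case
    proof (cases "fst p \<le> m")
      case False
      then have "fst p = Suc m" "\<forall>q\<in>set L. fst q = Suc m" using Cons.prems by force+
      then have "filter (\<lambda>p. fst p \<le> m) L = []" "filter (\<lambda>p. fst p = Suc m) L = L"
        by (auto simp: filter_empty_conv filter_id_conv)
      then show ?thesis using \<open>fst p = Suc m\<close> by simp
    qed (use Cons in auto)
  qed simp
  have "?A = blocks m (\<lambda>i. map snd (filter (\<lambda>p. fst p = i) ?A))"
    by (rule Suc.IH) (use Suc.prems(1) in \<open>auto simp: sorted_filter\<close>)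
  also have "\<dots> = blocks m (\<lambda>i. map snd (filter (\<lambda>p. fst p = i) L))"
    by (rule blocks_cong) (auto intro!: arg_cong[where f = "map snd"] filter_cong)
  finally have A: "?A = \<dots>" .
  have C: "map (Pair (Suc m)) (map snd ?C) = ?C" by (auto intro!: map_idI prod_eqI)
  have "blocks (Suc m) (\<lambda>i. map snd (filter (\<lambda>p. fst p = i) L)) = ?A @ ?C"
    unfolding blocks_Suc A[symmetric] C ..
  then show ?case using split[OF Suc.prems] by simp
qed

lemma mass_Cons: "mass (p # L) a = (if fst p = a then snd p else 0) + mass L a"
  by (simp add: mass_def)

lemma nz_nz [simp]: "nz (nz L) = nz L"
  by (simp add: nz_def)

lemma nz_coords_sub: "fst ` set (nz (coords k t)) \<subseteq> {..k}"
  by (auto dest: nz_coordsD)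

lemma wt_map_apfst [simp]: "wt (map (apfst h) L) = wt L"
  by (auto simp: wt_def)

text \<open>The normal form of a point of \<open>fat X\<close>. The fat realization sees the
  individual weights, the realization only the sums of the blocks. Blocks beyond m are empty so that
  equal points have equal functions \<open>B\<close>.\<close>

definition canonical :: "'x topology \<Rightarrow> nat \<Rightarrow> ((nat \<Rightarrow> real) \<Rightarrow> 'x) \<Rightarrow> (nat \<Rightarrow> real list) \<Rightarrow> bool" where
  "canonical X m f B \<longleftrightarrow> nondeg X m f \<and> (\<forall>i\<le>m. B i \<noteq> [] \<and> (\<forall>w\<in>set (B i). 0 < w)) \<and>
     (\<forall>i>m. B i = []) \<and> (\<Sum>i\<le>m. sum_list (B i)) = 1"

lemma sum_list_pos': "L \<noteq> [] \<Longrightarrow> \<forall>w\<in>set L. 0 < w \<Longrightarrow> 0 < (sum_list L :: real)"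
  by (induction L) (auto simp: add_pos_nonneg sum_list_nonneg less_imp_le)

lemma blocks_weighted:
  "\<lbrakk>\<And>i w. i \<le> m \<Longrightarrow> w \<in> set (B i) \<Longrightarrow> 0 \<le> w; (\<Sum>i\<le>m. sum_list (B i)) = 1\<rbrakk> \<Longrightarrow> weighted (blocks m B)"
  by (auto simp: weighted_def sum_blocks set_blocks)

lemma canonicalD:
  assumes "canonical X m f B"
  shows "f \<in> simplices (Sing X) m" "weighted (blocks m B)" "nz (blocks m B) = blocks m B" "set (map fst (blocks m B)) = {..m}"
    "\<And>i. i \<le> m \<Longrightarrow> 0 < sum_list (B i)"
proof -
  note a = assms[unfolded canonical_def]
  show "f \<in> simplices (Sing X) m" using a by (simp add: nondeg_def)
  show "weighted (blocks m B)" by (rule blocks_weighted) (use a in \<open>auto simp: less_imp_le\<close>)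
  show "nz (blocks m B) = blocks m B" using a unfolding nz_blocks by (intro blocks_cong) (force simp: filter_id_conv)
  show "set (map fst (blocks m B)) = {..m}"
  proof
    show "{..m} \<subseteq> set (map fst (blocks m B))"
    proof
      fix i assume i: "i \<in> {..m}"
      then have "(i, hd (B i)) \<in> set (blocks m B)" using a by (simp add: set_blocks)
      then show "i \<in> set (map fst (blocks m B))" by force
    qed
  qed (auto simp: set_blocks)
  show "0 < sum_list (B i)" if "i \<le> m" for i using a that by (intro sum_list_pos') auto
qed

text \<open>Uniqueness of the nondegenerate simplex gives the labels; the blocks are then read off
  the weights.\<close>

lemma canonical_unique:
  assumes c: "canonical X m f B" "canonical X r g C" and eq: "lpt f (blocks m B) = lpt g (blocks r C)"
  shows "m = r" "f = g" "B = C"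
proof -
  note D = canonicalD[OF c(1)] and E = canonicalD[OF c(2)]
  have ne: "blocks m B \<noteq> []" "blocks r C \<noteq> []" using weighted_nonempty D(2) E(2) by blast+
  have len: "length (blocks m B) = length (blocks r C)"
    using eq ne by (cases "blocks m B"; cases "blocks r C") (auto simp: lpt_def)
  obtain k where k: "length (blocks m B) = Suc k" using ne by (cases "blocks m B") auto
  note u = eilenberg_zilber_unique[of X m f "map fst (blocks m B)" k r g "map fst (blocks r C)"]
  have s: "lsimp f (map fst (blocks m B)) = lsimp g (map fst (blocks r C))" "wt (blocks m B) = wt (blocks r C)"
    using eq by (auto simp: lpt_def)
  have fst: "m = r" "f = g" "map fst (blocks m B) = map fst (blocks r C)"
    using u D E c s k len sorted_blocks[of m B] sorted_blocks[of r C] unfolding canonical_def by simp_all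
  then show "m = r" "f = g" by auto
  have "map snd (blocks m B) = map snd (blocks r C)"
  proof (rule nth_equalityI)
    fix j assume "j < length (map snd (blocks m B))"
    then show "map snd (blocks m B) ! j = map snd (blocks r C) ! j"
      using fun_cong[OF s(2), of j] len by (simp add: wt_def)
  qed (simp add: len)
  with fst(3) have eqf: "blocks m B = blocks r C" by (rule pair_list_eqI)
  show "B = C"
  proof
    fix i
    show "B i = C i"
      using blocks_inverse[of i m B] blocks_inverse[of i m C] eqf fst(1) c unfolding canonical_def
      by (cases "i \<le> m") auto
  qed
qed

text \<open>One simplex \<open>f\<close> and one map \<open>h\<close> of vertices serve all lists of
  the same mass, and the block sums depend on the mass alone. This uniformity is what makes block
  sums invariant under gluing.\<close>

definition reduces where
  "reduces X k x \<mu> m f h \<longleftrightarrow> (\<forall>L. weighted L \<longrightarrow> nz L = L \<longrightarrow> sorted (map fst L) \<longrightarrow> fst ` set L \<subseteq> {..k} \<longrightarrow> mass L = \<mu> \<longrightarrow>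
    (\<exists>B. canonical X m f B \<and> lpt x L = lpt f (blocks m B) \<and> (\<forall>i\<le>m. sum_list (B i) = (\<Sum>a | a \<le> k \<and> \<mu> a \<noteq> 0 \<and> h a = i. \<mu> a))))"

text \<open>The nondegenerate simplex is taken from the face of \<open>x\<close> spanned by the
  support of \<open>\<mu>\<close>, which is common to all lists of this mass. The bound on m forces
  the dimension to drop when a vertex loses its mass.\<close>

lemma canonical_reduction:
  assumes x: "x \<in> simplices (Sing X) k" and \<mu>: "\<And>i. 0 \<le> \<mu> i" "\<And>i. i > k \<Longrightarrow> \<mu> i = 0" "\<exists>i. \<mu> i \<noteq> 0"
  obtains m f h where "reduces X k x \<mu> m f h" "m < card {a. a \<le> k \<and> \<mu> a \<noteq> 0}"
proof -
  define S where "S = {a. a \<le> k \<and> \<mu> a \<noteq> 0}"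
  have finS: "finite S" by (simp add: S_def)
  obtain i0 where "\<mu> i0 \<noteq> 0" using \<mu>(3) by blast
  then have "i0 \<in> S" using \<mu>(2)[of i0] by (cases "i0 \<le> k") (auto simp: S_def)
  then have Sne: "S \<noteq> {}" by blast
  define \<kappa> where "\<kappa> = sorted_list_of_set S"
  have \<kappa>: "set \<kappa> = S" "sorted \<kappa>" "\<kappa> \<noteq> []" using finS Sne by (auto simp: \<kappa>_def)
  have y: "lsimp x \<kappa> \<in> simplices (Sing X) (length \<kappa> - 1)"
    by (rule lsimp_Sing[OF x \<kappa>(3)]) (auto simp: \<kappa> S_def)
  obtain m f ks where f: "nondeg X m f" "length ks = Suc (length \<kappa> - 1)" "sorted ks" "set ks = {..m}" "lsimp x \<kappa> = lsimp f ks"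
    by (rule eilenberg_zilber_exists[OF y])
  have lks: "length ks = length \<kappa>" using f(2) \<kappa>(3) by (cases \<kappa>) auto
  \<comment> \<open>\<open>ks\<close> assigns vertices of \<open>f\<close> to the positions in
    \<open>\<kappa>\<close>; \<open>h\<close> is the same assignment on the vertices of
    \<open>x\<close> in the support.\<close>
  define h where "h a = ks ! (THE j. j < length \<kappa> \<and> \<kappa> ! j = a)" for a
  have the: "(THE j. j < length \<kappa> \<and> \<kappa> ! j = \<kappa> ! l) = l" if "l < length \<kappa>" for l
    using that finS by (intro the_equality) (auto simp: \<kappa>_def nth_eq_iff_index_eq)
  have main: "\<exists>B. canonical X m f B \<and> lpt x L = lpt f (blocks m B) \<and> (\<forall>i\<le>m. sum_list (B i) = (\<Sum>a\<in>{a \<in> S. h a = i}. \<mu> a))"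
    if L: "weighted L" "nz L = L" "sorted (map fst L)" "fst ` set L \<subseteq> {..k}" "mass L = \<mu>" for L
  proof -
    have pos: "0 < snd p" if "p \<in> set L" for p
    proof -
      have "0 \<le> snd p" using L(1) that by (auto simp: weighted_def)
      moreover have "p \<in> set (nz L)" using L(2) that by simp
      ultimately show ?thesis by (auto simp: nz_def)
    qed
    \<comment> \<open>Since all weights are positive, the support of the mass is exactly the set of
      labels that occur.\<close>
    have ml: "mass L a \<noteq> 0 \<longleftrightarrow> a \<in> fst ` set L" for a
    proof
      assume a: "a \<in> fst ` set L"
      have "0 < mass L a" if "\<forall>p\<in>set L. 0 < snd p" "a \<in> fst ` set L" for L :: "(nat \<times> real) list"
        using that
      proof (induction L)
        case (Cons p L)
        have "0 \<le> mass L a" unfolding mass_def by (rule sum_list_nonneg) (use Cons.prems less_imp_le in auto)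
        moreover have "0 < mass L a" if "a \<in> fst ` set L" using Cons that by auto
        moreover have "0 < snd p" using Cons.prems by simp
        ultimately show ?case using Cons.prems(2) unfolding mass_Cons by (auto simp: add_pos_nonneg)
      qed simp
      then show "mass L a \<noteq> 0" using a pos by (metis less_irrefl)
    next
      assume "mass L a \<noteq> 0"
      moreover have "mass L a = 0" if "a \<notin> fst ` set L"
      proof -
        have e: "map (\<lambda>p. if fst p = a then snd p else 0) L = map (\<lambda>p. 0) L" using that by (intro map_cong) auto
        show ?thesis unfolding mass_def e by simp
      qed
      ultimately show "a \<in> fst ` set L" by blast
    qed
    have fS: "fst ` set L = S" using ml L(4,5) by (auto simp: S_def)
    have Lk: "map fst L \<noteq> []" "set (map fst L) \<subseteq> {..k}" using weighted_nonempty[OF L(1)] L(4) by auto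
    have sm: "set (map fst L) = S" using fS by simp
    obtain y' js where j0: "length js = length (map fst L)" "sorted js" "set js = {..card (set (map fst L)) - 1}"
        "lsimp x (map fst L) = lsimp y' js" "y' = lsimp x (sorted_list_of_set (set (map fst L)))"
        "\<And>i. i < length (map fst L) \<Longrightarrow> sorted_list_of_set (set (map fst L)) ! (js ! i) = map fst L ! i"
      by (rule factor_through_support[OF x Lk L(3)]) (rule that)
    have js: "length js = length L" "sorted js" "set js = {..card S - 1}"
        "lsimp x (map fst L) = lsimp y' js" "y' = lsimp x \<kappa>" "\<And>i. i < length L \<Longrightarrow> \<kappa> ! (js ! i) = fst (L ! i)"
      using j0 unfolding sm \<kappa>_def[symmetric] by simp_all
    have lk: "length \<kappa> = card S" by (simp add: \<kappa>_def)
    have jl: "js ! i < length \<kappa>" if "i < length L" for i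
    proof -
      have "js ! i \<le> card S - 1" using js(1,3) that nth_mem[of i js] by auto
      moreover have "card S \<noteq> 0" using Sne finS by simp
      ultimately show ?thesis using lk by linarith
    qed
    have hj: "ks ! (js ! i) = h (fst (L ! i))" if "i < length L" for i
      using js(6)[OF that] the[OF jl[OF that]] by (simp add: h_def)
    define L' where "L' = map (apfst h) L"
    have fstL': "map fst L' = map ((!) ks) js"
      using js(1) hj by (auto simp: L'_def intro!: nth_equalityI)
    have "lsimp x (map fst L) = lsimp f (map fst L')"
      unfolding js(4,5) f(5) fstL' by (rule lsimp_lsimp) (use Lk js(1) jl lks in \<open>auto simp: in_set_conv_nth\<close>)
    moreover have "wt L' = wt L" by (auto simp: wt_def L'_def)
    ultimately have pt: "lpt x L = lpt f L'" by (simp add: lpt_def L'_def)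
    have sL': "sorted (map fst L')"
      unfolding fstL' sorted_iff_nth_mono using js(1,2) jl lks
      by (auto intro!: sorted_nth_mono[OF f(3)] sorted_nth_mono[OF js(2)])
    have img: "fst ` set L' = {..m}"
    proof -
      obtain c where c: "card S = Suc c" using Sne finS by (metis card_eq_0_iff not0_implies_Suc)
      have "set js = {..<length \<kappa>}" unfolding js(3) lk c by (simp add: lessThan_Suc_atMost)
      then have "set (map ((!) ks) js) = set ks"
        using nth_image[of "length ks" ks] lks by (simp add: atLeast0LessThan)
      then show ?thesis using fstL' f(4) by (metis list.set_map)
    qed
    define B where "B = (\<lambda>i. map snd (filter (\<lambda>p. fst p = i) L'))"
    have fB: "blocks m B = L'" unfolding B_def by (rule sorted_eq_blocks[symmetric]) (use sL' img in auto)
    have wL': "weighted L'" using L(1) by (auto simp: L'_def weighted_def o_def)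
    have le: "fst p \<le> m" if "p \<in> set L'" for p using img that by (metis atMost_iff imageI)
    have "B i \<noteq> []" if "i \<le> m" for i
    proof -
      have "i \<in> fst ` set L'" unfolding img using that by simp
      then obtain p where p: "i = fst p" "p \<in> set L'" by (rule imageE)
      then have "p \<in> set (filter (\<lambda>p. fst p = i) L')" by simp
      then have "filter (\<lambda>p. fst p = i) L' \<noteq> []" by (metis empty_iff empty_set)
      then show ?thesis unfolding B_def map_is_Nil_conv .
    qed
    moreover have "0 < w" if "w \<in> set (B i)" for w i using pos that by (auto simp: B_def L'_def)
    moreover have "B i = []" if "i > m" for i unfolding B_def map_is_Nil_conv filter_empty_conv using le that by (metis not_less)
    moreover have "(\<Sum>i\<le>m. sum_list (B i)) = 1" using sum_blocks[of m B] fB wL' by (simp add: weighted_def)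
    ultimately have "canonical X m f B" using f(1) by (auto simp: canonical_def)
    moreover have "sum_list (B i) = (\<Sum>a\<in>{a \<in> S. h a = i}. \<mu> a)" if "i \<le> m" for i
    proof -
      have "sum_list (B i) = mass L' i" using mass_blocks[of m B] fB that by simp
      also have "mass L' i = (\<Sum>p\<leftarrow>L. if h (fst p) = i then snd p else 0)" by (simp add: mass_def L'_def o_def cong: if_cong)
      also have "\<dots> = (\<Sum>a\<in>{a \<in> S. h a = i}. mass L a)"
      proof -
        have "(\<Sum>p\<leftarrow>M. if h (fst p) = i then snd p else 0) = (\<Sum>a\<in>{a \<in> S. h a = i}. mass M a)"
          if "fst ` set M \<subseteq> S" for M :: "(nat \<times> real) list"
          using that
        proof (induction M)
          case (Cons p M)
          have "(\<Sum>a\<in>{a \<in> S. h a = i}. if fst p = a then snd p else 0) = (if h (fst p) = i then snd p else 0)"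
            using Cons.prems finS by (auto simp: sum.delta')
          then show ?case using Cons by (simp add: mass_def sum.distrib)
        qed (simp add: mass_def)
        then show ?thesis using fS by simp
      qed
      finally show ?thesis using L(5) by simp
    qed
    ultimately show ?thesis using pt fB by auto
  qed
  have "card (set ks) \<le> length ks" by (rule card_length)
  then have "m < card S" using f(4) lks by (simp add: \<kappa>_def)
  then show thesis
    by (intro that[of m f h]) (use main in \<open>simp_all add: reduces_def S_def conj_assoc\<close>)
qed

lemma fat_cases:
  assumes "z \<in> topspace (fat X)"
  obtains m f B where "canonical X m f B" "z = lpt f (blocks m B)"
proof -
  obtain k x t where z: "z = lpt x (nz (coords k t))" "x \<in> simplices (Sing X) k" "t \<in> standard_simplex k"
    using assms by (auto simp: topspace_fat topspace_prerealization nf_def)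
  have t: "\<And>i. 0 \<le> t i" "\<And>i. i > k \<Longrightarrow> t i = 0" "\<exists>i. t i \<noteq> 0"
    using z(3) by (auto simp: standard_simplex_def) (metis sum.neutral zero_neq_one)
  obtain m f h where R: "reduces X k x t m f h"
    by (rule canonical_reduction[OF z(2) t]) (erule that | assumption)+
  have "weighted (nz (coords k t))" "mass (nz (coords k t)) = t"
    using coords_weighted[OF z(3)] mass_coords[OF z(3)] by simp_all
  from R[unfolded reduces_def, rule_format, OF this(1) nz_nz sorted_nz_coords nz_coords_sub this(2)]
  obtain B where B: "canonical X m f B" "lpt x (nz (coords k t)) = lpt f (blocks m B)" by (elim exE conjE)
  show thesis by (rule that[OF B(1)]) (simp only: z(1) B(2))
qed

text \<open>The normal form of a point of the geometric realization: a nondegenerate simplex together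
  with an interior point of it.\<close>

lemma rc_canonical_unique:
  assumes c: "canonical X m f B" "canonical X r g C"
    and eq: "rc X (lpt f (blocks m B)) = rc X (lpt g (blocks r C))"
  shows "m = r" "f = g" "\<And>i. i \<le> m \<Longrightarrow> sum_list (B i) = sum_list (C i)"
proof -
  \<comment> \<open>The dimension, the simplex and the block sums of the canonical form, collected
    in a set whose invariance under a single gluing is then shown.\<close>
  define \<Phi> where "\<Phi> a = {(m, f, s). \<exists>B. canonical X m f B \<and> nf a = lpt f (blocks m B) \<and> s = (\<lambda>i. sum_list (B i))}" for a
  have inv: "\<Phi> a = \<Phi> b" if ab: "glue (Sing X) a b" for a b
  proof -
    obtain n k \<sigma> x t where g: "\<sigma> \<in> order_maps n k" "x \<in> simplices (Sing X) k" "t \<in> standard_simplex n"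
      "a = ((n, act (Sing X) n k \<sigma> x), t)" "b = ((k, x), delta_map n k \<sigma> t)"
      using ab unfolding glue_def by blast
    define "is" where "is = map \<sigma> [0..<Suc n]"
    note o = order_map_list[OF g(1), folded is_def]
    note l = act_lsimp[OF o(1-3), unfolded o(4) o(5)[unfolded o(4)]]
    have a: "a = ((n, lsimp x is), t)" and b: "b = ((k, x), push is t)" using g l by auto
    have p: "push is t \<in> standard_simplex k" using push_in[of t "is"] g(3) o by simp
    let ?La = "map (apfst ((!) is)) (nz (coords n t))" and ?Lb = "nz (coords k (push is t))"
    have len: "length is = Suc n" by (simp add: is_def)
    have wn: "weighted (nz (coords n t))" using coords_weighted[OF g(3)] by simp
    have nfa: "nf a = lpt x ?La"
      unfolding a nf_def split
      by (rule lpt_lsimp[OF weighted_nonempty[OF wn]]) (use len in \<open>auto simp: less_Suc_eq_le dest: nz_coordsD\<close>)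
    have nfb: "nf b = lpt x ?Lb" by (simp add: b nf_def)
    have wa: "weighted ?La" using wn by (auto simp: weighted_def o_def)
    have wb: "weighted ?Lb" using coords_weighted[OF p] by simp
    have ma: "mass ?La = push is t"
    proof -
      have "mass ?La = mass (map (apfst ((!) is)) (coords n t))" by (simp flip: nz_map_apfst)
      also have "\<dots> = push is t"
      proof -
        have "map fst (map (apfst ((!) is)) (coords n t)) = is"
          using len by (auto simp: coords_def intro!: nth_equalityI simp del: upt_Suc)
        moreover have "wt (map (apfst ((!) is)) (coords n t)) = t"
          using wt_coords[OF g(3)] by simp
        ultimately show ?thesis using mass_push[of "map (apfst ((!) is)) (coords n t)"] by simp
      qed
      finally show ?thesis .
    qed
    have mb: "mass ?Lb = push is t" using mass_coords[OF p] by simp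
    have sa: "sorted (map fst ?La)"
    proof -
      have "map fst ?La = map ((!) is) (map fst (nz (coords n t)))" by simp
      moreover have "sorted (map ((!) is) l)" if "sorted l" "\<forall>i\<in>set l. i \<le> n" for l
        using that len by (auto simp: sorted_iff_nth_mono less_Suc_eq_le intro!: sorted_nth_mono[OF o(3)])
      ultimately show ?thesis
        using sorted_nz_coords[of n t] nz_coordsD[of _ n t] by (metis (no_types, lifting) imageE list.set_map)
    qed
    note rb = nz_coords_sub[of k "push is t"]
    have ra: "fst ` set ?La \<subseteq> {..k}"
    proof
      fix b assume "b \<in> fst ` set ?La"
      then obtain p where p: "p \<in> set (nz (coords n t))" "b = is ! fst p" by auto
      then have "fst p < length is" using len nz_coordsD[OF p(1)] by simp
      then show "b \<in> {..k}" using o(2) p(2) by (metis nth_mem subsetD)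
    qed
    have t: "\<And>i. 0 \<le> push is t i" "\<And>i. i > k \<Longrightarrow> push is t i = 0" "\<exists>i. push is t i \<noteq> 0"
      using p by (auto simp: standard_simplex_def) (metis sum.neutral zero_neq_one)
    \<comment> \<open>Both sides of the gluing have mass \<open>push is t\<close>, so one reduction
      treats them together.\<close>
    obtain m f h where R: "reduces X k x (push is t) m f h"
      by (rule canonical_reduction[OF g(2) t]) (erule that | assumption)+
    obtain B1 where B1: "canonical X m f B1" "lpt x ?La = lpt f (blocks m B1)"
      "\<forall>i\<le>m. sum_list (B1 i) = (\<Sum>a | a \<le> k \<and> push is t a \<noteq> 0 \<and> h a = i. push is t a)"
      using R[unfolded reduces_def, rule_format, OF wa _ sa ra ma] by (auto simp: nz_map_apfst)
    obtain B2 where B2: "canonical X m f B2" "lpt x ?Lb = lpt f (blocks m B2)"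
      "\<forall>i\<le>m. sum_list (B2 i) = (\<Sum>a | a \<le> k \<and> push is t a \<noteq> 0 \<and> h a = i. push is t a)"
      using R[unfolded reduces_def, rule_format, OF wb _ sorted_nz_coords rb mb] by auto
    have s12: "(\<lambda>i. sum_list (B1 i)) = (\<lambda>i. sum_list (B2 i))"
    proof
      fix i show "sum_list (B1 i) = sum_list (B2 i)"
        using B1 B2 unfolding canonical_def by (cases "i \<le> m") auto
    qed
    have "\<Phi> a = {(m, f, \<lambda>i. sum_list (B1 i))}"
      unfolding \<Phi>_def nfa B1(2) using B1(1) canonical_unique by fastforce
    moreover have "\<Phi> b = {(m, f, \<lambda>i. sum_list (B2 i))}"
      unfolding \<Phi>_def nfb B2(2) using B2(1) canonical_unique by fastforce
    ultimately show ?thesis using s12 by simp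
  qed
  have "\<Phi> (lpt f (blocks m B)) = \<Phi> (lpt g (blocks r C))"
    using eq inv unfolding realization_class_eq_iff by (rule equivclp_invariant)
  moreover have "nf (lpt f (blocks m B)) = lpt f (blocks m B)" "nf (lpt g (blocks r C)) = lpt g (blocks r C)"
    using nf_lpt canonicalD(2,3) c by metis+
  moreover have "(m, f, \<lambda>i. sum_list (B i)) \<in> \<Phi> (lpt f (blocks m B))"
    using c(1) nf_lpt canonicalD(2,3) unfolding \<Phi>_def by fastforce
  ultimately have "(m, f, \<lambda>i. sum_list (B i)) \<in> \<Phi> (lpt g (blocks r C))" by simp
  then obtain B' where B': "canonical X m f B'" "nf (lpt g (blocks r C)) = lpt f (blocks m B')" "(\<lambda>i. sum_list (B i)) = (\<lambda>i. sum_list (B' i))"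
    by (auto simp: \<Phi>_def)
  have "lpt g (blocks r C) = lpt f (blocks m B')" using B'(2) nf_lpt canonicalD(2,3) c(2) by metis
  note u = canonical_unique[OF c(2) B'(1) this]
  then show "m = r" "f = g" by auto
  show "sum_list (B i) = sum_list (C i)" for i using u(3) B'(3) by metis
qed

section \<open>A section of the realization into the fat realization\<close>

definition mn :: "nat \<Rightarrow> (nat \<Rightarrow> real) \<Rightarrow> real" where "mn m s = Min (s ` {..m})"
text \<open>Normalised to be 1 at the barycentre and 0 on the boundary of the simplex.\<close>

definition nu :: "nat \<Rightarrow> (nat \<Rightarrow> real) \<Rightarrow> real" where "nu m s = real (Suc m) * mn m s"
text \<open>The value 1 for \<nu> \<le> 1/2 removes the smallest block completely there. The
  decrease to 0 at the barycentre keeps the product of \<open>lam \<nu>\<close> and \<nu> at most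
  1/2, hence the denominator of \<open>kf\<close> away from 0.\<close>

definition lam :: "real \<Rightarrow> real" where "lam \<nu> = min 1 (2 * (1 - \<nu>))"
text \<open>Zero on the boundary, where a step must agree with the faces, and 1 from \<nu> = 1/4 on.
  Up to 1/4 the bound \<open>cap\<close> is 1, so for every \<nu> either the blocks are collapsed or
  the face has its full time.\<close>

definition gam :: "real \<Rightarrow> real" where "gam \<nu> = min 1 (4 * \<nu>)"

text \<open>The deformation on a list over a nondegenerate simplex, with equal neighbouring vertices grouped in blocks
  and \<open>\<nu>\<close> the normalised smallest block sum. For \<open>\<nu> \<ge> 1/2\<close> every block is collapsed to a single entry; for
  \<open>\<nu> \<le> 1/2\<close> the smallest block is pushed to zero and the deformation continues over a proper face.\<close>

definition kf :: "nat \<Rightarrow> (nat \<Rightarrow> real) \<Rightarrow> real \<Rightarrow> nat \<Rightarrow> real" where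
  "kf m s \<theta> i = (1 - \<theta> * lam (nu m s) * (mn m s / s i)) / (1 - \<theta> * lam (nu m s) * nu m s)"

text \<open>The factor \<open>kf\<close> subtracts a common multiple of the minimum from all block
  sums and renormalises. The fraction \<open>g\<close> of each block then moves into one new entry
  at the end of the block.\<close>

definition stp :: "nat \<Rightarrow> real \<Rightarrow> (nat \<Rightarrow> real list) \<Rightarrow> nat \<Rightarrow> real list" where
  "stp m \<theta> B = (let s = (\<lambda>i. sum_list (B i)); g = \<theta> * gam (nu m s) in
     (\<lambda>i. map (\<lambda>w. (1 - g) * (w * kf m s \<theta> i)) (B i) @ [g * (s i * kf m s \<theta> i)]))"

text \<open>The clock of dimension m, running while \<open>\<tau>\<close> goes from 2^-(m+1) to
  2^-m; larger dimensions run earlier.\<close>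

definition th :: "nat \<Rightarrow> real \<Rightarrow> real" where "th m \<tau> = min 1 (max 0 (2 ^ Suc m * \<tau> - 1))"
text \<open>The time granted to the face. At \<nu> = 1/2 it is 2^-m, when faces have not begun to
  move and the two branches of the recursion meet; for \<nu> \<le> 1/4 it is 1.\<close>

definition cap :: "nat \<Rightarrow> real \<Rightarrow> real" where "cap m \<nu> = (1/2) ^ m + (1 - (1/2) ^ m) * min 1 (2 - 4 * \<nu>)"

definition prob_on :: "nat \<Rightarrow> (nat \<Rightarrow> real) \<Rightarrow> bool" where
  "prob_on m s \<longleftrightarrow> (\<forall>i\<le>m. 0 \<le> s i) \<and> sum s {..m} = 1"

section \<open>Estimates for a single step\<close>

lemma mn_le: "i \<le> m \<Longrightarrow> mn m s \<le> s i"
  by (auto simp: mn_def intro!: Min_le)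

lemma mn_attained: "\<exists>i\<le>m. s i = mn m s"
proof -
  have "Min (s ` {..m}) \<in> s ` {..m}" by (rule Min_in) auto
  then show ?thesis unfolding mn_def by (metis atMost_iff imageE)
qed

lemma mn_nonneg: "prob_on m s \<Longrightarrow> 0 \<le> mn m s"
  using mn_attained[of m s] by (auto simp: prob_on_def)

lemma nu_bounds:
  assumes "prob_on m s" shows "0 \<le> nu m s" "nu m s \<le> 1"
proof -
  show "0 \<le> nu m s" using mn_nonneg[OF assms] by (simp add: nu_def)
  have "real (card {..m}) * mn m s \<le> sum s {..m}"
    by (rule sum_bounded_below) (simp add: mn_le)
  then show "nu m s \<le> 1" using assms by (simp add: nu_def prob_on_def)
qed

lemma lam_bounds: "\<nu> \<le> 1 \<Longrightarrow> 0 \<le> lam \<nu>" "lam \<nu> \<le> 1"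
  by (auto simp: lam_def)

lemma lam_nu: "0 \<le> \<nu> \<Longrightarrow> \<nu> \<le> 1 \<Longrightarrow> lam \<nu> * \<nu> \<le> 1/2"
proof -
  assume a: "0 \<le> \<nu>" "\<nu> \<le> 1"
  have "2 * (1 - \<nu>) * \<nu> \<le> 1/2"
    using sum_squares_ge_zero[of "\<nu> - 1/2" 0] by (simp add: algebra_simps power2_eq_square)
  moreover have "lam \<nu> * \<nu> \<le> 2 * (1 - \<nu>) * \<nu>" by (rule mult_right_mono) (use a in \<open>auto simp: lam_def\<close>)
  ultimately show ?thesis by simp
qed

lemma gam_bounds: "0 \<le> \<nu> \<Longrightarrow> 0 \<le> gam \<nu>" "gam \<nu> \<le> 1"
  by (auto simp: gam_def)

lemma kf_denom:
  assumes "prob_on m s" "0 \<le> \<theta>" "\<theta> \<le> 1" shows "1/2 \<le> 1 - \<theta> * lam (nu m s) * nu m s"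
proof -
  have "\<theta> * (lam (nu m s) * nu m s) \<le> 1 * (1/2)"
    by (rule mult_mono) (use lam_nu nu_bounds[OF assms(1)] lam_bounds assms in auto)
  then show ?thesis by (simp add: mult.assoc)
qed

lemma kf_nonneg:
  assumes "prob_on m s" "0 \<le> \<theta>" "\<theta> \<le> 1" "i \<le> m" shows "0 \<le> kf m s \<theta> i"
proof -
  have r: "mn m s / s i \<le> 1" "0 \<le> mn m s / s i"
    using mn_le[OF assms(4), of s] mn_nonneg[OF assms(1)] by (auto simp: divide_le_eq_1)
  have c: "\<theta> * lam (nu m s) \<le> 1" "0 \<le> \<theta> * lam (nu m s)"
    using assms lam_bounds nu_bounds[OF assms(1)] by (auto intro: mult_le_one)
  have "\<theta> * lam (nu m s) * (mn m s / s i) \<le> 1" by (rule mult_le_one[OF c(1) r(2) r(1)])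
  then show ?thesis using kf_denom[OF assms(1-3)] by (simp add: kf_def)
qed

lemma kf_sum:
  assumes s: "prob_on m s" "0 \<le> \<theta>" "\<theta> \<le> 1"
  shows "(\<Sum>i\<le>m. s i * kf m s \<theta> i) = 1"
proof -
  let ?c = "\<theta> * lam (nu m s)"
  have "(\<Sum>i\<le>m. s i * (1 - ?c * (mn m s / s i))) = 1 - ?c * nu m s"
  proof (cases "mn m s = 0")
    case True
    then show ?thesis using s(1) by (simp add: nu_def prob_on_def)
  next
    case False
    then have "s i \<noteq> 0" if "i \<le> m" for i using mn_nonneg[OF s(1)] mn_le[OF that, of s] by linarith
    then have "(\<Sum>i\<le>m. s i * (1 - ?c * (mn m s / s i))) = (\<Sum>i\<le>m. s i - ?c * mn m s)"
      by (intro sum.cong) (auto simp: field_simps)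
    also have "\<dots> = 1 - ?c * nu m s" using s(1) by (simp add: sum_subtractf nu_def prob_on_def algebra_simps)
    finally show ?thesis .
  qed
  then show ?thesis using kf_denom[OF s]
    unfolding kf_def times_divide_eq_right sum_divide_distrib[symmetric] by simp
qed

lemma stp_sum: "sum_list (stp m \<theta> B i) = sum_list (B i) * kf m (\<lambda>i. sum_list (B i)) \<theta> i"
proof -
  have *: "sum_list (map (\<lambda>w. c * (w * k)) L) = c * (sum_list L * k)" for c k :: real and L
    by (induction L) (auto simp: algebra_simps)
  show ?thesis unfolding stp_def Let_def sum_list_append * by (simp add: algebra_simps)
qed

definition wblocks :: "nat \<Rightarrow> (nat \<Rightarrow> real list) \<Rightarrow> bool" where
  "wblocks m B \<longleftrightarrow> (\<forall>i\<le>m. \<forall>w\<in>set (B i). 0 \<le> w) \<and> (\<Sum>i\<le>m. sum_list (B i)) = 1"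

lemma wblocks_weighted: "wblocks m B \<Longrightarrow> weighted (blocks m B)"
  by (rule blocks_weighted) (auto simp: wblocks_def)

lemma wblocks_canonical: "canonical X m f B \<Longrightarrow> wblocks m B"
  by (auto simp: canonical_def wblocks_def less_imp_le)

lemma prob_on_blocks: "wblocks m B \<Longrightarrow> prob_on m (\<lambda>i. sum_list (B i))"
  by (auto simp: prob_on_def wblocks_def intro!: sum_list_nonneg)

lemma nz_sorted: "sorted (map fst L) \<Longrightarrow> sorted (map fst (nz L))"
  unfolding nz_def by (rule sorted_filter)

lemma nz_sub: "fst ` set L \<subseteq> A \<Longrightarrow> fst ` set (nz L) \<subseteq> A"
  by (auto simp: nz_def)

lemma stp_blocks:
  assumes B: "wblocks m B" and \<theta>: "0 \<le> \<theta>" "\<theta> \<le> 1"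
  shows "wblocks m (stp m \<theta> B)" "weighted (blocks m (stp m \<theta> B))"
proof -
  have p: "prob_on m (\<lambda>i. sum_list (B i))" by (rule prob_on_blocks[OF B])
  define g where "g = \<theta> * gam (nu m (\<lambda>i. sum_list (B i)))"
  have g: "0 \<le> g" "g \<le> 1" using \<theta> gam_bounds nu_bounds[OF p] by (auto simp: g_def intro: mult_le_one)
  have 1: "0 \<le> w" if "i \<le> m" "w \<in> set (stp m \<theta> B i)" for i w
    using that g kf_nonneg[OF p \<theta> that(1)] B p
    by (auto simp: stp_def Let_def prob_on_def wblocks_def simp flip: g_def)
  have 2: "(\<Sum>i\<le>m. sum_list (stp m \<theta> B i)) = 1"
    unfolding stp_sum by (rule kf_sum[OF p \<theta>])
  show "wblocks m (stp m \<theta> B)" using 1 2 by (auto simp: wblocks_def)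
  then show "weighted (blocks m (stp m \<theta> B))" by (rule wblocks_weighted)
qed

lemma mn_cong: "(\<And>i. i \<le> m \<Longrightarrow> s i = s' i) \<Longrightarrow> mn m s = mn m s'"
  unfolding mn_def by (rule arg_cong[where f = Min]) auto

lemma nu_cong: "(\<And>i. i \<le> m \<Longrightarrow> s i = s' i) \<Longrightarrow> nu m s = nu m s'"
  unfolding nu_def using mn_cong[of m s s'] by simp

lemma kf_cong: "(\<And>i. i \<le> m \<Longrightarrow> s i = s' i) \<Longrightarrow> i \<le> m \<Longrightarrow> kf m s \<theta> i = kf m s' \<theta> i"
  unfolding kf_def using mn_cong[of m s s'] nu_cong[of m s s'] by simp

text \<open>Zero entries influence neither the block sums nor the positive entries after a step, so
  a step is defined on points of \<open>fat X\<close>.\<close>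

lemma nz_stp_cong:
  assumes "\<And>i. i \<le> m \<Longrightarrow> filter (\<lambda>w. w \<noteq> 0) (B i) = filter (\<lambda>w. w \<noteq> 0) (C i)"
  shows "nz (blocks m (stp m \<theta> B)) = nz (blocks m (stp m \<theta> C))"
proof -
  have sl: "sum_list (filter (\<lambda>w. w \<noteq> 0) L) = sum_list L" for L :: "real list" by (induction L) auto
  have s: "sum_list (B i) = sum_list (C i)" if "i \<le> m" for i using assms[OF that] sl by metis
  have fm: "filter (\<lambda>w. w \<noteq> 0) (map (\<lambda>w. c * (w * k)) L) = filter (\<lambda>w. w \<noteq> 0) (map (\<lambda>w. c * (w * k)) (filter (\<lambda>w. w \<noteq> 0) L))"
    for c k :: real and L by (induction L) auto
  show ?thesis
    unfolding nz_blocks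
  proof (rule blocks_cong)
    fix i assume i: "i \<le> m"
    have n: "nu m (\<lambda>i. sum_list (B i)) = nu m (\<lambda>i. sum_list (C i))" by (rule nu_cong) (rule s)
    have k: "kf m (\<lambda>i. sum_list (B i)) \<theta> i = kf m (\<lambda>i. sum_list (C i)) \<theta> i" by (rule kf_cong[OF s i])
    show "filter (\<lambda>w. w \<noteq> 0) (stp m \<theta> B i) = filter (\<lambda>w. w \<noteq> 0) (stp m \<theta> C i)"
      unfolding stp_def Let_def n k s[OF i] filter_append
      using fm[of _ _ "B i"] fm[of _ _ "C i"] assms[OF i] by simp
  qed
qed

lemma nz_stp_id:
  assumes "\<theta> = 0 \<or> mn m (\<lambda>i. sum_list (B i)) = 0"
  shows "nz (blocks m (stp m \<theta> B)) = nz (blocks m B)"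
  unfolding nz_blocks
proof (rule blocks_cong)
  fix i assume "i \<le> m"
  have 1: "kf m (\<lambda>i. sum_list (B i)) \<theta> i = 1" using assms by (auto simp: kf_def nu_def)
  have 2: "\<theta> * gam (nu m (\<lambda>i. sum_list (B i))) = 0" using assms by (auto simp: gam_def nu_def)
  show "filter (\<lambda>w. w \<noteq> 0) (stp m \<theta> B i) = filter (\<lambda>w. w \<noteq> 0) (B i)"
    unfolding stp_def Let_def 1 2 by simp
qed

text \<open>With \<open>g\<close> = 1 the old entries get weight zero, and the one remaining entry
  of a block is a function of the block sums.\<close>

lemma stp_collapse:
  assumes "gam (nu m (\<lambda>i. sum_list (B i))) = 1" "\<And>i. i \<le> m \<Longrightarrow> sum_list (B i) = sum_list (C i)"
  shows "nz (blocks m (stp m 1 B)) = nz (blocks m (stp m 1 C))"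
  unfolding nz_blocks
proof (rule blocks_cong)
  fix i assume i: "i \<le> m"
  have n: "nu m (\<lambda>i. sum_list (B i)) = nu m (\<lambda>i. sum_list (C i))" by (rule nu_cong) (rule assms)
  have k: "kf m (\<lambda>i. sum_list (B i)) \<theta> i = kf m (\<lambda>i. sum_list (C i)) \<theta> i" for \<theta> by (rule kf_cong[OF assms(2) i])
  show "filter (\<lambda>w. w \<noteq> 0) (stp m 1 B i) = filter (\<lambda>w. w \<noteq> 0) (stp m 1 C i)"
    unfolding stp_def Let_def n[symmetric] k assms(1) assms(2)[OF i] by (simp add: o_def)
qed

text \<open>At a positive minimal block the numerator of \<open>kf\<close> is 1 - 1, since
  \<open>lam\<close> is 1 for these \<nu>.\<close>

lemma stp_zero_block:
  assumes p: "prob_on m (\<lambda>i. sum_list (B i))" "nu m (\<lambda>i. sum_list (B i)) \<le> 1/2"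
    and i: "i \<le> m" "sum_list (B i) = mn m (\<lambda>i. sum_list (B i))" and B: "\<And>w. w \<in> set (B i) \<Longrightarrow> 0 \<le> w"
  shows "\<forall>w\<in>set (stp m 1 B i). w = 0"
proof (cases "sum_list (B i) = 0")
  case True
  then have "\<forall>w\<in>set (B i). w = 0" using B by (simp add: sum_list_nonneg_eq_0_iff)
  then show ?thesis using True by (auto simp: stp_def Let_def)
next
  case False
  then have "kf m (\<lambda>i. sum_list (B i)) 1 i = 0"
    using p(2) i(2) by (simp add: kf_def lam_def)
  then show ?thesis by (auto simp: stp_def Let_def)
qed

section \<open>The deformation by recursion over the dimension\<close>

definition dec :: "'x topology \<Rightarrow> ((nat \<Rightarrow> real) \<Rightarrow> 'x) prepoint \<Rightarrow> nat \<times> ((nat \<Rightarrow> real) \<Rightarrow> 'x) \<times> (nat \<Rightarrow> real list)" where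
  "dec X z = (SOME (m, f, B). canonical X m f B \<and> z = lpt f (blocks m B))"

lemma dec: assumes "canonical X m f B" shows "dec X (lpt f (blocks m B)) = (m, f, B)"
  unfolding dec_def
proof (rule some_equality)
  show "case (m, f, B) of (m', f', B') \<Rightarrow> canonical X m' f' B' \<and> lpt f (blocks m B) = lpt f' (blocks m' B')"
    using assms by simp
  fix a assume a: "case a of (m', f', B') \<Rightarrow> canonical X m' f' B' \<and> lpt f (blocks m B) = lpt f' (blocks m' B')"
  obtain m' f' B' where e: "a = (m', f', B')" by (cases a)
  show "a = (m, f, B)" using canonical_unique[OF assms, of m' f' B'] a unfolding e by simp
qed

text \<open>Recursion over a bound for the rank avoids a termination argument: that the rank drops
  on a face is a property of the normal form, proved afterwards. \<open>Jr_J\<close> removes the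
  bound.\<close>

primrec Jr :: "'x topology \<Rightarrow> nat \<Rightarrow> real \<Rightarrow> ((nat \<Rightarrow> real) \<Rightarrow> 'x) prepoint \<Rightarrow> ((nat \<Rightarrow> real) \<Rightarrow> 'x) prepoint" where
  "Jr X 0 \<tau> z = z"
| "Jr X (Suc M) \<tau> z = (case dec X z of (m, f, B) \<Rightarrow>
     if m = M then
       (let z' = nf (lpt f (blocks m (stp m (th m \<tau>) B))); \<nu> = nu m (\<lambda>i. sum_list (B i)) in
        if \<tau> \<le> (1/2) ^ m \<or> 1/2 \<le> \<nu> then z' else Jr X M (min \<tau> (cap m \<nu>)) z')
     else Jr X M \<tau> z)"

definition rank where "rank X z = fst (dec X z)"

definition J where "J X \<tau> z = Jr X (Suc (rank X z)) \<tau> z"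

lemma Jr_J: "rank X z < M \<Longrightarrow> Jr X M \<tau> z = J X \<tau> z"
proof (induction M)
  case (Suc M)
  show ?case
  proof (cases "rank X z = M")
    case False
    then have "Jr X (Suc M) \<tau> z = Jr X M \<tau> z" by (auto simp: rank_def split: prod.splits)
    then show ?thesis using Suc False by simp
  qed (simp add: J_def del: Jr.simps)
qed simp

lemma th_bounds: "0 \<le> th m \<tau>" "th m \<tau> \<le> 1" by (auto simp: th_def)

lemma th_1: "(1/2) ^ m \<le> \<tau> \<Longrightarrow> th m \<tau> = 1"
proof -
  assume "(1/2) ^ m \<le> \<tau>"
  then have "1 \<le> 2 ^ m * \<tau>" by (simp add: power_one_over divide_le_eq mult.commute)
  then show ?thesis by (simp add: th_def)
qed

lemma th_0: "\<tau> \<le> (1/2) ^ Suc m \<Longrightarrow> th m \<tau> = 0"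
proof -
  assume "\<tau> \<le> (1/2) ^ Suc m"
  then have "2 ^ Suc m * \<tau> \<le> 1" by (simp add: power_one_over le_divide_eq mult.commute)
  then show ?thesis by (simp add: th_def)
qed

lemma cap_bounds:
  assumes "\<nu> \<le> 1/2" shows "(1/2) ^ m \<le> cap m \<nu>" "cap m \<nu> \<le> 1"
proof -
  have p: "(1/2::real) ^ m \<le> 1" by (simp add: power_le_one)
  show "(1/2) ^ m \<le> cap m \<nu>" using p assms by (simp add: cap_def)
  have "(1 - (1/2) ^ m) * min 1 (2 - 4 * \<nu>) \<le> (1 - (1/2) ^ m) * 1"
    by (rule mult_left_mono) (use p in auto)
  then show "cap m \<nu> \<le> 1" by (simp add: cap_def)
qed

text \<open>A vertex without mass leaves at most k vertices in the support, and the dimension of the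
  canonical form is below their number.\<close>

lemma rank_less:
  assumes x: "x \<in> simplices (Sing X) k" and L: "weighted L" "sorted (map fst L)" "fst ` set L \<subseteq> {..k}"
    and i: "i \<le> k" "mass L i = 0"
  obtains m f B where "canonical X m f B" "lpt x (nz L) = lpt f (blocks m B)" "m < k"
proof -
  have m: "\<And>i. 0 \<le> mass L i" "\<And>i. i > k \<Longrightarrow> mass L i = 0" "\<exists>i. mass L i \<noteq> 0"
  proof -
    have p: "push (map fst L) (wt L) \<in> standard_simplex k"
      by (rule push_in) (use wt_in[OF L(1)] weighted_nonempty[OF L(1)] L(3) in auto)
    then show "\<And>i. 0 \<le> mass L i" "\<And>i. i > k \<Longrightarrow> mass L i = 0" "\<exists>i. mass L i \<noteq> 0"
      unfolding mass_push by (auto simp: standard_simplex_def) (metis sum.neutral zero_neq_one)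
  qed
  obtain r f h where R: "reduces X k x (mass L) r f h" "r < card {a. a \<le> k \<and> mass L a \<noteq> 0}"
    by (rule canonical_reduction[OF x m]) (erule that | assumption)+
  have "weighted (nz L)" "nz (nz L) = nz L" "sorted (map fst (nz L))" "fst ` set (nz L) \<subseteq> {..k}" "mass (nz L) = mass L"
    using L nz_sorted[OF L(2)] nz_sub[OF L(3)] by auto
  from R(1)[unfolded reduces_def, rule_format, OF this]
  obtain B where B: "canonical X r f B" "lpt x (nz L) = lpt f (blocks r B)" by (elim exE conjE)
  have "card {a. a \<le> k \<and> mass L a \<noteq> 0} \<le> card ({..k} - {i})"
    by (rule card_mono) (use i in auto)
  then have "r < k" using R(2) i(1) by simp
  then show thesis using that B by blast
qed

text \<open>After a complete step with \<nu> < 1/2 a block has sum 0. The new point then has smaller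
  rank, so the recursive call is again \<open>J\<close>.\<close>

lemma J_canonical:
  assumes c: "canonical X m f B"
  shows "J X \<tau> (lpt f (blocks m B)) =
    (let z' = nf (lpt f (blocks m (stp m (th m \<tau>) B))); \<nu> = nu m (\<lambda>i. sum_list (B i)) in
     if \<tau> \<le> (1/2) ^ m \<or> 1/2 \<le> \<nu> then z' else J X (min \<tau> (cap m \<nu>)) z')"
proof -
  have r: "rank X (lpt f (blocks m B)) = m" by (simp add: rank_def dec[OF c])
  let ?z = "nf (lpt f (blocks m (stp m (th m \<tau>) B)))" and ?\<nu> = "nu m (\<lambda>i. sum_list (B i))"
  have B: "wblocks m B" by (rule wblocks_canonical[OF c])
  have "Jr X m (min \<tau> (cap m ?\<nu>)) ?z = J X (min \<tau> (cap m ?\<nu>)) ?z" if "\<not> \<tau> \<le> (1/2) ^ m" "\<not> 1/2 \<le> ?\<nu>"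
  proof -
    have t1: "th m \<tau> = 1" using that th_1[of m \<tau>] by simp
    note S = stp_blocks[OF B th_bounds[of m \<tau>]]
    obtain i where i: "i \<le> m" "sum_list (B i) = mn m (\<lambda>i. sum_list (B i))"
      using mn_attained[of m "\<lambda>i. sum_list (B i)"] by blast
    have "\<forall>w\<in>set (stp m 1 B i). w = 0"
      by (rule stp_zero_block) (use prob_on_blocks[OF B] that(2) i B in \<open>auto simp: wblocks_def\<close>)
    then have "sum_list (stp m 1 B i) = 0" by (metis sum_list_0 map_idI)
    then have m0: "mass (blocks m (stp m (th m \<tau>) B)) i = 0" using i(1) t1 by (simp add: mass_blocks)
    have "fst ` set (blocks m (stp m (th m \<tau>) B)) \<subseteq> {..m}" by (auto simp: set_blocks)
    from rank_less[OF canonicalD(1)[OF c] S(2) sorted_blocks this i(1) m0]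
    obtain m' f' B' where "canonical X m' f' B'" "lpt f (nz (blocks m (stp m (th m \<tau>) B))) = lpt f' (blocks m' B')" "m' < m" .
    then have "rank X ?z < m" using nf_lpt[OF S(2), of f] by (simp add: rank_def dec)
    then show ?thesis by (rule Jr_J)
  qed
  then show ?thesis unfolding J_def r Jr.simps dec[OF c] Let_def split by simp
qed

lemma J_small:
  assumes c: "canonical X m f B" and t: "\<tau> \<le> (1/2) ^ Suc m"
  shows "J X \<tau> (lpt f (blocks m B)) = lpt f (blocks m B)"
proof -
  have B: "wblocks m B" by (rule wblocks_canonical[OF c])
  have "(1/2::real) ^ Suc m \<le> (1/2) ^ m" by (simp add: power_le_one)
  then have "\<tau> \<le> (1/2) ^ m" using t by linarith
  then have "J X \<tau> (lpt f (blocks m B)) = nf (lpt f (blocks m (stp m 0 B)))"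
    unfolding J_canonical[OF c] Let_def th_0[OF t] by simp
  also have "\<dots> = lpt f (nz (blocks m (stp m 0 B)))"
    by (rule nf_lpt) (rule stp_blocks(2)[OF B], auto)
  also have "\<dots> = lpt f (blocks m B)" using nz_stp_id[of 0 m B] canonicalD(3)[OF c] by simp
  finally show ?thesis .
qed

text \<open>The recursion persists when block sums vanish and the point lies on a face. There \<nu>
  = 0, the step is trivial and \<open>cap\<close> is 1, so the second branch is the deformation of
  the face; in the first branch with \<tau> \<le> 2^-m the face is at rest.\<close>

lemma J_blocks:
  assumes f: "nondeg X m f" and B: "wblocks m B" and \<tau>: "0 \<le> \<tau>" "\<tau> \<le> 1"
  shows "J X \<tau> (nf (lpt f (blocks m B))) =
    (let z' = nf (lpt f (blocks m (stp m (th m \<tau>) B))); \<nu> = nu m (\<lambda>i. sum_list (B i)) in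
     if \<tau> \<le> (1/2) ^ m \<or> 1/2 \<le> \<nu> then z' else J X (min \<tau> (cap m \<nu>)) z')"
proof (cases "\<forall>i\<le>m. sum_list (B i) \<noteq> 0")
  case True
  define C where "C = (\<lambda>i. if i \<le> m then filter (\<lambda>w. w \<noteq> 0) (B i) else [])"
  have sl: "sum_list (filter (\<lambda>w. w \<noteq> 0) L) = sum_list L" for L :: "real list" by (induction L) auto
  have sC: "sum_list (C i) = sum_list (B i)" if "i \<le> m" for i using that sl by (simp add: C_def)
  have "C i \<noteq> []" if "i \<le> m" for i using True sC[OF that] that by (metis sum_list.Nil)
  moreover have "0 < w" if "i \<le> m" "w \<in> set (C i)" for i w using that B by (force simp: C_def wblocks_def order.order_iff_strict)
  ultimately have c: "canonical X m f C" using f B sC by (auto simp: canonical_def C_def wblocks_def)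
  have bC: "blocks m C = nz (blocks m B)" unfolding nz_blocks by (rule blocks_cong) (simp add: C_def)
  have 1: "nf (lpt f (blocks m B)) = lpt f (blocks m C)"
    unfolding bC by (rule nf_lpt[OF wblocks_weighted[OF B]])
  have BC: "wblocks m C" by (rule wblocks_canonical[OF c])
  have 2: "nf (lpt f (blocks m (stp m (th m \<tau>) C))) = nf (lpt f (blocks m (stp m (th m \<tau>) B)))"
  proof -
    have "nz (blocks m (stp m (th m \<tau>) C)) = nz (blocks m (stp m (th m \<tau>) B))"
      by (rule nz_stp_cong) (simp add: C_def)
    then show ?thesis
      using nf_lpt[OF stp_blocks(2)[OF BC th_bounds]] nf_lpt[OF stp_blocks(2)[OF B th_bounds]] by metis
  qed
  have 3: "nu m (\<lambda>i. sum_list (C i)) = nu m (\<lambda>i. sum_list (B i))" by (rule nu_cong) (rule sC)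
  show ?thesis unfolding 1 J_canonical[OF c] 2 3 ..
next
  case False
  then obtain i where i: "i \<le> m" "sum_list (B i) = 0" by blast
  have p: "prob_on m (\<lambda>i. sum_list (B i))" by (rule prob_on_blocks[OF B])
  have mn0: "mn m (\<lambda>i. sum_list (B i)) = 0" using mn_le[OF i(1), of "\<lambda>i. sum_list (B i)"] mn_nonneg[OF p] i(2) by simp
  have nu0: "nu m (\<lambda>i. sum_list (B i)) = 0" by (simp add: nu_def mn0)
  have w: "weighted (blocks m B)" by (rule wblocks_weighted[OF B])
  have z: "nf (lpt f (blocks m (stp m (th m \<tau>) B))) = nf (lpt f (blocks m B))"
    using nf_lpt[OF stp_blocks(2)[OF B th_bounds], of f m \<tau>] nf_lpt[OF w, of f] nz_stp_id[of "th m \<tau>" m B] mn0 by simp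
  have fs: "f \<in> simplices (Sing X) m" using f by (simp add: nondeg_def)
  have "fst ` set (blocks m B) \<subseteq> {..m}" "mass (blocks m B) i = 0" using i by (auto simp: set_blocks mass_blocks)
  from rank_less[OF fs w sorted_blocks this(1) i(1) this(2)]
  obtain m' f' B' where c: "canonical X m' f' B'" "lpt f (nz (blocks m B)) = lpt f' (blocks m' B')" "m' < m" .
  have zc: "nf (lpt f (blocks m B)) = lpt f' (blocks m' B')" using nf_lpt[OF w, of f] c(2) by simp
  show ?thesis
  proof (cases "\<tau> \<le> (1/2) ^ m")
    case True
    have "(1/2::real) ^ m \<le> (1/2) ^ Suc m'" by (rule power_decreasing) (use c(3) in auto)
    then have "J X \<tau> (nf (lpt f (blocks m B))) = nf (lpt f (blocks m B))"
      unfolding zc using True by (intro J_small[OF c(1)]) linarith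
    then show ?thesis using True z by simp
  next
    case False
    have "min \<tau> (cap m 0) = \<tau>" using \<tau> by (simp add: cap_def)
    then show ?thesis using False z nu0 by simp
  qed
qed

text \<open>Masses after a step depend only on the block sums, so the images in the realization
  agree by induction over m. At time 1 the points themselves agree: for \<nu> > 1/4 the blocks are
  collapsed, and otherwise \<open>cap\<close> is 1 and the induction hypothesis applies at full
  time.\<close>

lemma J_collapse:
  assumes "canonical X m f B" "canonical X m f C" "\<And>i. i \<le> m \<Longrightarrow> sum_list (B i) = sum_list (C i)" "0 \<le> \<tau>" "\<tau> \<le> 1"
  shows "rc X (J X \<tau> (lpt f (blocks m B))) = rc X (J X \<tau> (lpt f (blocks m C)))"
    and "\<tau> = 1 \<Longrightarrow> J X \<tau> (lpt f (blocks m B)) = J X \<tau> (lpt f (blocks m C))"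
proof -
  have "rc X (J X \<tau> (lpt f (blocks m B))) = rc X (J X \<tau> (lpt f (blocks m C))) \<and>
     (\<tau> = 1 \<longrightarrow> J X \<tau> (lpt f (blocks m B)) = J X \<tau> (lpt f (blocks m C)))"
    using assms
  proof (induction m arbitrary: f B C \<tau> rule: less_induct)
    case (less m)
    note c = less.prems(1) and d = less.prems(2) and s = less.prems(3)
    have B: "wblocks m B" by (rule wblocks_canonical[OF c])
    have C: "wblocks m C" by (rule wblocks_canonical[OF d])
    let ?\<theta> = "th m \<tau>" and ?\<nu> = "nu m (\<lambda>i. sum_list (B i))"
    let ?z = "nf (lpt f (blocks m (stp m ?\<theta> B)))" and ?y = "nf (lpt f (blocks m (stp m ?\<theta> C)))"
    have \<nu>: "nu m (\<lambda>i. sum_list (C i)) = ?\<nu>" by (rule nu_cong) (simp add: s)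
    note SB = stp_blocks[OF B th_bounds[of m \<tau>]] and SC = stp_blocks[OF C th_bounds[of m \<tau>]]
    have zn: "?z = lpt f (nz (blocks m (stp m ?\<theta> B)))" "?y = lpt f (nz (blocks m (stp m ?\<theta> C)))"
      using nf_lpt[OF SB(2)] nf_lpt[OF SC(2)] by blast+
    have mass: "mass (blocks m (stp m ?\<theta> B)) = mass (blocks m (stp m ?\<theta> C))"
      unfolding mass_blocks stp_sum using s kf_cong[of m "\<lambda>i. sum_list (B i)" "\<lambda>i. sum_list (C i)"] by (auto simp: fun_eq_iff)
    have fs: "f \<in> simplices (Sing X) m" by (rule canonicalD(1)[OF c])
    have q: "rc X (lpt f (nz L)) = rc X ((m, f), mass L)" if "weighted L" "sorted (map fst L)" "fst ` set L \<subseteq> {..m}" for L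
      using rc_lpt_sorted[OF fs, of "nz L"] that nz_sorted[OF that(2)] nz_sub[OF that(3)] by simp
    have sub: "fst ` set (blocks m D) \<subseteq> {..m}" for D :: "nat \<Rightarrow> real list" by (auto simp: set_blocks)
    have rcz: "rc X ?z = rc X ?y" unfolding zn using q[OF SB(2) sorted_blocks sub] q[OF SC(2) sorted_blocks sub] mass by simp
    have eq1: "?z = ?y" if "?\<theta> = 1" "gam ?\<nu> = 1"
      unfolding zn unfolding that(1) using stp_collapse[of m B C] that(2) s by simp
    show ?case
    proof (cases "\<tau> \<le> (1/2) ^ m \<or> 1/2 \<le> ?\<nu>")
      case True
      have "?z = ?y" if "\<tau> = 1"
      proof (rule eq1)
        show "?\<theta> = 1" by (rule th_1) (simp add: that power_le_one)
        have "1/2 \<le> ?\<nu>"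
        proof (rule ccontr)
          assume "\<not> 1/2 \<le> ?\<nu>"
          then have le: "1 \<le> (1/2::real) ^ m" using True that by simp
          have "m = 0"
          proof (rule ccontr)
            assume "m \<noteq> 0"
            then have "(1/2::real) ^ m \<le> (1/2) ^ 1" by (intro power_decreasing) auto
            then show False using le by simp
          qed
          then have "?\<nu> = 1" using B by (simp add: nu_def mn_def wblocks_def)
          then show False using \<open>\<not> 1/2 \<le> ?\<nu>\<close> by simp
        qed
        then show "gam ?\<nu> = 1" by (simp add: gam_def)
      qed
      then show ?thesis using True rcz unfolding J_canonical[OF c] J_canonical[OF d] Let_def \<nu> by simp
    next
      case False
      then have t1: "?\<theta> = 1" by (intro th_1) simp
      let ?\<sigma> = "min \<tau> (cap m ?\<nu>)"
      have J1: "J X \<tau> (lpt f (blocks m B)) = J X ?\<sigma> ?z" "J X \<tau> (lpt f (blocks m C)) = J X ?\<sigma> ?y"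
        using False unfolding J_canonical[OF c] J_canonical[OF d] Let_def \<nu> by simp_all
      obtain i where i: "i \<le> m" "sum_list (B i) = mn m (\<lambda>i. sum_list (B i))"
        using mn_attained[of m "\<lambda>i. sum_list (B i)"] by blast
      have "\<forall>w\<in>set (stp m 1 B i). w = 0"
        by (rule stp_zero_block) (use prob_on_blocks[OF B] False i B in \<open>auto simp: wblocks_def\<close>)
      then have "sum_list (stp m 1 B i) = 0" by (metis sum_list_0 map_idI)
      then have mB: "mass (blocks m (stp m ?\<theta> B)) i = 0" using i(1) t1 by (simp add: mass_blocks)
      then have mC: "mass (blocks m (stp m ?\<theta> C)) i = 0" using mass by simp
      obtain m1 f1 B1 where c1: "canonical X m1 f1 B1" "lpt f (nz (blocks m (stp m ?\<theta> B))) = lpt f1 (blocks m1 B1)" "m1 < m"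
        by (rule rank_less[OF fs SB(2) sorted_blocks sub i(1) mB])
      obtain m2 f2 C1 where d1: "canonical X m2 f2 C1" "lpt f (nz (blocks m (stp m ?\<theta> C))) = lpt f2 (blocks m2 C1)" "m2 < m"
        by (rule rank_less[OF fs SC(2) sorted_blocks sub i(1) mC])
      have z1: "?z = lpt f1 (blocks m1 B1)" "?y = lpt f2 (blocks m2 C1)" using zn c1(2) d1(2) by auto
      note u = rc_canonical_unique[OF c1(1) d1(1) rcz[unfolded z1]]
      have d1': "canonical X m1 f1 C1" using d1(1) u by simp
      have z2: "?y = lpt f1 (blocks m1 C1)" using z1(2) u by simp
      have \<sigma>: "0 \<le> ?\<sigma>" "?\<sigma> \<le> 1" using less.prems(4,5) cap_bounds(1)[of ?\<nu> m] False zero_le_power[of "1/2::real" m] by linarith+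
      note IH = less.IH[OF c1(3) c1(1) d1' u(3) \<sigma>]
      have "J X ?\<sigma> ?z = J X ?\<sigma> ?y" if "\<tau> = 1"
      proof (cases "?\<nu> \<le> 1/4")
        case True
        then have "?\<sigma> = 1" using that by (simp add: cap_def)
        then show ?thesis using IH unfolding z1(1) z2 by simp
      next
        case False
        then have "gam ?\<nu> = 1" by (simp add: gam_def)
        then show ?thesis using eq1[OF t1] by simp
      qed
      then show ?thesis using IH unfolding J1 z1(1) z2 by simp
    qed
  qed
  then show "rc X (J X \<tau> (lpt f (blocks m B))) = rc X (J X \<tau> (lpt f (blocks m C)))"
    and "\<tau> = 1 \<Longrightarrow> J X \<tau> (lpt f (blocks m B)) = J X \<tau> (lpt f (blocks m C))" by auto
qed

section \<open>Continuity of the deformation\<close>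

text \<open>Only zeros of \<open>s\<close> are critical. The product is bounded by \<open>u\<close>,
  which tends to 0 there, and the value at such a point is 0 by the convention on division.\<close>

lemma continuous_map_ratio:
  assumes a: "continuous_map T euclideanreal a" and s: "continuous_map T euclideanreal s" and u: "continuous_map T euclideanreal u"
    and b: "\<And>p. p \<in> topspace T \<Longrightarrow> 0 \<le> a p \<and> a p \<le> s p \<and> 0 \<le> u p \<and> u p \<le> s p"
  shows "continuous_map T euclideanreal (\<lambda>p. a p * (u p / s p))"
  unfolding continuous_map_atin limitin_canonical_iff
proof
  fix x assume x: "x \<in> topspace T"
  have l: "(a \<longlongrightarrow> a x) (atin T x)" "(s \<longlongrightarrow> s x) (atin T x)" "(u \<longlongrightarrow> u x) (atin T x)"
    using a s u x by (auto simp: continuous_map_atin)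
  show "((\<lambda>p. a p * (u p / s p)) \<longlongrightarrow> a x * (u x / s x)) (atin T x)"
  proof (cases "s x = 0")
    case False
    then show ?thesis by (intro tendsto_intros l)
  next
    case True
    then have u0: "u x = 0" using b[OF x] by simp
    have "eventually (\<lambda>p. p \<in> topspace T) (atin T x)"
      unfolding eventually_atin using x by (intro disjI2 exI[of _ "topspace T"]) auto
    then have "eventually (\<lambda>p. norm (a p * (u p / s p)) \<le> u p) (atin T x)"
    proof (rule eventually_mono)
      fix p assume "p \<in> topspace T"
      note c = b[OF this]
      show "norm (a p * (u p / s p)) \<le> u p"
      proof (cases "s p = 0")
        case False
        then have "a p / s p \<le> 1" using c by simp
        then have "(a p / s p) * u p \<le> 1 * u p" by (rule mult_right_mono) (use c in simp)
        then show ?thesis using c by (simp add: abs_mult)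
      qed (use c in simp)
    qed
    then have "((\<lambda>p. a p * (u p / s p)) \<longlongrightarrow> 0) (atin T x)"
      by (rule Lim_null_comparison) (use l(3) u0 in simp)
    then show ?thesis using u0 by simp
  qed
qed

lemma continuous_mn:
  assumes "\<And>i. i \<le> m \<Longrightarrow> continuous_map T euclideanreal (s i)"
  shows "continuous_map T euclideanreal (\<lambda>p. mn m (\<lambda>i. s i p))"
  using assms
proof (induction m)
  case 0 then show ?case by (simp add: mn_def)
next
  case (Suc m)
  have "mn (Suc m) s = min (s (Suc m)) (mn m s)" for s
    by (simp add: mn_def atMost_Suc)
  then show ?case using Suc by (auto intro!: continuous_map_real_min)
qed

lemma closedin_le:
  assumes "continuous_map T euclideanreal a" "continuous_map T euclideanreal b"
  shows "closedin T {p \<in> topspace T. a p \<le> b p}"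
proof -
  have "closedin T {p \<in> topspace T. a p - b p \<in> {..0}}"
    by (rule closedin_continuous_map_preimage[of T euclideanreal]) (use assms in \<open>auto intro: continuous_map_diff\<close>)
  then show ?thesis by simp
qed

definition fib :: "nat \<Rightarrow> nat list \<Rightarrow> nat \<Rightarrow> nat list" where
  "fib k is i = filter (\<lambda>j. is ! j = i) [0..<Suc k]"

lemma coords_blocks:
  assumes "length is = Suc k" "sorted is" "set is \<subseteq> {..m}"
  shows "map (apfst ((!) is)) (coords k t) = blocks m (\<lambda>i. map t (fib k is i))"
proof -
  let ?L = "map (apfst ((!) is)) (coords k t)"
  have fst: "map fst ?L = is" using assms(1) by (auto simp: coords_def intro!: nth_equalityI simp del: upt_Suc)
  have "?L = blocks m (\<lambda>i. map snd (filter (\<lambda>p. fst p = i) ?L))"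
    by (rule sorted_eq_blocks) (use fst assms in \<open>auto simp: image_comp simp flip: set_map\<close>)
  also have "\<dots> = blocks m (\<lambda>i. map t (fib k is i))"
    by (rule blocks_cong) (simp add: coords_def filter_map o_def fib_def del: upt_Suc)
  finally show ?thesis .
qed

lemma sum_fib:
  assumes "length is = Suc k" shows "sum_list (map t (fib k is i)) = push is t i"
proof -
  have "set (fib k is i) = {j. j < length is \<and> is ! j = i}" "distinct (fib k is i)"
    using assms by (auto simp: fib_def simp del: upt_Suc)
  then show ?thesis by (simp add: push_def sum_list_distinct_conv_sum_set)
qed

lemma nf_blocks:
  assumes "length is = Suc k" "sorted is" "set is = {..m}" "t \<in> standard_simplex k"
  shows "nf ((k, lsimp f is), t) = nf (lpt f (blocks m (\<lambda>i. map t (fib k is i))))" "wblocks m (\<lambda>i. map t (fib k is i))"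
    "weighted (blocks m (\<lambda>i. map t (fib k is i)))"
proof -
  have ne: "is \<noteq> []" using assms(1) by auto
  have "push is t \<in> standard_simplex m" using push_in[of t "is" m] assms ne by simp
  then show w: "wblocks m (\<lambda>i. map t (fib k is i))"
    using assms(4) by (auto simp: wblocks_def sum_fib[OF assms(1)] standard_simplex_def)
  then show w2: "weighted (blocks m (\<lambda>i. map t (fib k is i)))" by (rule wblocks_weighted)
  have "nf ((k, lsimp f is), t) = lpt (lsimp f is) (nz (coords k t))" by (simp add: nf_def)
  also have "\<dots> = lpt f (map (apfst ((!) is)) (nz (coords k t)))"
    by (rule lpt_lsimp) (use weighted_nonempty coords_weighted[OF assms(4)] assms(1) in \<open>auto simp: less_Suc_eq_le dest: nz_coordsD weighted_nonempty[of "nz (coords k t)", simplified]\<close>)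
  also have "\<dots> = lpt f (nz (blocks m (\<lambda>i. map t (fib k is i))))"
    using coords_blocks[of "is" k m t] assms by (simp flip: nz_map_apfst)
  also have "\<dots> = nf (lpt f (blocks m (\<lambda>i. map t (fib k is i))))" by (rule nf_lpt[OF w2, symmetric])
  finally show "nf ((k, lsimp f is), t) = nf (lpt f (blocks m (\<lambda>i. map t (fib k is i))))" .
qed

text \<open>Names for the entries of a block after a step: \<open>Some j\<close> for the old entry
  at position j, \<open>None\<close> for the new one. They do not involve the weights, so the labels
  stay fixed as \<open>continuous_lists\<close> requires.\<close>

definition codes :: "nat \<Rightarrow> nat list \<Rightarrow> nat \<Rightarrow> nat option list" where
  "codes k is i = map Some (fib k is i) @ [None]"

definition cw :: "nat \<Rightarrow> nat list \<Rightarrow> real \<Rightarrow> (nat \<Rightarrow> real) \<Rightarrow> nat \<times> nat option \<Rightarrow> real" where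
  "cw m is \<theta> t a = (let s = push is t; g = \<theta> * gam (nu m s) in
     case snd a of Some j \<Rightarrow> (1 - g) * (t j * kf m s \<theta> (fst a)) | None \<Rightarrow> g * (s (fst a) * kf m s \<theta> (fst a)))"

lemma stp_codes:
  assumes "length is = Suc k"
  shows "blocks m (stp m \<theta> (\<lambda>i. map t (fib k is i))) = map (\<lambda>a. (fst a, cw m is \<theta> t a)) (blocks m (codes k is))"
proof -
  have 1: "stp m \<theta> (\<lambda>i. map t (fib k is i)) i = map (\<lambda>c. cw m is \<theta> t (i, c)) (codes k is i)" for i
    unfolding stp_def Let_def sum_fib[OF assms] codes_def cw_def by (simp add: o_def)
  have 2: "blocks m (\<lambda>i. map (V i) (c i)) = map (\<lambda>a. (fst a, V (fst a) (snd a))) (blocks m c)" for V :: "nat \<Rightarrow> nat option \<Rightarrow> real" and c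
    by (simp add: blocks_def map_concat o_def)
  have "blocks m (stp m \<theta> (\<lambda>i. map t (fib k is i))) = blocks m (\<lambda>i. map (\<lambda>c. cw m is \<theta> t (i, c)) (codes k is i))"
    by (rule blocks_cong) (rule 1)
  also have "\<dots> = map (\<lambda>a. (fst a, cw m is \<theta> t (fst a, snd a))) (blocks m (codes k is))" by (rule 2)
  finally show ?thesis by simp
qed

text \<open>The factor \<open>kf\<close> is singular where a block sum vanishes. In every weight it
  is multiplied by a quantity bounded by that block sum, which puts it under
  \<open>continuous_map_ratio\<close>.\<close>

lemma continuous_cw:
  assumes \<theta>: "continuous_map T euclideanreal \<theta>" and t: "continuous_map T (simplex_space k) t"
    and \<theta>b: "\<And>p. p \<in> topspace T \<Longrightarrow> 0 \<le> \<theta> p \<and> \<theta> p \<le> 1"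
    and "is": "length is = Suc k" "sorted is" "set is = {..m}"
  shows "continuous_map T euclideanreal (\<lambda>p. nu m (push is (t p)))"
    and "\<And>i. continuous_map T euclideanreal (\<lambda>p. push is (t p) i)"
    and "continuous_map T euclideanreal (\<lambda>p. mn m (push is (t p)))"
    and "\<And>a. a \<in> set (blocks m (codes k is)) \<Longrightarrow> continuous_map T euclideanreal (\<lambda>p. cw m is (\<theta> p) (t p) a)"
proof -
  have tin: "t p \<in> standard_simplex k" if "p \<in> topspace T" for p
    using t that by (auto simp: continuous_map_def)
  have tj: "continuous_map T euclideanreal (\<lambda>p. t p j)" for j by (rule continuous_simplex_coord[OF t])
  show s: "continuous_map T euclideanreal (\<lambda>p. push is (t p) i)" for i
    unfolding push_def by (intro continuous_map_sum tj) auto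
  show mnc: "continuous_map T euclideanreal (\<lambda>p. mn m (push is (t p)))"
    using continuous_mn[of m T "\<lambda>i p. push is (t p) i"] s by simp
  show nuc: "continuous_map T euclideanreal (\<lambda>p. nu m (push is (t p)))"
    unfolding nu_def by (intro continuous_map_real_mult mnc continuous_map_const[THEN iffD2]) auto
  have lc: "continuous_map T euclideanreal (\<lambda>p. lam (nu m (push is (t p))))"
    unfolding lam_def by (intro continuous_intros nuc) auto
  have gc: "continuous_map T euclideanreal (\<lambda>p. gam (nu m (push is (t p))))"
    unfolding gam_def by (intro continuous_intros nuc) auto
  have pr: "prob_on m (push is (t p))" if "p \<in> topspace T" for p
    using prob_on_blocks[OF nf_blocks(2)[OF "is" tin[OF that]]] sum_fib[OF "is"(1)] by simp
  have k: "continuous_map T euclideanreal (\<lambda>p. w p * kf m (push is (t p)) (\<theta> p) i)"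
    if i: "i \<le> m" and w: "continuous_map T euclideanreal w" "\<And>p. p \<in> topspace T \<Longrightarrow> 0 \<le> w p \<and> w p \<le> push is (t p) i" for i w
  proof -
    have r: "continuous_map T euclideanreal (\<lambda>p. w p * (mn m (push is (t p)) / push is (t p) i))"
      by (rule continuous_map_ratio[OF w(1) s mnc]) (use w(2) mn_le[OF i] mn_nonneg[OF pr] in auto)
    have e: "w p * kf m (push is (t p)) (\<theta> p) i =
      (w p - \<theta> p * lam (nu m (push is (t p))) * (w p * (mn m (push is (t p)) / push is (t p) i))) /
      (1 - \<theta> p * lam (nu m (push is (t p))) * nu m (push is (t p)))" for p
      by (simp add: kf_def algebra_simps)
    have dn: "1 - \<theta> p * lam (nu m (push is (t p))) * nu m (push is (t p)) \<noteq> 0" if "p \<in> topspace T" for p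
      using kf_denom[OF pr[OF that], of "\<theta> p"] \<theta>b[OF that] by linarith
    have num: "continuous_map T euclideanreal (\<lambda>p. w p - \<theta> p * lam (nu m (push is (t p))) * (w p * (mn m (push is (t p)) / push is (t p) i)))"
      by (intro continuous_map_diff continuous_map_real_mult w(1) \<theta> lc r)
    have den: "continuous_map T euclideanreal (\<lambda>p. 1 - \<theta> p * lam (nu m (push is (t p))) * nu m (push is (t p)))"
      by (intro continuous_map_diff continuous_map_real_mult \<theta> lc nuc) simp
    show ?thesis unfolding e by (rule continuous_map_real_divide[OF num den dn])
  qed
  fix a assume a: "a \<in> set (blocks m (codes k is))"
  obtain i c where ic: "a = (i, c)" "i \<le> m" "c \<in> set (codes k is i)" using a by (auto simp: set_blocks)
  have s0: "0 \<le> push is (t p) i" if "p \<in> topspace T" for p using pr[OF that] ic(2) by (simp add: prob_on_def)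
  show "continuous_map T euclideanreal (\<lambda>p. cw m is (\<theta> p) (t p) a)"
  proof (cases c)
    case None
    have "continuous_map T euclideanreal (\<lambda>p. push is (t p) i * kf m (push is (t p)) (\<theta> p) i)"
      by (rule k[OF ic(2) s]) (use s0 in auto)
    then show ?thesis using None ic(1) \<theta> gc by (auto simp: cw_def Let_def intro!: continuous_map_real_mult)
  next
    case (Some j)
    then have j: "j < length is" "is ! j = i" using ic(3) "is"(1) by (auto simp: codes_def fib_def simp del: upt_Suc)
    have "continuous_map T euclideanreal (\<lambda>p. t p j * kf m (push is (t p)) (\<theta> p) i)"
    proof (rule k[OF ic(2) tj])
      fix p assume p: "p \<in> topspace T"
      have "t p j \<le> (\<Sum>l | l < length is \<and> is ! l = i. t p l)"
        by (rule member_le_sum) (use j tin[OF p] in \<open>auto simp: standard_simplex_def\<close>)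
      then show "0 \<le> t p j \<and> t p j \<le> push is (t p) i" using tin[OF p] by (simp add: push_def standard_simplex_def)
    qed
    then show ?thesis using Some ic(1) \<theta> gc by (auto simp: cw_def Let_def intro!: continuous_map_real_mult continuous_map_diff)
  qed
qed

lemma eilenberg_zilber_small:
  assumes y: "y \<in> simplices (Sing X) r" and "is": "length is = Suc k" "set is \<subseteq> {..r}" "sorted is" and i: "i \<le> r" "i \<notin> set is"
  obtains m f js where "nondeg X m f" "length js = Suc k" "sorted js" "set js = {..m}" "lsimp y is = lsimp f js" "m < r"
proof -
  have ne: "is \<noteq> []" using "is" by auto
  obtain y' ks where y': "y' \<in> simplices (Sing X) (card (set is) - 1)" "length ks = length is"
    "sorted ks" "set ks = {..card (set is) - 1}" "lsimp y is = lsimp y' ks"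
    by (rule factor_through_support[OF y ne "is"(2,3)]) (rule that; assumption)
  obtain m f js where f: "nondeg X m f" "length js = Suc (card (set is) - 1)" "sorted js" "set js = {..m}" "y' = lsimp f js"
    by (rule eilenberg_zilber_exists[OF y'(1)])
  have kle: "ks ! a < length js" if "a < length ks" for a using y'(4) f(2) nth_mem[OF that] by auto
  have e: "lsimp y is = lsimp f (map ((!) js) ks)"
    unfolding y'(5) f(5) by (rule lsimp_lsimp) (use y'(2,4) f(2) ne in auto)
  have srt: "sorted (map ((!) js) ks)"
    unfolding sorted_iff_nth_mono using kle
    by (auto intro!: sorted_nth_mono[OF f(3)] sorted_nth_mono[OF y'(3)])
  have st: "set (map ((!) js) ks) = {..m}"
    using nth_image[of "length js" js] y'(4) f(2,4) by (simp add: atLeast0LessThan lessThan_Suc_atMost)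
  have "m < r"
  proof -
    have "Suc m \<le> length js" using card_length[of js] f(4) by simp
    moreover have "card (set is) \<le> card ({..r} - {i})" by (rule card_mono) (use "is"(2) i in auto)
    moreover have "card (set is) \<noteq> 0" using ne by simp
    ultimately show ?thesis using f(2) i(1) by simp
  qed
  then show thesis using that[OF f(1) _ srt st e] y'(2) "is"(1) by simp
qed

text \<open>Induction over m, pasting finitely many closed sets: one on which a single step is the
  whole deformation, and for each i the set \<open>Q i\<close> on which block i is smallest. On
  \<open>Q i\<close> this block has weight zero after the step; deleting it leaves a list over a
  nondegenerate simplex of smaller dimension.\<close>

lemma continuous_J_simplex:
  assumes "nondeg X m f" "length is = Suc k" "sorted is" "set is = {..m}"
  shows "continuous_map (prod_topology unit_interval (simplex_space k)) (fat X) (\<lambda>p. J X (fst p) (nf ((k, lsimp f is), snd p)))"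
  using assms
proof (induction m arbitrary: f "is" k rule: less_induct)
  case (less m)
  note f = less.prems(1) and "is" = less.prems(2-4)
  let ?T = "prod_topology unit_interval (simplex_space k)"
  have fs: "f \<in> simplices (Sing X) m" using f by (simp add: nondeg_def)
  define A where "A = blocks m (codes k is)"
  define L where "L p = map (\<lambda>a. (fst a, cw m is (th m (fst p)) (snd p) a)) A" for p
  define z where "z p = nf (lpt f (L p))" for p
  define n where "n p = nu m (push is (snd p))" for p :: "real \<times> (nat \<Rightarrow> real)"
  have cf: "continuous_map ?T euclideanreal fst"
    using continuous_map_fst[of unit_interval] continuous_map_in_subtopology by blast
  have c\<theta>: "continuous_map ?T euclideanreal (\<lambda>p. th m (fst p))"
    unfolding th_def by (intro continuous_intros cf) auto
  have tb: "p \<in> topspace ?T \<Longrightarrow> 0 \<le> th m (fst p) \<and> th m (fst p) \<le> 1" for p using th_bounds by blast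
  note cc = continuous_cw[OF c\<theta> continuous_map_snd tb "is"]
  have Ane: "A \<noteq> []"
  proof -
    have "(0, None) \<in> set A" by (simp add: A_def set_blocks codes_def)
    then show ?thesis by auto
  qed
  have cwc: "continuous_map ?T euclideanreal (\<lambda>p. cw m is (th m (fst p)) (snd p) a)" if "a \<in> set A" for a
    using cc(4) that by (simp add: A_def)
  have nc: "continuous_map ?T euclideanreal n" unfolding n_def by (rule cc(1))
  note sc = cc(2) and mc = cc(3)
  have Lb: "L p = blocks m (stp m (th m (fst p)) (\<lambda>i. map (snd p) (fib k is i)))" for p
    unfolding L_def A_def by (rule stp_codes[OF "is"(1), symmetric])
  have wB: "wblocks m (\<lambda>i. map (snd p) (fib k is i))" if "p \<in> topspace ?T" for p
    by (rule nf_blocks(2)[OF "is"]) (use that in auto)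
  have wL: "weighted (L p)" if "p \<in> topspace ?T" for p
    unfolding Lb by (rule stp_blocks(2)[OF wB[OF that] th_bounds])
  have fstL: "map fst (L p) = map fst A" for p by (simp add: L_def)
  have subA: "set (map fst A) \<subseteq> {..m}" by (auto simp: A_def set_blocks)
  have sortA: "sorted (map fst A)" unfolding A_def by (rule sorted_blocks)
  have zc: "continuous_map ?T (fat X) z"
    unfolding z_def fat_def
  proof (rule continuous_lists[of f "map fst A"])
    show "lsimp f (map fst A) \<in> simplices (Sing X) (length (map fst A) - 1)"
      by (rule lsimp_Sing[OF fs]) (use Ane subA in auto)
    show "continuous_map ?T euclideanreal (\<lambda>p. snd (L p ! j))" if "j < length (map fst A)" for j
      using cwc[of "A ! j"] that by (simp add: L_def)
  qed (use wL fstL in auto)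
  have J: "J X (fst p) (nf ((k, lsimp f is), snd p)) =
     (if fst p \<le> (1/2) ^ m \<or> 1/2 \<le> n p then z p else J X (min (fst p) (cap m (n p))) (z p))" if "p \<in> topspace ?T" for p
    using J_blocks[OF f wB[OF that], of "fst p"] nf_blocks(1)[OF "is", of "snd p" f] that
    unfolding Let_def z_def Lb n_def sum_fib[OF "is"(1)] by auto
  \<comment> \<open>For these parameters the step is complete and block i is the smallest, so its
    entries vanish.\<close>
  have zero: "cw m is (th m (fst p)) (snd p) a = 0"
    if p: "p \<in> topspace ?T" "(1/2) ^ m \<le> fst p" "n p \<le> 1/2" "push is (snd p) i = mn m (push is (snd p))" and i: "i \<le> m" and a: "a \<in> set A" "fst a = i" for p i a
  proof -
    let ?B = "\<lambda>i. map (snd p) (fib k is i)"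
    have "\<forall>w\<in>set (stp m 1 ?B i). w = 0"
      by (rule stp_zero_block) (use prob_on_blocks[OF wB[OF p(1)]] wB[OF p(1)] p i in \<open>auto simp: wblocks_def n_def sum_fib[OF "is"(1)]\<close>)
    moreover have "(i, cw m is (th m (fst p)) (snd p) a) \<in> set (L p)" using a by (auto simp: L_def)
    ultimately show ?thesis unfolding Lb th_1[OF p(2)] set_blocks by auto
  qed
  define A' where "A' i = filter (\<lambda>a. fst a \<noteq> i) A" for i
  define L' where "L' i p = map (\<lambda>a. (fst a, cw m is (th m (fst p)) (snd p) a)) (A' i)" for i p
  define Q where "Q i = {p \<in> topspace ?T. (1/2) ^ m \<le> fst p \<and> n p \<le> 1/2 \<and> push is (snd p) i = mn m (push is (snd p))}" for i
  have nzL': "nz (L' i p) = nz (L p)" if "p \<in> Q i" "i \<le> m" for i p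
  proof -
    have gen: "nz (map (\<lambda>a. (fst a, V a)) (filter (\<lambda>a. fst a \<noteq> i) B)) = nz (map (\<lambda>a. (fst a, V a)) B)"
      if "\<forall>a\<in>set B. fst a = i \<longrightarrow> V a = 0" for B :: "(nat \<times> nat option) list" and V :: "nat \<times> nat option \<Rightarrow> real"
      using that by (induction B) (auto simp: nz_def)
    show ?thesis unfolding L'_def L_def A'_def
    proof (rule gen, intro ballI impI)
      fix a assume a: "a \<in> set A" "fst a = i"
      show "cw m is (th m (fst p)) (snd p) a = 0"
        by (rule zero[of p i]) (use that a in \<open>auto simp: Q_def\<close>)
    qed
  qed
  have wL': "weighted (L' i p)" if "p \<in> Q i" "i \<le> m" for i p
    using nzL'[OF that] wL[of p] that(1) weighted_nz by (metis (no_types, lifting) Q_def mem_Collect_eq)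
  have zL': "z p = nf ((length (A' i) - 1, lsimp f (map fst (A' i))), wt (L' i p))" if "p \<in> Q i" "i \<le> m" for i p
  proof -
    have "z p = lpt f (nz (L p))" unfolding z_def by (rule nf_lpt[OF wL]) (use that in \<open>simp add: Q_def\<close>)
    also have "\<dots> = nf (lpt f (L' i p))" using nf_lpt[OF wL'[OF that], of f] nzL'[OF that] by simp
    finally show ?thesis by (simp add: lpt_def L'_def o_def)
  qed
  have Qc: "closedin ?T (Q i)" if "i \<le> m" for i
  proof -
    have e: "Q i = {p \<in> topspace ?T. (1/2) ^ m \<le> fst p} \<inter> {p \<in> topspace ?T. n p \<le> 1/2} \<inter> {p \<in> topspace ?T. push is (snd p) i \<le> mn m (push is (snd p))}"
      using mn_le[OF that] by (auto simp: Q_def intro: antisym)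
    have 1: "closedin ?T {p \<in> topspace ?T. (1/2) ^ m \<le> fst p}" by (rule closedin_le[OF _ cf]) simp
    have 2: "closedin ?T {p \<in> topspace ?T. n p \<le> 1/2}" by (rule closedin_le[OF nc]) simp
    have 3: "closedin ?T {p \<in> topspace ?T. push is (snd p) i \<le> mn m (push is (snd p))}" by (rule closedin_le[OF sc mc])
    show ?thesis unfolding e by (intro closedin_Int 1 2 3)
  qed
  have Qcont: "continuous_map (subtopology ?T (Q i)) (fat X) (\<lambda>p. J X (min (fst p) (cap m (n p))) (z p))" if i: "i \<le> m" for i
  proof (cases "topspace (subtopology ?T (Q i)) = {}")
    case True then show ?thesis unfolding continuous_map_def True by simp
  next
    case False
    then obtain p0 where p0: "p0 \<in> Q i" by auto
    have ne: "A' i \<noteq> []" using weighted_nonempty[OF wL'[OF p0 i]] by (auto simp: L'_def)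
    have len: "length (map fst (A' i)) = Suc (length (A' i) - 1)" using ne by (cases "A' i") auto
    have sub': "set (map fst (A' i)) \<subseteq> {..m}" "i \<notin> set (map fst (A' i))" using subA by (auto simp: A'_def)
    have sort': "sorted (map fst (A' i))" unfolding A'_def using sortA by (rule sorted_filter)
    obtain m' f' js where f': "nondeg X m' f'" "length js = Suc (length (A' i) - 1)" "sorted js" "set js = {..m'}"
      "lsimp f (map fst (A' i)) = lsimp f' js" "m' < m"
      by (rule eilenberg_zilber_small[OF fs len sub'(1) sort' i sub'(2)])
    note IH = less.IH[OF f'(6,1-4)]
    define u where "u p = (min (fst p) (cap m (n p)), wt (L' i p))" for p
    have "continuous_map (subtopology ?T (Q i)) (prod_topology unit_interval (simplex_space (length (A' i) - 1))) u"
      unfolding u_def continuous_map_paired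
    proof
      have "continuous_map (subtopology ?T (Q i)) euclideanreal (\<lambda>p. min (fst p) (cap m (n p)))"
        unfolding cap_def
        by (rule continuous_map_from_subtopology)
          (intro continuous_map_real_min continuous_map_add continuous_map_real_mult continuous_map_diff cf nc, simp_all)
      moreover have "0 \<le> min (fst p) (cap m (n p))" if "p \<in> Q i" for p
      proof -
        have "(0::real) \<le> (1/2) ^ m" by simp
        moreover have "(1/2) ^ m \<le> fst p" "(1/2) ^ m \<le> cap m (n p)" using that cap_bounds(1) by (simp_all add: Q_def)
        ultimately show ?thesis by linarith
      qed
      ultimately show "continuous_map (subtopology ?T (Q i)) unit_interval (\<lambda>p. min (fst p) (cap m (n p)))"
        by (auto simp: continuous_map_in_subtopology Q_def)
      show "continuous_map (subtopology ?T (Q i)) (simplex_space (length (A' i) - 1)) (\<lambda>p. wt (L' i p))"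
      proof (rule continuous_map_simplexI)
        fix j assume "j \<le> length (A' i) - 1"
        then have j: "j < length (A' i)" using ne by (cases "A' i") auto
        then have "A' i ! j \<in> set A" using nth_mem[OF j] by (auto simp: A'_def)
        then have "continuous_map (subtopology ?T (Q i)) euclideanreal (\<lambda>p. cw m is (th m (fst p)) (snd p) (A' i ! j))"
          by (intro continuous_map_from_subtopology cwc)
        then show "continuous_map (subtopology ?T (Q i)) euclideanreal (\<lambda>p. wt (L' i p) j)"
          using j by (simp add: wt_def L'_def)
      next
        fix p assume "p \<in> topspace (subtopology ?T (Q i))"
        then have "p \<in> Q i" by simp
        then show "wt (L' i p) \<in> standard_simplex (length (A' i) - 1)"
          using wt_in[OF wL'[OF _ i]] by (simp add: L'_def)
      qed
    qed
    from continuous_map_compose[OF this IH]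
    show ?thesis
      by (rule continuous_map_eq) (use zL'[OF _ i] f'(5) in \<open>auto simp: u_def\<close>)
  qed
  \<comment> \<open>On the overlap with the first closed set the time for the face is at most 2^-m,
    and the face is still at rest.\<close>
  have J2: "J X (min (fst p) (cap m (n p))) (z p) = z p" if p: "p \<in> Q i" "i \<le> m" and e: "fst p \<le> (1/2) ^ m \<or> 1/2 \<le> n p" for p i
  proof -
    have pT: "p \<in> topspace ?T" using p(1) by (simp add: Q_def)
    have "mass (L p) i = 0"
    proof -
      have "(\<lambda>q. if fst q = i then snd q else 0) q = 0" if "q \<in> set (L p)" for q
        using that zero[of p i] p by (auto simp: L_def Q_def)
      then have "map (\<lambda>q. if fst q = i then snd q else 0) (L p) = map (\<lambda>q. 0) (L p)" by (intro map_cong) auto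
      then show ?thesis unfolding mass_def by (metis sum_list_0)
    qed
    moreover have "fst ` set (L p) \<subseteq> {..m}" using subA fstL[of p] by (metis set_map)
    moreover have "sorted (map fst (L p))" using sortA fstL[of p] by simp
    ultimately obtain m' f' B' where c: "canonical X m' f' B'" "lpt f (nz (L p)) = lpt f' (blocks m' B')" "m' < m"
      using rank_less[OF fs wL[OF pT] _ _ p(2)] by blast
    have zp: "z p = lpt f' (blocks m' B')" unfolding z_def using nf_lpt[OF wL[OF pT], of f] c(2) by simp
    have "min (fst p) (cap m (n p)) \<le> (1/2) ^ m"
    proof (cases "fst p \<le> (1/2) ^ m")
      case False
      then have "n p = 1/2" using e p(1) by (auto simp: Q_def)
      then have "cap m (n p) = (1/2) ^ m" by (simp only: cap_def) simp
      then show ?thesis by simp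
    qed simp
    moreover have "(1/2::real) ^ m \<le> (1/2) ^ Suc m'" by (rule power_decreasing) (use c(3) in auto)
    ultimately show ?thesis unfolding zp by (intro J_small[OF c(1)]) linarith
  qed
  define Tt where "Tt c = (case c of None \<Rightarrow> {p \<in> topspace ?T. fst p \<le> (1/2) ^ m} \<union> {p \<in> topspace ?T. 1/2 \<le> n p} | Some i \<Rightarrow> Q i)" for c :: "nat option"
  define F where "F c p = (case c of None \<Rightarrow> z p | Some (i::nat) \<Rightarrow> J X (min (fst p) (cap m (n p))) (z p))" for c p
  show ?case
  proof (rule pasting_lemma_closed[of "insert None (Some ` {..m})" ?T Tt _ F])
    show "finite (insert None (Some ` {..m}))" by simp
    show "closedin ?T (Tt c)" if "c \<in> insert None (Some ` {..m})" for c
    proof (cases c)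
      case None
      have 1: "closedin ?T {p \<in> topspace ?T. fst p \<le> (1/2) ^ m}" by (rule closedin_le[OF cf]) simp
      have 2: "closedin ?T {p \<in> topspace ?T. 1/2 \<le> n p}" by (rule closedin_le[OF _ nc]) simp
      show ?thesis unfolding None Tt_def option.case by (rule closedin_Un[OF 1 2])
    qed (use that Qc in \<open>auto simp: Tt_def\<close>)
    show "continuous_map (subtopology ?T (Tt c)) (fat X) (F c)" if "c \<in> insert None (Some ` {..m})" for c
      using that Qcont zc by (auto simp: Tt_def F_def[abs_def] intro: continuous_map_from_subtopology)
    show "F c p = F d p" if "c \<in> insert None (Some ` {..m})" "d \<in> insert None (Some ` {..m})" "p \<in> topspace ?T \<inter> Tt c \<inter> Tt d" for c d p
      using that J2[of p] by (cases c; cases d) (auto simp: Tt_def F_def)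
    show "\<exists>c. c \<in> insert None (Some ` {..m}) \<and> p \<in> Tt c \<and> J X (fst p) (nf ((k, lsimp f is), snd p)) = F c p" if p: "p \<in> topspace ?T" for p
    proof (cases "fst p \<le> (1/2) ^ m \<or> 1/2 \<le> n p")
      case True
      then show ?thesis using J[OF p] p by (intro exI[of _ None]) (auto simp: Tt_def F_def)
    next
      case False
      obtain i where "i \<le> m" "push is (snd p) i = mn m (push is (snd p))" using mn_attained by blast
      then show ?thesis using J[OF p] p False by (intro exI[of _ "Some i"]) (auto simp: Tt_def F_def Q_def)
    qed
  qed
qed

lemma J_rc_cong:
  assumes "z \<in> topspace (fat X)" "y \<in> topspace (fat X)" "rc X z = rc X y" "0 \<le> \<tau>" "\<tau> \<le> 1"
  shows "rc X (J X \<tau> z) = rc X (J X \<tau> y)" "J X 1 z = J X 1 y"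
proof -
  obtain m f B where c: "canonical X m f B" "z = lpt f (blocks m B)" by (rule fat_cases[OF assms(1)])
  obtain r g C where d: "canonical X r g C" "y = lpt g (blocks r C)" by (rule fat_cases[OF assms(2)])
  note u = rc_canonical_unique[OF c(1) d(1)] assms(3)[unfolded c d]
  have d': "canonical X m f C" "y = lpt f (blocks m C)" using d u by auto
  show "rc X (J X \<tau> z) = rc X (J X \<tau> y)" "J X 1 z = J X 1 y"
    unfolding c(2) d'(2) using J_collapse[OF c(1) d'(1)] u assms(4,5) by auto
qed

abbreviation e0 :: "nat \<Rightarrow> real" where "e0 \<equiv> \<lambda>j. if j = 0 then 1 else 0"

lemma J_vertex:
  assumes x: "x \<in> simplices (Sing X) 0" and \<tau>: "0 \<le> \<tau>" "\<tau> \<le> 1"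
  shows "rc X (J X \<tau> (nf ((0, x), e0))) = rc X ((0, x), e0)" "J X 1 (nf ((0, x), e0)) = nf ((0, x), e0)"
proof -
  define B :: "nat \<Rightarrow> real list" where "B = (\<lambda>i. if i = 0 then [1] else [])"
  have c: "canonical X 0 x B" using x by (auto simp: canonical_def nondeg_def B_def)
  have v: "nf ((0, x), e0) = lpt x (blocks 0 B)"
    by (simp add: nf_def coords_def nz_def blocks_def B_def)
  have B: "wblocks 0 B" by (rule wblocks_canonical[OF c])
  have J: "J X \<tau> (nf ((0, x), e0)) = lpt x (nz (blocks 0 (stp 0 (th 0 \<tau>) B)))" if "\<tau> \<le> 1" for \<tau>
    unfolding v J_canonical[OF c] Let_def using that nf_lpt[OF stp_blocks(2)[OF B th_bounds], of x 0 \<tau>] by simp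
  have w: "weighted (blocks 0 (stp 0 (th 0 \<tau>) B))" by (rule stp_blocks(2)[OF B th_bounds])
  have "rc X (lpt x (nz (blocks 0 (stp 0 (th 0 \<tau>) B)))) = rc X ((0, x), mass (blocks 0 (stp 0 (th 0 \<tau>) B)))"
  proof -
    have "fst ` set (blocks 0 (stp 0 (th 0 \<tau>) B)) \<subseteq> {..0}" by (auto simp: set_blocks)
    from rc_lpt_sorted[OF x _ nz_sub[OF this] nz_sorted[OF sorted_blocks]] show ?thesis using w by simp
  qed
  moreover have "mass (blocks 0 (stp 0 (th 0 \<tau>) B)) = e0"
    using stp_blocks(1)[OF B th_bounds, of 0 \<tau>] by (auto simp: mass_blocks wblocks_def)
  ultimately show "rc X (J X \<tau> (nf ((0, x), e0))) = rc X ((0, x), e0)" using J[OF \<tau>(2)] by simp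
  have "th 0 1 = 1" by (simp add: th_def)
  moreover have "nz (blocks 0 (stp 0 1 B)) = blocks 0 B"
    by (simp add: blocks_def stp_def B_def nz_def gam_def nu_def mn_def lam_def kf_def)
  ultimately show "J X 1 (nf ((0, x), e0)) = nf ((0, x), e0)" using J[of 1] v by simp
qed

text \<open>At time 1 the deformation depends only on the image in the realization and so descends
  to a map \<open>g\<close> into \<open>fat X\<close>. At other times only its projection descends,
  which gives \<open>\<Gamma>\<close>. The clauses on vertices take care of base points.\<close>

lemma fat_section:
  obtains g \<Gamma> where "continuous_map (realization (Sing X)) (fat X) g"
    "continuous_map (prod_topology unit_interval (realization (Sing X))) (realization (Sing X)) \<Gamma>"
    "\<And>p. p \<in> topspace (realization (Sing X)) \<Longrightarrow> \<Gamma> (0, p) = p \<and> \<Gamma> (1, p) = rc X (g p)"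
    "\<And>x \<tau>. x \<in> simplices (Sing X) 0 \<Longrightarrow> \<tau> \<in> {0..1} \<Longrightarrow> \<Gamma> (\<tau>, rc X ((0, x), e0)) = rc X ((0, x), e0)"
    "\<And>x. x \<in> simplices (Sing X) 0 \<Longrightarrow> g (rc X ((0, x), e0)) = nf ((0, x), e0)"
proof -
  have glue: "rc X (J X \<tau> (nf a)) = rc X (J X \<tau> (nf b)) \<and> J X 1 (nf a) = J X 1 (nf b)"
    if "\<sigma> \<in> order_maps n m" "x \<in> simplices (Sing X) m" "t \<in> standard_simplex n" "0 \<le> \<tau>" "\<tau> \<le> 1"
      "a = ((n, act (Sing X) n m \<sigma> x), t)" "b = ((m, x), delta_map n m \<sigma> t)" for n m \<sigma> x t a b \<tau>
  proof -
    have s: "act (Sing X) n m \<sigma> x \<in> simplices (Sing X) n"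
      using simplicial_set_Sing[of X] that(1,2) unfolding simplicial_set_def by blast
    have d: "delta_map n m \<sigma> t \<in> standard_simplex m" by (rule delta_map_in[OF that(1,3)])
    have "rc X (nf a) = rc X (nf b)"
      unfolding that(6,7) rc_nf[OF s that(3)] rc_nf[OF that(2) d] by (rule realization_class_act[OF that(1-3)])
    moreover have "nf a \<in> topspace (fat X)" "nf b \<in> topspace (fat X)"
      unfolding topspace_fat that(6,7) using s d that by (auto simp: topspace_prerealization)
    ultimately show ?thesis using J_rc_cong that(4,5) by blast
  qed
  define g where "g = lift_class (\<lambda>a. J X 1 (nf a))"
  have g: "g (rc X a) = J X 1 (nf a)" for a
    unfolding g_def by (rule lift_class) (use glue[where \<tau> = 1] in auto)
  define \<Gamma> where "\<Gamma> = (\<lambda>(\<tau>, C). lift_class (\<lambda>a. rc X (J X (min 1 (max 0 \<tau>)) (nf a))) C)"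
  have \<Gamma>: "\<Gamma> (\<tau>, rc X a) = rc X (J X \<tau> (nf a))" if "\<tau> \<in> {0..1}" for \<tau> a
  proof -
    have m: "min 1 (max 0 \<tau>) = \<tau>" using that by auto
    have "lift_class (\<lambda>a. rc X (J X \<tau> (nf a))) (rc X a) = rc X (J X \<tau> (nf a))"
      by (rule lift_class) (use glue[where \<tau> = \<tau>] that in auto)
    then show ?thesis by (simp add: \<Gamma>_def m)
  qed
  have J1: "continuous_map (prod_topology unit_interval (simplex_space k)) (fat X) (\<lambda>p. J X (fst p) (nf ((k, x), snd p)))"
    if x: "x \<in> simplices (Sing X) k" for k x
  proof -
    obtain m f "is" where f: "nondeg X m f" "length is = Suc k" "sorted is" "set is = {..m}" "x = lsimp f is"
      by (rule eilenberg_zilber_exists[OF x])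
    show ?thesis using continuous_J_simplex[OF f(1-4)] by (simp add: f(5))
  qed
  have 1: "continuous_map (realization (Sing X)) (fat X) g"
    unfolding realization_def
  proof (rule continuous_map_prerealization_quotient)
    fix k x assume x: "x \<in> simplices (Sing X) k"
    have "continuous_map (simplex_space k) (prod_topology unit_interval (simplex_space k)) (\<lambda>t. (1, t))"
      by (auto simp: continuous_map_paired)
    from continuous_map_compose[OF this J1[OF x]]
    show "continuous_map (simplex_space k) (fat X) (\<lambda>t. g (rc X ((k, x), t)))" by (simp add: g o_def)
  qed
  have 2: "continuous_map (prod_topology unit_interval (realization (Sing X))) (realization (Sing X)) (\<lambda>(\<tau>, C). \<Gamma> (\<tau>, C))"
    unfolding realization_def[of "Sing X"]
  proof (rule continuous_map_prod_prerealization_quotient[OF locally_compact_unit_interval])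
    fix k x assume x: "x \<in> simplices (Sing X) k"
    from continuous_map_compose[OF J1[OF x] continuous_rc_fat]
    show "continuous_map (prod_topology unit_interval (simplex_space k)) (quotient_topology (prerealization (Sing X)) (rc X)) (\<lambda>(\<tau>, t). \<Gamma> (\<tau>, rc X ((k, x), t)))"
      unfolding realization_def by (rule continuous_map_eq) (auto simp: \<Gamma>)
  qed
  have 3: "\<Gamma> (0, p) = p \<and> \<Gamma> (1, p) = rc X (g p)" if p: "p \<in> topspace (realization (Sing X))" for p
  proof -
    obtain k x t where p: "p = rc X ((k, x), t)" "x \<in> simplices (Sing X) k" "t \<in> standard_simplex k"
      by (rule realization_cases[OF p])
    have "nf ((k, x), t) \<in> topspace (fat X)" unfolding topspace_fat using p by (auto simp: topspace_prerealization)
    then obtain m f B where c: "canonical X m f B" "nf ((k, x), t) = lpt f (blocks m B)" by (rule fat_cases)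
    have "J X 0 (nf ((k, x), t)) = nf ((k, x), t)" unfolding c(2) by (rule J_small[OF c(1)]) simp
    then show ?thesis using \<Gamma>[of 0] \<Gamma>[of 1] g p rc_nf[OF p(2,3)] by simp
  qed
  show thesis
    by (rule that[OF 1 _ 3]) (use 2 J_vertex(1) J_vertex(2)[of _ X 0] in \<open>auto simp: \<Gamma> g\<close>)
qed

section \<open>Approximation of maps from cubes\<close>

definition ev :: "((nat \<Rightarrow> real) \<Rightarrow> 'x) prepoint set \<Rightarrow> 'x" where
  "ev = lift_class (\<lambda>((n, f), t). f t)"

lemma ev_rc: "ev (rc X ((n, f), t)) = f t"
proof -
  have "lift_class (\<lambda>((n, f), t). f t) (rc X ((n, f), t)) = (\<lambda>((n, f), t). f t) ((n, f), t)"
    by (rule lift_class) (auto simp: Sing_def)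
  then show ?thesis by (simp add: ev_def)
qed

lemma continuous_ev: "continuous_map (realization (Sing X)) X ev"
  unfolding realization_def
proof (rule continuous_map_prerealization_quotient)
  fix n s assume "s \<in> simplices (Sing X) n"
  then show "continuous_map (simplex_space n) X (\<lambda>t. ev (rc X ((n, s), t)))"
    by (simp add: ev_rc Sing_simplices)
qed

lemma ev_lpt: "weighted L \<Longrightarrow> ev (rc X (lpt \<Psi> L)) = \<Psi> (mass L)"
  using wt_in[of L] by (simp add: lpt_def ev_rc lsimp_def mass_push)

text \<open>How far \<open>w\<close> lies inside each of the consecutive intervals, starting at \<open>a\<close>, whose lengths are the weights.\<close>

fun rooms :: "real \<Rightarrow> real \<Rightarrow> ('i \<times> real) list \<Rightarrow> real list" where
  "rooms w a [] = []"
| "rooms w a (p # L) = max 0 (min (w - a) (a + snd p - w)) # rooms w (a + snd p) L"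

definition rl :: "real \<Rightarrow> real \<Rightarrow> ('i \<times> real) list \<Rightarrow> ('i \<times> real) list" where
  "rl w a L = zip (map fst L) (rooms w a L)"

text \<open>At most one summand is nonzero: this is the distance from the mark to the nearer end of
  the interval with the mark in its interior, and 0 if there is none.\<close>

definition rm :: "real \<Rightarrow> ('i \<times> real) list \<Rightarrow> real" where
  "rm w L = sum_list (rooms w 0 L)"

section \<open>Marks in the subdivided unit interval\<close>

lemma length_rooms [simp]: "length (rooms w a L) = length L"
  by (induction L arbitrary: a) auto

lemma rooms_nonneg: "r \<in> set (rooms w a L) \<Longrightarrow> 0 \<le> r"
  by (induction L arbitrary: a) auto

lemma rm_nonneg: "0 \<le> rm w L"
  unfolding rm_def by (rule sum_list_nonneg) (rule rooms_nonneg)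

lemma rooms_nth:
  "j < length L \<Longrightarrow> rooms w a L ! j =
    max 0 (min (w - (a + (\<Sum>i<j. snd (L ! i)))) (a + (\<Sum>i<j. snd (L ! i)) + snd (L ! j) - w))"
proof (induction L arbitrary: a j)
  case (Cons p L)
  show ?case
  proof (cases j)
    case (Suc j')
    have "(\<Sum>i<j. snd ((p # L) ! i)) = snd p + (\<Sum>i<j'. snd (L ! i))"
      unfolding Suc by (subst sum.lessThan_Suc_shift) simp
    then show ?thesis using Cons.IH[of j' "a + snd p"] Cons.prems Suc by (simp add: add.assoc del: sum.lessThan_Suc)
  qed simp
qed simp

text \<open>An interval of length zero has no room and its removal does not shift the others, so
  rooms make sense on \<open>fat X\<close>.\<close>

lemma rooms_nz: "nz (rl w a (nz L)) = nz (rl w a L)" "sum_list (rooms w a (nz L)) = sum_list (rooms w a L)"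
proof (induction L arbitrary: a)
  case (Cons p L)
  have "max 0 (min (w - a) (a - w)) = 0" by auto
  { case 1 then show ?case using Cons(1)[of "a + snd p"] \<open>max 0 _ = 0\<close>
      by (cases "snd p = 0") (auto simp: nz_def rl_def) }
  { case 2 then show ?case using Cons(2)[of "a + snd p"] \<open>max 0 _ = 0\<close>
      by (cases "snd p = 0") (auto simp: nz_def) }
qed (simp_all add: nz_def rl_def)

lemma rm_nz: "rm w (nz L) = rm w L"
  unfolding rm_def by (rule rooms_nz(2))

lemma rooms_apfst [simp]: "rooms w a (map (apfst h) L) = rooms w a L"
  by (induction L arbitrary: a) auto

lemma rooms_above:
  assumes "\<forall>p\<in>set L. 0 \<le> snd p" "w \<le> a" shows "nz (rl w a L) = []" "sum_list (rooms w a L) = 0"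
  using assms
proof (induction L arbitrary: a)
  case (Cons p L)
  { case 1 then show ?case using Cons(1)[of "a + snd p"] by (auto simp: nz_def rl_def) }
  { case 2 then show ?case using Cons(2)[of "a + snd p"] by auto }
qed (simp_all add: nz_def rl_def)

text \<open>At most one interval of the partition contains \<open>w\<close> in its interior.\<close>

lemma rooms_single:
  assumes "\<forall>p\<in>set L. 0 \<le> snd p" "sum_list (rooms w a L) \<noteq> 0"
  shows "\<exists>i\<in>fst ` set L. nz (rl w a L) = [(i, sum_list (rooms w a L))]"
  using assms
proof (induction L arbitrary: a)
  case (Cons p L)
  show ?case
  proof (cases "max 0 (min (w - a) (a + snd p - w)) = 0")
    case True
    then obtain i where "i \<in> fst ` set L" "nz (rl w (a + snd p) L) = [(i, sum_list (rooms w (a + snd p) L))]"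
      using Cons.IH[of "a + snd p"] Cons.prems by auto
    then show ?thesis using True by (intro bexI[of _ i]) (auto simp: nz_def rl_def)
  next
    case False
    then have "w \<le> a + snd p" by auto
    then have "nz (rl w (a + snd p) L) = []" "sum_list (rooms w (a + snd p) L) = 0"
      using rooms_above[of L w "a + snd p"] Cons.prems(1) by auto
    then show ?thesis using False by (intro bexI[of _ "fst p"]) (auto simp: nz_def rl_def)
  qed
qed simp

definition cmass :: "real list \<Rightarrow> (nat \<Rightarrow> real) \<Rightarrow> ('i \<times> real) list \<Rightarrow> real" where
  "cmass ws c L = (\<Sum>l<length ws. c l * rm (ws ! l) L)"

text \<open>\<open>phil\<close> keeps the list with total weight \<open>1 - A\<close>, where \<open>A\<close> is \<open>cmass\<close>, and gives the weight \<open>c l\<close> times its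
  room to the vertex whose interval contains the mark \<open>ws ! l\<close>, normalising when \<open>A > 1\<close>. The number of entries
  does not depend on the weights, which is what continuity on the fat realization requires.\<close>

definition pw :: "real list \<Rightarrow> (nat \<Rightarrow> real) \<Rightarrow> ('i \<times> real) list \<Rightarrow> nat option \<times> nat \<Rightarrow> real" where
  "pw ws c L a = (case fst a of None \<Rightarrow> max 0 (1 - cmass ws c L) * snd (L ! snd a)
     | Some l \<Rightarrow> c l * (rooms (ws ! l) 0 L ! snd a)) / max 1 (cmass ws c L)"

text \<open>\<open>None\<close> names the old entries and \<open>Some l\<close> the entries of mark
  l. Every mark has an entry for every vertex, so the labels stay fixed while the interval
  containing the mark changes.\<close>

definition pcodes :: "nat \<Rightarrow> nat \<Rightarrow> (nat option \<times> nat) list" where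
  "pcodes N k = map (Pair None) [0..<k] @ concat (map (\<lambda>l. map (Pair (Some l)) [0..<k]) [0..<N])"

definition phil :: "real list \<Rightarrow> (nat \<Rightarrow> real) \<Rightarrow> ('i \<times> real) list \<Rightarrow> ('i \<times> real) list" where
  "phil ws c L = map (\<lambda>a. (fst (L ! snd a), pw ws c L a)) (pcodes (length ws) (length L))"

lemma map_nth_fst: "map (\<lambda>i. (fst (L ! i), g (snd (L ! i)))) [0..<length L] = map (apsnd g) L"
  by (auto intro!: nth_equalityI prod_eqI)

lemma map_nth_rooms: "map (\<lambda>i. (fst (L ! i), g (rooms w a L ! i))) [0..<length L] = map (apsnd g) (rl w a L)"
  by (auto intro!: nth_equalityI prod_eqI simp: rl_def)

lemma phil_eq:
  "phil ws c L = map (apsnd (\<lambda>t. max 0 (1 - cmass ws c L) * t / max 1 (cmass ws c L))) L @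
     concat (map (\<lambda>l. map (apsnd (\<lambda>r. c l * r / max 1 (cmass ws c L))) (rl (ws ! l) 0 L)) [0..<length ws])"
  unfolding phil_def pcodes_def map_append map_concat map_map o_def
  by (simp add: pw_def o_def map_nth_fst[where g = "\<lambda>t. max 0 (1 - cmass ws c L) * t / max 1 (cmass ws c L)"]
      map_nth_rooms[where g = "\<lambda>r. c _ * r / max 1 (cmass ws c L)"])

lemma nz_append: "nz (A @ B) = nz A @ nz B"
  by (simp add: nz_def)

lemma nz_concat: "nz (concat Ls) = concat (map nz Ls)"
  by (induction Ls) (auto simp: nz_def)

lemma nz_map_apsnd: "g 0 = 0 \<Longrightarrow> nz (map (apsnd g) L) = nz (map (apsnd g) (nz L))"
  by (induction L) (auto simp: nz_def)

lemma cmass_nz: "cmass ws c (nz L) = cmass ws c L"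
  by (simp add: cmass_def rm_nz)

text \<open>Entries of weight zero contribute neither weight nor room, so \<open>phil\<close> passes
  to points of \<open>fat X\<close>.\<close>

lemma phil_nz: "nz (phil ws c (nz L)) = nz (phil ws c L)"
proof -
  have 1: "nz (map (apsnd (\<lambda>r. k * r / N)) (rl w 0 (nz L))) = nz (map (apsnd (\<lambda>r. k * r / N)) (rl w 0 L))" for k N w :: real
    using nz_map_apsnd[of "\<lambda>r. k * r / N" "rl w 0 L"] nz_map_apsnd[of "\<lambda>r. k * r / N" "rl w 0 (nz L)"] rooms_nz(1)[of w 0 L] by simp
  show ?thesis
    unfolding phil_eq nz_append nz_concat map_map o_def cmass_nz 1
    using nz_map_apsnd[of "\<lambda>t. max 0 (1 - cmass ws c L) * t / max 1 (cmass ws c L)" L] by simp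
qed

lemma phil_apfst: "phil ws c (map (apfst h) L) = map (apfst h) (phil ws c L)"
proof -
  have 1: "cmass ws c (map (apfst h) L) = cmass ws c L" by (simp add: cmass_def rm_def)
  have len: "snd a < length L" if "a \<in> set (pcodes N (length L))" for a N using that by (auto simp: pcodes_def)
  show ?thesis using len unfolding phil_def by (auto simp: pw_def 1 split: option.split)
qed

lemma fst_phil: "fst ` set (phil ws c L) \<subseteq> fst ` set L"
  by (auto simp: phil_def pcodes_def)

text \<open>Before division the old entries carry max 0 (1 - A) and the new ones A in total, which
  add up to the denominator max 1 A.\<close>

lemma phil_weighted:
  assumes L: "weighted L" and c: "\<And>l. l < length ws \<Longrightarrow> 0 \<le> c l"
  shows "weighted (phil ws c L)"
proof -
  let ?A = "cmass ws c L"
  have A0: "0 \<le> ?A" unfolding cmass_def by (intro sum_nonneg mult_nonneg_nonneg c rm_nonneg) auto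
  have 1: "0 \<le> snd p" if "p \<in> set (phil ws c L)" for p
  proof -
    obtain a where a: "p = (fst (L ! snd a), pw ws c L a)" "a \<in> set (pcodes (length ws) (length L))" using \<open>p \<in> set (phil ws c L)\<close> unfolding phil_def set_map by (rule imageE)
    then have "snd a < length L" by (auto simp: pcodes_def)
    then have n0: "0 \<le> snd (L ! snd a)" using L nth_mem[of "snd a" L] by (auto simp: weighted_def)
    have r0: "0 \<le> rooms w 0 L ! snd a" for w by (rule rooms_nonneg[OF nth_mem]) (use \<open>snd a < length L\<close> in simp)
    show ?thesis using a c n0 r0 by (auto simp: pw_def pcodes_def split: option.split)
  qed
  have s1: "(\<Sum>x\<leftarrow>M. k * snd x / N) = k * sum_list (map snd M) / N" for k N :: real and M :: "('i \<times> real) list"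
    by (induction M) (auto simp: algebra_simps add_divide_distrib)
  have s2: "sum_list (map snd (rl w 0 L)) = rm w L" for w by (simp add: rl_def rm_def)
  have "sum_list (map snd (phil ws c L)) = max 0 (1 - ?A) / max 1 ?A + (\<Sum>l\<leftarrow>[0..<length ws]. c l * rm (ws ! l) L / max 1 ?A)"
    unfolding phil_eq map_append sum_list_append map_concat sum_list_concat map_map o_def
    using L by (simp add: weighted_def o_def s1 s2)
  also have "(\<Sum>l\<leftarrow>[0..<length ws]. c l * rm (ws ! l) L / max 1 ?A) = ?A / max 1 ?A"
    by (simp add: interv_sum_list_conv_sum_set_nat atLeast0LessThan cmass_def sum_divide_distrib)
  also have "max 0 (1 - ?A) / max 1 ?A + ?A / max 1 ?A = 1"
    unfolding add_divide_distrib[symmetric] using A0 by (auto simp: max_def)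
  finally show ?thesis using 1 by (auto simp: weighted_def)
qed

definition phiR :: "'x topology \<Rightarrow> real list \<Rightarrow> (nat \<Rightarrow> real) \<Rightarrow> ((nat \<Rightarrow> real) \<Rightarrow> 'x) prepoint \<Rightarrow> ((nat \<Rightarrow> real) \<Rightarrow> 'x) prepoint set" where
  "phiR X ws c a = (case a of ((k, x), t) \<Rightarrow> rc X (lpt x (phil ws c (coords k t))))"

definition rmp :: "real \<Rightarrow> ((nat \<Rightarrow> real) \<Rightarrow> 'x) prepoint \<Rightarrow> real" where
  "rmp w a = (case a of ((k, x), t) \<Rightarrow> rm w (coords k t))"

lemma coords_wt_apfst: "L \<noteq> [] \<Longrightarrow> map (apfst ((!) (map fst L))) (coords (length L - 1) (wt L)) = L"
  by (auto simp: coords_def wt_def intro!: nth_equalityI prod_eqI simp del: upt_Suc)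

lemma rmp_lpt: "weighted L \<Longrightarrow> rmp w (lpt \<Psi> L) = rm w L"
proof -
  assume "weighted L"
  then have ne: "L \<noteq> []" by (rule weighted_nonempty)
  have "rm w L = rm w (map (apfst ((!) (map fst L))) (coords (length L - 1) (wt L)))"
    by (rule arg_cong[OF coords_wt_apfst[OF ne, symmetric]])
  also have "\<dots> = rm w (coords (length L - 1) (wt L))" by (simp only: rm_def rooms_apfst)
  finally show ?thesis by (simp add: rmp_def lpt_def)
qed

lemma phiR_lpt:
  assumes "weighted L" shows "phiR X ws c (lpt \<Psi> L) = rc X (lpt \<Psi> (phil ws c L))"
proof -
  have ne: "L \<noteq> []" by (rule weighted_nonempty[OF assms])
  let ?C = "coords (length L - 1) (wt L)"
  have "phil ws c ?C \<noteq> []"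
    by (simp add: phil_def pcodes_def coords_def del: upt_Suc)
  moreover have "fst ` set (phil ws c ?C) \<subseteq> {..<length (map fst L)}"
    using fst_phil[of ws c ?C] ne by (auto simp: coords_def simp del: upt_Suc)
  ultimately have "lpt (lsimp \<Psi> (map fst L)) (phil ws c ?C) = lpt \<Psi> (map (apfst ((!) (map fst L))) (phil ws c ?C))"
    by (rule lpt_lsimp)
  then show ?thesis
    unfolding phil_apfst[symmetric] coords_wt_apfst[OF ne] by (simp add: phiR_def lpt_def[of \<Psi> L])
qed

lemma phil_Sing:
  assumes "lsimp \<Psi> (map fst L) \<in> simplices (Sing X) (length L - 1)" "L \<noteq> []"
  shows "lsimp \<Psi> (map fst (phil ws c L)) \<in> simplices (Sing X) (length (phil ws c L) - 1)"
proof -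
  let ?js = "map snd (pcodes (length ws) (length L))"
  have m: "map fst (phil ws c L) = map ((!) (map fst L)) ?js"
    by (auto simp: phil_def pcodes_def)
  have ne: "?js \<noteq> []" using assms(2) by (simp add: pcodes_def)
  have sub: "set ?js \<subseteq> {..<length L}" by (auto simp: pcodes_def)
  have "lsimp (lsimp \<Psi> (map fst L)) ?js = lsimp \<Psi> (map ((!) (map fst L)) ?js)"
    by (rule lsimp_lsimp[OF ne]) (use sub in simp)
  moreover have "lsimp (lsimp \<Psi> (map fst L)) ?js \<in> simplices (Sing X) (length ?js - 1)"
    by (rule lsimp_Sing[OF assms(1) ne]) (use sub assms(2) in fastforce)
  ultimately show ?thesis unfolding m by (simp add: phil_def)
qed

lemma phiR_nf:
  assumes "x \<in> simplices (Sing X) k" "t \<in> standard_simplex k" "\<And>l. l < length ws \<Longrightarrow> 0 \<le> c l"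
  shows "phiR X ws c (nf ((k, x), t)) = phiR X ws c ((k, x), t)" "rmp w (nf ((k, x), t)) = rmp w ((k, x), t)"
proof -
  let ?L = "coords k t"
  have w: "weighted ?L" by (rule coords_weighted[OF assms(2)])
  have S: "lsimp x (map fst ?L) \<in> simplices (Sing X) (length ?L - 1)"
    using assms(1) by (simp add: coords_fst lsimp_id[OF assms(1)] del: upt_Suc)
  have ne: "?L \<noteq> []" by (rule weighted_nonempty[OF w])
  have w': "weighted (nz ?L)" using w by simp
  have S': "lsimp x (map fst (nz ?L)) \<in> simplices (Sing X) (length (nz ?L) - 1)"
    using lsimp_sublist[OF S ne] weighted_nonempty[OF w'] by (simp add: nz_def)
  have "rc X (lpt x (phil ws c (nz ?L))) = rc X (lpt x (nz (phil ws c (nz ?L))))"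
    by (rule rc_lpt_nz[symmetric]) (use phil_weighted[OF w' assms(3)] phil_Sing[OF S' weighted_nonempty[OF w']] in auto)
  also have "\<dots> = rc X (lpt x (phil ws c ?L))"
    unfolding phil_nz by (rule rc_lpt_nz) (use phil_weighted[OF w assms(3)] phil_Sing[OF S ne] in auto)
  finally show "phiR X ws c (nf ((k, x), t)) = phiR X ws c ((k, x), t)"
    unfolding nf_def split phiR_lpt[OF w'] by (simp add: phiR_def)
  show "rmp w (nf ((k, x), t)) = rmp w ((k, x), t)"
    unfolding nf_def split rmp_lpt[OF w'] rm_nz by (simp add: rmp_def)
qed

lemma continuous_rm_coords:
  assumes "continuous_map T (simplex_space k) t"
  shows "continuous_map T euclideanreal (\<lambda>p. rm w (coords k (t p)))"
    and "j \<le> k \<Longrightarrow> continuous_map T euclideanreal (\<lambda>p. rooms w 0 (coords k (t p)) ! j)"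
proof -
  have tj: "continuous_map T euclideanreal (\<lambda>p. t p j)" for j by (rule continuous_simplex_coord[OF assms])
  have e: "rooms w 0 (coords k t) ! j = max 0 (min (w - (\<Sum>i<j. t i)) ((\<Sum>i<j. t i) + t j - w))" if "j \<le> k" for j t
  proof -
    have "(\<Sum>i<j. snd (coords k t ! i)) = (\<Sum>i<j. t i)" using that by (intro sum.cong) (auto simp: coords_def simp del: upt_Suc)
    then show ?thesis using that by (subst rooms_nth) (auto simp: coords_def simp del: upt_Suc)
  qed
  show r: "continuous_map T euclideanreal (\<lambda>p. rooms w 0 (coords k (t p)) ! j)" if "j \<le> k" for j
    unfolding e[OF that] by (intro continuous_intros tj) auto
  have e2: "rm w (coords k t) = (\<Sum>j<Suc k. rooms w 0 (coords k t) ! j)" for t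
    by (simp add: rm_def sum_list_sum_nth atLeast0LessThan coords_fst del: sum.lessThan_Suc)
  show "continuous_map T euclideanreal (\<lambda>p. rm w (coords k (t p)))"
    unfolding e2 by (intro continuous_map_sum r) auto
qed

lemma continuous_rmp: "continuous_map (fat X) euclideanreal (rmp w)"
  unfolding fat_def
proof (rule continuous_map_prerealization_quotient)
  fix n s assume s: "s \<in> simplices (Sing X) n"
  have "continuous_map (simplex_space n) euclideanreal (\<lambda>t. rm w (coords n t))"
    by (rule continuous_rm_coords(1)[OF continuous_map_id[unfolded id_def]])
  then show "continuous_map (simplex_space n) euclideanreal (\<lambda>t. rmp w (nf ((n, s), t)))"
  proof (rule continuous_map_eq)
    fix t assume "t \<in> topspace (simplex_space n)"
    then have "rmp w (nf ((n, s), t)) = rmp w ((n, s), t)" by (intro phiR_nf(2)[OF s, where ws = "[]" and c = "\<lambda>_. 0"]) auto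
    then show "rm w (coords n t) = rmp w (nf ((n, s), t))" by (simp add: rmp_def)
  qed
qed

text \<open>A compact Hausdorff box for the coefficients, so that the product with it preserves
  quotient maps; hence coefficients are kept below a bound \<open>M\<close>.\<close>

definition par_space :: "real \<Rightarrow> (nat \<Rightarrow> real) topology" where
  "par_space M = product_topology (\<lambda>_. top_of_set {0..M}) UNIV"

lemma par_space: "locally_compact_space (par_space M)" "Hausdorff_space (par_space M)"
  "topspace (par_space M) = {c. \<forall>l. 0 \<le> c l \<and> c l \<le> M}"
proof -
  have "compact_space (par_space M)" unfolding par_space_def compact_space_product_topology
    by (auto intro: compact_space_subtopology)
  then show "locally_compact_space (par_space M)" by (rule compact_imp_locally_compact_space)
  show "Hausdorff_space (par_space M)" unfolding par_space_def Hausdorff_space_product_topology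
    by (auto intro: Hausdorff_space_subtopology)
  show "topspace (par_space M) = {c. \<forall>l. 0 \<le> c l \<and> c l \<le> M}"
    by (auto simp: par_space_def)
qed

text \<open>With the coefficients as an independent parameter, the labels are constant over each
  simplex of the prerealization and \<open>continuous_lists\<close> applies. The map on
  \<open>T\<close> is a composition with this one.\<close>

lemma continuous_phiR:
  assumes z: "continuous_map T (fat X) z" and c: "\<And>l. continuous_map T euclideanreal (\<lambda>p. c p l)"
    and b: "\<And>p l. p \<in> topspace T \<Longrightarrow> 0 \<le> c p l \<and> c p l \<le> M"
  shows "continuous_map T (realization (Sing X)) (\<lambda>p. phiR X ws (c p) (z p))"
proof -
  have 1: "continuous_map (prod_topology (par_space M) (fat X)) (realization (Sing X)) (\<lambda>(c, z). phiR X ws c z)"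
    unfolding fat_def
  proof (rule continuous_map_prod_prerealization_quotient[OF par_space(1,2)])
    fix n s assume s: "s \<in> simplices (Sing X) n"
    let ?T = "prod_topology (par_space M) (simplex_space n)"
    have cl: "continuous_map ?T euclideanreal (\<lambda>p. fst p l)" for l
    proof -
      have "continuous_map (par_space M) euclideanreal (\<lambda>c. c l)"
        using continuous_map_product_projection[of l UNIV "\<lambda>_. top_of_set {0..M}"]
        by (simp add: par_space_def continuous_map_in_subtopology)
      from continuous_map_compose[OF continuous_map_fst this] show ?thesis by (simp add: o_def)
    qed
    note rc' = continuous_rm_coords[OF continuous_map_snd[of "par_space M" "simplex_space n"]]
    have cm: "continuous_map ?T euclideanreal (\<lambda>p. cmass ws (fst p) (coords n (snd p)))"
      unfolding cmass_def by (intro continuous_map_sum continuous_map_real_mult cl rc') auto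
    let ?P = "\<lambda>p. phil ws (fst p) (coords n (snd p))"
    have fstp: "map fst (?P p) = map (\<lambda>a. snd a) (pcodes (length ws) (Suc n))" for p
      by (auto simp: phil_def coords_def pcodes_def simp del: upt_Suc)
    let ?is = "map (\<lambda>a. snd a) (pcodes (length ws) (Suc n))"
    have "continuous_map ?T (realization (Sing X)) (\<lambda>p. rc X (lpt s (?P p)))"
      unfolding realization_def
    proof (rule continuous_lists[of s ?is])
      show "lsimp s ?is \<in> simplices (Sing X) (length ?is - 1)"
        by (rule lsimp_Sing[OF s]) (auto simp: pcodes_def simp del: upt_Suc)
      show "map fst (?P p) = ?is \<and> weighted (?P p)" if "p \<in> topspace ?T" for p
        using that by (auto simp: fstp par_space(3) intro!: phil_weighted coords_weighted)
      show "continuous_map ?T euclideanreal (\<lambda>p. snd (?P p ! j))" if j: "j < length ?is" for j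
      proof -
        define a where "a = pcodes (length ws) (Suc n) ! j"
        have a: "a \<in> set (pcodes (length ws) (Suc n))" using j nth_mem unfolding a_def by simp
        then have an: "snd a \<le> n" by (auto simp: pcodes_def simp del: upt_Suc)
        have e: "snd (?P p ! j) = pw ws (fst p) (coords n (snd p)) a" for p
          using j by (simp add: phil_def coords_fst a_def)
        have sn: "snd (coords n t ! snd a) = t (snd a)" for t using an by (simp add: coords_def del: upt_Suc)
        have tc: "continuous_map ?T euclideanreal (\<lambda>p. snd p (snd a))" by (rule continuous_simplex_coord[OF continuous_map_snd])
        show ?thesis unfolding e pw_def sn
        proof (rule continuous_map_real_divide)
          show "continuous_map ?T euclideanreal (\<lambda>p. max 1 (cmass ws (fst p) (coords n (snd p))))"
            by (intro continuous_map_real_max cm) simp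
          show "continuous_map ?T euclideanreal (\<lambda>p. case fst a of None \<Rightarrow> max 0 (1 - cmass ws (fst p) (coords n (snd p))) * snd p (snd a)
             | Some l \<Rightarrow> fst p l * rooms (ws ! l) 0 (coords n (snd p)) ! snd a)"
            by (cases "fst a") (auto intro!: continuous_map_real_mult continuous_map_real_max continuous_map_diff cm tc cl rc'(2)[OF an])
        qed (simp add: max_def)
      qed
    qed
    then show "continuous_map ?T (realization (Sing X)) (\<lambda>(c, t). phiR X ws c (nf ((n, s), t)))"
    proof (rule continuous_map_eq)
      fix p assume p: "p \<in> topspace ?T"
      then have "phiR X ws (fst p) (nf ((n, s), snd p)) = phiR X ws (fst p) ((n, s), snd p)"
        by (intro phiR_nf(1)[OF s]) (auto simp: par_space(3))
      then show "rc X (lpt s (?P p)) = (case p of (c, t) \<Rightarrow> phiR X ws c (nf ((n, s), t)))"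
        by (simp add: phiR_def split_beta)
    qed
  qed
  have "continuous_map T (par_space M) c"
    unfolding par_space_def continuous_map_componentwise_UNIV
    using c b by (auto simp: continuous_map_in_subtopology)
  then have "continuous_map T (prod_topology (par_space M) (fat X)) (\<lambda>p. (c p, z p))"
    using z by (simp add: continuous_map_paired)
  from continuous_map_compose[OF this 1] show ?thesis by (simp add: o_def)
qed

definition prob_fun :: "'i set \<Rightarrow> ('i \<Rightarrow> real) \<Rightarrow> bool" where
  "prob_fun I \<xi> \<longleftrightarrow> (\<forall>i. 0 \<le> \<xi> i) \<and> (\<forall>i. i \<notin> I \<longrightarrow> \<xi> i = 0) \<and> sum \<xi> I = 1"

lemma push_prob:
  assumes c: "c \<in> standard_simplex (length is - 1)" and ne: "is \<noteq> []"
  shows "prob_fun (set is) (push is c)"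
proof -
  have l: "{..length is - 1} = {..<length is}" using ne by (cases "is") auto
  have c: "0 \<le> c i" "(\<Sum>j<length is. c j) = 1" for i
    using c l by (auto simp: standard_simplex_def)
  have "sum (push is c) (set is) = (\<Sum>i\<in>set is. \<Sum>j | j \<in> {..<length is} \<and> is ! j = i. c j)"
    unfolding push_def by (intro sum.cong) auto
  also have "\<dots> = (\<Sum>j<length is. c j)" by (rule sum.group) auto
  finally have 1: "sum (push is c) (set is) = 1" using c by simp
  have "push is c i = 0" if "i \<notin> set is" for i
  proof -
    have "{j. j < length is \<and> is ! j = i} = {}" using that nth_mem by fastforce
    then show ?thesis by (metis push_def sum.empty)
  qed
  then show ?thesis using 1 c by (auto simp: prob_fun_def push_def intro!: sum_nonneg)
qed

lemma prob_fun_mono: "prob_fun I \<xi> \<Longrightarrow> I \<subseteq> I' \<Longrightarrow> finite I' \<Longrightarrow> prob_fun I' \<xi>"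
  unfolding prob_fun_def using sum.mono_neutral_right[of I' I \<xi>] by auto

lemma lsimp_cong:
  assumes "is \<noteq> []" "\<And>\<xi>. prob_fun (set is) \<xi> \<Longrightarrow> \<Psi> \<xi> = \<Psi>' \<xi>"
  shows "lsimp \<Psi> is = lsimp \<Psi>' is"
  unfolding lsimp_def using push_prob[OF _ assms(1)] assms(2) by (auto simp: fun_eq_iff restrict_def)

lemma lpt_cong:
  assumes "L \<noteq> []" "\<And>\<xi>. prob_fun (fst ` set L) \<xi> \<Longrightarrow> \<Psi> \<xi> = \<Psi>' \<xi>"
  shows "lpt \<Psi> L = lpt \<Psi>' L"
  unfolding lpt_def using lsimp_cong[of "map fst L" \<Psi> \<Psi>'] assms by simp

lemma standard_simplex_zero: "c \<in> standard_simplex 0 \<longleftrightarrow> c = e0"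
proof
  assume "c = e0"
  then show "c \<in> standard_simplex 0" by (simp add: standard_simplex_def)
qed (auto simp: standard_simplex_def fun_eq_iff)

text \<open>On the vertices of positive weight the simplex is constant, hence a degeneracy of
  \<open>x0\<close>. This is how homotopies are seen to be fixed on the boundary of the
  cube.\<close>

lemma rc_lpt_const:
  assumes x0: "x0 \<in> simplices (Sing X) 0" and L: "weighted L" "lsimp \<Psi> (map fst L) \<in> simplices (Sing X) (length L - 1)"
    and c: "\<And>\<xi>. prob_fun (fst ` set (nz L)) \<xi> \<Longrightarrow> \<Psi> \<xi> = x0 e0"
  shows "rc X (lpt \<Psi> L) = rc X ((0, x0), e0)"
proof -
  have ne: "nz L \<noteq> []" using L(1) by (intro weighted_nonempty) simp
  let ?k = "length (nz L) - 1" and ?\<sigma> = "restrict (\<lambda>_. 0) {..length (nz L) - 1} :: nat \<Rightarrow> nat"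
  have \<sigma>: "?\<sigma> \<in> order_maps ?k 0" by (auto simp: order_maps_def mono_on_def)
  have d: "delta_map ?k 0 ?\<sigma> t = e0" if "t \<in> standard_simplex ?k" for t
  proof -
    have "{j. j \<le> ?k \<and> ?\<sigma> j = 0} = {..?k}" by auto
    then have "(\<Sum>j | j \<le> ?k \<and> ?\<sigma> j = 0. t j) = 1" using that by (simp add: standard_simplex_def)
    then show ?thesis by (auto simp: delta_map_def fun_eq_iff)
  qed
  have w: "wt (nz L) \<in> standard_simplex ?k" by (rule wt_in) (simp add: L)
  have "lsimp \<Psi> (map fst (nz L)) = act (Sing X) ?k 0 ?\<sigma> x0"
  proof -
    have "lsimp \<Psi> (map fst (nz L)) = restrict (\<lambda>_. x0 e0) (standard_simplex ?k)"
      unfolding lsimp_def length_map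
    proof (rule restrict_ext)
      fix t assume "t \<in> standard_simplex ?k"
      then have "prob_fun (fst ` set (nz L)) (push (map fst (nz L)) t)"
        using push_prob[of t "map fst (nz L)"] ne unfolding length_map set_map by simp
      then show "\<Psi> (push (map fst (nz L)) t) = x0 e0" by (rule c)
    qed
    also have "\<dots> = restrict (x0 \<circ> delta_map ?k 0 ?\<sigma>) (standard_simplex ?k)"
      by (rule restrict_ext) (simp only: o_def d)
    finally show ?thesis by (simp add: Sing_def)
  qed
  then have "rc X (lpt \<Psi> (nz L)) = rc X ((?k, act (Sing X) ?k 0 ?\<sigma> x0), wt (nz L))" by (simp add: lpt_def)
  also have "\<dots> = rc X ((0, x0), e0)" by (simp only: realization_class_act[OF \<sigma> x0 w] d[OF w])
  finally show ?thesis using rc_lpt_nz[OF L] by simp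
qed

lemma mass_enum: "mass (map (\<lambda>l. (l, r l)) [0..<N]) = (\<lambda>l. if l < N then r l else 0)"
  by (rule ext) (simp add: mass_def o_def interv_sum_list_conv_sum_set_nat atLeast0LessThan)

section \<open>Cubes, nets and partitions of unity\<close>

lemma topspace_cube: "topspace (cube n) = {..<n} \<rightarrow>\<^sub>E {0..1}"
  by (simp add: cube_def)

lemma continuous_cube_coord: "continuous_map T (cube n) f \<Longrightarrow> i < n \<Longrightarrow> continuous_map T euclideanreal (\<lambda>x. f x i)"
  unfolding cube_def by (simp add: continuous_map_componentwise continuous_map_in_subtopology)

lemma continuous_map_cubeI:
  assumes "\<And>i. i < n \<Longrightarrow> continuous_map T euclideanreal (\<lambda>x. f x i)" "\<And>x. x \<in> topspace T \<Longrightarrow> f x \<in> topspace (cube n)"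
  shows "continuous_map T (cube n) f"
  using assms unfolding cube_def by (fastforce simp: continuous_map_componentwise continuous_map_in_subtopology PiE_iff)

lemma cube_boundary_sub: "cube_boundary n \<subseteq> topspace (cube n)"
  by (auto simp: cube_boundary_def)

abbreviation rbh :: "nat \<Rightarrow> 'a topology \<Rightarrow> 'a \<Rightarrow> ((nat \<Rightarrow> real) \<Rightarrow> 'a) \<Rightarrow> ((nat \<Rightarrow> real) \<Rightarrow> 'a) \<Rightarrow> bool" where
  "rbh n Y y \<equiv> homotopic_with (\<lambda>h. \<forall>s\<in>cube_boundary n. h s = y) (cube n) Y"

lemma rbh_iff:
  "rbh n Y y f g \<longleftrightarrow> (\<exists>h. continuous_map (prod_topology unit_interval (cube n)) Y h \<and>
     (\<forall>s\<in>topspace (cube n). h (0, s) = f s) \<and> (\<forall>s\<in>topspace (cube n). h (1, s) = g s) \<and>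
     (\<forall>\<tau>\<in>{0..1}. \<forall>s\<in>cube_boundary n. h (\<tau>, s) = y))"
  by (rule homotopic_with) (use cube_boundary_sub in \<open>auto simp: subset_iff\<close>)

lemma rbhI:
  assumes "continuous_map (prod_topology unit_interval (cube n)) Y (\<lambda>p. h (fst p) (snd p))"
    "\<And>s. s \<in> topspace (cube n) \<Longrightarrow> h 0 s = f s" "\<And>s. s \<in> topspace (cube n) \<Longrightarrow> h 1 s = g s"
    "\<And>\<tau> s. 0 \<le> \<tau> \<Longrightarrow> \<tau> \<le> 1 \<Longrightarrow> s \<in> cube_boundary n \<Longrightarrow> h \<tau> s = y"
  shows "rbh n Y y f g"
  unfolding rbh_iff by (rule exI[of _ "\<lambda>p. h (fst p) (snd p)"]) (use assms in auto)

lemma rbh_compose: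
  assumes "rbh n Y y f g" "continuous_map Y Z \<phi>"
  shows "rbh n Z (\<phi> y) (\<phi> \<circ> f) (\<phi> \<circ> g)"
  by (rule homotopic_with_compose_continuous_map_left[OF assms]) auto

text \<open>Room for small moves: maps are first made constant on the collar by
  \<open>clamp\<close>, and points within 1/4 of a boundary point in each coordinate still lie in
  it.\<close>

definition collar :: "nat \<Rightarrow> (nat \<Rightarrow> real) set" where
  "collar n = {s \<in> topspace (cube n). \<exists>i<n. s i \<le> 1/4 \<or> 3/4 \<le> s i}"

definition bx :: "nat \<Rightarrow> real \<Rightarrow> (nat \<Rightarrow> real) \<Rightarrow> (nat \<Rightarrow> real) set" where
  "bx n \<delta> z = {s \<in> topspace (cube n). \<forall>i<n. \<bar>s i - z i\<bar> < \<delta>}"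

definition bump :: "nat \<Rightarrow> real \<Rightarrow> (nat \<Rightarrow> real) \<Rightarrow> (nat \<Rightarrow> real) \<Rightarrow> real" where
  "bump n \<delta> z s = (\<Prod>i<n. max 0 (\<delta> - \<bar>s i - z i\<bar>))"

definition rho :: "nat \<Rightarrow> (nat \<Rightarrow> real) list \<Rightarrow> real \<Rightarrow> nat \<Rightarrow> (nat \<Rightarrow> real) \<Rightarrow> real" where
  "rho n zs \<delta> l s = bump n \<delta> (zs ! l) s / (\<Sum>k<length zs. bump n \<delta> (zs ! k) s)"

definition net :: "nat \<Rightarrow> (nat \<Rightarrow> real) list \<Rightarrow> real \<Rightarrow> bool" where
  "net n zs \<delta> \<longleftrightarrow> 0 < \<delta> \<and> set zs \<subseteq> topspace (cube n) \<and>
     (\<forall>s\<in>topspace (cube n). \<exists>l<length zs. s \<in> bx n \<delta> (zs ! l))"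

lemma bump_nonneg: "0 \<le> bump n \<delta> z s"
  unfolding bump_def by (rule prod_nonneg) auto

lemma bump_nonzero: "bump n \<delta> z s \<noteq> 0 \<longleftrightarrow> (\<forall>i<n. \<bar>s i - z i\<bar> < \<delta>)"
proof -
  have "max 0 (\<delta> - a) = 0 \<longleftrightarrow> \<not> a < \<delta>" for a by auto
  then show ?thesis by (simp add: bump_def Ball_def)
qed

lemma continuous_bump: "continuous_map (cube n) euclideanreal (bump n \<delta> z)"
  unfolding bump_def
  by (intro continuous_map_prod continuous_map_real_max continuous_map_diff continuous_map_real_abs
      continuous_cube_coord[OF continuous_map_id[unfolded id_def]]) auto

lemma openin_bx: "openin (cube n) (bx n \<delta> z)"
proof -
  have "openin (cube n) {s \<in> topspace (cube n). bump n \<delta> z s \<in> - {0}}"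
    by (rule openin_continuous_map_preimage[OF continuous_bump]) auto
  also have "{s \<in> topspace (cube n). bump n \<delta> z s \<in> - {0}} = bx n \<delta> z"
    using bump_nonzero[of n \<delta> z] by (auto simp: bx_def)
  finally show ?thesis .
qed

lemma compact_cube: "compact_space (cube n)"
  unfolding cube_def compact_space_product_topology by (auto intro: compact_space_subtopology)

lemma cube_finite_subcover:
  assumes "\<And>p. p \<in> topspace (cube n) \<Longrightarrow> 0 < r p"
  obtains P where "finite P" "P \<subseteq> topspace (cube n)" "topspace (cube n) \<subseteq> (\<Union>p\<in>P. bx n (r p) p)"
proof -
  have "p \<in> bx n (r p) p" if "p \<in> topspace (cube n)" for p using assms[OF that] that by (auto simp: bx_def)
  then have "topspace (cube n) \<subseteq> \<Union>((\<lambda>p. bx n (r p) p) ` topspace (cube n))" by blast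
  then obtain \<F> where F: "finite \<F>" "\<F> \<subseteq> (\<lambda>p. bx n (r p) p) ` topspace (cube n)" "topspace (cube n) \<subseteq> \<Union>\<F>"
    using compact_cube[of n, unfolded compact_space_alt, rule_format, of "(\<lambda>p. bx n (r p) p) ` topspace (cube n)"]
      openin_bx by (auto simp: image_iff)
  obtain P where "P \<subseteq> topspace (cube n)" "finite P" "\<F> = (\<lambda>p. bx n (r p) p) ` P"
    using finite_subset_image[OF F(1,2)] by blast
  then show thesis using that F(3) by auto
qed

lemma exists_net:
  assumes "0 < \<delta>" obtains zs where "net n zs \<delta>"
proof -
  obtain P where P: "finite P" "P \<subseteq> topspace (cube n)" "topspace (cube n) \<subseteq> (\<Union>p\<in>P. bx n \<delta> p)"
    by (rule cube_finite_subcover[of n "\<lambda>_. \<delta>"]) (use assms in auto)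
  obtain zs where zs: "set zs = P" using finite_list[OF P(1)] by blast
  have "\<exists>l<length zs. s \<in> bx n \<delta> (zs ! l)" if s: "s \<in> topspace (cube n)" for s
  proof -
    obtain p where "p \<in> set zs" "s \<in> bx n \<delta> p" using s P(3) zs by auto
    then show ?thesis by (auto simp: in_set_conv_nth)
  qed
  then show thesis using that[of zs] assms zs P(2) unfolding net_def by blast
qed

lemma rho_facts:
  assumes "net n zs \<delta>"
  shows "0 \<le> rho n zs \<delta> l s"
    and "s \<in> topspace (cube n) \<Longrightarrow> (\<Sum>l<length zs. rho n zs \<delta> l s) = 1"
    and "rho n zs \<delta> l s \<noteq> 0 \<Longrightarrow> i < n \<Longrightarrow> \<bar>s i - (zs ! l) i\<bar> < \<delta>"
    and "continuous_map (cube n) euclideanreal (rho n zs \<delta> l)"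
proof -
  show "0 \<le> rho n zs \<delta> l s" by (simp add: rho_def bump_nonneg sum_nonneg)
  show "rho n zs \<delta> l s \<noteq> 0 \<Longrightarrow> i < n \<Longrightarrow> \<bar>s i - (zs ! l) i\<bar> < \<delta>"
    using bump_nonzero[of n \<delta> "zs ! l" s] by (auto simp: rho_def)
  have p: "(\<Sum>k<length zs. bump n \<delta> (zs ! k) s) \<noteq> 0" if s: "s \<in> topspace (cube n)" for s
  proof -
    obtain l where l: "l < length zs" "s \<in> bx n \<delta> (zs ! l)" using s assms by (auto simp: net_def)
    then have "bump n \<delta> (zs ! l) s \<noteq> 0" unfolding bump_nonzero by (auto simp: bx_def)
    then have "0 < bump n \<delta> (zs ! l) s" using bump_nonneg[of n \<delta> "zs ! l" s] by simp
    then have "0 < (\<Sum>k<length zs. bump n \<delta> (zs ! k) s)" by (intro sum_pos2[of _ l]) (use l bump_nonneg in auto)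
    then show ?thesis by simp
  qed
  show "s \<in> topspace (cube n) \<Longrightarrow> (\<Sum>l<length zs. rho n zs \<delta> l s) = 1"
    using p by (simp add: rho_def flip: sum_divide_distrib)
  show "continuous_map (cube n) euclideanreal (rho n zs \<delta> l)"
    unfolding rho_def by (intro continuous_map_real_divide continuous_map_sum continuous_bump p) auto
qed

lemma convex_sum_less:
  fixes e v :: "nat \<Rightarrow> real"
  assumes "\<And>l. 0 \<le> e l" "(\<Sum>l<N. e l) = 1" "\<And>l. l < N \<Longrightarrow> e l \<noteq> 0 \<Longrightarrow> \<bar>v l - a\<bar> < d"
  shows "\<bar>(\<Sum>l<N. e l * v l) - a\<bar> < d"
proof -
  have "\<exists>l<N. e l \<noteq> 0"
  proof (rule ccontr)
    assume "\<not> ?thesis"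
    then have "(\<Sum>l<N. e l) = 0" by (intro sum.neutral) auto
    then show False using assms(2) by simp
  qed
  then obtain l0 where l0: "l0 < N" "e l0 \<noteq> 0" by blast
  have "(\<Sum>l<N. e l * v l) - a = (\<Sum>l<N. e l * v l) - (\<Sum>l<N. e l) * a" using assms(2) by simp
  also have "\<dots> = (\<Sum>l<N. e l * (v l - a))"
    by (simp only: sum_distrib_right right_diff_distrib sum_subtractf)
  finally have "\<bar>(\<Sum>l<N. e l * v l) - a\<bar> \<le> (\<Sum>l<N. \<bar>e l * (v l - a)\<bar>)" by simp
  also have "\<dots> = (\<Sum>l<N. e l * \<bar>v l - a\<bar>)" by (simp add: abs_mult assms(1))
  also have "\<dots> < (\<Sum>l<N. e l * d)"
  proof (rule sum_strict_mono_ex1)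
    show "\<forall>l\<in>{..<N}. e l * \<bar>v l - a\<bar> \<le> e l * d"
    proof
      fix l assume "l \<in> {..<N}"
      then show "e l * \<bar>v l - a\<bar> \<le> e l * d" using assms(1)[of l] assms(3)[of l] by (cases "e l = 0") (auto intro: mult_left_mono)
    qed
    show "\<exists>l\<in>{..<N}. e l * \<bar>v l - a\<bar> < e l * d"
      using l0 assms(1)[of l0] assms(3)[of l0] by (intro bexI[of _ l0] mult_strict_left_mono) auto
  qed simp
  also have "\<dots> = d" using assms(2) by (simp flip: sum_distrib_right)
  finally show ?thesis .
qed

definition bary :: "nat \<Rightarrow> (nat \<Rightarrow> real) list \<Rightarrow> (nat \<Rightarrow> real) \<Rightarrow> nat \<Rightarrow> real" where
  "bary n zs e = restrict (\<lambda>i. \<Sum>l<length zs. e l * (zs ! l) i) {..<n}"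

lemma bary_in:
  assumes "\<And>l. 0 \<le> e l" "(\<Sum>l<length zs. e l) = 1" "set zs \<subseteq> topspace (cube n)"
  shows "bary n zs e \<in> topspace (cube n)"
proof -
  have z: "0 \<le> (zs ! l) i" "(zs ! l) i \<le> 1" if "l < length zs" "i < n" for l i
  proof -
    have "zs ! l \<in> topspace (cube n)" using assms(3) nth_mem[OF that(1)] by blast
    then show "0 \<le> (zs ! l) i" "(zs ! l) i \<le> 1" using that(2) by (auto simp: topspace_cube PiE_iff)
  qed
  have "(\<Sum>l<length zs. e l * (zs ! l) i) \<le> (\<Sum>l<length zs. e l)" if "i < n" for i
    by (rule sum_mono) (use z that assms(1) in \<open>auto intro: mult_left_le\<close>)
  then show ?thesis using z assms(1,2) by (auto simp: bary_def topspace_cube intro!: sum_nonneg)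
qed

lemma bary_near:
  assumes "\<And>l. 0 \<le> e l" "(\<Sum>l<length zs. e l) = 1" "\<And>l. l < length zs \<Longrightarrow> e l \<noteq> 0 \<Longrightarrow> \<bar>(zs ! l) i - a\<bar> < d" "i < n"
  shows "\<bar>bary n zs e i - a\<bar> < d"
  using convex_sum_less[OF assms(1,2,3)] assms(4) by (simp add: bary_def)

lemma bary_cong: "(\<And>l. l < length zs \<Longrightarrow> e l = e' l) \<Longrightarrow> bary n zs e = bary n zs e'"
  unfolding bary_def by (auto intro!: restrict_ext sum.cong)

lemma collar_near:
  assumes s: "s \<in> cube_boundary n" and y: "y \<in> topspace (cube n)" "\<And>i. i < n \<Longrightarrow> \<bar>y i - s i\<bar> < d" and d: "d \<le> 1/4"
  shows "y \<in> collar n"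
proof -
  obtain i where i: "i < n" "s i = 0 \<or> s i = 1" using s by (auto simp: cube_boundary_def)
  then have "y i \<le> 1/4 \<or> 3/4 \<le> y i" using y(2)[OF i(1)] d by auto
  then show ?thesis using y(1) i(1) by (auto simp: collar_def)
qed

text \<open>Only net points within \<open>\<delta>\<close> of the boundary point carry weight, and
  their barycentre is as close to it.\<close>

lemma boundary_bary:
  assumes net: "net n zs \<delta>" "\<delta> \<le> 1/4" and s: "s \<in> cube_boundary n" and e: "\<And>l. 0 \<le> e l" "(\<Sum>l<length zs. e l) = 1"
    and supp: "\<And>l. e l \<noteq> 0 \<Longrightarrow> rho n zs \<delta> l s \<noteq> 0"
  shows "bary n zs e \<in> collar n"
proof (rule collar_near[OF s])
  show "bary n zs e \<in> topspace (cube n)" using net by (intro bary_in e) (auto simp: net_def)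
  show "\<bar>bary n zs e i - s i\<bar> < \<delta>" if "i < n" for i
  proof (rule bary_near[OF e _ that])
    fix l assume "e l \<noteq> 0"
    then show "\<bar>(zs ! l) i - s i\<bar> < \<delta>" using rho_facts(3)[OF net(1) supp that] by (simp add: abs_minus_commute)
  qed
qed (rule net)

definition kap :: "nat \<Rightarrow> 'x topology \<Rightarrow> ((nat \<Rightarrow> real) \<Rightarrow> 'x) \<Rightarrow> (nat \<Rightarrow> real) list \<Rightarrow> real \<Rightarrow>
    (nat \<Rightarrow> real) \<Rightarrow> ((nat \<Rightarrow> real) \<Rightarrow> 'x) prepoint set" where
  "kap n X \<phi> zs \<delta> s = rc X (lpt (\<lambda>\<xi>. \<phi> (bary n zs \<xi>)) (map (\<lambda>l. (l, rho n zs \<delta> l s)) [0..<length zs]))"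

lemma weighted_enum:
  assumes "net n zs \<delta>" "s \<in> topspace (cube n)"
  shows "weighted (map (\<lambda>l. (f l, rho n zs \<delta> l s)) [0..<length zs])"
  using rho_facts(1,2)[OF assms(1)] assms(2)
  by (auto simp: weighted_def o_def interv_sum_list_conv_sum_set_nat atLeast0LessThan)

lemma push_Pair: "push (map (Pair b) js) c (b', l) = (if b' = b then push js c l else 0)"
proof -
  have "{j. j < length js \<and> map (Pair b) js ! j = (b', l)} = (if b' = b then {j. j < length js \<and> js ! j = l} else {})"
    by (auto split: if_splits)
  then show ?thesis by (auto simp: push_def)
qed

text \<open>A list inside one of the two copies is a list over the single labels, with the weight
  function extended by zero to the other copy.\<close>

lemma lpt_Pair:
  "lpt F (map (\<lambda>l. ((b, l), r l)) [0..<N]) = lpt (\<lambda>\<eta>. F (\<lambda>(b', l). if b' = b then \<eta> l else 0)) (map (\<lambda>l. (l, r l)) [0..<N])"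
proof -
  have "push (map (Pair b) [0..<N]) c = (\<lambda>(b', l). if b' = b then push [0..<N] c l else 0)" for c :: "nat \<Rightarrow> real"
    by (rule ext) (auto simp: push_Pair)
  then show ?thesis by (simp add: lpt_def lsimp_def o_def wt_def cong: if_cong)
qed

definition items :: "nat \<Rightarrow> (bool \<times> nat) list" where
  "items N = map (Pair False) [0..<N] @ map (Pair True) [0..<N]"

lemma lsimp_half:
  assumes S: "lsimp F (items N) \<in> simplices (Sing X) (length (items N) - 1)" and N: "0 < N"
  shows "lsimp F (map (Pair b) [0..<N]) \<in> simplices (Sing X) (N - 1)"
proof -
  let ?js = "if b then [N..<N+N] else [0..<N]"
  have e: "map ((!) (items N)) ?js = map (Pair b) [0..<N]"
    by (auto simp: items_def nth_append intro!: nth_equalityI)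
  have ne: "?js \<noteq> []" using N by simp
  have "lsimp (lsimp F (items N)) ?js \<in> simplices (Sing X) (length ?js - 1)"
    by (rule lsimp_Sing[OF S ne]) (use N in \<open>auto simp: items_def\<close>)
  also have "lsimp (lsimp F (items N)) ?js = lsimp F (map ((!) (items N)) ?js)"
    by (rule lsimp_lsimp[OF ne]) (auto simp: items_def)
  also have "length ?js = N" by simp
  finally show ?thesis unfolding e .
qed

text \<open>Both halves of the doubled list span faces of one simplex, and sliding the weights from one
  to the other moves between them.\<close>

lemma two_lists:
  assumes net: "net n zs \<delta>" and x0: "x0 \<in> simplices (Sing X) 0"
    and F: "continuous_map (simplex_space (length (items (length zs)) - 1)) X (\<lambda>c. F (push (items (length zs)) c))"
    and bdry: "\<And>s \<xi>. s \<in> cube_boundary n \<Longrightarrow> prob_fun (UNIV \<times> {l. l < length zs \<and> rho n zs \<delta> l s \<noteq> 0}) \<xi> \<Longrightarrow> F \<xi> = x0 e0"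
  shows "rbh n (realization (Sing X)) (rc X ((0, x0), e0))
    (\<lambda>s. rc X (lpt F (map (\<lambda>l. ((False, l), rho n zs \<delta> l s)) [0..<length zs])))
    (\<lambda>s. rc X (lpt F (map (\<lambda>l. ((True, l), rho n zs \<delta> l s)) [0..<length zs])))"
proof -
  let ?N = "length zs"
  let ?L = "\<lambda>\<tau> s. map (\<lambda>l. ((False, l), (1 - \<tau>) * rho n zs \<delta> l s)) [0..<?N] @ map (\<lambda>l. ((True, l), \<tau> * rho n zs \<delta> l s)) [0..<?N]"
  have fst: "map fst (?L \<tau> s) = items ?N" for \<tau> s by (simp add: items_def o_def)
  have len: "length (?L \<tau> s) = length (items ?N)" for \<tau> s by (simp add: items_def)
  have S: "lsimp F (items ?N) \<in> simplices (Sing X) (length (items ?N) - 1)" by (rule lsimp_Sing_general[OF F])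
  have w: "weighted (?L \<tau> s)" if "0 \<le> \<tau>" "\<tau> \<le> 1" "s \<in> topspace (cube n)" for \<tau> s
    using that rho_facts(1,2)[OF net]
    by (auto simp: weighted_def o_def interv_sum_list_conv_sum_set_nat atLeast0LessThan simp flip: sum_distrib_left)
  have S': "lsimp F (map fst (?L \<tau> s)) \<in> simplices (Sing X) (length (?L \<tau> s) - 1)" for \<tau> s
    unfolding fst len by (rule S)
  let ?T = "prod_topology unit_interval (cube n)"
  have cfst: "continuous_map ?T euclideanreal fst"
    using continuous_map_fst[of unit_interval] continuous_map_in_subtopology by blast
  have crho: "continuous_map ?T euclideanreal (\<lambda>p. rho n zs \<delta> l (snd p))" for l
    using continuous_map_compose[OF continuous_map_snd rho_facts(4)[OF net]] by (simp add: o_def)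
  have C: "continuous_map ?T (realization (Sing X)) (\<lambda>p. rc X (lpt F (?L (fst p) (snd p))))"
    unfolding realization_def
  proof (rule continuous_lists[OF S])
    show "map fst (?L (fst p) (snd p)) = items ?N \<and> weighted (?L (fst p) (snd p))" if "p \<in> topspace ?T" for p
      using that fst w by auto
    show "continuous_map ?T euclideanreal (\<lambda>p. snd (?L (fst p) (snd p) ! j))" if "j < length (items ?N)" for j
      using that by (cases "j < ?N") (auto simp: nth_append items_def intro!: continuous_map_real_mult continuous_map_diff cfst crho)
  qed
  have nz0: "nz (?L 0 s) = nz (map (\<lambda>l. ((False, l), rho n zs \<delta> l s)) [0..<?N])" for s
    by (simp add: nz_def filter_map o_def)
  have nz1: "nz (?L 1 s) = nz (map (\<lambda>l. ((True, l), rho n zs \<delta> l s)) [0..<?N])" for s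
    by (simp add: nz_def filter_map o_def)
  have red: "rc X (lpt F (nz (map (\<lambda>l. ((b, l), rho n zs \<delta> l s)) [0..<?N]))) = rc X (lpt F (map (\<lambda>l. ((b, l), rho n zs \<delta> l s)) [0..<?N]))"
    if s: "s \<in> topspace (cube n)" for b s
  proof (rule rc_lpt_nz)
    show w: "weighted (map (\<lambda>l. ((b, l), rho n zs \<delta> l s)) [0..<?N])" by (rule weighted_enum[OF net s])
    show "lsimp F (map fst (map (\<lambda>l. ((b, l), rho n zs \<delta> l s)) [0..<?N])) \<in> simplices (Sing X) (length (map (\<lambda>l. ((b, l), rho n zs \<delta> l s)) [0..<?N]) - 1)"
      using lsimp_half[OF S, of b] weighted_nonempty[OF w] by (simp add: o_def)
  qed
  show ?thesis
  proof (rule rbhI[where h = "\<lambda>\<tau> s. rc X (lpt F (?L \<tau> s))", OF C])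
    fix s assume s: "s \<in> topspace (cube n)"
    show "rc X (lpt F (?L 0 s)) = rc X (lpt F (map (\<lambda>l. ((False, l), rho n zs \<delta> l s)) [0..<?N]))"
      using rc_lpt_nz[OF w[OF _ _ s] S', of 0] red[OF s, of False] by (simp only: nz0)
    show "rc X (lpt F (?L 1 s)) = rc X (lpt F (map (\<lambda>l. ((True, l), rho n zs \<delta> l s)) [0..<?N]))"
      using rc_lpt_nz[OF w[OF _ _ s] S', of 1] red[OF s, of True] by (simp only: nz1)
  next
    fix \<tau> :: real and s assume t: "0 \<le> \<tau>" "\<tau> \<le> 1" and s: "s \<in> cube_boundary n"
    have s': "s \<in> topspace (cube n)" using s cube_boundary_sub by blast
    show "rc X (lpt F (?L \<tau> s)) = rc X ((0, x0), e0)"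
    proof (rule rc_lpt_const[OF x0 w[OF t s'] S'])
      fix \<xi> assume p: "prob_fun (fst ` set (nz (?L \<tau> s))) \<xi>"
      have "fst ` set (nz (?L \<tau> s)) \<subseteq> UNIV \<times> {l. l < ?N \<and> rho n zs \<delta> l s \<noteq> 0}" by (auto simp: nz_def)
      moreover have "finite (UNIV \<times> {l. l < ?N \<and> rho n zs \<delta> l s \<noteq> 0} :: (bool \<times> nat) set)"
        by (rule finite_cartesian_product) simp_all
      ultimately show "F \<xi> = x0 e0" by (rule bdry[OF s prob_fun_mono[OF p]])
    qed
  qed
qed

lemma prob_bool_nat:
  fixes N :: nat
  assumes "prob_fun (UNIV \<times> {l. l < N \<and> P l}) \<xi>"
  shows "(\<Sum>l<N. \<xi> (False, l) + \<xi> (True, l)) = 1" "\<xi> (False, l) + \<xi> (True, l) \<noteq> 0 \<Longrightarrow> l < N \<and> P l"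
    "0 \<le> \<xi> (False, l) + \<xi> (True, l)" "0 \<le> \<xi> (b, l)" "(\<Sum>l<N. \<xi> (b, l)) \<le> 1"
proof -
  have "finite (UNIV \<times> {..<N} :: (bool \<times> nat) set)" by (rule finite_cartesian_product) simp_all
  moreover have "UNIV \<times> {l. l < N \<and> P l} \<subseteq> UNIV \<times> {..<N}" by auto
  ultimately have "prob_fun (UNIV \<times> {..<N}) \<xi>" using prob_fun_mono[OF assms] by blast
  then have "(\<Sum>p\<in>UNIV \<times> {..<N}. \<xi> p) = 1" by (simp add: prob_fun_def)
  then show 1: "(\<Sum>l<N. \<xi> (False, l) + \<xi> (True, l)) = 1"
    by (simp add: UNIV_bool sum.distrib flip: sum.cartesian_product[of "\<lambda>b l. \<xi> (b, l)", simplified])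
  show "\<xi> (False, l) + \<xi> (True, l) \<noteq> 0 \<Longrightarrow> l < N \<and> P l"
    using assms by (cases "l < N \<and> P l") (auto simp: prob_fun_def)
  have 0: "0 \<le> \<xi> p" for p using assms unfolding prob_fun_def by blast
  show "0 \<le> \<xi> (b, l)" "0 \<le> \<xi> (False, l) + \<xi> (True, l)" using 0 by (simp_all add: add_nonneg_nonneg)
  have "(\<Sum>l<N. \<xi> (b, l)) \<le> (\<Sum>l<N. \<xi> (False, l) + \<xi> (True, l))"
    by (rule sum_mono) (use 0 in \<open>cases b; simp\<close>)
  then show "(\<Sum>l<N. \<xi> (b, l)) \<le> 1" using 1 by simp
qed

lemma items_prob:
  assumes "c \<in> standard_simplex (length (items N) - 1)" "0 < N"
  shows "prob_fun (UNIV \<times> {l. l < N \<and> True}) (push (items N) c)"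
  by (rule prob_fun_mono[OF push_prob[OF assms(1)]]) (use assms(2) in \<open>auto simp: items_def\<close>)

lemma net_nonempty: "net n zs \<delta> \<Longrightarrow> 0 < length zs"
proof -
  have "restrict (\<lambda>_. 0) {..<n} \<in> topspace (cube n)" by (auto simp: topspace_cube)
  then show "net n zs \<delta> \<Longrightarrow> 0 < length zs" unfolding net_def by (metis less_nat_zero_code neq0_conv)
qed

lemma continuous_push_coord:
  "k = length is - 1 \<Longrightarrow> continuous_map (simplex_space k) euclideanreal (\<lambda>c. push is c a)"
  unfolding push_def by (intro continuous_map_sum continuous_simplex_coord[OF continuous_map_id[unfolded id_def]]) auto

lemma continuous_items_bary:
  assumes "net n zs \<delta>"
  defines "N \<equiv> length zs"
  shows "continuous_map (simplex_space (length (items N) - 1)) (cube n)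
    (\<lambda>c. bary n zs (\<lambda>l. push (items N) c (False, l) + push (items N) c (True, l)))"
proof (rule continuous_map_cubeI)
  fix i assume "i < n"
  then show "continuous_map (simplex_space (length (items N) - 1)) euclideanreal
    (\<lambda>c. bary n zs (\<lambda>l. push (items N) c (False, l) + push (items N) c (True, l)) i)"
    by (auto simp: bary_def intro!: continuous_map_sum continuous_map_real_mult continuous_map_add continuous_push_coord)
next
  fix c assume "c \<in> topspace (simplex_space (length (items N) - 1))"
  then have "prob_fun (UNIV \<times> {l. l < N \<and> True}) (push (items N) c)" using net_nonempty[OF assms(1)] by (intro items_prob) (auto simp: N_def)
  from prob_bool_nat[OF this] show "bary n zs (\<lambda>l. push (items N) c (False, l) + push (items N) c (True, l)) \<in> topspace (cube n)"
    using assms by (intro bary_in) (auto simp: N_def net_def)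
qed

text \<open>On doubled labels the total weight of the second copy is the time of \<open>h\<close>,
  and the sum of both copies gives the position in the cube. The two halves are then the two ends of
  the homotopy.\<close>

lemma kap_homotopy:
  assumes net: "net n zs \<delta>" "\<delta> \<le> 1/4" and x0: "x0 \<in> simplices (Sing X) 0"
    and h: "continuous_map (prod_topology unit_interval (cube n)) X h"
    and col: "\<And>\<tau> s. 0 \<le> \<tau> \<Longrightarrow> \<tau> \<le> 1 \<Longrightarrow> s \<in> collar n \<Longrightarrow> h (\<tau>, s) = x0 e0"
  shows "rbh n (realization (Sing X)) (rc X ((0, x0), e0)) (kap n X (\<lambda>s. h (0, s)) zs \<delta>) (kap n X (\<lambda>s. h (1, s)) zs \<delta>)"
proof -
  let ?N = "length zs"
  define F where "F \<xi> = h (\<Sum>l<?N. \<xi> (True, l), bary n zs (\<lambda>l. \<xi> (False, l) + \<xi> (True, l)))" for \<xi>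
  have N: "0 < ?N" by (rule net_nonempty[OF net(1)])
  have "rbh n (realization (Sing X)) (rc X ((0, x0), e0))
    (\<lambda>s. rc X (lpt F (map (\<lambda>l. ((False, l), rho n zs \<delta> l s)) [0..<length zs])))
    (\<lambda>s. rc X (lpt F (map (\<lambda>l. ((True, l), rho n zs \<delta> l s)) [0..<length zs])))"
  proof (rule two_lists[OF net(1) x0])
    let ?S = "simplex_space (length (items ?N) - 1)"
    have "continuous_map ?S unit_interval (\<lambda>c. \<Sum>l<?N. push (items ?N) c (True, l))"
      unfolding continuous_map_in_subtopology
    proof (intro conjI funcsetI)
      fix c assume "c \<in> topspace ?S"
      then have p: "prob_fun (UNIV \<times> {l. l < ?N \<and> True}) (push (items ?N) c)" using N by (intro items_prob) auto
      show "(\<Sum>l<?N. push (items ?N) c (True, l)) \<in> {0..1}"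
        using prob_bool_nat(4,5)[OF p] by (auto intro!: sum_nonneg)
    qed (intro continuous_map_sum continuous_push_coord, auto)
    then have "continuous_map ?S (prod_topology unit_interval (cube n))
      (\<lambda>c. (\<Sum>l<?N. push (items ?N) c (True, l), bary n zs (\<lambda>l. push (items ?N) c (False, l) + push (items ?N) c (True, l))))"
      using continuous_items_bary[OF net(1)] by (simp add: continuous_map_paired)
    from continuous_map_compose[OF this h] show "continuous_map ?S X (\<lambda>c. F (push (items ?N) c))"
      by (simp add: F_def o_def)
    show "F \<xi> = x0 e0" if s: "s \<in> cube_boundary n" and p: "prob_fun (UNIV \<times> {l. l < ?N \<and> rho n zs \<delta> l s \<noteq> 0}) \<xi>" for s \<xi>
      unfolding F_def
    proof (rule col)
      show "bary n zs (\<lambda>l. \<xi> (False, l) + \<xi> (True, l)) \<in> collar n"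
        by (rule boundary_bary[OF net s]) (use prob_bool_nat[OF p] in auto)
    qed (use prob_bool_nat[OF p] in \<open>auto intro!: sum_nonneg\<close>)
  qed
  also have "(\<lambda>s. rc X (lpt F (map (\<lambda>l. ((False, l), rho n zs \<delta> l s)) [0..<length zs]))) = kap n X (\<lambda>s. h (0, s)) zs \<delta>"
    unfolding lpt_Pair kap_def[abs_def] by (simp add: F_def)
  also have "(\<lambda>s. rc X (lpt F (map (\<lambda>l. ((True, l), rho n zs \<delta> l s)) [0..<length zs]))) = kap n X (\<lambda>s. h (1, s)) zs \<delta>"
    unfolding lpt_Pair kap_def[abs_def]
  \<comment> \<open>The time is 1 only for weight functions of total mass 1, so the two label maps
    are compared on these.\<close>
  proof (rule ext, rule arg_cong[where f = "rc X"], rule lpt_cong)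
    fix s :: "nat \<Rightarrow> real" and \<xi> :: "nat \<Rightarrow> real"
    assume "prob_fun (fst ` set (map (\<lambda>l. (l, rho n zs \<delta> l s)) [0..<?N])) \<xi>"
    then have "prob_fun {..<?N} \<xi>" by (rule prob_fun_mono) auto
    then have "(\<Sum>l<?N. \<xi> l) = 1" by (simp add: prob_fun_def)
    then show "F (\<lambda>(b', l). if b' = True then \<xi> l else 0) = h (1, bary n zs \<xi>)" by (simp add: F_def)
  qed (use N in simp)
  finally show ?thesis .
qed

lemma ev_kap:
  assumes "net n zs \<delta>" "s \<in> topspace (cube n)"
  shows "ev (kap n X \<phi> zs \<delta> s) = \<phi> (bary n zs (\<lambda>l. rho n zs \<delta> l s))"
  unfolding kap_def ev_lpt[OF weighted_enum[OF assms]] mass_enum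
  by (rule arg_cong[where f = \<phi>], rule bary_cong) simp

text \<open>The evaluation at s is \<open>\<phi>\<close> at a barycentre of net points close to s,
  and a segment joins the two. From a boundary point the segment stays in the collar.\<close>

lemma kap_ev_homotopy:
  assumes net: "net n zs \<delta>" "\<delta> \<le> 1/4" and \<phi>: "continuous_map (cube n) X \<phi>" and col: "\<And>s. s \<in> collar n \<Longrightarrow> \<phi> s = y"
  shows "rbh n X y (ev \<circ> kap n X \<phi> zs \<delta>) \<phi>"
proof (rule rbhI)
  let ?b = "\<lambda>s. bary n zs (\<lambda>l. rho n zs \<delta> l s)"
  let ?m = "\<lambda>\<tau> s. restrict (\<lambda>i. (1 - \<tau>) * ?b s i + \<tau> * s i) {..<n}"
  let ?T = "prod_topology unit_interval (cube n)"
  have b: "?b s \<in> topspace (cube n)" if "s \<in> topspace (cube n)" for s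
    using net rho_facts(1,2)[OF net(1)] that by (intro bary_in) (auto simp: net_def)
  have m: "?m \<tau> s \<in> topspace (cube n)" if "0 \<le> \<tau>" "\<tau> \<le> 1" "s \<in> topspace (cube n)" for \<tau> s
    using b[OF that(3)] that by (auto simp: topspace_cube PiE_iff intro!: convex_bound_le add_nonneg_nonneg mult_nonneg_nonneg)
  have cfst: "continuous_map ?T euclideanreal fst"
    using continuous_map_fst[of unit_interval] continuous_map_in_subtopology by blast
  have crho: "continuous_map ?T euclideanreal (\<lambda>p. rho n zs \<delta> l (snd p))" for l
    using continuous_map_compose[OF continuous_map_snd rho_facts(4)[OF net(1)]] by (simp add: o_def)
  have "continuous_map ?T (cube n) (\<lambda>p. ?m (fst p) (snd p))"
  proof (rule continuous_map_cubeI)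
    fix i assume "i < n"
    then show "continuous_map ?T euclideanreal (\<lambda>p. ?m (fst p) (snd p) i)"
      unfolding bary_def by (simp, intro continuous_map_add continuous_map_real_mult continuous_map_diff continuous_map_sum cfst crho
          continuous_cube_coord[OF continuous_map_snd]) auto
  qed (use m in auto)
  from continuous_map_compose[OF this \<phi>] show "continuous_map ?T X (\<lambda>p. \<phi> (?m (fst p) (snd p)))" by (simp add: o_def)
  show "\<phi> (?m 0 s) = (ev \<circ> kap n X \<phi> zs \<delta>) s" if s: "s \<in> topspace (cube n)" for s
  proof -
    have "?m 0 s = ?b s" using b[OF s] by (auto simp: topspace_cube PiE_iff extensional_def fun_eq_iff)
    then show ?thesis by (simp only: o_def ev_kap[OF net(1) s])
  qed
  show "\<phi> (?m 1 s) = \<phi> s" if "s \<in> topspace (cube n)" for s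
  proof -
    have "?m 1 s = s" using that by (auto simp: topspace_cube PiE_iff extensional_def fun_eq_iff)
    then show ?thesis by simp
  qed
  show "\<phi> (?m \<tau> s) = y" if t: "0 \<le> \<tau>" "\<tau> \<le> 1" and s: "s \<in> cube_boundary n" for \<tau> s
  proof (rule col, rule collar_near[OF s _ _ net(2)])
    have s': "s \<in> topspace (cube n)" using s cube_boundary_sub by blast
    show "?m \<tau> s \<in> topspace (cube n)" by (rule m[OF t s'])
    fix i assume i: "i < n"
    have n1: "\<bar>?b s i - s i\<bar> < \<delta>"
    proof (rule bary_near[OF _ _ _ i])
      fix l assume "rho n zs \<delta> l s \<noteq> 0"
      then show "\<bar>(zs ! l) i - s i\<bar> < \<delta>" using rho_facts(3)[OF net(1) _ i] by (metis abs_minus_commute)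
    qed (use rho_facts(1,2)[OF net(1)] s' in auto)
    have e1: "\<bar>?m \<tau> s i - s i\<bar> = \<bar>(1 - \<tau>) * (?b s i - s i)\<bar>"
      using i by (simp add: algebra_simps)
    have l1: "\<bar>(1 - \<tau>) * (?b s i - s i)\<bar> \<le> 1 * \<bar>?b s i - s i\<bar>"
      unfolding abs_mult by (rule mult_right_mono) (use t in auto)
    show "\<bar>?m \<tau> s i - s i\<bar> < \<delta>" by (rule le_less_trans[OF eq_refl[OF e1] le_less_trans[OF l1[unfolded mult_1] n1]])
  qed
qed

section \<open>Vertices selected by marks\<close>

lemma fat_point:
  assumes "z \<in> topspace (fat X)"
  obtains k x t where "z = ((k, x), t)" "x \<in> simplices (Sing X) k" "t \<in> standard_simplex k" "nf z = z"
  using assms subsetD[OF fat_pre assms] nf_fat[OF assms] by (auto simp: topspace_prerealization)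

lemma lsimp_coords: "x \<in> simplices (Sing X) k \<Longrightarrow> lsimp x (map fst (coords k t)) \<in> simplices (Sing X) (length (coords k t) - 1)"
  by (simp add: coords_fst lsimp_id del: upt_Suc)

lemma nz_scale: "k \<noteq> 0 \<Longrightarrow> nz (map (apsnd (\<lambda>r. k * r)) M) = map (apsnd (\<lambda>r. k * r)) (nz M)"
  by (induction M) (auto simp: nz_def)

lemma nz_scale_zero: "nz (map (apsnd (\<lambda>r. 0)) M) = []"
  by (induction M) (auto simp: nz_def)

lemma phiR_zero:
  assumes "z \<in> topspace (fat X)" shows "phiR X ws (\<lambda>_. 0) z = rc X z"
proof -
  obtain k x t where z: "z = ((k, x), t)" "x \<in> simplices (Sing X) k" "t \<in> standard_simplex k"
    by (rule fat_point[OF assms])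
  let ?L = "coords k t"
  have w: "weighted ?L" by (rule coords_weighted[OF z(3)])
  have ne: "?L \<noteq> []" by (rule weighted_nonempty[OF w])
  have m: "map (apsnd (\<lambda>t. t)) ?L = ?L" by (simp add: apsnd_def map_prod_def)
  have cm: "cmass ws (\<lambda>_. 0) ?L = 0" by (simp add: cmass_def)
  have "nz (phil ws (\<lambda>_. 0) ?L) = nz ?L"
    unfolding phil_eq cm nz_append nz_concat map_map o_def using m by (simp add: nz_scale_zero)
  moreover have "rc X (lpt x (nz (phil ws (\<lambda>_. 0) ?L))) = rc X (lpt x (phil ws (\<lambda>_. 0) ?L))"
    by (rule rc_lpt_nz[OF phil_weighted[OF w] phil_Sing[OF lsimp_coords[OF z(2)] ne]]) simp
  moreover have "rc X (lpt x (nz ?L)) = rc X z"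
    using rc_nf[OF z(2,3)] by (simp add: z(1) nf_def)
  ultimately show ?thesis by (simp add: phiR_def z(1))
qed

lemma phiR_vertex:
  assumes x0: "x0 \<in> simplices (Sing X) 0" and c: "\<And>l. l < length ws \<Longrightarrow> 0 \<le> c l"
  shows "phiR X ws c (nf ((0, x0), e0)) = rc X ((0, x0), e0)"
proof -
  have e0: "e0 \<in> standard_simplex 0" by (simp add: standard_simplex_zero)
  have w: "weighted (coords 0 e0)" by (rule coords_weighted[OF e0])
  have "rc X (lpt x0 (phil ws c (coords 0 e0))) = rc X ((0, x0), e0)"
  proof (rule rc_lpt_const[OF x0 phil_weighted[OF w c] phil_Sing[OF lsimp_coords[OF x0] weighted_nonempty[OF w]]])
    fix \<xi> assume p: "prob_fun (fst ` set (nz (phil ws c (coords 0 e0)))) \<xi>"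
    have "fst ` set (nz (phil ws c (coords 0 e0))) \<subseteq> fst ` set (phil ws c (coords 0 e0))" by (auto simp: nz_def)
    also have "\<dots> \<subseteq> fst ` set (coords 0 e0)" by (rule fst_phil)
    also have "\<dots> = {0}" by (simp add: coords_def)
    finally have "prob_fun {0} \<xi>" by (intro prob_fun_mono[OF p]) auto
    then have "\<xi> = e0" by (auto simp: prob_fun_def fun_eq_iff)
    then show "x0 \<xi> = x0 e0" by simp
  qed
  then have "phiR X ws c ((0, x0), e0) = rc X ((0, x0), e0)" by (simp add: phiR_def)
  moreover have "phiR X ws c (nf ((0, x0), e0)) = phiR X ws c ((0, x0), e0)" by (rule phiR_nf(1)[OF x0 e0 c])
  ultimately show ?thesis by simp
qed

text \<open>The label whose interval contains the mark in its interior; meaningful when the room of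
  the mark is nonzero.\<close>

definition vtx :: "real \<Rightarrow> ('i \<times> real) list \<Rightarrow> 'i" where
  "vtx w L = fst (hd (nz (rl w 0 L)))"

lemma vtx:
  assumes "weighted L" "rm w L \<noteq> 0"
  shows "nz (rl w 0 L) = [(vtx w L, rm w L)]" "vtx w L \<in> fst ` set L"
proof -
  have "\<forall>p\<in>set L. 0 \<le> snd p" using assms(1) by (simp add: weighted_def)
  then obtain i where "i \<in> fst ` set L" "nz (rl w 0 L) = [(i, rm w L)]"
    using rooms_single[of L w 0] assms(2) unfolding rm_def by blast
  then show "nz (rl w 0 L) = [(vtx w L, rm w L)]" "vtx w L \<in> fst ` set L" by (simp_all add: vtx_def)
qed

lemma vtx_apfst:
  assumes "weighted L" "rm w L \<noteq> 0" shows "vtx w (map (apfst h) L) = h (vtx w L)"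
proof -
  have "rl w 0 (map (apfst h) L) = map (apfst h) (rl w 0 L)"
    by (auto intro!: nth_equalityI prod_eqI simp: rl_def)
  then show ?thesis using vtx(1)[OF assms] by (simp add: vtx_def[of w "map _ _"] nz_map_apfst)
qed

lemma vtx_nz: "vtx w (nz L) = vtx w L"
  by (simp add: vtx_def rooms_nz(1))

text \<open>One vertex for each mark, in the order of \<open>us\<close>; marks in the same interval
  repeat a vertex.\<close>

definition spine :: "real list \<Rightarrow> ((nat \<Rightarrow> real) \<Rightarrow> 'x) prepoint \<Rightarrow> (nat \<Rightarrow> real) \<Rightarrow> 'x" where
  "spine us z = (case z of ((k, x), t) \<Rightarrow> lsimp x (map (\<lambda>w. vtx w (coords k t)) us))"

lemma spine_lpt:
  assumes L: "weighted L" and us: "us \<noteq> []" "\<And>w. w \<in> set us \<Longrightarrow> rm w L \<noteq> 0"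
  shows "spine us (lpt \<Psi> L) = lsimp \<Psi> (map (\<lambda>w. vtx w L) us)"
proof -
  let ?C = "coords (length L - 1) (wt L)"
  have ne: "L \<noteq> []" by (rule weighted_nonempty[OF L])
  have wC: "weighted ?C" by (rule coords_weighted[OF wt_in[OF L]])
  have rC: "rm w ?C = rm w L" for w
    using rmp_lpt[OF L, of w \<Psi>] by (simp add: rmp_def lpt_def)
  have v: "map fst L ! vtx w ?C = vtx w L" if "w \<in> set us" for w
    using vtx_apfst[OF wC, of w "(!) (map fst L)"] us(2)[OF that] unfolding coords_wt_apfst[OF ne] rC by simp
  have b: "vtx w ?C < length L" if "w \<in> set us" for w
  proof -
    have "vtx w ?C \<in> fst ` set ?C" by (rule vtx(2)[OF wC]) (use us(2)[OF that] rC in simp)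
    then have "vtx w ?C \<le> length L - 1" by (auto simp: coords_def simp del: upt_Suc)
    then show ?thesis using ne by (cases L) auto
  qed
  have "lsimp (lsimp \<Psi> (map fst L)) (map (\<lambda>w. vtx w ?C) us) = lsimp \<Psi> (map ((!) (map fst L)) (map (\<lambda>w. vtx w ?C) us))"
    by (rule lsimp_lsimp) (use us b in auto)
  also have "map ((!) (map fst L)) (map (\<lambda>w. vtx w ?C) us) = map (\<lambda>w. vtx w L) us" using v by simp
  finally show ?thesis by (simp add: spine_def lpt_def)
qed

text \<open>For \<open>cmass\<close> equal to 1 the old entries get weight zero, and each mark with
  nonzero coefficient leaves a single entry.\<close>

lemma nz_phil:
  assumes L: "weighted L" and cm: "cmass ws c L = 1"
    and r: "\<And>l. l < length ws \<Longrightarrow> c l \<noteq> 0 \<Longrightarrow> rm (ws ! l) L \<noteq> 0"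
  shows "nz (phil ws c L) = map (\<lambda>l. (vtx (ws ! l) L, c l * rm (ws ! l) L)) (filter (\<lambda>l. c l \<noteq> 0) [0..<length ws])"
proof -
  have 1: "nz (map (apsnd (\<lambda>r. c l * r)) (rl (ws ! l) 0 L)) = (if c l \<noteq> 0 then [(vtx (ws ! l) L, c l * rm (ws ! l) L)] else [])"
    if "l < length ws" for l
    using vtx(1)[OF L r[OF that]] by (auto simp: nz_scale nz_scale_zero)
  have 2: "concat (map (\<lambda>l. if Q l then [f l] else []) xs) = map f (filter Q xs)" for Q :: "nat \<Rightarrow> bool" and f :: "nat \<Rightarrow> 'a \<times> real" and xs
    by (induction xs) auto
  have "nz (phil ws c L) = concat (map (\<lambda>l. nz (map (apsnd (\<lambda>r. c l * r)) (rl (ws ! l) 0 L))) [0..<length ws])"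
    unfolding phil_eq cm nz_append nz_concat map_map o_def by (simp add: nz_scale_zero)
  also have "\<dots> = concat (map (\<lambda>l. if c l \<noteq> 0 then [(vtx (ws ! l) L, c l * rm (ws ! l) L)] else []) [0..<length ws])"
    using 1 by (intro arg_cong[where f = concat] map_cong) auto
  also have "\<dots> = map (\<lambda>l. (vtx (ws ! l) L, c l * rm (ws ! l) L)) (filter (\<lambda>l. c l \<noteq> 0) [0..<length ws])"
    by (rule 2)
  finally show ?thesis .
qed

text \<open>The marks are singled out by a predicate \<open>P\<close>, weaker than
  \<open>c l \<noteq> 0\<close>, so that one list of marks serves several coefficient functions with
  zeros in different places.\<close>

lemma phiR_spine:
  assumes z: "z \<in> topspace (fat X)" and c: "\<And>l. l < length ws \<Longrightarrow> 0 \<le> c l"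
    and s: "(\<Sum>l<length ws. c l * rmp (ws ! l) z) = 1"
    and P: "\<And>l. l < length ws \<Longrightarrow> P l \<Longrightarrow> 0 < rmp (ws ! l) z" "\<And>l. l < length ws \<Longrightarrow> \<not> P l \<Longrightarrow> c l = 0"
  defines "ls \<equiv> filter P [0..<length ws]"
  shows "phiR X ws c z = rc X ((length ls - 1, spine (map ((!) ws) ls) z), \<lambda>j. if j < length ls then c (ls ! j) * rmp (ws ! (ls ! j)) z else 0)"
proof -
  obtain k x t where z: "z = ((k, x), t)" "x \<in> simplices (Sing X) k" "t \<in> standard_simplex k" by (rule fat_point[OF z])
  let ?L = "coords k t"
  have w: "weighted ?L" by (rule coords_weighted[OF z(3)])
  have rmp: "rmp u z = rm u ?L" for u by (simp add: rmp_def z(1))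
  let ?M = "map (\<lambda>l. (vtx (ws ! l) ?L, c l * rm (ws ! l) ?L)) ls"
  have ls: "l < length ws" "rm (ws ! l) ?L > 0" if "l \<in> set ls" for l using that P(1) by (auto simp: ls_def rmp)
  have nzM: "nz ?M = nz (phil ws c ?L)"
  proof -
    have "nz (phil ws c ?L) = map (\<lambda>l. (vtx (ws ! l) ?L, c l * rm (ws ! l) ?L)) (filter (\<lambda>l. c l \<noteq> 0) [0..<length ws])"
    proof (rule nz_phil[OF w])
      show "cmass ws c ?L = 1" using s by (simp add: cmass_def rmp)
      fix l assume l: "l < length ws" "c l \<noteq> 0"
      then have "P l" using P(2) by blast
      then show "rm (ws ! l) ?L \<noteq> 0" using P(1)[OF l(1)] by (simp add: rmp)
    qed
    also have "filter (\<lambda>l. c l \<noteq> 0) [0..<length ws] = filter (\<lambda>l. c l * rm (ws ! l) ?L \<noteq> 0) ls"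
      unfolding ls_def filter_filter by (rule filter_cong) (use P rmp in force)+
    finally show ?thesis by (simp add: nz_def filter_map o_def)
  qed
  have "weighted (nz ?M)" unfolding nzM using phil_weighted[OF w c] by simp
  then have wM: "weighted ?M" by simp
  have ne: "ls \<noteq> []" using weighted_nonempty[OF wM] by simp
  have v: "vtx (ws ! l) ?L \<le> k" if "l \<in> set ls" for l
    using vtx(2)[OF w, of "ws ! l"] ls[OF that] by (auto simp: coords_def simp del: upt_Suc)
  have SM: "lsimp x (map fst ?M) \<in> simplices (Sing X) (length ?M - 1)"
    using lsimp_Sing[OF z(2), of "map fst ?M"] ne v by (auto simp: o_def)
  have "phiR X ws c z = rc X (lpt x (phil ws c ?L))" by (simp add: phiR_def z(1))
  also have "\<dots> = rc X (lpt x (nz (phil ws c ?L)))"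
    by (rule rc_lpt_nz[symmetric, OF phil_weighted[OF w c] phil_Sing[OF lsimp_coords[OF z(2)] weighted_nonempty[OF w]]])
  also have "\<dots> = rc X (lpt x ?M)" unfolding nzM[symmetric] by (rule rc_lpt_nz[OF wM SM])
  also have "lpt x ?M = ((length ls - 1, spine (map ((!) ws) ls) z), \<lambda>j. if j < length ls then c (ls ! j) * rmp (ws ! (ls ! j)) z else 0)"
    by (auto simp: lpt_def spine_def z(1) o_def wt_def rmp_def fun_eq_iff)
  finally show ?thesis .
qed

lemma openin_fat:
  assumes "U \<subseteq> topspace (fat X)"
    and "\<And>n s. s \<in> simplices (Sing X) n \<Longrightarrow> openin (simplex_space n) {t \<in> standard_simplex n. nf ((n, s), t) \<in> U}"
  shows "openin (fat X) U"
proof -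
  have "openin (prerealization (Sing X)) {a \<in> topspace (prerealization (Sing X)). nf a \<in> U}"
    using assms(2) unfolding prerealization_def openin_sum_topology by (auto simp: conj_commute)
  then show ?thesis using assms(1) by (simp add: fat_def openin_quotient_topology)
qed

lemma vtx_coords:
  assumes t: "t \<in> standard_simplex n"
  shows "i \<le> n \<Longrightarrow> 0 < rooms w 0 (coords n t) ! i \<Longrightarrow> vtx w (coords n t) = i \<and> 0 < rm w (coords n t)"
    and "rm w (coords n t) \<noteq> 0 \<Longrightarrow> vtx w (coords n t) \<le> n \<and> 0 < rooms w 0 (coords n t) ! vtx w (coords n t)"
proof -
  let ?L = "coords n t"
  have w: "weighted ?L" by (rule coords_weighted[OF t])
  have rl: "set (rl w 0 ?L) = {(j, rooms w 0 ?L ! j) | j. j \<le> n}"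
  proof -
    have "rl w 0 ?L = map (\<lambda>j. (j, rooms w 0 ?L ! j)) [0..<Suc n]"
      by (auto intro!: nth_equalityI simp: rl_def coords_fst simp del: upt_Suc)
    then show ?thesis by (auto simp del: upt_Suc)
  qed
  have 1: "rooms w 0 ?L ! i \<le> rm w ?L" if "i \<le> n" for i
  proof -
    have "rooms w 0 ?L ! i \<in> set (rooms w 0 ?L)" using that by (intro nth_mem) (simp add: coords_fst)
    then show ?thesis unfolding rm_def by (intro member_le_sum_list) (auto simp: rooms_nonneg)
  qed
  show "vtx w ?L = i \<and> 0 < rm w ?L" if i: "i \<le> n" "0 < rooms w 0 ?L ! i"
  proof -
    have r: "0 < rm w ?L" using 1[OF i(1)] i(2) by linarith
    have "(i, rooms w 0 ?L ! i) \<in> set (nz (rl w 0 ?L))" using i unfolding nz_def set_filter rl by auto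
    then show ?thesis using vtx(1)[OF w] r by simp
  qed
  show "vtx w ?L \<le> n \<and> 0 < rooms w 0 ?L ! vtx w ?L" if r: "rm w ?L \<noteq> 0"
  proof -
    have "(vtx w ?L, rm w ?L) \<in> set (nz (rl w 0 ?L))" using vtx(1)[OF w r] by simp
    then have "(vtx w ?L, rm w ?L) \<in> set (rl w 0 ?L)" by (simp add: nz_def)
    then have "vtx w ?L \<le> n" "rooms w 0 ?L ! vtx w ?L = rm w ?L" unfolding rl by auto
    then show ?thesis using r rm_nonneg[of w ?L] by simp
  qed
qed

text \<open>Within one simplex the selected vertices persist while their rooms stay positive, and
  positivity of the product \<open>g\<close> of these rooms is an open condition.\<close>

lemma openin_spine:
  assumes us: "us \<noteq> []"
  shows "openin (fat X) {z \<in> topspace (fat X). (\<forall>w\<in>set us. 0 < rmp w z) \<and> spine us z = v}"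
proof (rule openin_fat)
  fix n s assume s: "s \<in> simplices (Sing X) n"
  let ?U = "{z \<in> topspace (fat X). (\<forall>w\<in>set us. 0 < rmp w z) \<and> spine us z = v}"
  let ?C = "\<lambda>t. coords n t"
  have mem: "nf ((n, s), t) \<in> ?U \<longleftrightarrow> (\<forall>w\<in>set us. 0 < rm w (?C t)) \<and> lsimp s (map (\<lambda>w. vtx w (?C t)) us) = v"
    if t: "t \<in> standard_simplex n" for t
  proof -
    have w: "weighted (nz (?C t))" using coords_weighted[OF t] by simp
    have 1: "nf ((n, s), t) \<in> topspace (fat X)" unfolding topspace_fat using s t by (auto simp: topspace_prerealization)
    have 2: "rmp w (nf ((n, s), t)) = rm w (?C t)" for w
      unfolding nf_def split rmp_lpt[OF w] by (rule rm_nz)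
    have 3: "spine us (nf ((n, s), t)) = lsimp s (map (\<lambda>w. vtx w (?C t)) us)" if "\<forall>w\<in>set us. 0 < rm w (?C t)"
      unfolding nf_def split using that by (intro trans[OF spine_lpt[OF w us]]) (auto simp: rm_nz vtx_nz)
    show ?thesis using 1 2 3 by auto
  qed
  show "openin (simplex_space n) {t \<in> standard_simplex n. nf ((n, s), t) \<in> ?U}"
  proof (subst openin_subopen, rule ballI)
    fix t0 assume "t0 \<in> {t \<in> standard_simplex n. nf ((n, s), t) \<in> ?U}"
    then have t0: "t0 \<in> standard_simplex n" "\<And>w. w \<in> set us \<Longrightarrow> 0 < rm w (?C t0)" "lsimp s (map (\<lambda>w. vtx w (?C t0)) us) = v"
      using mem by auto
    define i where "i w = vtx w (?C t0)" for w
    have i: "i w \<le> n" "0 < rooms w 0 (?C t0) ! i w" if "w \<in> set us" for w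
      using vtx_coords(2)[OF t0(1), of w] t0(2)[OF that] by (auto simp: i_def)
    define g where "g t = (\<Prod>w\<in>set us. rooms w 0 (?C t) ! i w)" for t
    have g: "continuous_map (simplex_space n) euclideanreal g"
      unfolding g_def by (intro continuous_map_prod continuous_rm_coords(2)[OF continuous_map_id[unfolded id_def]] i) auto
    let ?T = "{t \<in> topspace (simplex_space n). g t \<in> {0<..}}"
    have "openin (simplex_space n) ?T" by (rule openin_continuous_map_preimage[OF g]) simp
    moreover have "t0 \<in> ?T" using t0(1) i(2) by (auto simp: g_def intro!: prod_pos)
    moreover have "?T \<subseteq> {t \<in> standard_simplex n. nf ((n, s), t) \<in> ?U}"
    proof
      fix t assume "t \<in> ?T"
      then have t: "t \<in> standard_simplex n" "0 < g t" by auto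
      have r: "0 < rooms w 0 (?C t) ! i w" if "w \<in> set us" for w
      proof -
        have "rooms w 0 (?C t) ! i w \<noteq> 0"
        proof
          assume "rooms w 0 (?C t) ! i w = 0"
          then have "g t = 0" unfolding g_def using that by (intro prod_zero) auto
          then show False using t(2) by simp
        qed
        moreover have "0 \<le> rooms w 0 (?C t) ! i w"
          by (rule rooms_nonneg[OF nth_mem]) (use i(1)[OF that] in \<open>simp add: coords_fst\<close>)
        ultimately show ?thesis by simp
      qed
      have v: "vtx w (?C t) = i w" "0 < rm w (?C t)" if "w \<in> set us" for w
        using vtx_coords(1)[OF t(1) i(1)[OF that] r[OF that]] by auto
      have me: "map (\<lambda>w. vtx w (?C t)) us = map (\<lambda>w. vtx w (?C t0)) us" using v(1) by (simp add: i_def)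
      have "lsimp s (map (\<lambda>w. vtx w (?C t)) us) = v" unfolding me by (rule t0(3))
      then show "t \<in> {t \<in> standard_simplex n. nf ((n, s), t) \<in> ?U}" using t(1) v(2) mem[OF t(1)] by blast
    qed
    ultimately show "\<exists>T. openin (simplex_space n) T \<and> t0 \<in> T \<and> T \<subseteq> {t \<in> standard_simplex n. nf ((n, s), t) \<in> ?U}" by blast
  qed
qed auto

text \<open>The zero-weight faces of \<^term>\<open>fat X\<close> are not glued to anything else, so the face spanned by
  the vertices whose intervals contain the given marks can only change where a mark leaves its interval.\<close>

lemma spine_path:
  assumes us: "us \<noteq> []" and \<gamma>: "continuous_map unit_interval (fat X) \<gamma>"
    and pos: "\<And>\<tau> w. 0 \<le> \<tau> \<Longrightarrow> \<tau> \<le> 1 \<Longrightarrow> w \<in> set us \<Longrightarrow> 0 < rmp w (\<gamma> \<tau>)"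
  shows "spine us (\<gamma> 0) = spine us (\<gamma> 1)"
proof -
  have "continuous_map unit_interval (discrete_topology UNIV) (\<lambda>\<tau>. spine us (\<gamma> \<tau>))"
    unfolding continuous_map_def
  proof (intro conjI allI impI)
    fix V :: "((nat \<Rightarrow> real) \<Rightarrow> 'a) set"
    let ?O = "\<lambda>v. {\<tau> \<in> topspace unit_interval. \<gamma> \<tau> \<in> {z \<in> topspace (fat X). (\<forall>w\<in>set us. 0 < rmp w z) \<and> spine us z = v}}"
    have "openin unit_interval (\<Union>v\<in>V. ?O v)"
    proof (rule openin_Union, clarify)
      fix v show "openin unit_interval (?O v)"
        by (rule openin_continuous_map_preimage[OF \<gamma> openin_spine[OF us]])
    qed
    also have "(\<Union>v\<in>V. ?O v) = {\<tau> \<in> topspace unit_interval. spine us (\<gamma> \<tau>) \<in> V}"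
      using pos \<gamma> by (auto simp: continuous_map_def)
    finally show "openin unit_interval {\<tau> \<in> topspace unit_interval. spine us (\<gamma> \<tau>) \<in> V}" .
  qed auto
  moreover have "connectedin unit_interval {0..1}"
    by (simp add: connectedin_subtopology connectedin_iff_connected)
  ultimately have "connectedin (discrete_topology UNIV) ((\<lambda>\<tau>. spine us (\<gamma> \<tau>)) ` {0..1})"
    by (rule connectedin_continuous_map_image)
  then obtain a where "(\<lambda>\<tau>. spine us (\<gamma> \<tau>)) ` {0..1} \<subseteq> {a}" unfolding connectedin_discrete_topology by blast
  moreover have "0 \<in> {0..1::real}" "1 \<in> {0..1::real}" by auto
  ultimately show ?thesis by blast
qed

section \<open>Comparing a lifted map with its approximation\<close>

text \<open>The weight \<open>A\<close> of the first copy of labels scales the coefficients of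
  \<open>phiR\<close>. For \<open>A\<close> = 0 the point \<open>z\<close> itself is evaluated,
  which gives \<open>kap\<close>. For \<open>A\<close> = 1 all weight sits on the spine, which by
  \<open>spine_path\<close> is the same at s and at the barycentre; so the first half is the point
  \<open>phiR\<close> in the realization.\<close>

lemma stage_two:
  fixes z :: "(nat \<Rightarrow> real) \<Rightarrow> ((nat \<Rightarrow> real) \<Rightarrow> 'x) prepoint"
  assumes z: "continuous_map (cube n) (fat X) z" and x0: "x0 \<in> simplices (Sing X) 0"
    and bd: "\<And>s. s \<in> collar n \<Longrightarrow> z s = nf ((0, x0), e0)"
    and net: "net n zs \<delta>" "\<delta> \<le> 1/12" and ws: "length ws = length zs" and \<kappa>: "0 < \<kappa>"
    and box: "\<And>l s. l < length zs \<Longrightarrow> s \<in> bx n (3 * \<delta>) (zs ! l) \<Longrightarrow> \<kappa> \<le> rmp (ws ! l) (z s)"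
  shows "rbh n (realization (Sing X)) (rc X ((0, x0), e0))
    (\<lambda>s. phiR X ws (\<lambda>l. if l < length zs then rho n zs \<delta> l s / max \<kappa> (rmp (ws ! l) (z s)) else 0) (z s))
    (kap n X (\<lambda>s. ev (rc X (z s))) zs \<delta>)"
proof -
  let ?N = "length zs" and ?v = "rc X ((0, x0), e0)"
  define y where "y \<xi> = bary n zs (\<lambda>l. \<xi> (False, l) + \<xi> (True, l))" for \<xi> :: "bool \<times> nat \<Rightarrow> real"
  define A where "A \<xi> = (\<Sum>l<?N. \<xi> (False, l))" for \<xi> :: "bool \<times> nat \<Rightarrow> real"
  \<comment> \<open>Dividing by the room turns the weight of the mark into the prescribed one. The
    lower bound \<open>\<kappa>\<close> keeps the quotient bounded where the mark has little room
    and the weight vanishes anyway.\<close>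
  define cf where "cf \<xi> l = (if l < ?N then A \<xi> * (\<xi> (False, l) + \<xi> (True, l)) / max \<kappa> (rmp (ws ! l) (z (y \<xi>))) else 0)" for \<xi> l
  define F where "F \<xi> = ev (phiR X ws (cf \<xi>) (z (y \<xi>)))" for \<xi>
  have N: "0 < ?N" by (rule net_nonempty[OF net(1)])
  have mx: "0 < max \<kappa> r" "max \<kappa> r \<noteq> 0" for r using \<kappa> by auto
  have zin: "z s \<in> topspace (fat X)" if "s \<in> topspace (cube n)" for s
    using z that by (auto simp: continuous_map_def)
  let ?S = "simplex_space (length (items ?N) - 1)"
  have pr: "prob_fun (UNIV \<times> {l. l < ?N \<and> True}) (push (items ?N) c)" if "c \<in> topspace ?S" for c
    using that N by (intro items_prob) auto
  have yc: "continuous_map ?S (cube n) (\<lambda>c. y (push (items ?N) c))"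
    unfolding y_def by (rule continuous_items_bary[OF net(1)])
  have zc: "continuous_map ?S (fat X) (\<lambda>c. z (y (push (items ?N) c)))"
    using continuous_map_compose[OF yc z] by (simp add: o_def)
  have rmc: "continuous_map ?S euclideanreal (\<lambda>c. rmp w (z (y (push (items ?N) c))))" for w
    using continuous_map_compose[OF zc continuous_rmp] by (simp add: o_def)
  have F: "continuous_map ?S X (\<lambda>c. F (push (items ?N) c))"
  proof -
    have "continuous_map ?S (realization (Sing X)) (\<lambda>c. phiR X ws (cf (push (items ?N) c)) (z (y (push (items ?N) c))))"
    proof (rule continuous_phiR[OF zc, where M = "1/\<kappa>"])
      fix l show "continuous_map ?S euclideanreal (\<lambda>c. cf (push (items ?N) c) l)"
      proof (cases "l < ?N")
        case True
        show ?thesis unfolding cf_def A_def if_P[OF True]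
          by (intro continuous_map_real_divide continuous_map_real_mult continuous_map_sum continuous_map_add
            continuous_push_coord continuous_map_real_max rmc) (simp_all add: mx)
      qed (simp add: cf_def)
    next
      fix c l assume "c \<in> topspace ?S"
      note p = prob_bool_nat[OF pr[OF this]]
      let ?\<xi> = "push (items ?N) c"
      have a: "0 \<le> A ?\<xi>" "A ?\<xi> \<le> 1" unfolding A_def using p(4,5) by (auto intro: sum_nonneg)
      show "0 \<le> cf ?\<xi> l \<and> cf ?\<xi> l \<le> 1/\<kappa>"
      proof (cases "l < ?N")
        case True
        have "?\<xi> (False, l) + ?\<xi> (True, l) \<le> (\<Sum>l<?N. ?\<xi> (False, l) + ?\<xi> (True, l))"
          by (rule member_le_sum[of l "{..<?N}" "\<lambda>l. ?\<xi> (False, l) + ?\<xi> (True, l)"]) (use True p(3) in auto)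
        then have e: "?\<xi> (False, l) + ?\<xi> (True, l) \<le> 1" using p(1) by simp
        have m: "A ?\<xi> * (?\<xi> (False, l) + ?\<xi> (True, l)) \<le> 1" using a e p(3) by (intro mult_le_one) auto
        have m0: "0 \<le> A ?\<xi> * (?\<xi> (False, l) + ?\<xi> (True, l))" using a(1) p(3) by (intro mult_nonneg_nonneg)
        have "A ?\<xi> * (?\<xi> (False, l) + ?\<xi> (True, l)) / max \<kappa> (rmp (ws ! l) (z (y ?\<xi>))) \<le> 1 / \<kappa>"
          by (rule frac_le) (use m m0 \<kappa> in auto)
        moreover have "0 \<le> A ?\<xi> * (?\<xi> (False, l) + ?\<xi> (True, l)) / max \<kappa> (rmp (ws ! l) (z (y ?\<xi>)))"
          by (rule divide_nonneg_pos[OF m0 mx(1)])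
        ultimately show ?thesis using True by (simp add: cf_def)
      qed (use \<kappa> in \<open>simp add: cf_def\<close>)
    qed
    from continuous_map_compose[OF this continuous_ev] show ?thesis by (simp add: F_def o_def)
  qed
  have cf0: "0 \<le> cf \<xi> l" if "\<And>b l. 0 \<le> \<xi> (b, l)" for \<xi> :: "bool \<times> nat \<Rightarrow> real" and l
    unfolding cf_def A_def using that mx(1) by (auto intro!: divide_nonneg_pos mult_nonneg_nonneg sum_nonneg add_nonneg_nonneg)
  have "rbh n (realization (Sing X)) ?v
    (\<lambda>s. rc X (lpt F (map (\<lambda>l. ((False, l), rho n zs \<delta> l s)) [0..<?N])))
    (\<lambda>s. rc X (lpt F (map (\<lambda>l. ((True, l), rho n zs \<delta> l s)) [0..<?N])))"
  proof (rule two_lists[OF net(1) x0 F])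
    fix s and \<xi> :: "bool \<times> nat \<Rightarrow> real" assume s: "s \<in> cube_boundary n" and p: "prob_fun (UNIV \<times> {l. l < ?N \<and> rho n zs \<delta> l s \<noteq> 0}) \<xi>"
    have "y \<xi> \<in> collar n" unfolding y_def
      by (rule boundary_bary[OF net(1) _ s]) (use prob_bool_nat[OF p] net(2) in auto)
    then have "phiR X ws (cf \<xi>) (z (y \<xi>)) = ?v"
      unfolding bd[OF \<open>y \<xi> \<in> collar n\<close>] by (intro phiR_vertex[OF x0] cf0 prob_bool_nat(4)[OF p])
    then show "F \<xi> = x0 e0" by (simp add: F_def ev_rc)
  qed
  moreover have "rc X (lpt F (map (\<lambda>l. ((True, l), rho n zs \<delta> l s)) [0..<?N])) = kap n X (\<lambda>s. ev (rc X (z s))) zs \<delta> s" for s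
    unfolding lpt_Pair kap_def
  proof (rule arg_cong[where f = "rc X"], rule lpt_cong)
    fix \<xi> :: "nat \<Rightarrow> real" assume "prob_fun (fst ` set (map (\<lambda>l. (l, rho n zs \<delta> l s)) [0..<?N])) \<xi>"
    then have p: "prob_fun {..<?N} \<xi>" by (rule prob_fun_mono) auto
    let ?\<xi> = "\<lambda>(b', l). if b' = True then \<xi> l else 0"
    have 1: "y ?\<xi> = bary n zs \<xi>" by (simp add: y_def)
    have 2: "cf ?\<xi> = (\<lambda>_. 0)" by (auto simp: cf_def A_def fun_eq_iff)
    have "bary n zs \<xi> \<in> topspace (cube n)" using p net(1) by (intro bary_in) (auto simp: prob_fun_def net_def)
    then have "phiR X ws (\<lambda>_. 0) (z (bary n zs \<xi>)) = rc X (z (bary n zs \<xi>))" by (intro phiR_zero zin)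
    then show "F ?\<xi> = ev (rc X (z (bary n zs \<xi>)))" unfolding F_def 1 2 by simp
  qed (use N in simp)
  moreover have "rc X (lpt F (map (\<lambda>l. ((False, l), rho n zs \<delta> l s)) [0..<?N])) =
    phiR X ws (\<lambda>l. if l < ?N then rho n zs \<delta> l s / max \<kappa> (rmp (ws ! l) (z s)) else 0) (z s)"
    if s: "s \<in> topspace (cube n)" for s
  proof -
    define ls where "ls = filter (\<lambda>l. rho n zs \<delta> l s \<noteq> 0) [0..<?N]"
    define us where "us = map ((!) ws) ls"
    have ls: "l < ?N" "rho n zs \<delta> l s \<noteq> 0" if "l \<in> set ls" for l using that by (auto simp: ls_def)
    have dist: "distinct ls" by (simp add: ls_def)
    have near: "\<bar>s i - (zs ! l) i\<bar> < \<delta>" if "l \<in> set ls" "i < n" for l i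
      by (rule rho_facts(3)[OF net(1) ls(2)[OF that(1)] that(2)])
    have pos3: "\<kappa> \<le> rmp (ws ! l) (z p)" if "l \<in> set ls" "p \<in> topspace (cube n)" "\<And>i. i < n \<Longrightarrow> \<bar>p i - (zs ! l) i\<bar> < 3 * \<delta>" for p l
      using that ls(1) by (intro box) (auto simp: bx_def)
    have pos: "\<kappa> \<le> rmp (ws ! l) (z s)" if "l \<in> set ls" for l
      using near[OF that] net(1) by (intro pos3[OF that s]) (fastforce simp: net_def)
    let ?c = "\<lambda>l. if l < ?N then rho n zs \<delta> l s / max \<kappa> (rmp (ws ! l) (z s)) else 0"
    have lss: "ls = filter (\<lambda>l. rho n zs \<delta> l s \<noteq> 0) [0..<length ws]" by (simp add: ls_def ws)
    have cm: "?c l * rmp (ws ! l) (z s) = rho n zs \<delta> l s" if "l < ?N" for l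
    proof (cases "rho n zs \<delta> l s = 0")
      case False
      then have "l \<in> set ls" using that by (simp add: ls_def)
      then have "max \<kappa> (rmp (ws ! l) (z s)) = rmp (ws ! l) (z s)" "rmp (ws ! l) (z s) \<noteq> 0" using pos \<kappa> by force+
      then show ?thesis using that by simp
    qed simp
    have R: "phiR X ws ?c (z s) = rc X ((length ls - 1, spine us (z s)), \<lambda>j. if j < length ls then ?c (ls ! j) * rmp (ws ! (ls ! j)) (z s) else 0)"
      unfolding us_def lss
    proof (rule phiR_spine[OF zin[OF s]])
      show "0 \<le> ?c l" for l using rho_facts(1)[OF net(1)] mx(1) by (auto intro: divide_nonneg_pos)
      show "(\<Sum>l<length ws. ?c l * rmp (ws ! l) (z s)) = 1"
        using cm rho_facts(2)[OF net(1) s] by (simp add: ws)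
      fix l assume l: "l < length ws"
      { assume "rho n zs \<delta> l s \<noteq> 0" then have "l \<in> set ls" using l by (simp add: ls_def ws)
        then show "0 < rmp (ws ! l) (z s)" using pos[of l] \<kappa> by linarith }
      { assume "\<not> rho n zs \<delta> l s \<noteq> 0" then show "?c l = 0" by simp }
    qed
    let ?M = "map (\<lambda>l. ((False, l), rho n zs \<delta> l s)) [0..<?N]"
    have nzM: "nz ?M = map (\<lambda>l. ((False, l), rho n zs \<delta> l s)) ls" by (simp add: nz_def filter_map o_def ls_def)
    have wM: "weighted ?M" by (rule weighted_enum[OF net(1) s])
    have "weighted (nz ?M)" using wM by simp
    then have ne: "ls \<noteq> []" unfolding nzM using weighted_nonempty by blast
    have SM: "lsimp F (map fst ?M) \<in> simplices (Sing X) (length ?M - 1)"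
      using lsimp_half[OF lsimp_Sing_general[OF F] N, of False] by (simp add: o_def)
    have sp: "F (push (map (Pair False) ls) c) = spine us (z s) c" if c: "c \<in> standard_simplex (length ls - 1)" for c
    proof -
      define \<xi> where "\<xi> = push (map (Pair False) ls) c"
      define e where "e = push ls c"
      have p: "prob_fun (set ls) e" unfolding e_def by (rule push_prob[OF c ne])
      have e: "\<xi> (False, l) + \<xi> (True, l) = e l" "\<xi> (False, l) = e l" for l by (simp_all add: \<xi>_def e_def push_Pair)
      have \<xi>0: "0 \<le> \<xi> (b, l)" for b l using p by (cases b) (simp_all add: \<xi>_def e_def push_Pair prob_fun_def)
      have "prob_fun {..<?N} e" by (rule prob_fun_mono[OF p]) (use ls(1) in auto)
      then have e1: "(\<Sum>l<?N. e l) = 1" and e0: "\<And>l. 0 \<le> e l" by (simp_all add: prob_fun_def)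
      have es: "l \<in> set ls" if "e l \<noteq> 0" for l using p that by (auto simp: prob_fun_def)
      have A1: "A \<xi> = 1" using e1 by (simp only: A_def e(2))
      have ye: "y \<xi> = bary n zs e" by (simp only: y_def e(1))
      have yin: "y \<xi> \<in> topspace (cube n)" unfolding ye using e0 e1 net(1) by (intro bary_in) (auto simp: net_def)
      \<comment> \<open>A barycentre of net points within \<open>\<delta>\<close> of s, each within
        twice \<open>\<delta>\<close> of the given one. The segment from s to it stays in the box of
        size three times \<open>\<delta>\<close>.\<close>
      have ynear: "\<bar>y \<xi> i - (zs ! l) i\<bar> < 2 * \<delta>" if l: "l \<in> set ls" and i: "i < n" for l i
        unfolding ye
      proof (rule bary_near[OF e0 e1 _ i])
        fix l' assume "e l' \<noteq> 0"
        then have "\<bar>s i - (zs ! l') i\<bar> < \<delta>" by (rule near[OF es i])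
        then show "\<bar>(zs ! l') i - (zs ! l) i\<bar> < 2 * \<delta>" using near[OF l i] by linarith
      qed
      let ?seg = "\<lambda>\<tau>. restrict (\<lambda>i. (1 - \<tau>) * s i + \<tau> * y \<xi> i) {..<n}"
      have segin: "?seg \<tau> \<in> topspace (cube n)" if "0 \<le> \<tau>" "\<tau> \<le> 1" for \<tau>
        using s yin that by (auto simp: topspace_cube PiE_iff intro!: convex_bound_le add_nonneg_nonneg mult_nonneg_nonneg)
      have segc: "continuous_map unit_interval (cube n) ?seg"
      proof (rule continuous_map_cubeI)
        show "continuous_map unit_interval euclideanreal (\<lambda>\<tau>. ?seg \<tau> i)" if "i < n" for i
          using that by simp (intro continuous_intros)
      qed (use segin in auto)
      have segnear: "\<bar>?seg \<tau> i - (zs ! l) i\<bar> < 3 * \<delta>" if t: "0 \<le> \<tau>" "\<tau> \<le> 1" and l: "l \<in> set ls" and i: "i < n" for \<tau> l i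
      proof -
        have "\<bar>(1 - \<tau>) * s i + \<tau> * y \<xi> i - (zs ! l) i\<bar> = \<bar>(1 - \<tau>) * (s i - (zs ! l) i) + \<tau> * (y \<xi> i - (zs ! l) i)\<bar>"
          by (simp add: algebra_simps)
        also have "\<dots> \<le> \<bar>(1 - \<tau>) * (s i - (zs ! l) i)\<bar> + \<bar>\<tau> * (y \<xi> i - (zs ! l) i)\<bar>" by (rule abs_triangle_ineq)
        also have "\<dots> = (1 - \<tau>) * \<bar>s i - (zs ! l) i\<bar> + \<tau> * \<bar>y \<xi> i - (zs ! l) i\<bar>" using t by (simp add: abs_mult)
        also have "\<dots> \<le> 2 * \<delta>"
          by (rule convex_bound_le) (use near[OF l i] ynear[OF l i] t net(1) in \<open>auto simp: net_def\<close>)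
        also have "\<dots> < 3 * \<delta>" using net(1) by (simp add: net_def)
        finally show ?thesis using i by simp
      qed
      \<comment> \<open>All marks in \<open>us\<close> keep room along the segment, so the selected
        face does not change.\<close>
      have "spine us (z (?seg 0)) = spine us (z (?seg 1))"
      proof (rule spine_path)
        show "continuous_map unit_interval (fat X) (\<lambda>\<tau>. z (?seg \<tau>))"
          using continuous_map_compose[OF segc z] by (simp add: o_def)
        show "0 < rmp w (z (?seg \<tau>))" if t: "0 \<le> \<tau>" "\<tau> \<le> 1" and "w \<in> set us" for \<tau> w
        proof -
          obtain l where l: "l \<in> set ls" "w = ws ! l" using \<open>w \<in> set us\<close> by (auto simp: us_def)
          show ?thesis unfolding l(2) by (rule less_le_trans[OF \<kappa> pos3[OF l(1) segin[OF t] segnear[OF t l(1)]]])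
        qed
      qed (use ne in \<open>simp add: us_def\<close>)
      moreover have "?seg 0 = s" using s by (auto simp: topspace_cube PiE_iff extensional_def fun_eq_iff)
      moreover have "?seg 1 = y \<xi>" using yin by (auto simp: topspace_cube PiE_iff extensional_def fun_eq_iff)
      ultimately have spy: "spine us (z s) = spine us (z (y \<xi>))" by simp
      have posy: "\<kappa> \<le> rmp (ws ! l) (z (y \<xi>))" if "l \<in> set ls" for l
        by (rule pos3[OF that yin]) (use ynear[OF that] net(1) in \<open>fastforce simp: net_def\<close>)
      have cfe: "cf \<xi> l = e l / max \<kappa> (rmp (ws ! l) (z (y \<xi>)))" if "l < ?N" for l
        unfolding cf_def if_P[OF that] A1 e(1) by simp
      have cfm: "cf \<xi> l * rmp (ws ! l) (z (y \<xi>)) = e l" if "l < ?N" for l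
      proof (cases "e l = 0")
        case False
        then have "max \<kappa> (rmp (ws ! l) (z (y \<xi>))) = rmp (ws ! l) (z (y \<xi>))" "rmp (ws ! l) (z (y \<xi>)) \<noteq> 0" using posy[OF es] \<kappa> by force+
        then show ?thesis using cfe[OF that] by simp
      qed (simp add: cfe[OF that])
      have "phiR X ws (cf \<xi>) (z (y \<xi>)) = rc X ((length ls - 1, spine us (z (y \<xi>))), \<lambda>j. if j < length ls then cf \<xi> (ls ! j) * rmp (ws ! (ls ! j)) (z (y \<xi>)) else 0)"
        unfolding us_def lss
      proof (rule phiR_spine[OF zin[OF yin]])
        show "0 \<le> cf \<xi> l" for l by (rule cf0) (rule \<xi>0)
      next
        show "(\<Sum>l<length ws. cf \<xi> l * rmp (ws ! l) (z (y \<xi>))) = 1" using cfm e1 by (simp add: ws)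
        fix l assume l: "l < length ws"
        { assume "rho n zs \<delta> l s \<noteq> 0" then have "l \<in> set ls" using l by (simp add: ls_def ws)
          then show "0 < rmp (ws ! l) (z (y \<xi>))" using posy[of l] \<kappa> by linarith }
        { assume "\<not> rho n zs \<delta> l s \<noteq> 0"
          then have "e l = 0" using es[of l] by (auto simp: ls_def)
          then show "cf \<xi> l = 0" using cfe[of l] l by (simp add: ws) }
      qed
      \<comment> \<open>The indices in \<open>ls\<close> are distinct, so pushing forward along
        \<open>ls\<close> and reading off at \<open>ls ! j\<close> returns the coordinate
        \<open>c j\<close>.\<close>
      moreover have "(\<lambda>j. if j < length ls then cf \<xi> (ls ! j) * rmp (ws ! (ls ! j)) (z (y \<xi>)) else 0) = c"
      proof
        fix j show "(if j < length ls then cf \<xi> (ls ! j) * rmp (ws ! (ls ! j)) (z (y \<xi>)) else 0) = c j"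
        proof (cases "j < length ls")
          case True
          have "{i. i < length ls \<and> ls ! i = ls ! j} = {j}" using True dist by (auto simp: nth_eq_iff_index_eq)
          then have "e (ls ! j) = c j" by (simp add: e_def push_def)
          then show ?thesis using True cfm[of "ls ! j"] ls(1)[OF nth_mem[OF True]] by simp
        next
          case False
          then have "j > length ls - 1" using ne by (cases ls) auto
          then show ?thesis using c False by (simp add: standard_simplex_def)
        qed
      qed
      ultimately show ?thesis by (simp add: F_def ev_rc spy flip: \<xi>_def)
    qed
    have "rc X (lpt F ?M) = rc X (lpt F (nz ?M))" by (rule rc_lpt_nz[OF wM SM, symmetric])
    also have "\<dots> = rc X ((length ls - 1, lsimp F (map (Pair False) ls)), wt (map (\<lambda>l. ((False, l), rho n zs \<delta> l s)) ls))"
      unfolding nzM by (simp add: lpt_def o_def)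
    also have "lsimp F (map (Pair False) ls) = spine us (z s)"
    proof -
      obtain k x t where "z s = ((k, x), t)" by (metis prod.exhaust)
      then have "spine us (z s) \<in> extensional (standard_simplex (length ls - 1))" by (simp add: spine_def lsimp_def us_def)
      then show ?thesis using sp by (auto simp: lsimp_def fun_eq_iff restrict_def extensional_def)
    qed
    also have "wt (map (\<lambda>l. ((False, l), rho n zs \<delta> l s)) ls) = (\<lambda>j. if j < length ls then ?c (ls ! j) * rmp (ws ! (ls ! j)) (z s) else 0)"
    proof
      fix j show "wt (map (\<lambda>l. ((False, l), rho n zs \<delta> l s)) ls) j = (if j < length ls then ?c (ls ! j) * rmp (ws ! (ls ! j)) (z s) else 0)"
        using cm[of "ls ! j"] ls(1)[OF nth_mem[of j ls]] by (auto simp: wt_def)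
    qed
    finally show ?thesis unfolding R .
  qed
  ultimately show ?thesis unfolding rbh_iff by auto
qed

text \<open>The coefficients of \<open>phiR\<close> grow from 0, where \<open>phiR\<close> is the
  projection of \<open>z\<close> to the realization.\<close>

lemma stage_one:
  fixes z :: "(nat \<Rightarrow> real) \<Rightarrow> ((nat \<Rightarrow> real) \<Rightarrow> 'x) prepoint"
  assumes z: "continuous_map (cube n) (fat X) z" and x0: "x0 \<in> simplices (Sing X) 0"
    and bd: "\<And>s. s \<in> cube_boundary n \<Longrightarrow> z s = nf ((0, x0), e0)"
    and net: "net n zs \<delta>" and \<kappa>: "0 < \<kappa>"
  shows "rbh n (realization (Sing X)) (rc X ((0, x0), e0)) (\<lambda>s. rc X (z s))
    (\<lambda>s. phiR X ws (\<lambda>l. if l < length zs then rho n zs \<delta> l s / max \<kappa> (rmp (ws ! l) (z s)) else 0) (z s))"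
proof -
  let ?N = "length zs" and ?T = "prod_topology unit_interval (cube n)"
  let ?c = "\<lambda>\<tau> s l. if l < ?N then \<tau> * (rho n zs \<delta> l s / max \<kappa> (rmp (ws ! l) (z s))) else 0"
  have mx: "0 < max \<kappa> r" "max \<kappa> r \<noteq> 0" for r using \<kappa> by auto
  have zc: "continuous_map ?T (fat X) (\<lambda>p. z (snd p))"
    using continuous_map_compose[OF continuous_map_snd z] by (simp add: o_def)
  have rmc: "continuous_map ?T euclideanreal (\<lambda>p. rmp w (z (snd p)))" for w
    using continuous_map_compose[OF zc continuous_rmp] by (simp add: o_def)
  have cfst: "continuous_map ?T euclideanreal fst"
    using continuous_map_fst[of unit_interval] continuous_map_in_subtopology by blast
  have crho: "continuous_map ?T euclideanreal (\<lambda>p. rho n zs \<delta> l (snd p))" for l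
    using continuous_map_compose[OF continuous_map_snd rho_facts(4)[OF net]] by (simp add: o_def)
  have b: "0 \<le> ?c \<tau> s l \<and> ?c \<tau> s l \<le> 1/\<kappa>" if t: "0 \<le> \<tau>" "\<tau> \<le> 1" and s: "s \<in> topspace (cube n)" for \<tau> s l
  proof (cases "l < ?N")
    case True
    have "rho n zs \<delta> l s \<le> (\<Sum>l<?N. rho n zs \<delta> l s)"
      by (rule member_le_sum) (use True rho_facts(1)[OF net] in auto)
    then have "rho n zs \<delta> l s \<le> 1" using rho_facts(2)[OF net s] by simp
    then have 1: "rho n zs \<delta> l s / max \<kappa> (rmp (ws ! l) (z s)) \<le> 1 / \<kappa>"
      by (intro frac_le) (use rho_facts(1)[OF net] \<kappa> in auto)
    have 0: "0 \<le> rho n zs \<delta> l s / max \<kappa> (rmp (ws ! l) (z s))"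
      by (rule divide_nonneg_pos[OF rho_facts(1)[OF net] mx(1)])
    have "\<tau> * (rho n zs \<delta> l s / max \<kappa> (rmp (ws ! l) (z s))) \<le> 1 * (rho n zs \<delta> l s / max \<kappa> (rmp (ws ! l) (z s)))"
      by (rule mult_right_mono[OF t(2) 0])
    then show ?thesis using True 1 mult_nonneg_nonneg[OF t(1) 0] by (simp only: if_True mult_1 simp_thms)
  qed (use \<kappa> in simp)
  have C: "continuous_map ?T (realization (Sing X)) (\<lambda>p. phiR X ws (?c (fst p) (snd p)) (z (snd p)))"
  proof (rule continuous_phiR[OF zc, where M = "1/\<kappa>"])
    fix l show "continuous_map ?T euclideanreal (\<lambda>p. ?c (fst p) (snd p) l)"
    proof (cases "l < ?N")
      case True
      show ?thesis unfolding if_P[OF True]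
        by (intro continuous_map_real_mult continuous_map_real_divide continuous_map_real_max cfst crho rmc) (simp_all add: mx)
    qed simp
  next
    fix p l assume p: "p \<in> topspace ?T"
    show "0 \<le> ?c (fst p) (snd p) l \<and> ?c (fst p) (snd p) l \<le> 1/\<kappa>" by (rule b) (use p in auto)
  qed
  show ?thesis
  proof (rule rbhI[OF C])
    show "phiR X ws (?c 0 s) (z s) = rc X (z s)" if "s \<in> topspace (cube n)" for s
    proof -
      have "z s \<in> topspace (fat X)" using z that by (auto simp: continuous_map_def)
      moreover have "?c 0 s = (\<lambda>_. 0)" by auto
      ultimately show ?thesis by (simp only: phiR_zero)
    qed
    show "phiR X ws (?c 1 s) (z s) = phiR X ws (\<lambda>l. if l < ?N then rho n zs \<delta> l s / max \<kappa> (rmp (ws ! l) (z s)) else 0) (z s)" for s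
      by (simp only: mult_1)
    show "phiR X ws (?c \<tau> s) (z s) = rc X ((0, x0), e0)" if "0 \<le> \<tau>" "\<tau> \<le> 1" "s \<in> cube_boundary n" for \<tau> s
    proof -
      have "s \<in> topspace (cube n)" using that(3) cube_boundary_sub by blast
      then have c: "0 \<le> ?c \<tau> s l" for l using b[OF that(1,2)] by blast
      have "phiR X ws (?c \<tau> s) (nf ((0, x0), e0)) = rc X ((0, x0), e0)" by (rule phiR_vertex[OF x0]) (rule c)
      then show ?thesis unfolding bd[OF that(3)] .
    qed
  qed
qed

text \<open>Half of the first positive weight is a mark in the interior of the first interval of
  positive length.\<close>

lemma rm_positive:
  assumes "z \<in> topspace (fat X)" obtains w where "0 < rmp w z"
proof -
  obtain k x t where z: "z = ((k, x), t)" "x \<in> simplices (Sing X) k" "t \<in> standard_simplex k" "nf z = z"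
    by (rule fat_point[OF assms])
  have w: "weighted (coords k t)" by (rule coords_weighted[OF z(3)])
  then have "nz (coords k t) \<noteq> []" by (intro weighted_nonempty) simp
  then obtain p L where L: "nz (coords k t) = p # L" by (cases "nz (coords k t)") auto
  have "p \<in> set (nz (coords k t))" using L by simp
  then have p: "0 < snd p" using w by (auto simp: nz_def weighted_def less_le)
  have "0 \<le> sum_list (rooms (snd p / 2) (snd p) L)" by (rule sum_list_nonneg) (rule rooms_nonneg)
  then have "0 < rm (snd p / 2) (nz (coords k t))" using p unfolding L rm_def by simp
  then have "0 < rmp (snd p / 2) z" by (simp add: rmp_def z(1) rm_nz)
  then show thesis by (rule that)
qed

lemma bx_in_open:
  assumes U: "openin (cube n) U" and p: "p \<in> U"
  obtains r where "0 < r" "bx n r p \<subseteq> U"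
proof -
  have "\<exists>V. finite {i \<in> {..<n}. V i \<noteq> topspace unit_interval} \<and> (\<forall>i\<in>{..<n}. openin unit_interval (V i)) \<and> p \<in> Pi\<^sub>E {..<n} V \<and> Pi\<^sub>E {..<n} V \<subseteq> U"
    using U p unfolding cube_def openin_product_topology_alt by blast
  then obtain V where V: "\<And>i. i < n \<Longrightarrow> openin unit_interval (V i)" "p \<in> Pi\<^sub>E {..<n} V" "Pi\<^sub>E {..<n} V \<subseteq> U" by auto
  have "\<exists>r>0. \<forall>x\<in>{0..1}. \<bar>x - p i\<bar> < r \<longrightarrow> x \<in> V i" if i: "i < n" for i
  proof -
    have "p i \<in> V i" using V(2) i by auto
    then obtain r where "0 < r" "\<forall>x\<in>{0..1}. dist x (p i) < r \<longrightarrow> x \<in> V i"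
      using V(1)[OF i] unfolding openin_euclidean_subtopology_iff by blast
    then show ?thesis by (auto simp: dist_real_def)
  qed
  then obtain r where r: "\<And>i. i < n \<Longrightarrow> 0 < r i \<and> (\<forall>x\<in>{0..1}. \<bar>x - p i\<bar> < r i \<longrightarrow> x \<in> V i)" by metis
  define R where "R = Min (insert 1 (r ` {..<n}))"
  have "0 < R" using r by (simp add: R_def)
  moreover have Rr: "R \<le> r i" if "i < n" for i unfolding R_def using that by (intro Min_le) auto
  have "bx n R p \<subseteq> U"
  proof
    fix s assume s: "s \<in> bx n R p"
    have "s i \<in> V i" if "i < n" for i
    proof -
      have "s i \<in> {0..1}" "\<bar>s i - p i\<bar> < R" using s that by (auto simp: bx_def topspace_cube)
      then show ?thesis using r[OF that] Rr[OF that] by (meson less_le_trans)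
    qed
    moreover have "s \<in> extensional {..<n}" using s by (simp add: bx_def topspace_cube PiE_def)
    ultimately have "s \<in> Pi\<^sub>E {..<n} V" by (simp add: PiE_iff)
    then show "s \<in> U" using V(3) by blast
  qed
  ultimately show thesis by (rule that)
qed

text \<open>Every point of the cube has a mark that keeps room on a whole box around it. A finite
  subcover gives a common lower bound \<open>\<kappa>\<close> and a scale \<open>\<delta>0\<close>;
  each net point takes the mark of a box that contains it.\<close>

lemma kap_approximation:
  fixes z :: "(nat \<Rightarrow> real) \<Rightarrow> ((nat \<Rightarrow> real) \<Rightarrow> 'x) prepoint"
  assumes z: "continuous_map (cube n) (fat X) z" and x0: "x0 \<in> simplices (Sing X) 0"
    and bd: "\<And>s. s \<in> collar n \<Longrightarrow> z s = nf ((0, x0), e0)"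
  obtains \<delta>0 where "0 < \<delta>0"
    "\<And>\<delta> zs. net n zs \<delta> \<Longrightarrow> \<delta> \<le> \<delta>0 \<Longrightarrow> rbh n (realization (Sing X)) (rc X ((0, x0), e0))
      (\<lambda>s. rc X (z s)) (kap n X (\<lambda>s. ev (rc X (z s))) zs \<delta>)"
proof -
  have zin: "z s \<in> topspace (fat X)" if "s \<in> topspace (cube n)" for s
    using z that by (auto simp: continuous_map_def)
  have "\<exists>w r. 0 < r \<and> 0 < rmp w (z p) \<and> (\<forall>s\<in>bx n (2 * r) p. rmp w (z p) / 2 < rmp w (z s))" if p: "p \<in> topspace (cube n)" for p
  proof -
    obtain w where w: "0 < rmp w (z p)" by (rule rm_positive[OF zin[OF p]])
    have "continuous_map (cube n) euclideanreal (\<lambda>s. rmp w (z s))"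
      using continuous_map_compose[OF z continuous_rmp] by (simp add: o_def)
    then have "openin (cube n) {s \<in> topspace (cube n). rmp w (z s) \<in> {rmp w (z p) / 2 <..}}"
      by (rule openin_continuous_map_preimage) simp
    then obtain r where r: "0 < r" "bx n r p \<subseteq> {s \<in> topspace (cube n). rmp w (z s) \<in> {rmp w (z p) / 2 <..}}"
      by (rule bx_in_open) (use p w in auto)
    have "\<forall>s\<in>bx n (2 * (r/2)) p. rmp w (z p) / 2 < rmp w (z s)" using r(2) by auto
    then show ?thesis using r(1) w by (intro exI[of _ w] exI[of _ "r/2"]) auto
  qed
  then obtain w r where wr: "\<And>p. p \<in> topspace (cube n) \<Longrightarrow> 0 < r p \<and> 0 < rmp (w p) (z p) \<and> (\<forall>s\<in>bx n (2 * r p) p. rmp (w p) (z p) / 2 < rmp (w p) (z s))"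
    by metis
  obtain P where P: "finite P" "P \<subseteq> topspace (cube n)" "topspace (cube n) \<subseteq> (\<Union>p\<in>P. bx n (r p) p)"
    by (rule cube_finite_subcover[of n r]) (use wr in auto)
  define \<kappa> where "\<kappa> = Min (insert 1 ((\<lambda>p. rmp (w p) (z p) / 2) ` P))"
  \<comment> \<open>With \<open>\<delta>\<close> at most \<open>r p / 3\<close>, a box of size three
    times \<open>\<delta>\<close> about a net point in the box of \<open>p\<close> lies in the box
    of twice the radius.\<close>
  define \<delta>0 where "\<delta>0 = Min (insert (1/12) ((\<lambda>p. r p / 3) ` P))"
  have \<kappa>: "0 < \<kappa>" and d0: "0 < \<delta>0" using wr P(1,2) by (auto simp: \<kappa>_def \<delta>0_def)
  have d12: "\<delta>0 \<le> 1/12" unfolding \<delta>0_def using P(1) by (intro Min_le) auto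
  have \<kappa>p: "\<kappa> \<le> rmp (w p) (z p) / 2" if "p \<in> P" for p
    unfolding \<kappa>_def by (rule Min_le) (use that P(1) in auto)
  have dp: "\<delta>0 \<le> r p / 3" if "p \<in> P" for p
    unfolding \<delta>0_def by (rule Min_le) (use that P(1) in auto)
  have "rbh n (realization (Sing X)) (rc X ((0, x0), e0)) (\<lambda>s. rc X (z s)) (kap n X (\<lambda>s. ev (rc X (z s))) zs \<delta>)"
    if net: "net n zs \<delta>" and d: "\<delta> \<le> \<delta>0" for zs \<delta>
  proof -
    have "\<exists>p\<in>P. zs ! l \<in> bx n (r p) p" if "l < length zs" for l
    proof -
      have "zs ! l \<in> topspace (cube n)" using net nth_mem[OF that] by (auto simp: net_def)
      then show ?thesis using P(3) by auto
    qed
    then obtain p where p: "\<And>l. l < length zs \<Longrightarrow> p l \<in> P \<and> zs ! l \<in> bx n (r (p l)) (p l)" by metis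
    define ws where "ws = map (\<lambda>l. w (p l)) [0..<length zs]"
    have box: "\<kappa> \<le> rmp (ws ! l) (z s)" if l: "l < length zs" and s: "s \<in> bx n (3 * \<delta>) (zs ! l)" for l s
    proof -
      have pl: "p l \<in> P" "zs ! l \<in> bx n (r (p l)) (p l)" using p[OF l] by auto
      have "\<bar>s i - p l i\<bar> < 2 * r (p l)" if i: "i < n" for i
      proof -
        have "\<bar>s i - (zs ! l) i\<bar> < 3 * \<delta>" "\<bar>(zs ! l) i - p l i\<bar> < r (p l)" using s pl(2) i by (auto simp: bx_def)
        then show ?thesis using d dp[OF pl(1)] by linarith
      qed
      then have "s \<in> bx n (2 * r (p l)) (p l)" using s by (simp add: bx_def)
      then have "rmp (w (p l)) (z (p l)) / 2 < rmp (w (p l)) (z s)" using wr[of "p l"] pl(1) P(2) by blast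
      then show ?thesis using \<kappa>p[OF pl(1)] l by (simp add: ws_def)
    qed
    have bd': "z s = nf ((0, x0), e0)" if "s \<in> cube_boundary n" for s
    proof (rule bd)
      show "s \<in> collar n" using that by (auto simp: collar_def cube_boundary_def)
    qed
    have d12': "\<delta> \<le> 1/12" using d d12 by linarith
    show ?thesis
      by (rule homotopic_with_trans[OF stage_one[OF z x0 bd' net \<kappa>] stage_two[OF z x0 bd net d12' _ \<kappa> box]]) (simp_all add: ws_def)
  qed
  then show thesis by (rule that[OF d0])
qed

section \<open>Homotopy groups and change of base point\<close>

text \<open>Stretches the inner cube [1/4, 3/4]^n over the unit cube and pushes the collar to the
  boundary, so that based maps become constant on the collar.\<close>

definition clamp :: "nat \<Rightarrow> (nat \<Rightarrow> real) \<Rightarrow> nat \<Rightarrow> real" where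
  "clamp n s = restrict (\<lambda>i. min 1 (max 0 (2 * s i - 1/2))) {..<n}"

lemma clamp_in: "clamp n s \<in> topspace (cube n)"
  by (auto simp: clamp_def topspace_cube)

lemma clamp_collar: "s \<in> collar n \<Longrightarrow> clamp n s \<in> cube_boundary n"
proof -
  assume "s \<in> collar n"
  then obtain i where i: "i < n" "s i \<le> 1/4 \<or> 3/4 \<le> s i" by (auto simp: collar_def)
  then have "clamp n s i = 0 \<or> clamp n s i = 1" by (auto simp: clamp_def)
  then show ?thesis using clamp_in i(1) by (auto simp: cube_boundary_def)
qed

lemma continuous_clamp: "continuous_map (cube n) (cube n) (clamp n)"
proof (rule continuous_map_cubeI)
  fix i assume i: "i < n"
  have "continuous_map (cube n) euclideanreal (\<lambda>s. s i)" by (rule continuous_cube_coord[OF continuous_map_id[unfolded id_def] i])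
  then show "continuous_map (cube n) euclideanreal (\<lambda>s. clamp n s i)"
    using i unfolding clamp_def
    by simp (intro continuous_map_real_min continuous_map_real_max continuous_map_diff continuous_map_real_mult, simp_all)
qed (rule clamp_in)

lemma rbh_refl: "f \<in> based_maps n X x \<Longrightarrow> rbh n X x f f"
  by (simp add: based_maps_def)

lemma rbh_based:
  assumes "rbh n X x f g" shows "f \<in> based_maps n X x" "g \<in> based_maps n X x"
  using homotopic_with_imp_continuous_maps[OF assms] homotopic_with_imp_property[OF assms] by (simp_all add: based_maps_def)

lemmas rbh_trans = homotopic_with_trans[where P = "\<lambda>h. \<forall>s\<in>cube_boundary n. h s = x" and X = "cube n" for n x]
lemmas rbh_sym = homotopic_with_symD[where P = "\<lambda>h. \<forall>s\<in>cube_boundary n. h s = x" and X = "cube n" for n x]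

text \<open>\<open>clamp\<close> fixes the coordinates 0 and 1, so the straight-line homotopy
  preserves the boundary.\<close>

lemma clamp_homotopic:
  assumes f: "f \<in> based_maps n X x"
  shows "rbh n X x (f \<circ> clamp n) f"
proof (rule rbhI)
  let ?m = "\<lambda>\<tau> s. restrict (\<lambda>i. (1 - \<tau>) * clamp n s i + \<tau> * s i) {..<n}"
  let ?T = "prod_topology unit_interval (cube n)"
  have fc: "continuous_map (cube n) X f" "\<And>s. s \<in> cube_boundary n \<Longrightarrow> f s = x" using f by (auto simp: based_maps_def)
  have m: "?m \<tau> s \<in> topspace (cube n)" if "0 \<le> \<tau>" "\<tau> \<le> 1" "s \<in> topspace (cube n)" for \<tau> s
    using clamp_in[of n s] that by (auto simp: topspace_cube PiE_iff intro!: convex_bound_le add_nonneg_nonneg mult_nonneg_nonneg)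
  have cfst: "continuous_map ?T euclideanreal fst"
    using continuous_map_fst[of unit_interval] continuous_map_in_subtopology by blast
  have cc: "continuous_map ?T (cube n) (\<lambda>p. clamp n (snd p))"
    using continuous_map_compose[OF continuous_map_snd continuous_clamp] by (simp add: o_def)
  have "continuous_map ?T (cube n) (\<lambda>p. ?m (fst p) (snd p))"
  proof (rule continuous_map_cubeI)
    fix i assume i: "i < n"
    then show "continuous_map ?T euclideanreal (\<lambda>p. ?m (fst p) (snd p) i)"
      by simp (intro continuous_map_add continuous_map_real_mult continuous_map_diff cfst
          continuous_cube_coord[OF continuous_map_snd i] continuous_cube_coord[OF cc i], simp)
  qed (use m in auto)
  from continuous_map_compose[OF this fc(1)] show "continuous_map ?T X (\<lambda>p. f (?m (fst p) (snd p)))" by (simp add: o_def)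
  show "f (?m 0 s) = (f \<circ> clamp n) s" for s
  proof -
    have "?m 0 s = clamp n s" by (auto simp: clamp_def fun_eq_iff)
    then show ?thesis by simp
  qed
  show "f (?m 1 s) = f s" if "s \<in> topspace (cube n)" for s
  proof -
    have "?m 1 s = s" using that by (auto simp: topspace_cube PiE_iff extensional_def fun_eq_iff)
    then show ?thesis by simp
  qed
  show "f (?m \<tau> s) = x" if t: "0 \<le> \<tau>" "\<tau> \<le> 1" and s: "s \<in> cube_boundary n" for \<tau> s
  proof (rule fc(2))
    obtain i where i: "i < n" "s i = 0 \<or> s i = 1" using s by (auto simp: cube_boundary_def)
    have "?m \<tau> s i = s i" using i by (auto simp: clamp_def)
    then have "\<exists>i<n. ?m \<tau> s i = 0 \<or> ?m \<tau> s i = 1" using i by (intro exI[of _ i]) simp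
    then show "?m \<tau> s \<in> cube_boundary n" using m[OF t, of s] s unfolding cube_boundary_def by blast
  qed
qed

text \<open>The doubled coordinate is cut off at 1 and at 0, which makes both pieces total on the
  cube; on the wall where they meet both lie in the boundary.\<close>

lemma rbh_concat:
  assumes n: "1 \<le> n" and f: "rbh n X x f f'" and g: "rbh n X x g g'"
  shows "rbh n X x (cube_concat f g) (cube_concat f' g')"
proof -
  let ?T = "prod_topology unit_interval (cube n)"
  obtain F where F: "continuous_map ?T X F" "\<And>s. s \<in> topspace (cube n) \<Longrightarrow> F (0, s) = f s" "\<And>s. s \<in> topspace (cube n) \<Longrightarrow> F (1, s) = f' s"
    "\<And>\<tau> s. \<tau> \<in> {0..1} \<Longrightarrow> s \<in> cube_boundary n \<Longrightarrow> F (\<tau>, s) = x" using f[unfolded rbh_iff] by blast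
  obtain G where G: "continuous_map ?T X G" "\<And>s. s \<in> topspace (cube n) \<Longrightarrow> G (0, s) = g s" "\<And>s. s \<in> topspace (cube n) \<Longrightarrow> G (1, s) = g' s"
    "\<And>\<tau> s. \<tau> \<in> {0..1} \<Longrightarrow> s \<in> cube_boundary n \<Longrightarrow> G (\<tau>, s) = x" using g[unfolded rbh_iff] by blast
  let ?a = "\<lambda>s. s(0 := min 1 (2 * s 0)) :: nat \<Rightarrow> real" and ?b = "\<lambda>s. s(0 := max 0 (2 * s 0 - 1)) :: nat \<Rightarrow> real"
  have ab: "?a s \<in> topspace (cube n)" "?b s \<in> topspace (cube n)" if "s \<in> topspace (cube n)" for s
    using that n by (auto simp: topspace_cube PiE_iff extensional_def)
  have bdI: "s \<in> cube_boundary n" if "s \<in> topspace (cube n)" "i < n" "s i = 0 \<or> s i = 1" for s i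
    using that by (auto simp: cube_boundary_def)
  have coord: "continuous_map ?T euclideanreal (\<lambda>p. snd p i)" if "i < n" for i
    by (rule continuous_cube_coord[OF continuous_map_snd that])
  have n0: "0 < n" using n by simp
  have cab: "continuous_map ?T (cube n) (\<lambda>p. ?a (snd p))" "continuous_map ?T (cube n) (\<lambda>p. ?b (snd p))"
  proof -
    show "continuous_map ?T (cube n) (\<lambda>p. ?a (snd p))"
    proof (rule continuous_map_cubeI)
      show "continuous_map ?T euclideanreal (\<lambda>p. ?a (snd p) i)" if "i < n" for i
        using coord[OF that] by (cases "i = 0") (auto intro!: continuous_map_real_min continuous_map_real_mult)
    qed (use ab in auto)
    show "continuous_map ?T (cube n) (\<lambda>p. ?b (snd p))"
    proof (rule continuous_map_cubeI)
      show "continuous_map ?T euclideanreal (\<lambda>p. ?b (snd p) i)" if "i < n" for i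
        using coord[OF that] by (cases "i = 0") (auto intro!: continuous_map_real_max continuous_map_real_mult continuous_map_diff)
    qed (use ab in auto)
  qed
  let ?h = "\<lambda>\<tau> s. if s 0 \<le> 1/2 then F (\<tau>, ?a s) else G (\<tau>, ?b s)"
  show ?thesis
  proof (rule rbhI)
    show "continuous_map ?T X (\<lambda>p. ?h (fst p) (snd p))"
    proof (rule continuous_map_cases_le)
      show "continuous_map ?T euclideanreal (\<lambda>p. snd p 0)" by (rule coord[OF n0])
      have "continuous_map ?T ?T (\<lambda>p. (fst p, ?a (snd p)))" using cab by (simp add: continuous_map_paired continuous_map_fst)
      from continuous_map_compose[OF this F(1)]
      show "continuous_map (subtopology ?T {p \<in> topspace ?T. snd p 0 \<le> 1/2}) X (\<lambda>p. F (fst p, ?a (snd p)))"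
        by (intro continuous_map_from_subtopology) (simp add: o_def)
      have "continuous_map ?T ?T (\<lambda>p. (fst p, ?b (snd p)))" using cab by (simp add: continuous_map_paired continuous_map_fst)
      from continuous_map_compose[OF this G(1)]
      show "continuous_map (subtopology ?T {p \<in> topspace ?T. 1/2 \<le> snd p 0}) X (\<lambda>p. G (fst p, ?b (snd p)))"
        by (intro continuous_map_from_subtopology) (simp add: o_def)
      show "F (fst p, ?a (snd p)) = G (fst p, ?b (snd p))" if p: "p \<in> topspace ?T" "snd p 0 = 1/2" for p
      proof -
        have s: "snd p \<in> topspace (cube n)" "fst p \<in> {0..1}" using p by auto
        have "?a (snd p) \<in> cube_boundary n" "?b (snd p) \<in> cube_boundary n"
          by (rule bdI[OF ab(1)[OF s(1)] n0], use p(2) in simp) (rule bdI[OF ab(2)[OF s(1)] n0], use p(2) in simp)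
        then show ?thesis using F(4)[OF s(2)] G(4)[OF s(2)] by simp
      qed
    qed simp
    fix s assume s: "s \<in> topspace (cube n)"
    have s0: "0 \<le> s 0" "s 0 \<le> 1" using s n0 by (auto simp: topspace_cube PiE_iff)
    show "?h 0 s = cube_concat f g s" "?h 1 s = cube_concat f' g' s"
      using F(2,3)[OF ab(1)[OF s]] G(2,3)[OF ab(2)[OF s]] s0 by (auto simp: cube_concat_def)
  next
    fix \<tau> :: real and s assume t: "0 \<le> \<tau>" "\<tau> \<le> 1" and s: "s \<in> cube_boundary n"
    have s': "s \<in> topspace (cube n)" using s cube_boundary_sub by blast
    obtain i where i: "i < n" "s i = 0 \<or> s i = 1" using s by (auto simp: cube_boundary_def)
    have "?a s \<in> cube_boundary n" if "s 0 \<le> 1/2"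
      by (rule bdI[OF ab(1)[OF s'] i(1)]) (use i(2) that in auto)
    moreover have "?b s \<in> cube_boundary n" if "\<not> s 0 \<le> 1/2"
      by (rule bdI[OF ab(2)[OF s'] i(1)]) (use i(2) that in auto)
    ultimately show "?h \<tau> s = x" using F(4) G(4) t by simp
  qed
qed

section \<open>Homotopy groups through representatives\<close>

lemma based_class_eq: "rbh n X x f g \<Longrightarrow> based_class n X x f = based_class n X x g"
  unfolding based_class_def by (rule Collect_cong) (rule iffI, erule rbh_trans[OF rbh_sym], assumption, erule rbh_trans, assumption)

lemma based_class_self: "f \<in> based_maps n X x \<Longrightarrow> f \<in> based_class n X x f"
  using rbh_refl by (simp add: based_class_def)

lemma based_class_eqD: "f \<in> based_maps n X x \<Longrightarrow> based_class n X x f = based_class n X x g \<Longrightarrow> rbh n X x g f"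
  using based_class_self by (fastforce simp: based_class_def)

lemma homotopy_group_mult:
  assumes "1 \<le> n" "f \<in> based_maps n X x" "g \<in> based_maps n X x"
  shows "mult (homotopy_group n X x) (based_class n X x f) (based_class n X x g) = based_class n X x (cube_concat f g)"
proof -
  have "based_class n X x (cube_concat f' g') = based_class n X x (cube_concat f g)"
    if "f' \<in> based_class n X x f" "g' \<in> based_class n X x g" for f' g'
    using based_class_eq[OF rbh_concat[OF assms(1)]] that unfolding based_class_def[of n X x f] based_class_def[of n X x g] by fastforce
  then show ?thesis using based_class_self[OF assms(2)] based_class_self[OF assms(3)]
    unfolding homotopy_group_def monoid.simps by blast
qed

lemma homotopy_group_map_class:
  assumes \<phi>: "continuous_map X Y \<phi>" and f: "f \<in> based_maps n X x"
  shows "homotopy_group_map n Y \<phi> x (based_class n X x f) = based_class n Y (\<phi> x) (\<phi> \<circ> f)"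
proof -
  have "based_class n Y (\<phi> x) (\<phi> \<circ> f') = based_class n Y (\<phi> x) (\<phi> \<circ> f)" if "f' \<in> based_class n X x f" for f'
    using based_class_eq[OF rbh_compose[OF _ \<phi>]] that unfolding based_class_def[of n X x f] by fastforce
  then show ?thesis using based_class_self[OF f] unfolding homotopy_group_map_def by blast
qed

lemma based_maps_compose: "continuous_map X Y \<phi> \<Longrightarrow> f \<in> based_maps n X x \<Longrightarrow> \<phi> \<circ> f \<in> based_maps n Y (\<phi> x)"
  by (auto simp: based_maps_def continuous_map_compose)

text \<open>Bijectivity on based homotopy classes in terms of representatives; the group structure
  enters only in \<open>homotopy_group_map_iso\<close>.\<close>

definition pi_bij :: "nat \<Rightarrow> 'a topology \<Rightarrow> 'b topology \<Rightarrow> ('a \<Rightarrow> 'b) \<Rightarrow> 'a \<Rightarrow> bool" where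
  "pi_bij n X Y \<phi> x \<longleftrightarrow>
    (\<forall>f\<in>based_maps n X x. \<forall>g\<in>based_maps n X x. rbh n Y (\<phi> x) (\<phi> \<circ> f) (\<phi> \<circ> g) \<longrightarrow> rbh n X x f g) \<and>
    (\<forall>g\<in>based_maps n Y (\<phi> x). \<exists>f\<in>based_maps n X x. rbh n Y (\<phi> x) (\<phi> \<circ> f) g)"

lemma homotopy_group_map_iso:
  assumes n: "1 \<le> n" and \<phi>: "continuous_map X Y \<phi>" and b: "pi_bij n X Y \<phi> x"
  shows "homotopy_group_map n Y \<phi> x \<in> iso (homotopy_group n X x) (homotopy_group n Y (\<phi> x))"
proof -
  let ?h = "homotopy_group_map n Y \<phi> x" and ?G = "homotopy_group n X x" and ?H = "homotopy_group n Y (\<phi> x)"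
  have cG: "carrier ?G = based_class n X x ` based_maps n X x" and cH: "carrier ?H = based_class n Y (\<phi> x) ` based_maps n Y (\<phi> x)"
    by (simp_all add: homotopy_group_def)
  have h: "?h (based_class n X x f) = based_class n Y (\<phi> x) (\<phi> \<circ> f)" if "f \<in> based_maps n X x" for f
    by (rule homotopy_group_map_class[OF \<phi> that])
  have im: "?h A \<in> carrier ?H" if "A \<in> carrier ?G" for A
    using that based_maps_compose[OF \<phi>] unfolding cG cH by (auto simp: h)
  have "?h (A \<otimes>\<^bsub>?G\<^esub> B) = ?h A \<otimes>\<^bsub>?H\<^esub> ?h B" if "A \<in> carrier ?G" "B \<in> carrier ?G" for A B
  proof -
    obtain f g where f: "A = based_class n X x f" "f \<in> based_maps n X x" and g: "B = based_class n X x g" "g \<in> based_maps n X x"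
      using \<open>A \<in> carrier ?G\<close> \<open>B \<in> carrier ?G\<close> unfolding cG by blast
    have "cube_concat f g \<in> based_maps n X x" by (rule rbh_based(1)[OF rbh_concat[OF n rbh_refl rbh_refl]]) (rule f g)+
    moreover have "\<phi> \<circ> cube_concat f g = cube_concat (\<phi> \<circ> f) (\<phi> \<circ> g)" by (auto simp: cube_concat_def)
    ultimately show ?thesis
      unfolding f(1) g(1) homotopy_group_mult[OF n f(2) g(2)] h[OF f(2)] h[OF g(2)]
        homotopy_group_mult[OF n based_maps_compose[OF \<phi> f(2)] based_maps_compose[OF \<phi> g(2)]] by (simp add: h)
  qed
  then have "?h \<in> hom ?G ?H" using im by (auto simp: hom_def)
  moreover have "bij_betw ?h (carrier ?G) (carrier ?H)"
    unfolding bij_betw_def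
  proof
    show "inj_on ?h (carrier ?G)"
    proof (rule inj_onI)
      fix A B assume "A \<in> carrier ?G" "B \<in> carrier ?G" and e: "?h A = ?h B"
      then obtain f g where f: "A = based_class n X x f" "f \<in> based_maps n X x" and g: "B = based_class n X x g" "g \<in> based_maps n X x"
        unfolding cG by blast
      have "rbh n Y (\<phi> x) (\<phi> \<circ> g) (\<phi> \<circ> f)"
        using e unfolding f(1) g(1) h[OF f(2)] h[OF g(2)] by (rule based_class_eqD[OF based_maps_compose[OF \<phi> f(2)]])
      then have "rbh n X x g f" using b f(2) g(2) unfolding pi_bij_def by blast
      then show "A = B" unfolding f(1) g(1) by (rule based_class_eq[symmetric])
    qed
    show "?h ` carrier ?G = carrier ?H"
    proof
      show "?h ` carrier ?G \<subseteq> carrier ?H" using im by blast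
      show "carrier ?H \<subseteq> ?h ` carrier ?G"
      proof
        fix B assume "B \<in> carrier ?H"
        then obtain g where g: "B = based_class n Y (\<phi> x) g" "g \<in> based_maps n Y (\<phi> x)" unfolding cH by blast
        then obtain f where f: "f \<in> based_maps n X x" "rbh n Y (\<phi> x) (\<phi> \<circ> f) g" using b unfolding pi_bij_def by blast
        have "B = ?h (based_class n X x f)" unfolding g(1) h[OF f(1)] by (rule based_class_eq[OF f(2), symmetric])
        then show "B \<in> ?h ` carrier ?G" unfolding cG using f(1) by blast
      qed
    qed
  qed
  ultimately show ?thesis by (simp add: iso_def)
qed

text \<open>Negative in the interior of the cube \<open>[1/4, 3/4]\<^sup>n\<close>, zero on its boundary, and growing to \<open>1\<close> on
  the boundary of the unit cube.\<close>

definition shell :: "nat \<Rightarrow> (nat \<Rightarrow> real) \<Rightarrow> real" where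
  "shell n v = (1 - (\<Prod>i<n. 1 - 4 * max 0 (max (1/4 - v i) (v i - 3/4)))) - (\<Prod>i<n. max 0 (min (v i - 1/4) (3/4 - v i)))"

section \<open>Transport of based maps along a path\<close>

lemma continuous_shell: "continuous_map (cube n) euclideanreal (shell n)"
  unfolding shell_def
  by (intro continuous_map_diff continuous_map_prod continuous_map_real_max continuous_map_real_min continuous_map_real_mult
      continuous_cube_coord[OF continuous_map_id[unfolded id_def]]) auto

text \<open>Off the collar the first product is 1 and the second positive, so the function is
  negative there.\<close>

lemma shell_clamp:
  assumes v: "v \<in> topspace (cube n)" and s: "0 \<le> shell n v"
  shows "clamp n v \<in> cube_boundary n"
proof (rule ccontr)
  assume b: "clamp n v \<notin> cube_boundary n"
  have i: "1/4 < v i \<and> v i < 3/4" if "i < n" for i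
  proof (rule ccontr)
    assume "\<not> (1/4 < v i \<and> v i < 3/4)"
    then have "v i \<le> 1/4 \<or> 3/4 \<le> v i" by auto
    then have "v \<in> collar n" using v that unfolding collar_def by blast
    then show False using b clamp_collar by blast
  qed
  have "(\<Prod>i<n. 1 - 4 * max 0 (max (1/4 - v i) (v i - 3/4))) = 1" by (rule prod.neutral) (use i in \<open>force simp: max_def\<close>)
  moreover have "0 < (\<Prod>i<n. max 0 (min (v i - 1/4) (3/4 - v i)))" by (rule prod_pos) (use i in auto)
  ultimately show False using s by (simp add: shell_def)
qed

lemma shell_bounds:
  assumes v: "v \<in> topspace (cube n)" shows "shell n v \<le> 1" "v \<in> cube_boundary n \<Longrightarrow> shell n v = 1"
proof -
  have vi: "0 \<le> v i" "v i \<le> 1" if "i < n" for i using v that by (auto simp: topspace_cube PiE_iff)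
  have "0 \<le> (\<Prod>i<n. 1 - 4 * max 0 (max (1/4 - v i) (v i - 3/4)))"
  proof (rule prod_nonneg)
    fix i assume "i \<in> {..<n}"
    then show "0 \<le> 1 - 4 * max 0 (max (1/4 - v i) (v i - 3/4))" using vi[of i] by (auto simp: max_def)
  qed
  moreover have "0 \<le> (\<Prod>i<n. max 0 (min (v i - 1/4) (3/4 - v i)))" by (rule prod_nonneg) auto
  ultimately show "shell n v \<le> 1" by (simp add: shell_def)
  assume "v \<in> cube_boundary n"
  then obtain i where i: "i < n" "v i = 0 \<or> v i = 1" by (auto simp: cube_boundary_def)
  have p1: "(\<Prod>i<n. 1 - 4 * max 0 (max (1/4 - v i) (v i - 3/4))) = 0"
    by (rule prod_zero) (use i in \<open>auto intro!: bexI[of _ i]\<close>)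
  have p2: "(\<Prod>i<n. max 0 (min (v i - 1/4) (3/4 - v i))) = 0"
    by (rule prod_zero) (use i in \<open>auto intro!: bexI[of _ i]\<close>)
  show "shell n v = 1" unfolding shell_def p1 p2 by simp
qed

text \<open>Change of base point along \<open>\<gamma>\<close>: \<open>f\<close> on the inner cube,
  and the path on the shell around it, running outwards.\<close>

definition wrap :: "nat \<Rightarrow> (real \<Rightarrow> 'a) \<Rightarrow> ((nat \<Rightarrow> real) \<Rightarrow> 'a) \<Rightarrow> (nat \<Rightarrow> real) \<Rightarrow> 'a" where
  "wrap n \<gamma> f v = (if shell n v \<le> 0 then f (clamp n v) else \<gamma> (max 0 (shell n v)))"

lemma continuous_wrap:
  assumes F: "continuous_map (prod_topology unit_interval (cube n)) A (\<lambda>p. F (fst p) (snd p))"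
    and G: "continuous_map (prod_topology unit_interval unit_interval) A (\<lambda>p. G (fst p) (snd p))"
    and agree: "\<And>\<sigma> s. 0 \<le> \<sigma> \<Longrightarrow> \<sigma> \<le> 1 \<Longrightarrow> s \<in> cube_boundary n \<Longrightarrow> F \<sigma> s = G \<sigma> 0"
  shows "continuous_map (prod_topology unit_interval (cube n)) A (\<lambda>p. wrap n (G (fst p)) (F (fst p)) (snd p))"
  unfolding wrap_def
proof (rule continuous_map_cases_le)
  let ?T = "prod_topology unit_interval (cube n)"
  have sh: "continuous_map ?T euclideanreal (\<lambda>p. shell n (snd p))"
    using continuous_map_compose[OF continuous_map_snd continuous_shell] by (simp add: o_def)
  then show "continuous_map ?T euclideanreal (\<lambda>p. shell n (snd p))" .
  have "continuous_map ?T (cube n) (\<lambda>p. clamp n (snd p))"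
    using continuous_map_compose[OF continuous_map_snd continuous_clamp] by (simp add: o_def)
  then have "continuous_map ?T ?T (\<lambda>p. (fst p, clamp n (snd p)))" by (simp add: continuous_map_paired continuous_map_fst)
  from continuous_map_compose[OF this F]
  show "continuous_map (subtopology ?T {p \<in> topspace ?T. shell n (snd p) \<le> 0}) A (\<lambda>p. F (fst p) (clamp n (snd p)))"
    by (intro continuous_map_from_subtopology) (simp add: o_def)
  have "continuous_map ?T unit_interval (\<lambda>p. max 0 (shell n (snd p)))"
    unfolding continuous_map_in_subtopology
  proof (intro conjI funcsetI)
    fix p assume "p \<in> topspace ?T"
    then show "max 0 (shell n (snd p)) \<in> {0..1}" using shell_bounds(1)[of "snd p" n] by auto
  qed (intro continuous_map_real_max sh, simp)
  then have "continuous_map ?T (prod_topology unit_interval unit_interval) (\<lambda>p. (fst p, max 0 (shell n (snd p))))"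
    unfolding continuous_map_paired by (rule conjI[OF continuous_map_fst])
  from continuous_map_compose[OF this G]
  show "continuous_map (subtopology ?T {p \<in> topspace ?T. 0 \<le> shell n (snd p)}) A (\<lambda>p. G (fst p) (max 0 (shell n (snd p))))"
    by (intro continuous_map_from_subtopology) (simp add: o_def)
  show "F (fst p) (clamp n (snd p)) = G (fst p) (max 0 (shell n (snd p)))" if "p \<in> topspace ?T" "shell n (snd p) = 0" for p
    using that agree[of "fst p"] shell_clamp[of "snd p" n] by auto
qed simp

lemma wrap_boundary: "v \<in> cube_boundary n \<Longrightarrow> wrap n \<gamma> f v = \<gamma> 1"
  using shell_bounds(2)[of v n] cube_boundary_sub[of n] by (auto simp: wrap_def)

lemma continuous_map_path_of: "continuous_map T unit_interval u \<Longrightarrow> pathin A \<gamma> \<Longrightarrow> continuous_map T A (\<lambda>p. \<gamma> (u p))"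
  using continuous_map_compose[of T unit_interval u A \<gamma>] by (simp add: pathin_def o_def)

lemma wrap_rbh:
  assumes \<gamma>: "pathin A \<gamma>" and f: "rbh n A (\<gamma> 0) f g"
  shows "rbh n A (\<gamma> 1) (wrap n \<gamma> f) (wrap n \<gamma> g)"
proof -
  obtain F where F: "continuous_map (prod_topology unit_interval (cube n)) A F" "\<And>s. s \<in> topspace (cube n) \<Longrightarrow> F (0, s) = f s" "\<And>s. s \<in> topspace (cube n) \<Longrightarrow> F (1, s) = g s"
    "\<And>\<tau> s. \<tau> \<in> {0..1} \<Longrightarrow> s \<in> cube_boundary n \<Longrightarrow> F (\<tau>, s) = \<gamma> 0" using f[unfolded rbh_iff] by blast
  show ?thesis
  proof (rule rbhI)
    show "continuous_map (prod_topology unit_interval (cube n)) A (\<lambda>p. wrap n \<gamma> (\<lambda>s. F (fst p, s)) (snd p))"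
    proof (rule continuous_wrap[where G = "\<lambda>_. \<gamma>" and F = "\<lambda>\<sigma> s. F (\<sigma>, s)"])
      show "continuous_map (prod_topology unit_interval unit_interval) A (\<lambda>p. \<gamma> (snd p))"
        by (rule continuous_map_path_of[OF continuous_map_snd \<gamma>])
    qed (use F(1,4) in simp_all)
    show "wrap n \<gamma> (\<lambda>s. F (0, s)) s = wrap n \<gamma> f s" "wrap n \<gamma> (\<lambda>s. F (1, s)) s = wrap n \<gamma> g s" for s
      using F(2,3)[OF clamp_in] by (simp_all add: wrap_def)
  qed (rule wrap_boundary)
qed

lemma wrap_compose: "\<phi> \<circ> wrap n \<gamma> f = wrap n (\<phi> \<circ> \<gamma>) (\<phi> \<circ> f)"
  by (auto simp: wrap_def)

lemma pathin_reverse: "pathin A \<gamma> \<Longrightarrow> pathin A (\<lambda>u. \<gamma> (1 - u))"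
  unfolding pathin_def
  by (rule continuous_map_compose[of _ unit_interval "\<lambda>u. 1 - u" _ \<gamma>, unfolded o_def])
    (auto intro!: continuous_intros)

text \<open>The path is shortened to its piece from \<open>\<gamma> 0\<close> to
  \<open>\<gamma> (1 - \<sigma>)\<close> as \<open>\<sigma>\<close> grows. At the end both shells
  are constant and two clampings of \<open>f\<close> remain.\<close>

lemma wrap_wrap:
  assumes \<gamma>: "pathin A \<gamma>" and f: "f \<in> based_maps n A (\<gamma> 0)"
  shows "rbh n A (\<gamma> 0) (wrap n (\<lambda>u. \<gamma> (1 - u)) (wrap n \<gamma> f)) f"
proof -
  let ?T = "prod_topology unit_interval (cube n)" and ?I = "prod_topology unit_interval unit_interval"
  have fb: "continuous_map (cube n) A f" "\<And>s. s \<in> cube_boundary n \<Longrightarrow> f s = \<gamma> 0" using f by (auto simp: based_maps_def)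
  have I: "continuous_map ?I unit_interval (\<lambda>p. (1 - fst p) * snd p)" "continuous_map ?I unit_interval (\<lambda>p. (1 - fst p) * (1 - snd p))"
  proof -
    have c: "continuous_map ?I euclideanreal fst" "continuous_map ?I euclideanreal snd"
      using continuous_map_fst[of unit_interval unit_interval] continuous_map_snd[of unit_interval unit_interval] continuous_map_in_subtopology by blast+
    have 1: "continuous_map ?I euclideanreal (\<lambda>_. 1)" by (rule continuous_map_const[THEN iffD2]) simp
    have le: "(1 - a) * b \<le> 1" if "0 \<le> a" "a \<le> 1" "0 \<le> b" "b \<le> 1" for a b :: real
      by (rule mult_le_one) (use that in auto)
    show "continuous_map ?I unit_interval (\<lambda>p. (1 - fst p) * snd p)"
      unfolding continuous_map_in_subtopology
      by (rule conjI[OF continuous_map_real_mult[OF continuous_map_diff[OF 1 c(1)] c(2)]]) (use le in auto)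
    show "continuous_map ?I unit_interval (\<lambda>p. (1 - fst p) * (1 - snd p))"
      unfolding continuous_map_in_subtopology
      by (rule conjI[OF continuous_map_real_mult[OF continuous_map_diff[OF 1 c(1)] continuous_map_diff[OF 1 c(2)]]]) (use le in auto)
  qed
  have fc: "continuous_map ?T A (\<lambda>p. f (snd p))"
    using continuous_map_compose[OF continuous_map_snd fb(1)] by (simp add: o_def)
  let ?F = "\<lambda>\<sigma>. wrap n (\<lambda>u. \<gamma> ((1 - \<sigma>) * u)) f"
  have F: "continuous_map ?T A (\<lambda>p. ?F (fst p) (snd p))"
    by (rule continuous_wrap[where F = "\<lambda>_. f" and G = "\<lambda>\<sigma> u. \<gamma> ((1 - \<sigma>) * u)", OF fc continuous_map_path_of[OF I(1) \<gamma>]])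
      (simp add: fb)
  have "rbh n A (\<gamma> 0) (wrap n (\<lambda>u. \<gamma> (1 - u)) (wrap n \<gamma> f)) ((f \<circ> clamp n) \<circ> clamp n)"
  proof (rule rbhI)
    show "continuous_map ?T A (\<lambda>p. wrap n (\<lambda>u. \<gamma> ((1 - fst p) * (1 - u))) (?F (fst p)) (snd p))"
      by (rule continuous_wrap[where F = ?F and G = "\<lambda>\<sigma> u. \<gamma> ((1 - \<sigma>) * (1 - u))", OF F continuous_map_path_of[OF I(2) \<gamma>]])
        (simp add: wrap_boundary)
    show "wrap n (\<lambda>u. \<gamma> ((1 - 0) * (1 - u))) (?F 0) s = wrap n (\<lambda>u. \<gamma> (1 - u)) (wrap n \<gamma> f) s" for s by simp
    have 1: "wrap n (\<lambda>u. \<gamma> 0) h s = h (clamp n s)" if "s \<in> topspace (cube n)" "\<And>s. s \<in> cube_boundary n \<Longrightarrow> h s = \<gamma> 0" for h s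
      using shell_clamp[OF that(1)] that(2) by (auto simp: wrap_def)
    show "wrap n (\<lambda>u. \<gamma> ((1 - 1) * (1 - u))) (?F 1) s = ((f \<circ> clamp n) \<circ> clamp n) s" if "s \<in> topspace (cube n)" for s
      using 1[OF that, where h = "wrap n (\<lambda>u. \<gamma> 0) f"] 1[OF clamp_in[of n s] fb(2)] by (simp add: wrap_boundary)
    show "wrap n (\<lambda>u. \<gamma> ((1 - \<sigma>) * (1 - u))) (?F \<sigma>) s = \<gamma> 0" if "s \<in> cube_boundary n" for \<sigma> s
      by (simp add: wrap_boundary[OF that])
  qed
  note w = this
  have c: "rbh n A (\<gamma> 0) (f \<circ> clamp n) f" by (rule clamp_homotopic[OF f])
  have "rbh n A (\<gamma> 0) ((f \<circ> clamp n) \<circ> clamp n) (f \<circ> clamp n)" by (rule clamp_homotopic[OF rbh_based(1)[OF c]])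
  then show ?thesis by (rule rbh_trans[OF w rbh_trans[OF _ c]])
qed

text \<open>Transport along the reversed path undoes transport along \<open>\<gamma>\<close> up to
  based homotopy, and both commute with composition by \<open>\<phi>\<close>.\<close>

lemma pi_bij_path:
  assumes \<phi>: "continuous_map A Y \<phi>" and p: "path_component_of A b b'" and B: "pi_bij n A Y \<phi> b'"
  shows "pi_bij n A Y \<phi> b"
proof -
  obtain \<gamma> where \<gamma>: "pathin A \<gamma>" "\<gamma> 0 = b" "\<gamma> 1 = b'" using p by (auto simp: path_component_of_def)
  let ?\<gamma> = "\<lambda>u. \<gamma> (1 - u)"
  have r: "pathin A ?\<gamma>" by (rule pathin_reverse[OF \<gamma>(1)])
  have \<phi>\<gamma>: "pathin Y (\<phi> \<circ> \<gamma>)" "pathin Y (\<phi> \<circ> ?\<gamma>)"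
    using \<gamma>(1) r unfolding pathin_def by (auto intro: continuous_map_compose[OF _ \<phi>])
  show ?thesis unfolding pi_bij_def
  proof (intro conjI ballI impI)
    fix f g assume f: "f \<in> based_maps n A b" and g: "g \<in> based_maps n A b" and fg: "rbh n Y (\<phi> b) (\<phi> \<circ> f) (\<phi> \<circ> g)"
    have "rbh n Y ((\<phi> \<circ> \<gamma>) 1) (wrap n (\<phi> \<circ> \<gamma>) (\<phi> \<circ> f)) (wrap n (\<phi> \<circ> \<gamma>) (\<phi> \<circ> g))"
      by (rule wrap_rbh[OF \<phi>\<gamma>(1)]) (use fg \<gamma>(2) in simp)
    then have 1: "rbh n Y (\<phi> b') (\<phi> \<circ> wrap n \<gamma> f) (\<phi> \<circ> wrap n \<gamma> g)" unfolding wrap_compose using \<gamma>(3) by simp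
    have w: "wrap n \<gamma> h \<in> based_maps n A b'" if "h \<in> based_maps n A b" for h
      using rbh_based(1)[OF wrap_rbh[OF \<gamma>(1) rbh_refl[of h n A "\<gamma> 0"]]] that \<gamma> by simp
    have 2: "rbh n A b' (wrap n \<gamma> f) (wrap n \<gamma> g)" using B 1 w[OF f] w[OF g] unfolding pi_bij_def by blast
    have 3: "rbh n A b (wrap n ?\<gamma> (wrap n \<gamma> f)) (wrap n ?\<gamma> (wrap n \<gamma> g))"
      using wrap_rbh[OF r, of n "wrap n \<gamma> f" "wrap n \<gamma> g"] 2 \<gamma> by simp
    have 4: "rbh n A b (wrap n ?\<gamma> (wrap n \<gamma> f)) f" "rbh n A b (wrap n ?\<gamma> (wrap n \<gamma> g)) g"
      using wrap_wrap[OF \<gamma>(1), of f n] wrap_wrap[OF \<gamma>(1), of g n] f g \<gamma>(2) by simp_all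
    show "rbh n A b f g" by (rule rbh_trans[OF rbh_sym[OF 4(1)] rbh_trans[OF 3 4(2)]])
  next
    fix g assume g: "g \<in> based_maps n Y (\<phi> b)"
    have "wrap n (\<phi> \<circ> \<gamma>) g \<in> based_maps n Y (\<phi> b')"
      using rbh_based(1)[OF wrap_rbh[OF \<phi>\<gamma>(1) rbh_refl[of g n Y "(\<phi> \<circ> \<gamma>) 0"]]] g \<gamma> by (simp add: o_def)
    then obtain f' where f': "f' \<in> based_maps n A b'" "rbh n Y (\<phi> b') (\<phi> \<circ> f') (wrap n (\<phi> \<circ> \<gamma>) g)"
      using B unfolding pi_bij_def by blast
    have f: "wrap n ?\<gamma> f' \<in> based_maps n A b"
      using rbh_based(1)[OF wrap_rbh[OF r rbh_refl[of f' n A "?\<gamma> 0"]]] f'(1) \<gamma> by simp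
    have "rbh n Y (\<phi> b) (wrap n (\<phi> \<circ> ?\<gamma>) (\<phi> \<circ> f')) (wrap n (\<phi> \<circ> ?\<gamma>) (wrap n (\<phi> \<circ> \<gamma>) g))"
      using wrap_rbh[OF \<phi>\<gamma>(2), of n "\<phi> \<circ> f'" "wrap n (\<phi> \<circ> \<gamma>) g"] f'(2) \<gamma> by simp
    moreover have "rbh n Y (\<phi> b) (wrap n (\<phi> \<circ> ?\<gamma>) (wrap n (\<phi> \<circ> \<gamma>) g)) g"
      using wrap_wrap[OF \<phi>\<gamma>(1), of g n] g \<gamma>(2) by (simp add: o_def)
    ultimately have "rbh n Y (\<phi> b) (\<phi> \<circ> wrap n ?\<gamma> f') g" unfolding wrap_compose by (rule rbh_trans)
    then show "\<exists>f\<in>based_maps n A b. rbh n Y (\<phi> b) (\<phi> \<circ> f) g" using f by blast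
  qed
qed

section \<open>Path components and criteria for weak equivalences\<close>

lemma path_component_of_map:
  assumes \<phi>: "continuous_map X Y \<phi>" and ab: "path_component_of X a b"
  shows "path_component_of Y (\<phi> a) (\<phi> b)"
proof -
  obtain g where g: "pathin X g" "g 0 = a" "g 1 = b" using ab by (auto simp: path_component_of_def)
  have "pathin Y (\<phi> \<circ> g)" using g(1) unfolding pathin_def by (rule continuous_map_compose[OF _ \<phi>])
  then show ?thesis unfolding path_component_of_def using g by (intro exI[of _ "\<phi> \<circ> g"]) simp
qed

lemma path_component_of_set_eq: "path_component_of X a b \<Longrightarrow> path_component_of_set X a = path_component_of_set X b"
  by (rule arg_cong[where f = Collect], rule path_component_of_equiv[THEN iffD1, THEN conjunct2, THEN conjunct2])

lemma bij_path_components: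
  assumes \<phi>: "continuous_map X Y \<phi>"
    and inj: "\<And>a b. a \<in> topspace X \<Longrightarrow> b \<in> topspace X \<Longrightarrow> path_component_of Y (\<phi> a) (\<phi> b) \<Longrightarrow> path_component_of X a b"
    and surj: "\<And>y. y \<in> topspace Y \<Longrightarrow> \<exists>x\<in>topspace X. path_component_of Y (\<phi> x) y"
  shows "bij_betw (\<lambda>C. \<Union>x\<in>C. path_component_of_set Y (\<phi> x)) (path_components_of X) (path_components_of Y)"
proof -
  let ?P = "\<lambda>C. \<Union>x\<in>C. path_component_of_set Y (\<phi> x)"
  note mono = path_component_of_map[OF \<phi>]
  have P: "?P (path_component_of_set X a) = path_component_of_set Y (\<phi> a)" if a: "a \<in> topspace X" for a
  proof (rule SUP_eq_const)
    have "path_component_of X a a" using a by (simp add: path_component_of_refl)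
    then show "path_component_of_set X a \<noteq> {}" by blast
    show "path_component_of_set Y (\<phi> x) = path_component_of_set Y (\<phi> a)" if "x \<in> path_component_of_set X a" for x
      by (rule path_component_of_set_eq[OF mono, symmetric]) (use that in simp)
  qed
  have \<phi>in: "\<phi> a \<in> topspace Y" if "a \<in> topspace X" for a using \<phi> that by (auto simp: continuous_map_def)
  show ?thesis unfolding bij_betw_def
  proof
    show "inj_on ?P (path_components_of X)"
    proof (rule inj_onI)
      fix C D assume "C \<in> path_components_of X" "D \<in> path_components_of X" and e: "?P C = ?P D"
      then obtain a b where a: "C = path_component_of_set X a" "a \<in> topspace X" and b: "D = path_component_of_set X b" "b \<in> topspace X"
        unfolding path_components_of_def by (elim imageE)
      have "path_component_of_set Y (\<phi> a) = path_component_of_set Y (\<phi> b)" using e unfolding a(1) b(1) P[OF a(2)] P[OF b(2)] .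
      moreover have "path_component_of Y (\<phi> b) (\<phi> b)" using \<phi>in[OF b(2)] by (simp add: path_component_of_refl)
      ultimately have "path_component_of Y (\<phi> a) (\<phi> b)" by blast
      then have "path_component_of X a b" by (rule inj[OF a(2) b(2)])
      then show "C = D" unfolding a(1) b(1) by (rule path_component_of_set_eq)
    qed
    show "?P ` path_components_of X = path_components_of Y"
    proof
      show "?P ` path_components_of X \<subseteq> path_components_of Y"
      proof
        fix D assume "D \<in> ?P ` path_components_of X"
        then obtain C where C: "D = ?P C" "C \<in> path_components_of X" by (rule imageE)
        then obtain a where a: "C = path_component_of_set X a" "a \<in> topspace X" unfolding path_components_of_def by (elim imageE)
        have "D = path_component_of_set Y (\<phi> a)" unfolding C(1) a(1) by (rule P[OF a(2)])
        then show "D \<in> path_components_of Y" unfolding path_components_of_def by (rule image_eqI[OF _ \<phi>in[OF a(2)]])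
      qed
      show "path_components_of Y \<subseteq> ?P ` path_components_of X"
      proof
        fix D assume "D \<in> path_components_of Y"
        then obtain y where y: "D = path_component_of_set Y y" "y \<in> topspace Y" unfolding path_components_of_def by (elim imageE)
        obtain x where x: "x \<in> topspace X" "path_component_of Y (\<phi> x) y" using surj[OF y(2)] by blast
        have "D = ?P (path_component_of_set X x)" unfolding P[OF x(1)] y(1) by (rule path_component_of_set_eq[OF x(2), symmetric])
        moreover have "path_component_of_set X x \<in> path_components_of X" unfolding path_components_of_def using x(1) by (rule imageI)
        ultimately show "D \<in> ?P ` path_components_of X" by (rule image_eqI)
      qed
    qed
  qed
qed

text \<open>By transport along paths, homotopy groups are tested at base points in a set
  \<open>V\<close> that every point can reach.\<close>

lemma weak_homotopy_equivalenceI: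
  assumes \<phi>: "continuous_map X Y \<phi>"
    and inj: "\<And>a b. a \<in> topspace X \<Longrightarrow> b \<in> topspace X \<Longrightarrow> path_component_of Y (\<phi> a) (\<phi> b) \<Longrightarrow> path_component_of X a b"
    and surj: "\<And>y. y \<in> topspace Y \<Longrightarrow> \<exists>x\<in>topspace X. path_component_of Y (\<phi> x) y"
    and V: "\<And>x. x \<in> topspace X \<Longrightarrow> \<exists>v\<in>V. path_component_of X x v"
    and b: "\<And>v n. v \<in> V \<Longrightarrow> pi_bij n X Y \<phi> v"
  shows "weak_homotopy_equivalence X Y \<phi>"
  unfolding weak_homotopy_equivalence_def
proof (intro conjI allI impI ballI)
  fix n :: nat and x assume n: "1 \<le> n" and x: "x \<in> topspace X"
  obtain v where v: "v \<in> V" "path_component_of X x v" using V[OF x] by blast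
  show "homotopy_group_map n Y \<phi> x \<in> iso (homotopy_group n X x) (homotopy_group n Y (\<phi> x))"
    by (rule homotopy_group_map_iso[OF n \<phi> pi_bij_path[OF \<phi> v(2) b[OF v(1)]]])
qed (rule \<phi>, rule bij_path_components[OF \<phi> inj surj])

lemma rbh_cong:
  assumes "rbh n X x f g" "\<And>s. s \<in> topspace (cube n) \<Longrightarrow> f' s = f s" "\<And>s. s \<in> topspace (cube n) \<Longrightarrow> g' s = g s"
  shows "rbh n X x f' g'"
  using assms(1) unfolding rbh_iff by (simp add: assms(2,3))

lemma based_mapsD: "f \<in> based_maps n X x \<Longrightarrow> continuous_map (cube n) X f" "f \<in> based_maps n X x \<Longrightarrow> s \<in> cube_boundary n \<Longrightarrow> f s = x"
  by (simp_all add: based_maps_def)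

lemma rbh_homotopy_compose:
  assumes K: "continuous_map (prod_topology unit_interval B) C K" and g: "g \<in> based_maps n B y"
    and st: "\<And>\<tau>. 0 \<le> \<tau> \<Longrightarrow> \<tau> \<le> 1 \<Longrightarrow> K (\<tau>, y) = c"
  shows "rbh n C c (\<lambda>s. K (0, g s)) (\<lambda>s. K (1, g s))"
proof (rule rbhI)
  have "continuous_map (prod_topology unit_interval (cube n)) B (\<lambda>p. g (snd p))"
    using continuous_map_compose[OF continuous_map_snd based_mapsD(1)[OF g]] by (simp add: o_def)
  then have "continuous_map (prod_topology unit_interval (cube n)) (prod_topology unit_interval B) (\<lambda>p. (fst p, g (snd p)))"
    unfolding continuous_map_paired by (rule conjI[OF continuous_map_fst])
  from continuous_map_compose[OF this K]
  show "continuous_map (prod_topology unit_interval (cube n)) C (\<lambda>p. K (fst p, g (snd p)))" by (simp add: o_def)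
qed (use based_mapsD(2)[OF g] st in auto)

text \<open>The strict left inverse gives injectivity at every base point. Surjectivity comes from
  the homotopy, which is based because it is stationary at the images of the chosen base
  points.\<close>

lemma weak_homotopy_equivalence_retract:
  assumes \<phi>: "continuous_map A B \<phi>" and r: "continuous_map B A r" and r\<phi>: "\<And>a. a \<in> topspace A \<Longrightarrow> r (\<phi> a) = a"
    and K: "continuous_map (prod_topology unit_interval B) B K" "\<And>b. b \<in> topspace B \<Longrightarrow> K (0, b) = b" "\<And>b. b \<in> topspace B \<Longrightarrow> K (1, b) = \<phi> (r b)"
    and V: "V \<subseteq> topspace A" "\<And>x. x \<in> topspace A \<Longrightarrow> \<exists>v\<in>V. path_component_of A x v"
    and st: "\<And>v \<tau>. v \<in> V \<Longrightarrow> 0 \<le> \<tau> \<Longrightarrow> \<tau> \<le> 1 \<Longrightarrow> K (\<tau>, \<phi> v) = \<phi> v"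
  shows "weak_homotopy_equivalence A B \<phi>"
proof (rule weak_homotopy_equivalenceI[OF \<phi> _ _ V(2)])
  show "path_component_of A a b" if "a \<in> topspace A" "b \<in> topspace A" "path_component_of B (\<phi> a) (\<phi> b)" for a b
    using path_component_of_map[OF r that(3)] r\<phi> that(1,2) by simp
  show "\<exists>x\<in>topspace A. path_component_of B (\<phi> x) y" if y: "y \<in> topspace B" for y
  proof (rule bexI[of _ "r y"])
    have "continuous_map unit_interval (prod_topology unit_interval B) (\<lambda>\<tau>. (\<tau>, y))"
      unfolding continuous_map_paired by (rule conjI) (use y in \<open>simp_all add: continuous_map_const\<close>)
    from continuous_map_compose[OF this K(1)] have "pathin B (\<lambda>\<tau>. K (\<tau>, y))" by (simp add: pathin_def o_def)
    then have "path_component_of B y (\<phi> (r y))"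
      unfolding path_component_of_def using K(2,3)[OF y] by (intro exI[of _ "\<lambda>\<tau>. K (\<tau>, y)"]) simp
    then show "path_component_of B (\<phi> (r y)) y" by (rule path_component_of_sym)
    show "r y \<in> topspace A" using r y by (auto simp: continuous_map_def)
  qed
  show "pi_bij n A B \<phi> v" if v: "v \<in> V" for v n
    unfolding pi_bij_def
  proof (intro conjI ballI impI)
    have rv: "r (\<phi> v) = v" using r\<phi> V(1) v by blast
    have rf: "r (\<phi> (f s)) = f s" if "f \<in> based_maps n A v" "s \<in> topspace (cube n)" for f s
      using that by (intro r\<phi>) (auto simp: based_maps_def continuous_map_def)
    fix f g assume f: "f \<in> based_maps n A v" and g: "g \<in> based_maps n A v" and fg: "rbh n B (\<phi> v) (\<phi> \<circ> f) (\<phi> \<circ> g)"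
    have "rbh n A v (r \<circ> (\<phi> \<circ> f)) (r \<circ> (\<phi> \<circ> g))" using rbh_compose[OF fg r] unfolding rv .
    then show "rbh n A v f g" by (rule rbh_cong) (simp_all add: rf f g)
  next
    have rv: "r (\<phi> v) = v" using r\<phi> V(1) v by blast
    fix g assume g: "g \<in> based_maps n B (\<phi> v)"
    have gin: "g s \<in> topspace B" if "s \<in> topspace (cube n)" for s using g that by (auto simp: based_maps_def continuous_map_def)
    have "rbh n B (\<phi> v) (\<lambda>s. K (0, g s)) (\<lambda>s. K (1, g s))" by (rule rbh_homotopy_compose[OF K(1) g st[OF v]])
    then have "rbh n B (\<phi> v) g (\<phi> \<circ> (r \<circ> g))" by (rule rbh_cong) (simp_all add: K gin)
    then have "rbh n B (\<phi> v) (\<phi> \<circ> (r \<circ> g)) g" by (rule rbh_sym)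
    moreover have "r \<circ> g \<in> based_maps n A v" using based_maps_compose[OF r g] unfolding rv .
    ultimately show "\<exists>f\<in>based_maps n A v. rbh n B (\<phi> v) (\<phi> \<circ> f) g" by blast
  qed
qed

section \<open>Evaluation as a weak equivalence\<close>

lemma continuous_clamp_homotopy:
  assumes H: "continuous_map (prod_topology unit_interval (cube n)) X H"
  shows "continuous_map (prod_topology unit_interval (cube n)) X (\<lambda>p. H (fst p, clamp n (snd p)))"
proof -
  have "continuous_map (prod_topology unit_interval (cube n)) (cube n) (\<lambda>p. clamp n (snd p))"
    using continuous_map_compose[OF continuous_map_snd continuous_clamp] by (simp add: o_def)
  then have "continuous_map (prod_topology unit_interval (cube n)) (prod_topology unit_interval (cube n)) (\<lambda>p. (fst p, clamp n (snd p)))"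
    unfolding continuous_map_paired by (rule conjI[OF continuous_map_fst])
  from continuous_map_compose[OF this H] show ?thesis by (simp add: o_def)
qed

text \<open>Clamping makes a homotopy that is fixed on the boundary constant on the collar, as
  \<open>kap_homotopy\<close> requires.\<close>

lemma kap_clamp_homotopy:
  assumes net: "net n zs \<delta>" "\<delta> \<le> 1/4" and x0: "x0 \<in> simplices (Sing X) 0" and h: "rbh n X (x0 e0) f g"
  shows "rbh n (realization (Sing X)) (rc X ((0, x0), e0)) (kap n X (f \<circ> clamp n) zs \<delta>) (kap n X (g \<circ> clamp n) zs \<delta>)"
proof -
  obtain H where H: "continuous_map (prod_topology unit_interval (cube n)) X H" "\<And>s. s \<in> topspace (cube n) \<Longrightarrow> H (0, s) = f s" "\<And>s. s \<in> topspace (cube n) \<Longrightarrow> H (1, s) = g s"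
    "\<And>\<tau> s. \<tau> \<in> {0..1} \<Longrightarrow> s \<in> cube_boundary n \<Longrightarrow> H (\<tau>, s) = x0 e0" using h[unfolded rbh_iff] by blast
  have "rbh n (realization (Sing X)) (rc X ((0, x0), e0)) (kap n X (\<lambda>s. (\<lambda>p. H (fst p, clamp n (snd p))) (0, s)) zs \<delta>)
      (kap n X (\<lambda>s. (\<lambda>p. H (fst p, clamp n (snd p))) (1, s)) zs \<delta>)"
    by (rule kap_homotopy[OF net x0 continuous_clamp_homotopy[OF H(1)]]) (use H(4) clamp_collar in auto)
  then show ?thesis by (simp add: H clamp_in o_def)
qed

text \<open>Injectivity: one net fine enough for both maps replaces each of them by
  \<open>kap\<close> of its evaluation, and a homotopy of the evaluations induces one between these.
  Surjectivity: \<open>kap\<close> of a clamped map evaluates to that map up to based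
  homotopy.\<close>

lemma ev_pi_bij:
  assumes x0: "x0 \<in> simplices (Sing X) 0"
  shows "pi_bij n (realization (Sing X)) X ev (rc X ((0, x0), e0))"
proof -
  let ?R = "realization (Sing X)" and ?v = "rc X ((0, x0), e0)"
  have evv: "ev ?v = x0 e0" by (rule ev_rc)
  have e0: "e0 \<in> standard_simplex 0" by (simp add: standard_simplex_zero)
  obtain g \<Gamma> where g: "continuous_map ?R (fat X) g" and \<Gamma>: "continuous_map (prod_topology unit_interval ?R) ?R \<Gamma>"
    and \<Gamma>e: "\<And>p. p \<in> topspace ?R \<Longrightarrow> \<Gamma> (0, p) = p \<and> \<Gamma> (1, p) = rc X (g p)"
    and \<Gamma>v: "\<And>x \<tau>. x \<in> simplices (Sing X) 0 \<Longrightarrow> \<tau> \<in> {0..1} \<Longrightarrow> \<Gamma> (\<tau>, rc X ((0, x), e0)) = rc X ((0, x), e0)"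
    and gv: "\<And>x. x \<in> simplices (Sing X) 0 \<Longrightarrow> g (rc X ((0, x), e0)) = nf ((0, x), e0)"
    by (rule fat_section) (erule that | assumption)+
  \<comment> \<open>The evaluation of the lifted map. It need not equal
    \<open>ev \<circ> \<psi>\<close>, but \<open>\<Gamma>\<close> makes the two homotopic relative
    to the boundary.\<close>
  let ?\<theta> = "\<lambda>\<psi> s. ev (rc X (g (\<psi> s)))"
  have approx: "\<exists>\<delta>0>0. \<forall>\<delta> zs. net n zs \<delta> \<longrightarrow> \<delta> \<le> \<delta>0 \<longrightarrow> rbh n ?R ?v \<psi> (kap n X (?\<theta> \<psi> \<circ> clamp n) zs \<delta>)"
    and th: "rbh n X (x0 e0) (?\<theta> \<psi>) (ev \<circ> \<psi>)" if \<psi>: "\<psi> \<in> based_maps n ?R ?v" for \<psi>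
  proof -
    have \<psi>in: "\<psi> s \<in> topspace ?R" if "s \<in> topspace (cube n)" for s
      using based_mapsD(1)[OF \<psi>] that by (auto simp: continuous_map_def)
    have 1: "rbh n ?R ?v (\<psi> \<circ> clamp n) \<psi>" by (rule clamp_homotopic[OF \<psi>])
    have "rbh n ?R ?v (\<lambda>s. \<Gamma> (0, (\<psi> \<circ> clamp n) s)) (\<lambda>s. \<Gamma> (1, (\<psi> \<circ> clamp n) s))"
      by (rule rbh_homotopy_compose[OF \<Gamma> rbh_based(1)[OF 1]]) (use \<Gamma>v[OF x0] in auto)
    then have 2: "rbh n ?R ?v (\<psi> \<circ> clamp n) (\<lambda>s. rc X (g (\<psi> (clamp n s))))"
      by (rule rbh_cong) (simp_all add: \<Gamma>e \<psi>in clamp_in)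
    have z: "continuous_map (cube n) (fat X) (\<lambda>s. g (\<psi> (clamp n s)))"
      using continuous_map_compose[OF continuous_map_compose[OF continuous_clamp based_mapsD(1)[OF \<psi>]] g] by (simp add: o_def)
    have bd: "g (\<psi> (clamp n s)) = nf ((0, x0), e0)" if "s \<in> collar n" for s
      using based_mapsD(2)[OF \<psi> clamp_collar[OF that]] gv[OF x0] by simp
    obtain \<delta>0 where d: "0 < \<delta>0" "\<And>\<delta> zs. net n zs \<delta> \<Longrightarrow> \<delta> \<le> \<delta>0 \<Longrightarrow> rbh n ?R ?v
      (\<lambda>s. rc X (g (\<psi> (clamp n s)))) (kap n X (\<lambda>s. ev (rc X (g (\<psi> (clamp n s))))) zs \<delta>)"
      by (rule kap_approximation[OF z x0 bd]) (assumption | erule that)+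
    have "rbh n ?R ?v \<psi> (kap n X (?\<theta> \<psi> \<circ> clamp n) zs \<delta>)" if "net n zs \<delta>" "\<delta> \<le> \<delta>0" for zs \<delta>
      using rbh_trans[OF rbh_sym[OF 1] rbh_trans[OF 2 d(2)[OF that]]] by (simp add: o_def)
    then show "\<exists>\<delta>0>0. \<forall>\<delta> zs. net n zs \<delta> \<longrightarrow> \<delta> \<le> \<delta>0 \<longrightarrow> rbh n ?R ?v \<psi> (kap n X (?\<theta> \<psi> \<circ> clamp n) zs \<delta>)" using d(1) by blast
    have "rbh n ?R ?v (\<lambda>s. \<Gamma> (0, \<psi> s)) (\<lambda>s. \<Gamma> (1, \<psi> s))"
      by (rule rbh_homotopy_compose[OF \<Gamma> \<psi>]) (use \<Gamma>v[OF x0] in auto)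
    then have "rbh n ?R ?v \<psi> (\<lambda>s. rc X (g (\<psi> s)))"
      by (rule rbh_cong) (simp_all add: \<Gamma>e \<psi>in)
    from rbh_sym[OF rbh_compose[OF this continuous_ev]] show "rbh n X (x0 e0) (?\<theta> \<psi>) (ev \<circ> \<psi>)" by (simp add: evv o_def)
  qed
  show ?thesis unfolding pi_bij_def evv
  proof (intro conjI ballI impI)
    fix \<psi>0 \<psi>1 assume p0: "\<psi>0 \<in> based_maps n ?R ?v" and p1: "\<psi>1 \<in> based_maps n ?R ?v" and h: "rbh n X (x0 e0) (ev \<circ> \<psi>0) (ev \<circ> \<psi>1)"
    obtain d0 where d0: "0 < d0" "\<And>\<delta> zs. net n zs \<delta> \<Longrightarrow> \<delta> \<le> d0 \<Longrightarrow> rbh n ?R ?v \<psi>0 (kap n X (?\<theta> \<psi>0 \<circ> clamp n) zs \<delta>)" using approx[OF p0] by blast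
    obtain d1 where d1: "0 < d1" "\<And>\<delta> zs. net n zs \<delta> \<Longrightarrow> \<delta> \<le> d1 \<Longrightarrow> rbh n ?R ?v \<psi>1 (kap n X (?\<theta> \<psi>1 \<circ> clamp n) zs \<delta>)" using approx[OF p1] by blast
    define \<delta> where "\<delta> = min d0 (min d1 (1/4))"
    have \<delta>: "0 < \<delta>" "\<delta> \<le> d0" "\<delta> \<le> d1" "\<delta> \<le> 1/4" using d0(1) d1(1) by (auto simp: \<delta>_def)
    obtain zs where zs: "net n zs \<delta>" by (rule exists_net[OF \<delta>(1)])
    have "rbh n X (x0 e0) (?\<theta> \<psi>0) (?\<theta> \<psi>1)" by (rule rbh_trans[OF th[OF p0] rbh_trans[OF h rbh_sym[OF th[OF p1]]]])
    then have "rbh n ?R ?v (kap n X (?\<theta> \<psi>0 \<circ> clamp n) zs \<delta>) (kap n X (?\<theta> \<psi>1 \<circ> clamp n) zs \<delta>)"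
      by (rule kap_clamp_homotopy[OF zs \<delta>(4) x0])
    then show "rbh n ?R ?v \<psi>0 \<psi>1"
      by (rule rbh_trans[OF d0(2)[OF zs \<delta>(2)] rbh_trans[OF _ rbh_sym[OF d1(2)[OF zs \<delta>(3)]]]])
  next
    fix \<phi> assume \<phi>: "\<phi> \<in> based_maps n X (x0 e0)"
    obtain zs where zs: "net n zs (1/4)" by (rule exists_net[of "1/4" n]) simp_all
    have "rbh n X (x0 e0) (ev \<circ> kap n X (\<phi> \<circ> clamp n) zs (1/4)) (\<phi> \<circ> clamp n)"
      by (rule kap_ev_homotopy[OF zs])
        (use continuous_map_compose[OF continuous_clamp based_mapsD(1)[OF \<phi>]] based_mapsD(2)[OF \<phi> clamp_collar] in auto)
    then have "rbh n X (x0 e0) (ev \<circ> kap n X (\<phi> \<circ> clamp n) zs (1/4)) \<phi>" by (rule rbh_trans[OF _ clamp_homotopic[OF \<phi>]])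
    moreover have "kap n X (\<phi> \<circ> clamp n) zs (1/4) \<in> based_maps n ?R ?v"
      by (rule rbh_based(1)[OF kap_clamp_homotopy[OF zs _ x0 rbh_refl[OF \<phi>]]]) simp
    ultimately show "\<exists>f\<in>based_maps n ?R ?v. rbh n X (x0 e0) (ev \<circ> f) \<phi>" by blast
  qed
qed

lemma point_simplex:
  assumes "y \<in> topspace X"
  shows "restrict (\<lambda>_. y) (standard_simplex 0) \<in> simplices (Sing X) 0"
proof -
  have "continuous_map (simplex_space 0) X (\<lambda>_. y)" using assms by (simp add: continuous_map_const)
  then have "continuous_map (simplex_space 0) X (restrict (\<lambda>_. y) (standard_simplex 0))"
    by (rule continuous_map_eq) simp
  then show ?thesis by (simp add: Sing_simplices)
qed

text \<open>A path in \<open>X\<close> is a singular 1-simplex, and its realization joins the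
  vertices of its end points.\<close>

lemma path_between_vertices:
  assumes x: "x0 \<in> simplices (Sing X) 0" "x1 \<in> simplices (Sing X) 0" and p: "path_component_of X (x0 e0) (x1 e0)"
  shows "path_component_of (realization (Sing X)) (rc X ((0, x0), e0)) (rc X ((0, x1), e0))"
proof -
  obtain g where g: "pathin X g" "g 0 = x0 e0" "g 1 = x1 e0" using p by (auto simp: path_component_of_def)
  define f where "f = restrict (\<lambda>t. g (t 1)) (standard_simplex 1)"
  have "continuous_map (simplex_space 1) unit_interval (\<lambda>t. t 1)"
    unfolding continuous_map_in_subtopology
    by (rule conjI[OF continuous_simplex_coord[OF continuous_map_id[unfolded id_def]]]) (auto simp: standard_simplex_def)
  from continuous_map_path_of[OF this g(1)] have "continuous_map (simplex_space 1) X f"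
    by (rule continuous_map_eq) (simp add: f_def)
  then have f: "f \<in> simplices (Sing X) 1" by (simp add: Sing_simplices f_def)
  define \<sigma> where "\<sigma> \<tau> = (\<lambda>j::nat. if j = 0 then 1 - \<tau> else if j = 1 then \<tau> else 0)" for \<tau> :: real
  have \<sigma>in: "\<sigma> \<tau> \<in> standard_simplex 1" if "0 \<le> \<tau>" "\<tau> \<le> 1" for \<tau>
    using that by (auto simp: standard_simplex_def \<sigma>_def)
  have \<sigma>: "continuous_map unit_interval (simplex_space 1) \<sigma>"
  proof (rule continuous_map_simplexI)
    fix i show "continuous_map unit_interval euclideanreal (\<lambda>\<tau>. \<sigma> \<tau> i)"
      unfolding \<sigma>_def by (cases "i = 0"; cases "i = 1") (auto intro!: continuous_intros)
  qed (use \<sigma>in in auto)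
  have end_point: "rc X ((1, f), \<sigma> (if b then 1 else 0)) = rc X ((0, x), e0)"
    if x: "x \<in> simplices (Sing X) 0" "x e0 = g (if b then 1 else 0)" for b x
  proof -
    let ?\<iota> = "restrict (\<lambda>_. if b then 1 else 0) {..0} :: nat \<Rightarrow> nat"
    have \<iota>: "?\<iota> \<in> order_maps 0 1" by (auto simp: order_maps_def mono_on_def)
    have d: "delta_map 0 1 ?\<iota> e0 = \<sigma> (if b then 1 else 0)"
    proof
      fix i
      have "{j. j \<le> 0 \<and> ?\<iota> j = i} = (if i = (if b then 1 else 0) then {0} else {})" by auto
      then show "delta_map 0 1 ?\<iota> e0 i = \<sigma> (if b then 1 else 0) i"
        unfolding delta_map_def \<sigma>_def by (cases b) (auto split: if_splits)
    qed
    have "act (Sing X) 0 1 ?\<iota> f = x"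
    proof
      fix c show "act (Sing X) 0 1 ?\<iota> f c = x c"
      proof (cases "c = e0")
        case True
        have "f (\<sigma> (if b then 1 else 0)) = g (if b then 1 else 0)" using \<sigma>in[of "if b then 1 else 0"] by (simp add: f_def \<sigma>_def)
        then show ?thesis using x(2) d True by (simp add: Sing_def standard_simplex_zero)
      next
        case False
        then have "c \<notin> standard_simplex 0" by (simp add: standard_simplex_zero)
        moreover have "x c = undefined" using x(1) \<open>c \<notin> standard_simplex 0\<close> unfolding Sing_simplices by (simp add: extensional_def)
        ultimately show ?thesis by (simp add: Sing_def)
      qed
    qed
    then show ?thesis using realization_class_act[OF \<iota> f, of e0] d by (simp add: standard_simplex_zero)
  qed
  have "pathin (realization (Sing X)) (\<lambda>\<tau>. rc X ((1, f), \<sigma> \<tau>))"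
    using continuous_map_compose[OF \<sigma> continuous_realization_class[OF f]] by (simp add: pathin_def o_def)
  then show ?thesis unfolding path_component_of_def
    using end_point[OF x(1), of False] end_point[OF x(2), of True] g(2,3)
    by (intro exI[of _ "\<lambda>\<tau>. rc X ((1, f), \<sigma> \<tau>)"]) simp
qed

lemma weak_homotopy_equivalence_ev: "weak_homotopy_equivalence (realization (Sing X)) X ev"
proof (rule weak_homotopy_equivalenceI[OF continuous_ev, where V = "{rc X ((0, x), e0) | x. x \<in> simplices (Sing X) 0}"])
  have vert: "\<exists>x. x \<in> simplices (Sing X) 0 \<and> path_component_of (realization (Sing X)) a (rc X ((0, x), e0))"
    if "a \<in> topspace (realization (Sing X))" for a
    by (rule realization_path_to_vertex[OF simplicial_set_Sing that]) blast
  then show "\<exists>v\<in>{rc X ((0, x), e0) | x. x \<in> simplices (Sing X) 0}. path_component_of (realization (Sing X)) a v"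
    if "a \<in> topspace (realization (Sing X))" for a
    using that by blast
  show "path_component_of (realization (Sing X)) a b"
    if a: "a \<in> topspace (realization (Sing X))" and b: "b \<in> topspace (realization (Sing X))" and p: "path_component_of X (ev a) (ev b)" for a b
  proof -
    obtain x where x: "x \<in> simplices (Sing X) 0" "path_component_of (realization (Sing X)) a (rc X ((0, x), e0))" using vert[OF a] by blast
    obtain y where y: "y \<in> simplices (Sing X) 0" "path_component_of (realization (Sing X)) b (rc X ((0, y), e0))" using vert[OF b] by blast
    have "path_component_of X (ev a) (x e0)" "path_component_of X (ev b) (y e0)"
      using path_component_of_map[OF continuous_ev x(2)] path_component_of_map[OF continuous_ev y(2)] by (simp_all add: ev_rc)
    then have "path_component_of X (x e0) (y e0)"
      using p by (meson path_component_of_sym path_component_of_trans)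
    from path_between_vertices[OF x(1) y(1) this] x(2) y(2) show ?thesis
      by (meson path_component_of_sym path_component_of_trans)
  qed
  show "\<exists>x\<in>topspace (realization (Sing X)). path_component_of X (ev x) y" if y: "y \<in> topspace X" for y
  proof (rule bexI)
    show "path_component_of X (ev (rc X ((0, restrict (\<lambda>_. y) (standard_simplex 0)), e0))) y"
      using y by (simp add: ev_rc standard_simplex_zero path_component_of_refl)
    show "rc X ((0, restrict (\<lambda>_. y) (standard_simplex 0)), e0) \<in> topspace (realization (Sing X))"
      by (rule realization_class_in[OF point_simplex[OF y]]) (simp add: standard_simplex_zero)
  qed
  show "pi_bij n (realization (Sing X)) X ev v" if "v \<in> {rc X ((0, x), e0) | x. x \<in> simplices (Sing X) 0}" for v n
    using that ev_pi_bij by blast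
qed

theorem theorem1p6:
  fixes M :: "'a measure" and X :: "'x topology"
  assumes "prob_space M" and "complete_measure M" and "atomless M"
  shows "homotopy_equivalence (realization (Sing X)) (realization (Sing_RV M X)) (natural_map M X) \<and>
    same_weak_homotopy_type TYPE(((nat \<Rightarrow> real) \<Rightarrow> 'x) prepoint set)
      (realization (Sing_RV M X)) X"
proof -
  interpret prob_space M by fact
  obtain U where U: "U \<in> borel_measurable M" "\<And>\<omega>. 0 \<le> U \<omega>"
    "\<And>t. 0 \<le> t \<Longrightarrow> t \<le> 1 \<Longrightarrow> prob {\<omega> \<in> space M. U \<omega> < t} = t"
    by (rule atomless_uniform[OF assms(3)]) blast
  interpret uniform_prob M U by unfold_locales (use U in auto)
  let ?S = "realization (Sing X)" and ?R = "realization (Sing_RV M X)"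
  let ?r = "realization_map (Sing X) sec_pullback"
  have \<phi>: "continuous_map ?S ?R (natural_map M X)"
    unfolding natural_map_def by (rule continuous_realization_map[OF simplicial_map_law_pullback[OF assms(1)]])
  have r: "continuous_map ?R ?S ?r" by (rule continuous_realization_map[OF simplicial_map_sec_pullback])
  have nat: "natural_map M X (rc X ((n, f), t)) = realization_class (Sing_RV M X) ((n, law_pullback M n f), t)"
    if "f \<in> simplices (Sing X) n" "t \<in> standard_simplex n" for n f t
    unfolding natural_map_def by (rule realization_map_class[OF simplicial_map_law_pullback[OF assms(1)] that])
  have law: "law_pullback M n f \<in> simplices (Sing_RV M X) n" if "f \<in> simplices (Sing X) n" for n f
    using simplicial_map_law_pullback[OF assms(1), of X] that unfolding simplicial_map_def by blast
  have r\<phi>: "?r (natural_map M X a) = a" if a: "a \<in> topspace ?S" for a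
  proof -
    obtain n f t where f: "a = rc X ((n, f), t)" "f \<in> simplices (Sing X) n" "t \<in> standard_simplex n"
      by (rule realization_cases[OF a])
    show ?thesis
      unfolding f(1) nat[OF f(2,3)] realization_map_class[OF simplicial_map_sec_pullback law[OF f(2)] f(3)] sec_law_pullback[OF f(2)] ..
  qed
  obtain K where K: "continuous_map (prod_topology unit_interval ?R) ?R K"
    "\<And>b. b \<in> topspace ?R \<Longrightarrow> K (0, b) = b" "\<And>b. b \<in> topspace ?R \<Longrightarrow> K (1, b) = natural_map M X (?r b)"
    and Kv: "\<And>f \<tau> e. f \<in> simplices (Sing_RV M X) 0 \<Longrightarrow> e \<in> standard_simplex 0 \<Longrightarrow> \<tau> \<in> {0..1} \<Longrightarrow>
      K (\<tau>, realization_class (Sing_RV M X) ((0, f), e)) = realization_class (Sing_RV M X) ((0, f), e)"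
    by (rule natural_map_homotopy[of X]) (rule that, assumption+)
  have "homotopic_with (\<lambda>_. True) ?S ?S (?r \<circ> natural_map M X) id"
    by (rule homotopic_with_equal) (use r\<phi> continuous_map_compose[OF \<phi> r] in auto)
  moreover have "homotopic_with (\<lambda>_. True) ?R ?R id (natural_map M X \<circ> ?r)"
    by (subst homotopic_with) (use K in auto)
  ultimately have he: "homotopy_equivalence ?S ?R (natural_map M X)"
    unfolding homotopy_equivalence_def using \<phi> r by (blast intro: homotopic_with_symD)
  have e0: "e0 \<in> standard_simplex 0" by (simp add: standard_simplex_zero)
  have "weak_homotopy_equivalence ?S ?R (natural_map M X)"
  proof (rule weak_homotopy_equivalence_retract[OF \<phi> r r\<phi> K, where V = "{rc X ((0, x), e0) | x. x \<in> simplices (Sing X) 0}"])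
    show "{rc X ((0, x), e0) | x. x \<in> simplices (Sing X) 0} \<subseteq> topspace ?S"
      using realization_class_in[OF _ e0, of _ "Sing X"] by blast
    show "\<exists>v\<in>{rc X ((0, x), e0) | x. x \<in> simplices (Sing X) 0}. path_component_of ?S a v" if "a \<in> topspace ?S" for a
      by (rule realization_path_to_vertex[OF simplicial_set_Sing that]) blast
    show "K (\<tau>, natural_map M X v) = natural_map M X v"
      if v: "v \<in> {rc X ((0, x), e0) | x. x \<in> simplices (Sing X) 0}" and t: "0 \<le> \<tau>" "\<tau> \<le> 1" for v \<tau>
    proof -
      obtain x where x: "v = rc X ((0, x), e0)" "x \<in> simplices (Sing X) 0" using v by blast
      show ?thesis unfolding x(1) nat[OF x(2) e0] by (rule Kv[OF law[OF x(2)] e0]) (use t in simp)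
    qed
  qed
  \<comment> \<open>The zigzag consists of the natural map from \<open>?S\<close> to
    \<open>?R\<close> and evaluation from \<open>?S\<close> to \<open>X\<close>; \<open>?S\<close>
    is the only intermediate space, whence the type argument in the statement.\<close>
  then have "weakly_linked ?R ?S" unfolding weakly_linked_def by blast
  moreover have "weakly_linked ?S X" unfolding weakly_linked_def using weak_homotopy_equivalence_ev by blast
  ultimately have "same_weak_homotopy_type TYPE(((nat \<Rightarrow> real) \<Rightarrow> 'x) prepoint set) ?R X"
    unfolding same_weak_homotopy_type_def by (blast intro: rtranclp.rtrancl_refl)
  then show ?thesis using he by blast
qed

end
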